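(* Let $s\in(0,1)$ and let $\mathscr U$ be the weak solution of the extended fractional wave problem with data $f\in L^2(0,T;L^2(\Omega))$, $g\in\mathbb H^s(\Omega)$, $h\in L^2(\Omega)$. Then, for every $\mathcal Y\ge1$, $$\|\nabla\mathscr U\|_{L^2(0,T;L^2(y^\alpha,\Omega\times(\mathcal Y,\infty)))}\lesssim e^{-\sqrt{\lambda_1}\,\mathcal Y/2}\,\Lambda(f,g,h),$$ where $\lambda_1$ is the first eigenvalue of $\mathcal L$ and $\Lambda(f,g,h)=\|f\|_{L^2(0,T;L^2(\Omega))}+\|g\|_{\mathbb H^s(\Omega)}+\|h\|_{L^2(\Omega)}$.
   Context: $\Omega\subset\mathbb R^n$ ($n\ge1$) is an open, bounded, convex polytope; $T>0$. $\mathcal L w=-\operatorname{div}(A\nabla w)+cw$ with homogeneous Dirichlet boundary conditions, where $A\in C^{0,1}(\Omega,GL(n,\mathbb R))$ is symmetric and uniformly positive definite and $0\le c\in L^\infty(\Omega)$. $(\lambda_k,\varphi_k)_{k\ge1}$ are its Dirichlet eigenpairs, $\lambda_k$ increasing (with multiplicity), $\{\varphi_k\}$ an orthonormal basis of $L^2(\Omega)$. For $r\ge0$, $\mathbb H^r(\Omega)=\{w=\sum_k w_k\varphi_k:\|w\|^2_{\mathbb H^r(\Omega)}=\sum_k\lambda_k^r|w_k|^2<\infty\}$; $\mathbb H^{-r}(\Omega)$ is its dual and $\langle\cdot,\cdot\rangle$ the duality pairing between $\mathbb H^{s}(\Omega)$ and $\mathbb H^{-s}(\Omega)$. For $s\in(0,1)$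 set $\alpha=1-2s$, $d_s=2^\alpha\Gamma(1-s)/\Gamma(s)$, $\mathcal C=\Omega\times(0,\infty)$ with points $x=(x',y)$, $\mathbf A=\operatorname{diag}\{A,1\}$, $\mathring H^1_L(y^\alpha,\mathcal C)=\{w\in H^1(y^\alpha,\mathcal C): w=0\text{ on }\partial\Omega\times[0,\infty)\}$, $a(w,\phi)=\frac1{d_s}\int_{\mathcal C}y^\alpha(\mathbf A\nabla w\cdot\nabla\phi+c\,w\phi)\,dx$; $\operatorname{tr}$ is the trace onto $\Omega\times\{0\}$, which maps $\mathring H^1_L(y^\alpha,\mathcal C)$ onto $\mathbb H^s(\Omega)$. The weak solution of the extended fractional wave problem is the unique $\mathscr U\in L^\infty(0,T;\mathring H^1_L(y^\alpha,\mathcal C))$ with $\operatorname{tr}\partial_t\mathscr U\in L^\infty(0,T;L^2(\Omega))$, $\operatorname{tr}\partial_t^2\mathscr U\in L^2(0,T;\mathbb H^{-s}(\Omega))$, $\operatorname{tr}\mathscr U(0)=g$, $\operatorname{tr}\partial_t\mathscr U(0)=h$ and, for a.e. $t$, $\langle\operatorname{tr}\partial_t^2\mathscr U,\operatorname{tr}\phi\rangle+a(\mathscr U,\phi)=\langle f,\operatorname{tr}\phi\rangle$ for all $\phi\in\mathring H^1_L(y^\alpha,\mathcal C)$. $L^2(y^\alpha,D)$ is the $L^2$ space on $D$ with measure $y^\alpha dx$. $a\lesssim b$ means $a\le Cb$ with a constant $C>0$ independent of $\mathscr U$, $f,g,h$ and $\mathcal Y$ (it may depend on the fixed $\Omega,A,c,s,T$).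 *)

theory Defs
  imports "HOL-Analysis.Analysis"
begin

section \<open>Weak gradients and Sobolev spaces\<close>

text \<open>
  Elements of Lebesgue and Sobolev spaces are represented by functions, not by classes modulo
  null sets; consequently all the norms below are only seminorms on these representatives.
\<close>

primrec C_k :: "nat \<Rightarrow> ('a::euclidean_space \<Rightarrow> real) \<Rightarrow> bool" where
  "C_k 0 f \<longleftrightarrow> continuous_on UNIV f"
| "C_k (Suc k) f \<longleftrightarrow> (\<forall>x. f differentiable (at x)) \<and>
     (\<forall>b\<in>Basis. C_k k (\<lambda>x. frechet_derivative f (at x) b))"

definition test_functions :: "'a::euclidean_space set \<Rightarrow> ('a \<Rightarrow> real) set" where
  "test_functions D = {\<psi>. (\<forall>k. C_k k \<psi>) \<and>
     compact (closure {x. \<psi> x \<noteq> 0}) \<and> closure {x. \<psi> x \<noteq> 0} \<subseteq> D}"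

definition locally_integrable ::
    "'a::euclidean_space set \<Rightarrow> ('a \<Rightarrow> 'b::euclidean_space) \<Rightarrow> bool" where
  "locally_integrable D w \<longleftrightarrow> (\<forall>K. compact K \<and> K \<subseteq> D \<longrightarrow> integrable (lebesgue_on K) w)"

definition has_weak_gradient ::
    "'a::euclidean_space set \<Rightarrow> ('a \<Rightarrow> real) \<Rightarrow> ('a \<Rightarrow> 'a) \<Rightarrow> bool" where
  "has_weak_gradient D w G \<longleftrightarrow> locally_integrable D w \<and> locally_integrable D G \<and>
     (\<forall>\<psi>\<in>test_functions D. \<forall>b\<in>Basis.
        (\<integral>x. w x * frechet_derivative \<psi> (at x) b \<partial>lebesgue_on D) =
        - (\<integral>x. (G x \<bullet> b) * \<psi> x \<partial>lebesgue_on D))"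

text \<open>On an open set the weak gradient is unique up to a null set, so the choice is immaterial.\<close>

definition weak_grad :: "'a::euclidean_space set \<Rightarrow> ('a \<Rightarrow> real) \<Rightarrow> 'a \<Rightarrow> 'a" where
  "weak_grad D w = (SOME G. has_weak_gradient D w G)"

definition L2 :: "'a measure \<Rightarrow> ('a \<Rightarrow> 'b::euclidean_space) set" where
  "L2 M = {w. w \<in> borel_measurable M \<and> integrable M (\<lambda>x. (norm (w x))\<^sup>2)}"

definition L2_norm :: "'a measure \<Rightarrow> ('a \<Rightarrow> 'b::euclidean_space) \<Rightarrow> real" where
  "L2_norm M w = sqrt (\<integral>x. (norm (w x))\<^sup>2 \<partial>M)"

definition L2_inner :: "'a measure \<Rightarrow> ('a \<Rightarrow> real) \<Rightarrow> ('a \<Rightarrow> real) \<Rightarrow> real" where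
  "L2_inner M v w = (\<integral>x. v x * w x \<partial>M)"

text \<open>
  In the following, \<open>D\<close> is the domain and \<open>M\<close> the (possibly weighted) measure on \<open>D\<close>
  with respect to which functions and gradients are square integrable.
\<close>

definition H1 :: "'a::euclidean_space measure \<Rightarrow> 'a set \<Rightarrow> ('a \<Rightarrow> real) set" where
  "H1 M D = {w \<in> L2 M. \<exists>G\<in>L2 M. has_weak_gradient D w G}"

definition H1_norm :: "'a::euclidean_space measure \<Rightarrow> 'a set \<Rightarrow> ('a \<Rightarrow> real) \<Rightarrow> real" where
  "H1_norm M D w = sqrt ((L2_norm M w)\<^sup>2 + (L2_norm M (weak_grad D w))\<^sup>2)"

text \<open>
  Vanishing of a Sobolev function on (a part of) the boundary, in the usual sense of a closure in
  the norm of \<open>H1 M D\<close>: the approximating smooth functions have compact support in \<open>E \<supseteq> D\<close>, hence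
  vanish near the part of the boundary of \<open>D\<close> lying outside \<open>E\<close>.
\<close>

definition H1_closure :: "'a::euclidean_space measure \<Rightarrow> 'a set \<Rightarrow> 'a set \<Rightarrow> ('a \<Rightarrow> real) set" where
  "H1_closure M D E = {w \<in> H1 M D. \<exists>\<psi>. (\<forall>j. \<psi> j \<in> test_functions E) \<and>
     (\<lambda>j::nat. H1_norm M D (\<lambda>x. \<psi> j x - w x)) \<longlonglongrightarrow> 0}"

definition H10 :: "'a::euclidean_space set \<Rightarrow> ('a \<Rightarrow> real) set" where
  "H10 \<Omega> = H1_closure (lebesgue_on \<Omega>) \<Omega> \<Omega>"


section \<open>The elliptic operator and its spectral scale\<close>

definition admissible_coefficients ::
    "(real^'n) set \<Rightarrow> (real^'n \<Rightarrow> real^'n^'n) \<Rightarrow> (real^'n \<Rightarrow> real) \<Rightarrow> bool" where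
  "admissible_coefficients \<Omega> A c \<longleftrightarrow>
     (\<exists>L. L-lipschitz_on \<Omega> A) \<and>
     (\<forall>x\<in>\<Omega>. invertible (A x) \<and> transpose (A x) = A x) \<and>
     (\<exists>a>0. \<forall>x\<in>\<Omega>. \<forall>\<xi>. a * (norm \<xi>)\<^sup>2 \<le> (A x *v \<xi>) \<bullet> \<xi>) \<and>
     c \<in> borel_measurable (lebesgue_on \<Omega>) \<and>
     (AE x in lebesgue_on \<Omega>. 0 \<le> c x) \<and>
     (\<exists>B. AE x in lebesgue_on \<Omega>. \<bar>c x\<bar> \<le> B)"

text \<open>
  The eigenvalue problem is understood weakly in \<open>H10 \<Omega>\<close>. Eigenpairs are enumerated from \<open>0\<close>,
  so that \<open>lam 0\<close> is the first eigenvalue.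
\<close>

definition dirichlet_eigenpairs ::
    "(real^'n) set \<Rightarrow> (real^'n \<Rightarrow> real^'n^'n) \<Rightarrow> (real^'n \<Rightarrow> real) \<Rightarrow>
     (nat \<Rightarrow> real) \<Rightarrow> (nat \<Rightarrow> real^'n \<Rightarrow> real) \<Rightarrow> bool" where
  "dirichlet_eigenpairs \<Omega> A c lam \<phi> \<longleftrightarrow>
     mono lam \<and>
     (\<forall>k. \<phi> k \<in> H10 \<Omega>) \<and>
     (\<forall>k. \<forall>v\<in>H10 \<Omega>.
        (\<integral>x. (A x *v weak_grad \<Omega> (\<phi> k) x) \<bullet> weak_grad \<Omega> v x + c x * \<phi> k x * v x \<partial>lebesgue_on \<Omega>)
        = lam k * L2_inner (lebesgue_on \<Omega>) (\<phi> k) v) \<and>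
     (\<forall>j k. L2_inner (lebesgue_on \<Omega>) (\<phi> j) (\<phi> k) = (if j = k then 1 else 0)) \<and>
     (\<forall>w\<in>L2 (lebesgue_on \<Omega>).
        (\<lambda>N. L2_norm (lebesgue_on \<Omega>)
          (\<lambda>x. w x - (\<Sum>k<N. L2_inner (lebesgue_on \<Omega>) w (\<phi> k) * \<phi> k x))) \<longlonglongrightarrow> 0)"

definition HH ::
    "(real^'n) set \<Rightarrow> (nat \<Rightarrow> real) \<Rightarrow> (nat \<Rightarrow> real^'n \<Rightarrow> real) \<Rightarrow> real \<Rightarrow> (real^'n \<Rightarrow> real) set" where
  "HH \<Omega> lam \<phi> r = {w \<in> L2 (lebesgue_on \<Omega>).
     summable (\<lambda>k. lam k powr r * (L2_inner (lebesgue_on \<Omega>) w (\<phi> k))\<^sup>2)}"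

definition HH_norm ::
    "(real^'n) set \<Rightarrow> (nat \<Rightarrow> real) \<Rightarrow> (nat \<Rightarrow> real^'n \<Rightarrow> real) \<Rightarrow> real \<Rightarrow> (real^'n \<Rightarrow> real) \<Rightarrow> real" where
  "HH_norm \<Omega> lam \<phi> r w = sqrt (\<Sum>k. lam k powr r * (L2_inner (lebesgue_on \<Omega>) w (\<phi> k))\<^sup>2)"

text \<open>
  The dual of a function space \<open>V\<close> with norm \<open>nrm\<close>; the duality pairing of \<open>F\<close> with \<open>v\<close>
  is just application \<open>F v\<close>. Boundedness makes \<open>F\<close> independent of the representative of \<open>v\<close>.
\<close>

definition dual_space ::
    "('a \<Rightarrow> real) set \<Rightarrow> (('a \<Rightarrow> real) \<Rightarrow> real) \<Rightarrow> (('a \<Rightarrow> real) \<Rightarrow> real) set" where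
  "dual_space V nrm = {F.
     (\<forall>u\<in>V. \<forall>v\<in>V. \<forall>a b. F (\<lambda>x. a * u x + b * v x) = a * F u + b * F v) \<and>
     (\<exists>B. \<forall>v\<in>V. \<bar>F v\<bar> \<le> B * nrm v)}"

definition dual_norm ::
    "('a \<Rightarrow> real) set \<Rightarrow> (('a \<Rightarrow> real) \<Rightarrow> real) \<Rightarrow> (('a \<Rightarrow> real) \<Rightarrow> real) \<Rightarrow> real" where
  "dual_norm V nrm F = (SUP v\<in>{v\<in>V. nrm v \<le> 1}. \<bar>F v\<bar>)"

definition HH_dual ::
    "(real^'n) set \<Rightarrow> (nat \<Rightarrow> real) \<Rightarrow> (nat \<Rightarrow> real^'n \<Rightarrow> real) \<Rightarrow> real \<Rightarrow>
     ((real^'n \<Rightarrow> real) \<Rightarrow> real) set" where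
  "HH_dual \<Omega> lam \<phi> r = dual_space (HH \<Omega> lam \<phi> r) (HH_norm \<Omega> lam \<phi> r)"

definition HH_dual_norm ::
    "(real^'n) set \<Rightarrow> (nat \<Rightarrow> real) \<Rightarrow> (nat \<Rightarrow> real^'n \<Rightarrow> real) \<Rightarrow> real \<Rightarrow>
     ((real^'n \<Rightarrow> real) \<Rightarrow> real) \<Rightarrow> real" where
  "HH_dual_norm \<Omega> lam \<phi> r = dual_norm (HH \<Omega> lam \<phi> r) (HH_norm \<Omega> lam \<phi> r)"


section \<open>The extension to the cylinder\<close>

definition cylinder :: "(real^'n) set \<Rightarrow> ((real^'n) \<times> real) set" where
  "cylinder \<Omega> = \<Omega> \<times> {0<..}"

definition weighted :: "real \<Rightarrow> ((real^'n) \<times> real) set \<Rightarrow> ((real^'n) \<times> real) measure" where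
  "weighted \<alpha> D = density (lebesgue_on D) (\<lambda>x. ennreal (snd x powr \<alpha>))"

definition HL :: "real \<Rightarrow> (real^'n) set \<Rightarrow> ((real^'n) \<times> real \<Rightarrow> real) set" where
  "HL \<alpha> \<Omega> = H1_closure (weighted \<alpha> (cylinder \<Omega>)) (cylinder \<Omega>) (\<Omega> \<times> UNIV)"

definition HL_norm :: "real \<Rightarrow> (real^'n) set \<Rightarrow> ((real^'n) \<times> real \<Rightarrow> real) \<Rightarrow> real" where
  "HL_norm \<alpha> \<Omega> = H1_norm (weighted \<alpha> (cylinder \<Omega>)) (cylinder \<Omega>)"

text \<open>
  The trace onto \<open>\<Omega> \<times> {0}\<close>: the extension by continuity of the restriction
  of smooth functions to \<open>y = 0\<close>, given as the closure of the graph of that restriction.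
\<close>

definition has_trace ::
    "real \<Rightarrow> (real^'n) set \<Rightarrow> ((real^'n) \<times> real \<Rightarrow> real) \<Rightarrow> (real^'n \<Rightarrow> real) \<Rightarrow> bool" where
  "has_trace \<alpha> \<Omega> w v \<longleftrightarrow> w \<in> HL \<alpha> \<Omega> \<and> v \<in> L2 (lebesgue_on \<Omega>) \<and>
     (\<exists>\<psi>. (\<forall>j. \<psi> j \<in> test_functions (\<Omega> \<times> UNIV)) \<and>
       (\<lambda>j::nat. HL_norm \<alpha> \<Omega> (\<lambda>x. \<psi> j x - w x)) \<longlonglongrightarrow> 0 \<and>
       (\<lambda>j. L2_norm (lebesgue_on \<Omega>) (\<lambda>x'. \<psi> j (x', 0) - v x')) \<longlonglongrightarrow> 0)"

definition d_const :: "real \<Rightarrow> real" where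
  "d_const s = 2 powr (1 - 2 * s) * Gamma (1 - s) / Gamma s"

definition diag_ext ::
    "(real^'n \<Rightarrow> real^'n^'n) \<Rightarrow> (real^'n) \<times> real \<Rightarrow> (real^'n) \<times> real \<Rightarrow> (real^'n) \<times> real" where
  "diag_ext A x p = (A (fst x) *v fst p, snd p)"

definition a_form ::
    "(real^'n) set \<Rightarrow> (real^'n \<Rightarrow> real^'n^'n) \<Rightarrow> (real^'n \<Rightarrow> real) \<Rightarrow> real \<Rightarrow>
     ((real^'n) \<times> real \<Rightarrow> real) \<Rightarrow> ((real^'n) \<times> real \<Rightarrow> real) \<Rightarrow> real" where
  "a_form \<Omega> A c s w v = 1 / d_const s *
     (\<integral>x. diag_ext A x (weak_grad (cylinder \<Omega>) w x) \<bullet> weak_grad (cylinder \<Omega>) v x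
            + c (fst x) * w x * v x \<partial>weighted (1 - 2 * s) (cylinder \<Omega>))"


section \<open>Functions of time with values in a function space\<close>

definition strongly_measurable ::
    "real \<Rightarrow> ('a \<Rightarrow> real) set \<Rightarrow> (('a \<Rightarrow> real) \<Rightarrow> real) \<Rightarrow> (real \<Rightarrow> 'a \<Rightarrow> real) \<Rightarrow> bool" where
  "strongly_measurable T X nrm u \<longleftrightarrow>
     (AE t in lebesgue_on {0<..<T}. u t \<in> X) \<and>
     (\<exists>S. (\<forall>j::nat. simple_function (lebesgue_on {0<..<T}) (S j) \<and> S j ` {0<..<T} \<subseteq> X) \<and>
       (AE t in lebesgue_on {0<..<T}. (\<lambda>j. nrm (\<lambda>x. S j t x - u t x)) \<longlonglongrightarrow> 0))"

definition Bochner_L2 ::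
    "real \<Rightarrow> ('a \<Rightarrow> real) set \<Rightarrow> (('a \<Rightarrow> real) \<Rightarrow> real) \<Rightarrow> (real \<Rightarrow> 'a \<Rightarrow> real) set" where
  "Bochner_L2 T X nrm = {u. strongly_measurable T X nrm u \<and>
     integrable (lebesgue_on {0<..<T}) (\<lambda>t. (nrm (u t))\<^sup>2)}"

definition Bochner_Linf ::
    "real \<Rightarrow> ('a \<Rightarrow> real) set \<Rightarrow> (('a \<Rightarrow> real) \<Rightarrow> real) \<Rightarrow> (real \<Rightarrow> 'a \<Rightarrow> real) set" where
  "Bochner_Linf T X nrm = {u. strongly_measurable T X nrm u \<and>
     (\<exists>B. AE t in lebesgue_on {0<..<T}. nrm (u t) \<le> B)}"

definition Bochner_L2_norm :: "real \<Rightarrow> ('v \<Rightarrow> real) \<Rightarrow> (real \<Rightarrow> 'v) \<Rightarrow> real" where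
  "Bochner_L2_norm T nrm u = sqrt (\<integral>t. (nrm (u t))\<^sup>2 \<partial>lebesgue_on {0<..<T})"

text \<open>The value at \<open>t = 0\<close> of the representative of \<open>u\<close> that is continuous on \<open>[0,T]\<close>.\<close>

definition has_initial_value ::
    "real \<Rightarrow> ('a \<Rightarrow> real) set \<Rightarrow> (('a \<Rightarrow> real) \<Rightarrow> real) \<Rightarrow> (real \<Rightarrow> 'a \<Rightarrow> real) \<Rightarrow> ('a \<Rightarrow> real) \<Rightarrow> bool"
  where
  "has_initial_value T X nrm u u0 \<longleftrightarrow> (\<exists>v.
     (\<forall>t\<in>{0..T}. v t \<in> X) \<and>
     (AE t in lebesgue_on {0<..<T}. nrm (\<lambda>x. u t x - v t x) = 0) \<and>
     (\<forall>t\<in>{0..T}. ((\<lambda>\<tau>. nrm (\<lambda>x. v \<tau> x - v t x)) \<longlongrightarrow> 0) (at t within {0..T})) \<and>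
     nrm (\<lambda>x. v 0 x - u0 x) = 0)"


section \<open>Weak solutions of the extended fractional wave problem\<close>

text \<open>
  Here \<open>u\<close> is the trace of \<open>U\<close>, while \<open>u1\<close> and \<open>u2\<close> are its first and second time derivatives in
  the sense of vector-valued distributions: the defining identities are tested with the
  elements \<open>w\<close> of \<open>L2\<close> and of \<open>HH s\<close>, respectively, which turns them into scalar weak
  derivatives on \<open>(0,T)\<close>. The function \<open>h\<close> is identified with the functional \<open>w \<mapsto> (h, w)\<close>.
\<close>

definition weak_solution ::
    "(real^'n) set \<Rightarrow> (real^'n \<Rightarrow> real^'n^'n) \<Rightarrow> (real^'n \<Rightarrow> real) \<Rightarrow>
     (nat \<Rightarrow> real) \<Rightarrow> (nat \<Rightarrow> real^'n \<Rightarrow> real) \<Rightarrow> real \<Rightarrow> real \<Rightarrow>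
     (real \<Rightarrow> real^'n \<Rightarrow> real) \<Rightarrow> (real^'n \<Rightarrow> real) \<Rightarrow> (real^'n \<Rightarrow> real) \<Rightarrow>
     (real \<Rightarrow> (real^'n) \<times> real \<Rightarrow> real) \<Rightarrow> bool" where
  "weak_solution \<Omega> A c lam \<phi> s T f g h U \<longleftrightarrow>
     U \<in> Bochner_Linf T (HL (1 - 2 * s) \<Omega>) (HL_norm (1 - 2 * s) \<Omega>) \<and>
     (\<exists>u u1 u2.
       (AE t in lebesgue_on {0<..<T}. has_trace (1 - 2 * s) \<Omega> (U t) (u t)) \<and>
       u1 \<in> Bochner_Linf T (L2 (lebesgue_on \<Omega>)) (L2_norm (lebesgue_on \<Omega>)) \<and>
       (\<forall>w\<in>L2 (lebesgue_on \<Omega>). has_weak_gradient {0<..<T}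
          (\<lambda>t. L2_inner (lebesgue_on \<Omega>) (u t) w) (\<lambda>t. L2_inner (lebesgue_on \<Omega>) (u1 t) w)) \<and>
       u2 \<in> Bochner_L2 T (HH_dual \<Omega> lam \<phi> s) (HH_dual_norm \<Omega> lam \<phi> s) \<and>
       (\<forall>w\<in>HH \<Omega> lam \<phi> s. has_weak_gradient {0<..<T}
          (\<lambda>t. L2_inner (lebesgue_on \<Omega>) (u1 t) w) (\<lambda>t. u2 t w)) \<and>
       has_initial_value T (L2 (lebesgue_on \<Omega>)) (L2_norm (lebesgue_on \<Omega>)) u g \<and>
       has_initial_value T (HH_dual \<Omega> lam \<phi> s) (HH_dual_norm \<Omega> lam \<phi> s)
          (\<lambda>t. L2_inner (lebesgue_on \<Omega>) (u1 t)) (L2_inner (lebesgue_on \<Omega>) h) \<and>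
       (AE t in lebesgue_on {0<..<T}. \<forall>v w. has_trace (1 - 2 * s) \<Omega> v w \<longrightarrow>
          u2 t w + a_form \<Omega> A c s (U t) v = L2_inner (lebesgue_on \<Omega>) (f t) w))"

end

theory Submission
  imports Defs
begin

text \<open>
  For almost every time \<open>t\<close>, the function \<open>W = U t\<close> is orthogonal, in the energy form \<open>a\<close>, to all functions
  with vanishing trace. Agmon's method then gives the decay: testing with \<open>\<eta>\<^sup>2 W\<close>, where \<open>\<eta>\<close> behaves like
  \<open>exp (\<gamma> y)\<close> with \<open>\<gamma> = sqrt (lam 0) / 2\<close>, and absorbing the commutator term by the spectral gap
  of the operator on the cross sections, bounds the energy of \<open>W\<close> above height \<open>Y\<close> by
  \<open>exp (- sqrt (lam 0) Y)\<close> times \<open>a(W, W)\<close>.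

  It remains to bound \<open>a(U t, U t)\<close> by the data. Let \<open>u\<^sub>k\<close> be the coefficients of the trace of \<open>U t\<close> and
  \<open>m\<^sub>k = a(U t, \<phi>\<^sub>k q)\<close> for a cut-off \<open>q\<close> in \<open>y\<close> with \<open>q(0) = 1\<close>. Symmetry of \<open>a\<close> between two times
  shows that \<open>m\<^sub>k = \<kappa>\<^sub>k u\<^sub>k\<close> with a constant \<open>\<kappa>\<^sub>k\<close>, and testing with cut-offs at the length scale
  \<open>lam k powr (-1/2)\<close> gives \<open>0 \<le> \<kappa>\<^sub>k \<lesssim> lam k powr s\<close>; no explicit knowledge of the (Bessel type) extension is
  needed. So each \<open>u\<^sub>k\<close> solves \<open>u\<^sub>k'' + \<kappa>\<^sub>k u\<^sub>k = f\<^sub>k\<close>, Duhamel's formula bounds \<open>\<kappa>\<^sub>k u\<^sub>k\<^sup>2\<close>, and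
  \<open>a(U t, U t)\<close> is the sum of \<open>\<kappa>\<^sub>k u\<^sub>k\<^sup>2\<close> over \<open>k\<close>.
\<close>

section \<open>Smooth functions\<close>

text \<open>For one mode the equation is scalar and Duhamel's formula is rigorous. What then has to
  be supplied is the link between the value of a mode at y = 0 and its flux there. The trace is only
  a closure of a graph, so every such identity is computed on approximating test functions and
  passes to the limit through uniform energy bounds. The upper bound on
  \<open>\<kappa>\<^sub>k\<close> is what allows g to be measured in \<open>HH s\<close>. A trace
  inequality on the half line, with the same power \<open>lam k powr s\<close>, places the trace of
  \<open>U t\<close> in \<open>HH s\<close>, so that the equation may be tested with
  \<open>U t\<close> itself and its energy expanded in modes. In the decay estimate the weight must
  be bounded for each Y, since \<open>U t\<close> is only square integrable, yet all constants have
  to be independent of that bound; it must also vanish at y = 0 to give a test function with zero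
  trace.\<close>

lemma C_k_SucI:
  assumes "\<And>x. (f has_derivative D x) (at x)"
    and "\<And>b. b \<in> Basis \<Longrightarrow> C_k k (\<lambda>x. D x b)"
  shows "C_k (Suc k) f"
proof -
  have "frechet_derivative f (at x) = D x" for x
    using frechet_derivative_at[OF assms(1)] by simp
  then show ?thesis
    using assms by (auto simp: differentiable_def)
qed

lemma C_k_SucD:
  assumes "C_k (Suc k) f"
  shows "(f has_derivative frechet_derivative f (at x)) (at x)"
    and "b \<in> Basis \<Longrightarrow> C_k k (\<lambda>x. frechet_derivative f (at x) b)"
  using assms by (auto simp: frechet_derivative_works)

lemma C_k_Suc_imp: "C_k (Suc k) f \<Longrightarrow> C_k k f"
proof (induction k arbitrary: f)
  case 0
  then show ?case
    by (auto intro!: continuous_at_imp_continuous_on differentiable_imp_continuous_within)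
next
  case (Suc k)
  then show ?case by (metis C_k.simps(2))
qed

lemma C_k_const: "C_k k (\<lambda>x. r)"
proof (induction k arbitrary: r)
  case (Suc k)
  show ?case
    by (rule C_k_SucI[of _ "\<lambda>_ _. 0"]) (auto intro!: Suc)
qed simp

lemma C_k_add: "C_k k f \<Longrightarrow> C_k k g \<Longrightarrow> C_k k (\<lambda>x. f x + g x)"
proof (induction k arbitrary: f g)
  case 0
  then show ?case by (auto intro: continuous_on_add)
next
  case (Suc k)
  show ?case
    by (rule C_k_SucI[OF has_derivative_add[OF C_k_SucD(1)[OF Suc(2)] C_k_SucD(1)[OF Suc(3)]]])
      (intro Suc.IH C_k_SucD(2)[OF Suc(2)] C_k_SucD(2)[OF Suc(3)])
qed

lemma C_k_mult: "C_k k f \<Longrightarrow> C_k k g \<Longrightarrow> C_k k (\<lambda>x. f x * g x)"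
proof (induction k arbitrary: f g)
  case 0
  then show ?case by (auto intro: continuous_on_mult)
next
  case (Suc k)
  show ?case
    by (rule C_k_SucI[OF has_derivative_mult[OF C_k_SucD(1)[OF Suc(2)] C_k_SucD(1)[OF Suc(3)]]])
      (intro C_k_add Suc.IH C_k_SucD(2)[OF Suc(2)] C_k_SucD(2)[OF Suc(3)]
        C_k_Suc_imp[OF Suc(2)] C_k_Suc_imp[OF Suc(3)])
qed

lemma C_k_sum: "(\<And>i. i \<in> I \<Longrightarrow> C_k k (f i)) \<Longrightarrow> C_k k (\<lambda>x. \<Sum>i\<in>I. f i x)"
  by (induction I rule: infinite_finite_induct) (auto intro: C_k_const C_k_add)

lemma C_k_prod: "(\<And>i. i \<in> I \<Longrightarrow> C_k k (f i)) \<Longrightarrow> C_k k (\<lambda>x. \<Prod>i\<in>I. f i x)"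
  by (induction I rule: infinite_finite_induct) (auto intro: C_k_const C_k_mult)

lemma C_k_inverse:
  assumes "C_k k f" and "\<And>x. f x \<noteq> 0"
  shows "C_k k (\<lambda>x. inverse (f x))"
  using assms
proof (induction k arbitrary: f)
  case 0
  then show ?case by (auto intro: continuous_on_inverse)
next
  case (Suc k)
  show ?case
  proof (rule C_k_SucI)
    show "((\<lambda>x. inverse (f x)) has_derivative
        (\<lambda>h. (- 1) * (frechet_derivative f (at x) h * (inverse (f x) * inverse (f x))))) (at x)" for x
      using Deriv.has_derivative_inverse[OF Suc.prems(2) C_k_SucD(1)[OF Suc.prems(1)], of x] Suc.prems(2)
      by (simp add: field_simps)
  next
    fix b :: 'a assume "b \<in> Basis"
    then show "C_k k (\<lambda>x. (- 1) * (frechet_derivative f (at x) b * (inverse (f x) * inverse (f x))))"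
      using Suc.IH[OF C_k_Suc_imp[OF Suc.prems(1)] Suc.prems(2)] C_k_SucD(2)[OF Suc.prems(1)]
      by (intro C_k_mult C_k_const) auto
  qed
qed

lemma C_k_affine:
  fixes f :: "'b::euclidean_space \<Rightarrow> real" and L :: "'a::euclidean_space \<Rightarrow> 'b"
  assumes "C_k k f" and L: "bounded_linear L"
  shows "C_k k (\<lambda>x. f (L x + a))"
  using assms(1)
proof (induction k arbitrary: f)
  case 0
  then show ?case
    using linear_continuous_on[OF L]
    by (auto intro!: continuous_on_compose2[of UNIV f] continuous_intros)
next
  case (Suc k)
  show ?case
  proof (rule C_k_SucI)
    \<comment> \<open>The derivative is expanded over the basis because \<open>C_k\<close> controls
      only derivatives in basis directions, while \<open>L\<close> sends a basis vector to an
      arbitrary one.\<close>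
    show "((\<lambda>x. f (L x + a)) has_derivative
        (\<lambda>h. \<Sum>b\<in>Basis. (L h \<bullet> b) * frechet_derivative f (at (L x + a)) b)) (at x)" for x
    proof -
      have f: "(f has_derivative frechet_derivative f (at (L x + a))) (at (L x + a))"
        by (rule C_k_SucD(1)[OF Suc.prems])
      have "((\<lambda>x. L x + a) has_derivative L) (at x)"
        by (auto intro!: derivative_eq_intros bounded_linear_imp_has_derivative[OF L])
      then have "((\<lambda>x. f (L x + a)) has_derivative
          (\<lambda>h. frechet_derivative f (at (L x + a)) (L h))) (at x)"
        using f by (rule has_derivative_compose)
      moreover have "frechet_derivative f (at (L x + a)) (L h) =
          (\<Sum>b\<in>Basis. (L h \<bullet> b) * frechet_derivative f (at (L x + a)) b)" for h
      proof -
        have "linear (frechet_derivative f (at (L x + a)))"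
          using f has_derivative_linear by blast
        then have "frechet_derivative f (at (L x + a)) (\<Sum>b\<in>Basis. (L h \<bullet> b) *\<^sub>R b) =
          (\<Sum>b\<in>Basis. (L h \<bullet> b) * frechet_derivative f (at (L x + a)) b)"
          by (simp add: linear_sum linear_cmul)
        then show ?thesis by (simp add: euclidean_representation)
      qed
      ultimately show ?thesis by simp
    qed
  next
    fix b :: 'a assume "b \<in> Basis"
    show "C_k k (\<lambda>x. \<Sum>i\<in>Basis. (L b \<bullet> i) * frechet_derivative f (at (L x + a)) i)"
      by (intro C_k_sum C_k_mult C_k_const Suc.IH C_k_SucD(2)[OF Suc.prems])
  qed
qed

lemma C_k_real_SucI:
  fixes f :: "real \<Rightarrow> real"
  assumes "\<And>x. (f has_real_derivative f' x) (at x)" and "C_k k f'"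
  shows "C_k (Suc k) f"
  using C_k_SucI[of f "\<lambda>x h. f' x * h" k] assms by (auto simp: has_field_derivative_def)

lemma C_k_real_SucD:
  fixes f :: "real \<Rightarrow> real"
  assumes "C_k (Suc k) f"
  shows "(f has_real_derivative deriv f x) (at x)" and "C_k k (deriv f)"
proof -
  have d: "(f has_derivative frechet_derivative f (at x)) (at x)" for x
    by (rule C_k_SucD(1)[OF assms])
  then have *: "(f has_real_derivative deriv f x) (at x)" for x
    using DERIV_deriv_iff_real_differentiable differentiable_def by blast
  have "frechet_derivative f (at x) 1 = deriv f x" for x
    using fun_cong[OF frechet_derivative_at[OF *[unfolded has_field_derivative_def]], of x 1] by simp
  with C_k_SucD(2)[OF assms, of 1] show "C_k k (deriv f)" by simp
  show "(f has_real_derivative deriv f x) (at x)" by (rule *)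
qed

definition smooth :: "('a::euclidean_space \<Rightarrow> real) \<Rightarrow> bool" where
  "smooth f \<longleftrightarrow> (\<forall>k. C_k k f)"

lemma smooth_const: "smooth (\<lambda>x. r)"
  by (simp add: smooth_def C_k_const)

lemma smooth_add: "smooth f \<Longrightarrow> smooth g \<Longrightarrow> smooth (\<lambda>x. f x + g x)"
  by (simp add: smooth_def C_k_add)

lemma smooth_mult: "smooth f \<Longrightarrow> smooth g \<Longrightarrow> smooth (\<lambda>x. f x * g x)"
  by (simp add: smooth_def C_k_mult)

lemma smooth_diff: "smooth f \<Longrightarrow> smooth g \<Longrightarrow> smooth (\<lambda>x. f x - g x)"
  using smooth_add[of f "\<lambda>x. (-1) * g x"] smooth_mult[OF smooth_const[of "-1"], of g] by simp

lemma smooth_prod: "(\<And>i. i \<in> I \<Longrightarrow> smooth (f i)) \<Longrightarrow> smooth (\<lambda>x. \<Prod>i\<in>I. f i x)"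
  by (simp add: smooth_def C_k_prod)

lemma smooth_inverse: "smooth f \<Longrightarrow> (\<And>x. f x \<noteq> 0) \<Longrightarrow> smooth (\<lambda>x. inverse (f x))"
  by (simp add: smooth_def C_k_inverse)

lemma smooth_affine: "smooth f \<Longrightarrow> bounded_linear L \<Longrightarrow> smooth (\<lambda>x. f (L x + a))"
  by (simp add: smooth_def C_k_affine)

lemma smooth_linear: "smooth f \<Longrightarrow> bounded_linear L \<Longrightarrow> smooth (\<lambda>x. f (L x))"
  using smooth_affine[of f L 0] by simp

lemma smooth_inner: "smooth (\<lambda>x. x \<bullet> b)"
proof -
  have "smooth (\<lambda>x::real. x)"
    unfolding smooth_def
  proof
    fix k show "C_k k (\<lambda>x::real. x)"
      by (cases k) (auto intro!: C_k_real_SucI C_k_const derivative_eq_intros)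
  qed
  from smooth_linear[OF this bounded_linear_inner_left] show ?thesis .
qed

lemma smooth_has_derivative: "smooth f \<Longrightarrow> (f has_derivative frechet_derivative f (at x)) (at x)"
  using C_k_SucD(1)[of 0 f x] unfolding smooth_def by blast

text \<open>\<open>C_k\<close> speaks of basis directions; linearity of the derivative extends this
  to every direction b, in particular to the vertical direction (0, 1) used on the cylinder.\<close>

lemma smooth_frechet_derivative:
  assumes "smooth f" shows "smooth (\<lambda>x. frechet_derivative f (at x) b)"
proof -
  have "frechet_derivative f (at x) b = (\<Sum>i\<in>Basis. (b \<bullet> i) * frechet_derivative f (at x) i)" for x
  proof -
    have "linear (frechet_derivative f (at x))"
      using smooth_has_derivative[OF assms] has_derivative_linear by blast
    then have "frechet_derivative f (at x) (\<Sum>i\<in>Basis. (b \<bullet> i) *\<^sub>R i) =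
      (\<Sum>i\<in>Basis. (b \<bullet> i) * frechet_derivative f (at x) i)"
      by (simp add: linear_sum linear_cmul)
    then show ?thesis by (simp add: euclidean_representation)
  qed
  moreover have "C_k k (\<lambda>x. \<Sum>i\<in>Basis. (b \<bullet> i) * frechet_derivative f (at x) i)" for k
    using assms unfolding smooth_def by (intro C_k_sum C_k_mult C_k_const C_k_SucD(2)) auto
  ultimately show ?thesis by (simp add: smooth_def)
qed

lemma smooth_continuous_on: "smooth f \<Longrightarrow> continuous_on S f"
  using C_k.simps(1)[of f] continuous_on_subset[of UNIV f S] unfolding smooth_def by blast

lemma smooth_deriv:
  fixes f :: "real \<Rightarrow> real"
  assumes "smooth f"
  shows "(f has_real_derivative deriv f x) (at x)" and "smooth (deriv f)"
proof -
  have *: "C_k (Suc k) f" for k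
    using assms unfolding smooth_def by blast
  show "(f has_real_derivative deriv f x) (at x)"
    by (rule C_k_real_SucD(1)[OF *])
  show "smooth (deriv f)"
    unfolding smooth_def using C_k_real_SucD(2)[OF *] by blast
qed

lemma smooth_exp: "smooth (exp :: real \<Rightarrow> real)"
proof -
  have "C_k k (exp :: real \<Rightarrow> real)" for k
  proof (induction k)
    case (Suc k)
    then show ?case by (intro C_k_real_SucI[OF DERIV_exp])
  qed (auto intro: continuous_intros)
  then show ?thesis by (simp add: smooth_def)
qed

text \<open>The family x^(-n) exp(-1/x), continued by zero. The exponent n is carried along because
  the linear span of the family is closed under differentiation, which turns smoothness into an
  induction.\<close>

definition flat_exp :: "nat \<Rightarrow> real \<Rightarrow> real" where
  "flat_exp n x = (if x \<le> 0 then 0 else inverse x ^ n * exp (- inverse x))"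

lemma flat_exp_tendsto_0: "(flat_exp n \<longlongrightarrow> 0) (at 0)"
proof -
  have "((\<lambda>x::real. x ^ n / exp x) \<longlongrightarrow> 0) at_top"
    by (rule tendsto_power_div_exp_0)
  then have "((\<lambda>x::real. inverse x ^ n / exp (inverse x)) \<longlongrightarrow> 0) (at_right 0)"
    using filterlim_inverse_at_top_right by (rule filterlim_compose)
  then have "(flat_exp n \<longlongrightarrow> 0) (at_right 0)"
    by (rule Lim_transform_eventually)
      (auto simp: flat_exp_def eventually_at_filter exp_minus divide_inverse)
  moreover have "(flat_exp n \<longlongrightarrow> 0) (at_left 0)"
    by (rule Lim_transform_eventually[of "\<lambda>x. 0"])
      (auto simp: flat_exp_def eventually_at_filter)
  ultimately show ?thesis
    using filterlim_split_at by blast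
qed

lemma flat_exp_has_derivative:
  "(flat_exp n has_real_derivative - real n * flat_exp (n + 1) x + flat_exp (n + 2) x) (at x)"
proof -
  consider "x > 0" | "x < 0" | "x = 0" by linarith
  then show ?thesis
  proof cases
    case 1
    have "((\<lambda>x. inverse x ^ n * exp (- inverse x)) has_real_derivative
        - real n * flat_exp (n + 1) x + flat_exp (n + 2) x) (at x)"
    proof -
      have "((\<lambda>x. inverse x ^ n) has_real_derivative - real n * inverse x ^ (n + 1)) (at x)"
        using DERIV_power[OF DERIV_inverse[of x UNIV], of n] 1
        by (cases n) (auto simp: algebra_simps)
      moreover have "((\<lambda>x. exp (- inverse x)) has_real_derivative
          inverse x ^ 2 * exp (- inverse x)) (at x)"
        using 1 by (auto intro!: derivative_eq_intros simp: power2_eq_square)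
      ultimately have "((\<lambda>x. inverse x ^ n * exp (- inverse x)) has_real_derivative
          - real n * inverse x ^ (n + 1) * exp (- inverse x)
          + inverse x ^ 2 * exp (- inverse x) * inverse x ^ n) (at x)"
        by (rule DERIV_mult)
      with 1 show ?thesis
        by (simp add: flat_exp_def power_add power2_eq_square mult_ac)
    qed
    moreover have "eventually (\<lambda>y. inverse y ^ n * exp (- inverse y) = flat_exp n y) (nhds x)"
      using eventually_nhds_in_open[of "{0<..}" x] 1
      by (auto elim!: eventually_mono simp: flat_exp_def)
    ultimately show ?thesis
      by (rule DERIV_cong_ev[OF refl _ refl, THEN iffD1, rotated])
  next
    case 2
    have "((\<lambda>x. 0) has_real_derivative - real n * flat_exp (n + 1) x + flat_exp (n + 2) x) (at x)"
      using 2 by (simp add: flat_exp_def)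
    moreover have "eventually (\<lambda>y. 0 = flat_exp n y) (nhds x)"
      using eventually_nhds_in_open[of "{..<0}" x] 2
      by (auto elim!: eventually_mono simp: flat_exp_def)
    ultimately show ?thesis
      by (rule DERIV_cong_ev[OF refl _ refl, THEN iffD1, rotated])
  next
    case 3
    \<comment> \<open>At the origin the difference quotient of \<open>flat_exp n\<close> is exactly
      \<open>flat_exp (Suc n)\<close>, which tends to 0.\<close>
    have "((\<lambda>h. (flat_exp n (0 + h) - flat_exp n 0) / h) \<longlongrightarrow> 0) (at 0)"
      by (rule Lim_transform_eventually[OF flat_exp_tendsto_0[of "Suc n"]])
        (auto simp: flat_exp_def eventually_at_filter divide_inverse)
    with 3 show ?thesis by (simp add: DERIV_def flat_exp_def)
  qed
qed

lemma smooth_flat_exp: "smooth (flat_exp n)"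
proof -
  have "C_k k (flat_exp n)" for k
  proof (induction k arbitrary: n)
    case 0
    then show ?case
      using flat_exp_has_derivative
      by (auto intro!: continuous_at_imp_continuous_on DERIV_isCont)
  next
    case (Suc k)
    then show ?case
      by (intro C_k_real_SucI[OF flat_exp_has_derivative] C_k_add C_k_mult C_k_const)
  qed
  then show ?thesis by (simp add: smooth_def)
qed

text \<open>Dividing by the sum with the reflected function makes the transition complete: the value
  is exactly 0 for x \<le> 0 and exactly 1 for x \<ge> 1. The denominator never vanishes since x and
  1 - x are not both nonpositive.\<close>

definition smooth_step :: "real \<Rightarrow> real" where
  "smooth_step x = flat_exp 0 x * inverse (flat_exp 0 x + flat_exp 0 (1 - x))"

lemma flat_exp_step_pos: "flat_exp 0 x + flat_exp 0 (1 - x) > 0"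
  by (cases "x \<le> 0") (auto simp: flat_exp_def add_pos_nonneg)

lemma smooth_smooth_step: "smooth smooth_step"
proof -
  have "smooth (\<lambda>x. flat_exp 0 ((- x) + 1))"
    by (rule smooth_affine[OF smooth_flat_exp]) (simp add: bounded_linear_minus bounded_linear_ident)
  then have "smooth (\<lambda>x. flat_exp 0 x * inverse (flat_exp 0 x + flat_exp 0 (1 - x)))"
    using flat_exp_step_pos
    by (intro smooth_mult smooth_inverse smooth_add smooth_flat_exp) (auto simp: less_le)
  then show ?thesis
    by (simp add: smooth_step_def[abs_def])
qed

lemma smooth_step_bounds: "0 \<le> smooth_step x" "smooth_step x \<le> 1"
proof -
  have "flat_exp 0 x \<ge> 0" "flat_exp 0 (1 - x) \<ge> 0"
    by (auto simp: flat_exp_def)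
  then show "0 \<le> smooth_step x" "smooth_step x \<le> 1"
    using flat_exp_step_pos[of x]
    by (auto simp: smooth_step_def divide_inverse[symmetric])
qed

lemma smooth_step_eq_0: "x \<le> 0 \<Longrightarrow> smooth_step x = 0"
  by (simp add: smooth_step_def flat_exp_def)

lemma smooth_step_eq_1: "1 \<le> x \<Longrightarrow> smooth_step x = 1"
  by (simp add: smooth_step_def flat_exp_def)

section \<open>Test functions\<close>

lemma test_functionsI:
  fixes f :: "'a::euclidean_space \<Rightarrow> real"
  assumes "smooth f" and "compact K" and "K \<subseteq> D" and "\<And>x. x \<notin> K \<Longrightarrow> f x = 0"
  shows "f \<in> test_functions D"
proof -
  have "closure {x. f x \<noteq> 0} \<subseteq> K"
    using assms(2,4) by (intro closure_minimal compact_imp_closed) auto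
  moreover from this have "compact (closure {x. f x \<noteq> 0})"
    using assms(2) by (meson bounded_subset closed_closure compact_eq_bounded_closed)
  ultimately show ?thesis
    using assms unfolding test_functions_def smooth_def by auto
qed

lemma test_functionsE:
  assumes "f \<in> test_functions D"
  obtains K where "smooth f" "compact K" "K \<subseteq> D" "\<forall>x. x \<notin> K \<longrightarrow> f x = 0"
proof
  show "\<forall>x. x \<notin> closure {x. f x \<noteq> 0} \<longrightarrow> f x = 0"
    using closure_subset[of "{x. f x \<noteq> 0}"] by blast
qed (use assms in \<open>auto simp: test_functions_def smooth_def\<close>)

lemma test_functions_smooth: "f \<in> test_functions D \<Longrightarrow> smooth f"
  by (auto simp: test_functions_def smooth_def)

lemma test_functions_mult:
  assumes "f \<in> test_functions D" and "smooth g"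
  shows "(\<lambda>x. g x * f x) \<in> test_functions D"
proof -
  obtain K where "smooth f" "compact K" "K \<subseteq> D" "\<forall>x. x \<notin> K \<longrightarrow> f x = 0"
    using assms(1) by (rule test_functionsE)
  with assms(2) show ?thesis
    by (intro test_functionsI[of _ K] smooth_mult) auto
qed

lemma frechet_derivative_eq_0_outside:
  assumes "compact K" and "\<And>x. x \<notin> K \<Longrightarrow> f x = 0" and "x \<notin> K"
  shows "frechet_derivative f (at x) = (\<lambda>h. 0)"
proof -
  have "((\<lambda>x. 0) has_derivative (\<lambda>h. 0)) (at x)" by simp
  then have "(f has_derivative (\<lambda>h. 0)) (at x)"
    by (rule has_derivative_transform_within_open[of _ _ _ _ "- K"])
      (use assms in \<open>auto simp: compact_imp_closed\<close>)
  then show ?thesis using frechet_derivative_at by metis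
qed

lemma test_functions_frechet_derivative:
  assumes "f \<in> test_functions D"
  shows "(\<lambda>x. frechet_derivative f (at x) b) \<in> test_functions D"
proof -
  obtain K where K: "smooth f" "compact K" "K \<subseteq> D" "\<forall>x. x \<notin> K \<longrightarrow> f x = 0"
    using assms by (rule test_functionsE)
  show ?thesis
    by (rule test_functionsI[OF smooth_frechet_derivative[OF K(1)] K(2,3)])
      (simp add: frechet_derivative_eq_0_outside[OF K(2) K(4)[rule_format]])
qed

lemma test_functions_bounded:
  assumes "f \<in> test_functions D"
  obtains B where "\<And>x. \<bar>f x\<bar> \<le> B" "0 \<le> B"
proof -
  obtain K where K: "smooth f" "compact K" "K \<subseteq> D" "\<forall>x. x \<notin> K \<longrightarrow> f x = 0"
    using assms by (rule test_functionsE)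
  have "bounded (f ` K)"
    by (intro compact_imp_bounded compact_continuous_image smooth_continuous_on K)
  then obtain B where "\<And>x. x \<in> K \<Longrightarrow> \<bar>f x\<bar> \<le> B"
    by (auto simp: bounded_iff)
  then have "\<bar>f x\<bar> \<le> max B 0" for x
    using K(4) by (cases "x \<in> K") (auto simp: le_max_iff_disj)
  then show thesis using that by fastforce
qed

lemma test_functions_integrable:
  fixes f :: "'a::euclidean_space \<Rightarrow> real"
  assumes "f \<in> test_functions D"
  shows "integrable lborel f"
proof -
  obtain K where K: "smooth f" "compact K" "K \<subseteq> D" "\<forall>x. x \<notin> K \<longrightarrow> f x = 0"
    using assms by (rule test_functionsE)
  have "integrable lborel (\<lambda>x. indicator K x *\<^sub>R f x)"
    by (intro borel_integrable_compact K smooth_continuous_on)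
  also have "(\<lambda>x. indicator K x *\<^sub>R f x) = f"
    using K(4) by (auto simp: indicator_def fun_eq_iff)
  finally show ?thesis .
qed

section \<open>Square integrable functions\<close>

lemma L2D:
  assumes "f \<in> L2 M"
  shows "f \<in> borel_measurable M" and "integrable M (\<lambda>x. (norm (f x))\<^sup>2)"
  using assms by (auto simp: L2_def)

lemma L2I:
  assumes "f \<in> borel_measurable M" and "integrable M g" and "AE x in M. (norm (f x))\<^sup>2 \<le> g x"
  shows "f \<in> L2 M"
  unfolding L2_def
proof (intro CollectI conjI assms(1) Bochner_Integration.integrable_bound[OF assms(2)])
  show "AE x in M. norm ((norm (f x))\<^sup>2) \<le> norm (g x)"
    using assms(3) by eventually_elim auto
qed (use assms(1) in measurable)

lemma L2_bounded_mult:
  fixes f :: "'a \<Rightarrow> 'b::euclidean_space" and g :: "'a \<Rightarrow> 'c::euclidean_space"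
  assumes "f \<in> L2 M" and "g \<in> borel_measurable M" and "AE x in M. norm (g x) \<le> C * norm (f x)"
  shows "g \<in> L2 M"
proof (rule L2I[OF assms(2)])
  show "integrable M (\<lambda>x. C\<^sup>2 * (norm (f x))\<^sup>2)"
    using L2D(2)[OF assms(1)] by simp
  show "AE x in M. (norm (g x))\<^sup>2 \<le> C\<^sup>2 * (norm (f x))\<^sup>2"
    using assms(3)
  proof eventually_elim
    case (elim x)
    then have "(norm (g x))\<^sup>2 \<le> (C * norm (f x))\<^sup>2"
      by (intro power_mono) auto
    then show ?case by (simp add: power_mult_distrib)
  qed
qed

lemma L2_add:
  assumes "f \<in> L2 M" and "g \<in> L2 M"
  shows "(\<lambda>x. f x + g x) \<in> L2 M"
proof (rule L2I[where g="\<lambda>x. 2 * (norm (f x))\<^sup>2 + 2 * (norm (g x))\<^sup>2"])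
  show "AE x in M. (norm (f x + g x))\<^sup>2 \<le> 2 * (norm (f x))\<^sup>2 + 2 * (norm (g x))\<^sup>2"
  proof (rule AE_I2)
    fix x
    have "(norm (f x + g x))\<^sup>2 \<le> (norm (f x) + norm (g x))\<^sup>2"
      by (intro power_mono norm_triangle_ineq) auto
    also have "\<dots> \<le> 2 * (norm (f x))\<^sup>2 + 2 * (norm (g x))\<^sup>2"
      using sum_squares_bound[of "norm (f x)" "norm (g x)"] by (simp add: power2_sum)
    finally show "(norm (f x + g x))\<^sup>2 \<le> 2 * (norm (f x))\<^sup>2 + 2 * (norm (g x))\<^sup>2" .
  qed
qed (use L2D[OF assms(1)] L2D[OF assms(2)] in auto)

lemma L2_scaleR:
  assumes "f \<in> L2 M"
  shows "(\<lambda>x. r *\<^sub>R f x) \<in> L2 M"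
  by (rule L2_bounded_mult[OF assms, of _ "\<bar>r\<bar>"]) (use L2D[OF assms] in auto)

lemma L2_cmult:
  fixes f :: "'a \<Rightarrow> real"
  assumes "f \<in> L2 M"
  shows "(\<lambda>x. r * f x) \<in> L2 M"
  using L2_scaleR[OF assms, of r] by simp

lemma L2_diff:
  assumes "f \<in> L2 M" and "g \<in> L2 M"
  shows "(\<lambda>x. f x - g x) \<in> L2 M"
  using L2_add[OF assms(1) L2_scaleR[OF assms(2), of "-1"]] by simp

lemma L2_zero: "(\<lambda>x. 0) \<in> L2 M"
  by (simp add: L2_def)

lemma L2_sum: "(\<And>i. i \<in> I \<Longrightarrow> f i \<in> L2 M) \<Longrightarrow> (\<lambda>x. \<Sum>i\<in>I. f i x) \<in> L2 M"
  by (induction I rule: infinite_finite_induct) (auto intro: L2_zero L2_add)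

lemma L2_norm_nonneg: "0 \<le> L2_norm M f"
  by (simp add: L2_norm_def)

lemma L2_norm_sq: "(L2_norm M f)\<^sup>2 = (\<integral>x. (norm (f x))\<^sup>2 \<partial>M)"
  by (simp add: L2_norm_def)

lemma L2_norm_cong_AE:
  assumes "f \<in> borel_measurable M" and "g \<in> borel_measurable M" and "AE x in M. f x = g x"
  shows "L2_norm M f = L2_norm M g"
proof -
  have "(\<integral>x. (norm (f x))\<^sup>2 \<partial>M) = (\<integral>x. (norm (g x))\<^sup>2 \<partial>M)"
    by (rule integral_cong_AE) (use assms in \<open>auto elim!: eventually_mono\<close>)
  then show ?thesis by (simp add: L2_norm_def)
qed

lemma L2_norm_minus_commute:
  "L2_norm M (\<lambda>x. f x - g x) = L2_norm M (\<lambda>x. g x - f x)"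
  by (simp add: L2_norm_def norm_minus_commute)

lemma L2_prod_integrable:
  fixes f :: "'a \<Rightarrow> 'b::euclidean_space" and g :: "'a \<Rightarrow> 'c::euclidean_space"
  assumes "f \<in> L2 M" and "g \<in> L2 M"
  shows "integrable M (\<lambda>x. norm (f x) * norm (g x))"
proof (rule Bochner_Integration.integrable_bound[where f="\<lambda>x. (norm (f x))\<^sup>2 + (norm (g x))\<^sup>2"])
  show "AE x in M. norm (norm (f x) * norm (g x)) \<le> norm ((norm (f x))\<^sup>2 + (norm (g x))\<^sup>2)"
  proof (rule AE_I2)
    fix x
    have "0 \<le> norm (f x) * norm (g x)" by simp
    moreover have "2 * (norm (f x) * norm (g x)) \<le> (norm (f x))\<^sup>2 + (norm (g x))\<^sup>2"
      using sum_squares_bound[of "norm (f x)" "norm (g x)"] by (simp add: mult.assoc)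
    ultimately have "norm (f x) * norm (g x) \<le> (norm (f x))\<^sup>2 + (norm (g x))\<^sup>2"
      by linarith
    then show "norm (norm (f x) * norm (g x)) \<le> norm ((norm (f x))\<^sup>2 + (norm (g x))\<^sup>2)"
      by simp
  qed
qed (use L2D[OF assms(1)] L2D[OF assms(2)] in auto)

text \<open>The algebra behind Cauchy-Schwarz, stated so that c = 0 is allowed: the forms below are
  only semidefinite on representatives.\<close>

lemma discriminant_nonpos:
  fixes a b c :: real
  assumes "\<And>r. 0 \<le> a + 2 * r * b + r\<^sup>2 * c" and "0 \<le> c" and "0 \<le> a"
  shows "b\<^sup>2 \<le> a * c"
proof (cases "c = 0")
  case True
  have "b = 0"
  proof (rule ccontr)
    assume b: "b \<noteq> 0"
    \<comment> \<open>With c = 0 the expression is affine in r; this choice of r gives it the value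
      -1.\<close>
    have "0 \<le> a + 2 * (- (a + 1) / (2 * b)) * b"
      using assms(1)[of "- (a + 1) / (2 * b)"] True by simp
    with b show False by (simp add: field_simps)
  qed
  with True show ?thesis by simp
next
  case False
  with assms(2) have c: "c > 0" by simp
  have "0 \<le> a + 2 * (- b / c) * b + (- b / c)\<^sup>2 * c" by (rule assms(1))
  also have "\<dots> = a - b\<^sup>2 / c"
    using c by (simp add: field_simps power2_eq_square)
  finally show ?thesis
    using c by (simp add: field_simps)
qed

lemma L2_Cauchy_Schwarz:
  fixes f :: "'a \<Rightarrow> 'b::euclidean_space" and g :: "'a \<Rightarrow> 'c::euclidean_space"
  assumes "f \<in> L2 M" and "g \<in> L2 M"
  shows "(\<integral>x. norm (f x) * norm (g x) \<partial>M) \<le> L2_norm M f * L2_norm M g"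
proof -
  note int = L2_prod_integrable[OF assms] L2D(2)[OF assms(1)] L2D(2)[OF assms(2)]
  let ?I = "\<integral>x. norm (f x) * norm (g x) \<partial>M"
  have "?I\<^sup>2 \<le> (\<integral>x. (norm (f x))\<^sup>2 \<partial>M) * (\<integral>x. (norm (g x))\<^sup>2 \<partial>M)"
  proof (rule discriminant_nonpos)
    fix r
    have "0 \<le> (\<integral>x. (norm (f x) + r * norm (g x))\<^sup>2 \<partial>M)"
      by simp
    also have "\<dots> = (\<integral>x. (norm (f x))\<^sup>2 + 2 * r * (norm (f x) * norm (g x)) + r\<^sup>2 * (norm (g x))\<^sup>2 \<partial>M)"
      by (intro Bochner_Integration.integral_cong) (auto simp: power2_eq_square algebra_simps)
    also have "\<dots> = (\<integral>x. (norm (f x))\<^sup>2 \<partial>M) + 2 * r * ?I + r\<^sup>2 * (\<integral>x. (norm (g x))\<^sup>2 \<partial>M)"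
      using int by simp
    finally show "0 \<le> \<dots>" .
  qed auto
  also have "\<dots> = (L2_norm M f * L2_norm M g)\<^sup>2"
    by (simp add: power_mult_distrib L2_norm_sq)
  finally show ?thesis
    by (rule power2_le_imp_le) (simp add: L2_norm_nonneg)
qed

lemma L2_norm_triangle:
  assumes "f \<in> L2 M" and "g \<in> L2 M"
  shows "L2_norm M (\<lambda>x. f x + g x) \<le> L2_norm M f + L2_norm M g"
proof -
  note int = L2_prod_integrable[OF assms] L2D(2)[OF assms(1)] L2D(2)[OF assms(2)]
  have "(L2_norm M (\<lambda>x. f x + g x))\<^sup>2 \<le>
      (\<integral>x. (norm (f x))\<^sup>2 + 2 * (norm (f x) * norm (g x)) + (norm (g x))\<^sup>2 \<partial>M)"
    unfolding L2_norm_sq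
  proof (rule integral_mono)
    show "(norm (f x + g x))\<^sup>2 \<le> (norm (f x))\<^sup>2 + 2 * (norm (f x) * norm (g x)) + (norm (g x))\<^sup>2" for x
      using power_mono[OF norm_triangle_ineq[of "f x" "g x"], of 2] by (simp add: power2_sum)
  qed (use int L2D(2)[OF L2_add[OF assms]] in auto)
  also have "\<dots> = (L2_norm M f)\<^sup>2 + 2 * (\<integral>x. norm (f x) * norm (g x) \<partial>M) + (L2_norm M g)\<^sup>2"
    using int by (simp add: L2_norm_sq)
  also have "\<dots> \<le> (L2_norm M f + L2_norm M g)\<^sup>2"
    using L2_Cauchy_Schwarz[OF assms] by (simp add: power2_sum)
  finally show ?thesis
    by (rule power2_le_imp_le) (simp add: L2_norm_nonneg)
qed

lemma L2_norm_triangle_diff: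
  assumes "f \<in> L2 M" and "g \<in> L2 M"
  shows "L2_norm M f \<le> L2_norm M (\<lambda>x. f x - g x) + L2_norm M g"
  using L2_norm_triangle[OF L2_diff[OF assms] assms(2)] by simp

lemma L2_norm_mono:
  fixes f :: "'a \<Rightarrow> 'b::euclidean_space" and g :: "'a \<Rightarrow> 'c::euclidean_space"
  assumes "f \<in> L2 M" and "g \<in> borel_measurable M" and "AE x in M. norm (g x) \<le> C * norm (f x)" "0 \<le> C"
  shows "L2_norm M g \<le> C * L2_norm M f"
proof -
  have "(L2_norm M g)\<^sup>2 \<le> (\<integral>x. C\<^sup>2 * (norm (f x))\<^sup>2 \<partial>M)"
    unfolding L2_norm_sq
  proof (rule integral_mono_AE)
    show "AE x in M. (norm (g x))\<^sup>2 \<le> C\<^sup>2 * (norm (f x))\<^sup>2"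
      using assms(3)
    proof eventually_elim
      case (elim x)
      then have "(norm (g x))\<^sup>2 \<le> (C * norm (f x))\<^sup>2"
        by (intro power_mono) auto
      then show ?case by (simp add: power_mult_distrib)
    qed
  qed (use L2D(2)[OF assms(1)] L2D(2)[OF L2_bounded_mult[OF assms(1-3)]] in auto)
  also have "\<dots> = (C * L2_norm M f)\<^sup>2"
    by (simp add: power_mult_distrib L2_norm_sq)
  finally show ?thesis
    by (rule power2_le_imp_le) (simp add: L2_norm_nonneg assms(4))
qed

lemma L2_tendsto_mono:
  fixes f :: "nat \<Rightarrow> 'a \<Rightarrow> 'b::euclidean_space" and g :: "nat \<Rightarrow> 'a \<Rightarrow> 'c::euclidean_space"
  assumes "(\<lambda>j. L2_norm M (f j)) \<longlonglongrightarrow> 0" and "\<And>j. f j \<in> L2 M" and "\<And>j. g j \<in> borel_measurable M"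
    and "\<And>j. AE x in M. norm (g j x) \<le> C * norm (f j x)" and "0 \<le> C"
  shows "(\<lambda>j. L2_norm M (g j)) \<longlonglongrightarrow> 0"
proof (rule tendsto_sandwich[OF _ _ tendsto_const])
  show "(\<lambda>j. C * L2_norm M (f j)) \<longlonglongrightarrow> 0"
    using tendsto_mult_right_zero[OF assms(1)] .
  show "\<forall>\<^sub>F j in sequentially. L2_norm M (g j) \<le> C * L2_norm M (f j)"
    using L2_norm_mono[OF assms(2-5)] by simp
qed (simp add: L2_norm_nonneg)

lemma L2_Pair:
  fixes f :: "'a \<Rightarrow> 'b::euclidean_space" and g :: "'a \<Rightarrow> 'c::euclidean_space"
  assumes "f \<in> L2 M" and "g \<in> L2 M"
  shows "(\<lambda>x. (f x, g x)) \<in> L2 M"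
  by (rule L2I[where g="\<lambda>x. (norm (f x))\<^sup>2 + (norm (g x))\<^sup>2"])
    (use L2D[OF assms(1)] L2D[OF assms(2)] in \<open>auto simp: norm_Pair borel_measurable_Pair\<close>)

lemma L2_norm_Pair:
  fixes f :: "'a \<Rightarrow> 'b::euclidean_space" and g :: "'a \<Rightarrow> 'c::euclidean_space"
  assumes "f \<in> L2 M" and "g \<in> L2 M"
  shows "L2_norm M (\<lambda>x. (f x, g x)) = sqrt ((L2_norm M f)\<^sup>2 + (L2_norm M g)\<^sup>2)"
  using L2D(2)[OF assms(1)] L2D(2)[OF assms(2)]
  by (simp add: L2_norm_def norm_Pair)

subsection \<open>Bounded bilinear forms\<close>

text \<open>Forms act on arbitrary square integrable fields, later on jets (value, gradient), and
  not on Sobolev functions. Continuity is then a pure L2 statement, and classical and weak gradients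
  are handled alike. Bilinearity holds at every point so that the integrand can be expanded freely;
  the bound is asked only almost everywhere because the coefficient c is bounded only in that
  sense.\<close>

locale L2_form =
  fixes M :: "'a measure" and \<Phi> :: "'a \<Rightarrow> 'b::euclidean_space \<Rightarrow> 'b \<Rightarrow> real" and C :: real
  assumes bilin: "bilinear (\<Phi> x)"
    and meas: "p \<in> borel_measurable M \<Longrightarrow> q \<in> borel_measurable M \<Longrightarrow>
      (\<lambda>x. \<Phi> x (p x) (q x)) \<in> borel_measurable M"
    and bound: "AE x in M. \<forall>u v. \<bar>\<Phi> x u v\<bar> \<le> C * norm u * norm v"
    and C_nonneg: "0 \<le> C"
begin

definition form :: "('a \<Rightarrow> 'b) \<Rightarrow> ('a \<Rightarrow> 'b) \<Rightarrow> real" where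
  "form p q = (\<integral>x. \<Phi> x (p x) (q x) \<partial>M)"

lemma integrable_form:
  assumes "p \<in> L2 M" and "q \<in> L2 M"
  shows "integrable M (\<lambda>x. \<Phi> x (p x) (q x))"
proof (rule Bochner_Integration.integrable_bound[where f="\<lambda>x. C * (norm (p x) * norm (q x))"])
  show "AE x in M. norm (\<Phi> x (p x) (q x)) \<le> norm (C * (norm (p x) * norm (q x)))"
    using bound
  proof eventually_elim
    case (elim x)
    then show ?case using C_nonneg by (simp add: mult.assoc abs_mult)
  qed
qed (use L2_prod_integrable[OF assms] meas L2D(1)[OF assms(1)] L2D(1)[OF assms(2)] in auto)

lemma form_bound:
  assumes "p \<in> L2 M" and "q \<in> L2 M"
  shows "\<bar>form p q\<bar> \<le> C * (L2_norm M p * L2_norm M q)"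
proof -
  have "\<bar>form p q\<bar> \<le> (\<integral>x. C * (norm (p x) * norm (q x)) \<partial>M)"
  proof -
    have "\<bar>form p q\<bar> \<le> (\<integral>x. norm (\<Phi> x (p x) (q x)) \<partial>M)"
      unfolding form_def real_norm_def[symmetric] by (rule integral_norm_bound)
    also have "\<dots> \<le> (\<integral>x. C * (norm (p x) * norm (q x)) \<partial>M)"
    proof (rule integral_mono_AE)
      show "AE x in M. norm (\<Phi> x (p x) (q x)) \<le> C * (norm (p x) * norm (q x))"
        using bound by eventually_elim (simp add: mult.assoc)
    qed (use L2_prod_integrable[OF assms] integrable_form[OF assms] in auto)
    finally show ?thesis .
  qed
  also have "\<dots> \<le> C * (L2_norm M p * L2_norm M q)"
    using L2_Cauchy_Schwarz[OF assms] C_nonneg by (simp add: mult_left_mono)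
  finally show ?thesis .
qed

lemma form_add_left:
  assumes "p \<in> L2 M" "p' \<in> L2 M" "q \<in> L2 M"
  shows "form (\<lambda>x. p x + p' x) q = form p q + form p' q"
  using integrable_form[OF assms(1,3)] integrable_form[OF assms(2,3)]
  by (simp add: form_def bilinear_ladd[OF bilin])

lemma form_add_right:
  assumes "p \<in> L2 M" "q \<in> L2 M" "q' \<in> L2 M"
  shows "form p (\<lambda>x. q x + q' x) = form p q + form p q'"
  using integrable_form[OF assms(1,2)] integrable_form[OF assms(1,3)]
  by (simp add: form_def bilinear_radd[OF bilin])

lemma form_scale_left: "form (\<lambda>x. r *\<^sub>R p x) q = r * form p q"
  by (simp add: form_def bilinear_lmul[OF bilin])

lemma form_scale_right: "form p (\<lambda>x. r *\<^sub>R q x) = r * form p q"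
  by (simp add: form_def bilinear_rmul[OF bilin])

lemma form_diff_left:
  assumes "p \<in> L2 M" "p' \<in> L2 M" "q \<in> L2 M"
  shows "form (\<lambda>x. p x - p' x) q = form p q - form p' q"
  using integrable_form[OF assms(1,3)] integrable_form[OF assms(2,3)]
  by (simp add: form_def bilinear_lsub[OF bilin])

lemma form_diff_right:
  assumes "p \<in> L2 M" "q \<in> L2 M" "q' \<in> L2 M"
  shows "form p (\<lambda>x. q x - q' x) = form p q - form p q'"
  using integrable_form[OF assms(1,2)] integrable_form[OF assms(1,3)]
  by (simp add: form_def bilinear_rsub[OF bilin])

lemma form_cong_AE:
  assumes "p \<in> borel_measurable M" "q \<in> borel_measurable M"
    "p' \<in> borel_measurable M" "q' \<in> borel_measurable M"
    and "AE x in M. p x = p' x" "AE x in M. q x = q' x"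
  shows "form p q = form p' q'"
  unfolding form_def
proof (rule integral_cong_AE)
  show "AE x in M. \<Phi> x (p x) (q x) = \<Phi> x (p' x) (q' x)"
    using assms(5,6) by eventually_elim simp
qed (use meas assms in auto)

lemma form_tendsto:
  assumes p: "p \<in> L2 M" "\<And>j. pj j \<in> L2 M" "(\<lambda>j. L2_norm M (\<lambda>x. pj j x - p x)) \<longlonglongrightarrow> 0"
    and q: "q \<in> L2 M" "\<And>j. qj j \<in> L2 M" "(\<lambda>j. L2_norm M (\<lambda>x. qj j x - q x)) \<longlonglongrightarrow> 0"
  shows "(\<lambda>j::nat. form (pj j) (qj j)) \<longlonglongrightarrow> form p q"
proof (rule LIM_zero_cancel, rule Lim_null_comparison)
  let ?P = "\<lambda>j. L2_norm M (\<lambda>x. pj j x - p x)" and ?Q = "\<lambda>j. L2_norm M (\<lambda>x. qj j x - q x)"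
  have "norm (form (pj j) (qj j) - form p q) \<le>
      C * (?P j * (?Q j + L2_norm M q)) + C * (L2_norm M p * ?Q j)" for j
  proof -
    have "form (pj j) (qj j) - form p q =
        form (\<lambda>x. pj j x - p x) (qj j) + form p (\<lambda>x. qj j x - q x)"
      by (simp add: form_diff_left form_diff_right p q)
    moreover have "\<bar>form (\<lambda>x. pj j x - p x) (qj j)\<bar> \<le> C * (?P j * (?Q j + L2_norm M q))"
    proof -
      have "\<bar>form (\<lambda>x. pj j x - p x) (qj j)\<bar> \<le> C * (?P j * L2_norm M (qj j))"
        by (rule form_bound[OF L2_diff[OF p(2,1)] q(2)])
      also have "\<dots> \<le> C * (?P j * (?Q j + L2_norm M q))"
        by (intro mult_left_mono L2_norm_triangle_diff q C_nonneg L2_norm_nonneg)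
      finally show ?thesis .
    qed
    moreover have "\<bar>form p (\<lambda>x. qj j x - q x)\<bar> \<le> C * (L2_norm M p * ?Q j)"
      by (rule form_bound[OF p(1) L2_diff[OF q(2,1)]])
    ultimately show ?thesis by simp
  qed
  then show "\<forall>\<^sub>F j in sequentially. norm (form (pj j) (qj j) - form p q) \<le>
      C * (?P j * (?Q j + L2_norm M q)) + C * (L2_norm M p * ?Q j)"
    by simp
  have "(\<lambda>j. C * (?P j * (?Q j + L2_norm M q)) + C * (L2_norm M p * ?Q j)) \<longlonglongrightarrow>
      C * (0 * (0 + L2_norm M q)) + C * (L2_norm M p * 0)"
    by (intro tendsto_intros p q)
  then show "(\<lambda>j. C * (?P j * (?Q j + L2_norm M q)) + C * (L2_norm M p * ?Q j)) \<longlonglongrightarrow> 0"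
    by simp
qed

end

locale L2_inner_form = L2_form +
  assumes sym: "AE x in M. \<forall>u v. \<Phi> x u v = \<Phi> x v u"
    and nonneg: "AE x in M. \<forall>u. 0 \<le> \<Phi> x u u"
begin

lemma form_sym:
  assumes "p \<in> L2 M" "q \<in> L2 M"
  shows "form p q = form q p"
  unfolding form_def
proof (rule integral_cong_AE)
  show "AE x in M. \<Phi> x (p x) (q x) = \<Phi> x (q x) (p x)"
    using sym by eventually_elim simp
qed (use meas L2D(1) assms in auto)

lemma form_nonneg: "0 \<le> form p p"
  unfolding form_def using nonneg by (intro integral_nonneg_AE) (auto elim!: eventually_mono)

lemma form_add_self:
  assumes "p \<in> L2 M" "q \<in> L2 M"
  shows "form (\<lambda>x. p x + r *\<^sub>R q x) (\<lambda>x. p x + r *\<^sub>R q x) = form p p + 2 * r * form p q + r\<^sup>2 * form q q"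
  using form_sym[OF assms]
  by (simp add: form_add_left form_add_right form_scale_left form_scale_right L2_add L2_scaleR assms
      power2_eq_square algebra_simps)

lemma form_Cauchy_Schwarz:
  assumes "p \<in> L2 M" "q \<in> L2 M"
  shows "(form p q)\<^sup>2 \<le> form p p * form q q"
  by (rule discriminant_nonpos)
    (simp_all add: form_add_self[OF assms, symmetric] form_nonneg)

end

lemma L2_form_inner: "L2_form M (\<lambda>x. (\<bullet>)) 1"
proof
  show "bilinear ((\<bullet>) :: 'b \<Rightarrow> 'b \<Rightarrow> real)"
    by (simp add: bilinear_def linear_iff inner_simps)
qed (auto simp: Cauchy_Schwarz_ineq2)

lemma L2_inner_integrable:
  fixes f g :: "'a \<Rightarrow> real"
  assumes "f \<in> L2 M" and "g \<in> L2 M"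
  shows "integrable M (\<lambda>x. f x * g x)"
  using L2_form.integrable_form[OF L2_form_inner assms] by simp

lemma L2_inner_bound:
  assumes "f \<in> L2 M" and "g \<in> L2 M"
  shows "\<bar>L2_inner M f g\<bar> \<le> L2_norm M f * L2_norm M g"
  using L2_form.form_bound[OF L2_form_inner assms]
  unfolding L2_form.form_def[OF L2_form_inner] L2_inner_def by simp

lemma L2_inner_commute: "L2_inner M f g = L2_inner M g f"
  by (simp add: L2_inner_def mult.commute)

lemma L2_inner_add:
  assumes "f \<in> L2 M" "f' \<in> L2 M" and "g \<in> L2 M"
  shows "L2_inner M (\<lambda>x. f x + f' x) g = L2_inner M f g + L2_inner M f' g"
  using assms by (simp add: L2_inner_def L2_inner_integrable distrib_right)

lemma L2_inner_diff:
  assumes "f \<in> L2 M" "f' \<in> L2 M" and "g \<in> L2 M"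
  shows "L2_inner M (\<lambda>x. f x - f' x) g = L2_inner M f g - L2_inner M f' g"
  using assms by (simp add: L2_inner_def L2_inner_integrable left_diff_distrib)

lemma L2_inner_cmult: "L2_inner M (\<lambda>x. r * f x) g = r * L2_inner M f g"
  by (simp add: L2_inner_def mult.assoc)

lemma L2_inner_sum:
  assumes "\<And>i. i \<in> I \<Longrightarrow> f i \<in> L2 M" and "g \<in> L2 M"
  shows "L2_inner M (\<lambda>x. \<Sum>i\<in>I. r i * f i x) g = (\<Sum>i\<in>I. r i * L2_inner M (f i) g)"
  using assms
  by (induction I rule: infinite_finite_induct)
    (auto simp: L2_inner_add L2_inner_cmult L2_sum L2_cmult, auto simp: L2_inner_def)

lemma L2_inner_self: "L2_inner M f f = (L2_norm M f)\<^sup>2"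
  unfolding L2_norm_sq by (simp add: L2_inner_def power2_eq_square)

lemma L2_inner_tendsto:
  assumes "f \<in> L2 M" "\<And>j. fj j \<in> L2 M" "(\<lambda>j. L2_norm M (\<lambda>x. fj j x - f x)) \<longlonglongrightarrow> 0" and "g \<in> L2 M"
  shows "(\<lambda>j::nat. L2_inner M (fj j) g) \<longlonglongrightarrow> L2_inner M f g"
proof (rule LIM_zero_cancel, rule Lim_null_comparison)
  show "\<forall>\<^sub>F j in sequentially. norm (L2_inner M (fj j) g - L2_inner M f g) \<le>
      L2_norm M (\<lambda>x. fj j x - f x) * L2_norm M g"
    using L2_inner_bound[OF L2_diff[OF assms(2,1)] assms(4)] L2_inner_diff[OF assms(2,1,4)] by simp
  show "(\<lambda>j. L2_norm M (\<lambda>x. fj j x - f x) * L2_norm M g) \<longlonglongrightarrow> 0"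
    by (rule tendsto_mult_left_zero[OF assms(3)])
qed

subsection \<open>Orthonormal bases\<close>

locale L2_basis =
  fixes M :: "'a measure" and \<phi> :: "nat \<Rightarrow> 'a \<Rightarrow> real"
  assumes phi_L2: "\<phi> k \<in> L2 M"
    and ortho: "L2_inner M (\<phi> j) (\<phi> k) = (if j = k then 1 else 0)"
    and complete: "w \<in> L2 M \<Longrightarrow>
      (\<lambda>N. L2_norm M (\<lambda>x. w x - (\<Sum>k<N. L2_inner M w (\<phi> k) * \<phi> k x))) \<longlonglongrightarrow> 0"
begin

lemma partial_sum_L2: "(\<lambda>x. \<Sum>k<N. r k * \<phi> k x) \<in> L2 M"
  by (intro L2_sum L2_cmult phi_L2)

lemma coeff_partial_sum:
  "L2_inner M (\<lambda>x. \<Sum>k<N. r k * \<phi> k x) (\<phi> j) = (if j < N then r j else 0)"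
proof -
  have "L2_inner M (\<lambda>x. \<Sum>k<N. r k * \<phi> k x) (\<phi> j) = (\<Sum>k<N. r k * (if k = j then 1 else 0))"
    by (simp add: L2_inner_sum phi_L2 ortho)
  also have "\<dots> = (\<Sum>k<N. if k = j then r k else 0)"
    by (intro sum.cong) auto
  finally show ?thesis by simp
qed

lemma partial_inner_sums:
  assumes "v \<in> L2 M" "w \<in> L2 M"
  shows "(\<lambda>k. L2_inner M v (\<phi> k) * L2_inner M w (\<phi> k)) sums L2_inner M v w"
proof -
  have "(\<lambda>N. L2_inner M (\<lambda>x. \<Sum>k<N. L2_inner M v (\<phi> k) * \<phi> k x) w) \<longlonglongrightarrow> L2_inner M v w"
    by (rule L2_inner_tendsto[OF assms(1) partial_sum_L2 _ assms(2)])
      (subst L2_norm_minus_commute, rule complete[OF assms(1)])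
  moreover have "L2_inner M (\<lambda>x. \<Sum>k<N. L2_inner M v (\<phi> k) * \<phi> k x) w =
      (\<Sum>k<N. L2_inner M v (\<phi> k) * L2_inner M w (\<phi> k))" for N
    by (simp add: L2_inner_sum phi_L2 assms L2_inner_commute[of M "\<phi> _" w])
  ultimately show ?thesis by (simp add: sums_def)
qed

lemma Parseval:
  assumes "w \<in> L2 M"
  shows "(\<lambda>k. (L2_inner M w (\<phi> k))\<^sup>2) sums (L2_norm M w)\<^sup>2"
  using partial_inner_sums[OF assms assms] by (simp add: L2_inner_self power2_eq_square)

lemma Bessel:
  assumes "w \<in> L2 M"
  shows "(\<Sum>k<N. (L2_inner M w (\<phi> k))\<^sup>2) \<le> (L2_norm M w)\<^sup>2"
  using sum_le_suminf[OF sums_summable[OF Parseval[OF assms]], of "{..<N}"]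
    sums_unique[OF Parseval[OF assms]] by simp

end

section \<open>Weak gradients\<close>

text \<open>A bridge between two measures: spaces are built on \<open>lebesgue_on\<close>, while
  translation invariance and the fundamental theorem of calculus are used for
  \<open>lborel\<close>.\<close>

lemma integrable_lebesgue_on_iff_lborel:
  fixes g :: "'a::euclidean_space \<Rightarrow> 'b::euclidean_space"
  assumes "g \<in> borel_measurable borel" and "D \<in> sets lebesgue" and "\<And>x. x \<notin> D \<Longrightarrow> g x = 0"
  shows "integrable (lebesgue_on D) g \<longleftrightarrow> integrable lborel g"
    and "integral\<^sup>L (lebesgue_on D) g = integral\<^sup>L lborel g"
proof -
  have "(\<lambda>x. indicator D x *\<^sub>R g x) = g"
    using assms(3) by (auto simp: fun_eq_iff indicator_def)
  then show "integrable (lebesgue_on D) g \<longleftrightarrow> integrable lborel g"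
    and "integral\<^sup>L (lebesgue_on D) g = integral\<^sup>L lborel g"
    using assms(1,2)
    by (simp_all add: integrable_restrict_space integral_restrict_space integrable_completion integral_completion)
qed

section \<open>Integration by parts against test functions\<close>

lemma smooth_borel_measurable: "smooth f \<Longrightarrow> f \<in> borel_measurable borel"
  by (intro borel_measurable_continuous_onI smooth_continuous_on)

lemma smooth_measurable_lebesgue_on: "smooth f \<Longrightarrow> f \<in> borel_measurable (lebesgue_on D)"
  by (intro measurable_restrict_space1 measurable_completion) (simp add: smooth_borel_measurable)

lemma smooth_line_derivative:
  fixes x b :: "'a::euclidean_space"
  assumes "smooth F"
  shows "((\<lambda>t. F (x + t *\<^sub>R b)) has_real_derivative frechet_derivative F (at (x + t *\<^sub>R b)) b) (at t)"
proof -
  let ?D = "frechet_derivative F (at (x + t *\<^sub>R b))"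
  have F: "(F has_derivative ?D) (at (x + t *\<^sub>R b))"
    by (rule smooth_has_derivative[OF assms])
  have "((\<lambda>t. x + t *\<^sub>R b) has_derivative (\<lambda>h. h *\<^sub>R b)) (at t)"
    by (auto intro!: derivative_eq_intros)
  from this F have "((\<lambda>t. F (x + t *\<^sub>R b)) has_derivative (\<lambda>h. ?D (h *\<^sub>R b))) (at t)"
    by (rule has_derivative_compose)
  moreover have "?D (h *\<^sub>R b) = ?D b * h" for h
    using has_derivative_linear[OF F] by (simp add: linear_cmul)
  ultimately show ?thesis
    by (simp add: has_field_derivative_def)
qed

lemma integral_lborel_translate:
  fixes f :: "'a::euclidean_space \<Rightarrow> real"
  assumes "f \<in> borel_measurable borel"
  shows "(\<integral>x. f (x + a) \<partial>lborel) = (\<integral>x. f x \<partial>lborel)"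
proof -
  have "(\<integral>x. f x \<partial>lborel) = (\<integral>x. f x \<partial>distr lborel borel ((+) a))"
    by (simp add: lborel_distr_plus)
  also have "\<dots> = (\<integral>x. f (a + x) \<partial>lborel)"
    using assms by (subst integral_distr) auto
  finally show ?thesis by (simp add: add.commute)
qed

lemma integrable_lborel_translate:
  fixes f :: "'a::euclidean_space \<Rightarrow> real"
  assumes "integrable lborel f"
  shows "integrable lborel (\<lambda>x. f (x + a))"
proof -
  have "integrable (distr lborel borel ((+) a)) f"
    using assms by (simp add: lborel_distr_plus)
  then have "integrable lborel (\<lambda>x. f (a + x))"
    using assms by (subst (asm) integrable_distr_eq) auto
  then show ?thesis by (simp add: add.commute)
qed

text \<open>The difference quotients have vanishing integral, by translation invariance.\<close>

lemma integral_frechet_derivative_eq_0: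
  fixes F :: "'a::euclidean_space \<Rightarrow> real"
  assumes F: "F \<in> test_functions D"
  shows "(\<integral>x. frechet_derivative F (at x) b \<partial>lborel) = 0"
proof -
  obtain K where K: "smooth F" "compact K" "K \<subseteq> D" "\<forall>x. x \<notin> K \<longrightarrow> F x = 0"
    using F by (rule test_functionsE)
  define h :: "nat \<Rightarrow> real" where "h n = 1 / (real n + 1)" for n
  have h: "0 < h n" "h n \<le> 1" for n
    by (auto simp: h_def)
  have h0: "h \<longlonglongrightarrow> 0"
    unfolding h_def using LIMSEQ_inverse_real_of_nat by (simp add: inverse_eq_divide add.commute)
  define Q where "Q n x = (F (x + h n *\<^sub>R b) - F x) / h n" for n x
  have meas: "F \<in> borel_measurable borel"
    by (rule smooth_borel_measurable[OF K(1)])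
  have int: "integrable lborel F"
    by (rule test_functions_integrable[OF F])
  have Q0: "(\<integral>x. Q n x \<partial>lborel) = 0" for n
    unfolding Q_def using int integrable_lborel_translate[OF int] integral_lborel_translate[OF meas]
    by simp
  obtain B where B: "\<And>x. \<bar>frechet_derivative F (at x) b\<bar> \<le> B" "0 \<le> B"
    using test_functions_bounded[OF test_functions_frechet_derivative[OF F]] by metis
  obtain R where R: "\<And>x. x \<in> K \<Longrightarrow> norm x \<le> R"
    using compact_imp_bounded[OF K(2)] by (auto simp: bounded_iff)
  \<comment> \<open>The domination: by the mean value theorem a quotient is a value of the
    derivative, and since the steps are at most 1 all quotients vanish outside a ball of radius R +
    norm b.\<close>
  have Q_bound: "\<bar>Q n x\<bar> \<le> B * indicator (cball 0 (R + norm b)) x" for n x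
  proof (cases "norm x \<le> R + norm b")
    case True
    have "\<exists>z>0. z < h n \<and> F (x + h n *\<^sub>R b) - F (x + 0 *\<^sub>R b) =
        (h n - 0) * frechet_derivative F (at (x + z *\<^sub>R b)) b"
      by (rule MVT2[where f = "\<lambda>t. F (x + t *\<^sub>R b)"]) (use h smooth_line_derivative[OF K(1)] in auto)
    then obtain z where "F (x + h n *\<^sub>R b) - F x = h n * frechet_derivative F (at (x + z *\<^sub>R b)) b"
      by auto
    then have "Q n x = frechet_derivative F (at (x + z *\<^sub>R b)) b"
      using h(1)[of n] by (simp add: Q_def)
    with B True show ?thesis by simp
  next
    case False
    have "norm (x + h n *\<^sub>R b) \<ge> norm x - norm (h n *\<^sub>R b)"
      by (metis norm_diff_ineq)
    moreover have "norm (h n *\<^sub>R b) \<le> norm b"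
      using h[of n] mult_right_mono[of "h n" 1 "norm b"] by simp
    ultimately have "norm (x + h n *\<^sub>R b) > R"
      using False by linarith
    moreover have "norm x > R"
      using False norm_ge_zero[of b] by linarith
    ultimately have "F (x + h n *\<^sub>R b) = 0" "F x = 0"
      using R K(4) by (metis not_le)+
    then show ?thesis using B by (simp add: Q_def)
  qed
  have "(\<lambda>n. \<integral>x. Q n x \<partial>lborel) \<longlonglongrightarrow> (\<integral>x. frechet_derivative F (at x) b \<partial>lborel)"
  proof (rule integral_dominated_convergence[where w="\<lambda>x. B * indicator (cball 0 (R + norm b)) x"])
    show "integrable lborel (\<lambda>x. B * indicator (cball (0::'a) (R + norm b)) x :: real)"
      using emeasure_bounded_finite[of "cball (0::'a) (R + norm b)"]
      by (intro integrable_mult_right integrable_real_indicator) auto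
    show "AE x in lborel. (\<lambda>n. Q n x) \<longlonglongrightarrow> frechet_derivative F (at x) b"
    proof (rule AE_I2)
      fix x
      have "((\<lambda>t. (F (x + (0 + t) *\<^sub>R b) - F (x + 0 *\<^sub>R b)) / t) \<longlongrightarrow> frechet_derivative F (at x) b) (at 0)"
        using smooth_line_derivative[OF K(1), of x b 0] by (simp add: DERIV_def)
      moreover have "filterlim h (at 0) sequentially"
        using h0 h(1) by (auto simp: filterlim_at less_le intro!: always_eventually)
      ultimately have "(\<lambda>n. (F (x + (0 + h n) *\<^sub>R b) - F (x + 0 *\<^sub>R b)) / h n) \<longlonglongrightarrow> frechet_derivative F (at x) b"
        by (rule filterlim_compose)
      then show "(\<lambda>n. Q n x) \<longlonglongrightarrow> frechet_derivative F (at x) b"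
        by (simp add: Q_def)
    qed
    show "(\<lambda>x. frechet_derivative F (at x) b) \<in> borel_measurable lborel"
      using smooth_borel_measurable[OF smooth_frechet_derivative[OF K(1)]] by simp
    show "Q n \<in> borel_measurable lborel" for n
      unfolding Q_def using meas by measurable
  qed (use Q_bound in auto)
  then show ?thesis
    using Q0 by (simp add: LIMSEQ_const_iff)
qed

definition gradient :: "('a::euclidean_space \<Rightarrow> real) \<Rightarrow> 'a \<Rightarrow> 'a" where
  "gradient f x = (\<Sum>b\<in>Basis. frechet_derivative f (at x) b *\<^sub>R b)"

lemma gradient_inner:
  assumes "b \<in> Basis"
  shows "gradient f x \<bullet> b = frechet_derivative f (at x) b"
  using assms by (simp add: gradient_def)

lemma gradient_inner_smooth:
  assumes "smooth f"
  shows "gradient f x \<bullet> v = frechet_derivative f (at x) v"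
proof -
  have "linear (frechet_derivative f (at x))"
    using smooth_has_derivative[OF assms] has_derivative_linear by blast
  then have "frechet_derivative f (at x) (\<Sum>i\<in>Basis. (v \<bullet> i) *\<^sub>R i) =
    (\<Sum>i\<in>Basis. (v \<bullet> i) * frechet_derivative f (at x) i)"
    by (simp add: linear_sum linear_cmul)
  then show ?thesis
    by (simp add: euclidean_representation gradient_def inner_sum_right mult.commute inner_commute[of _ v])
qed

lemma gradient_measurable: "smooth f \<Longrightarrow> gradient f \<in> borel_measurable borel"
  unfolding gradient_def
  using smooth_borel_measurable[OF smooth_frechet_derivative] by measurable

lemma frechet_derivative_mult:
  assumes "smooth f" "smooth g"
  shows "frechet_derivative (\<lambda>x. f x * g x) (at x) b =
    f x * frechet_derivative g (at x) b + frechet_derivative f (at x) b * g x"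
  using fun_cong[OF frechet_derivative_at[OF has_derivative_mult[OF smooth_has_derivative[OF assms(1)]
          smooth_has_derivative[OF assms(2)]]], of x b] by simp

lemma gradient_mult:
  assumes "smooth f" "smooth g"
  shows "gradient (\<lambda>x. f x * g x) x = f x *\<^sub>R gradient g x + g x *\<^sub>R gradient f x"
  by (simp add: gradient_def frechet_derivative_mult[OF assms] scaleR_sum_right sum.distrib
      scaleR_add_left mult.commute)

lemma integral_by_parts_test:
  assumes "smooth f" and "\<psi> \<in> test_functions D"
  shows "(\<integral>x. f x * frechet_derivative \<psi> (at x) b \<partial>lborel) =
    - (\<integral>x. frechet_derivative f (at x) b * \<psi> x \<partial>lborel)"
proof -
  note \<psi> = test_functions_smooth[OF assms(2)]
  have "integrable lborel (\<lambda>x. f x * frechet_derivative \<psi> (at x) b)"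
    by (intro test_functions_integrable[of _ D] test_functions_mult assms test_functions_frechet_derivative)
  moreover have "integrable lborel (\<lambda>x. frechet_derivative f (at x) b * \<psi> x)"
    by (intro test_functions_integrable[of _ D] test_functions_mult assms smooth_frechet_derivative)
  moreover have "(\<integral>x. frechet_derivative (\<lambda>x. f x * \<psi> x) (at x) b \<partial>lborel) = 0"
    by (intro integral_frechet_derivative_eq_0[of _ D] test_functions_mult assms)
  ultimately show ?thesis
    using frechet_derivative_mult[OF assms(1) \<psi>, of _ b] by simp
qed

lemma locally_integrable_bounded:
  fixes f :: "'a::euclidean_space \<Rightarrow> 'b::euclidean_space"
  assumes "f \<in> borel_measurable borel" and "\<And>K. compact K \<Longrightarrow> bounded (f ` K)"
  shows "locally_integrable D f"
  unfolding locally_integrable_def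
proof (intro allI impI)
  fix K assume K: "compact K \<and> K \<subseteq> D"
  then obtain B where B: "\<And>x. x \<in> K \<Longrightarrow> norm (f x) \<le> B"
    using assms(2)[of K] by (auto simp: bounded_iff)
  have fin: "emeasure lborel K < \<infinity>"
    using K emeasure_bounded_finite compact_imp_bounded by blast
  have KS: "K \<in> sets borel"
    using K by (auto intro: borel_closed compact_imp_closed)
  have "integrable lborel (\<lambda>x. indicator K x *\<^sub>R f x)"
  proof (rule Bochner_Integration.integrable_bound[where f="\<lambda>x. B * indicator K x"])
    show "integrable lborel (\<lambda>x. B * indicator K x :: real)"
      using fin KS by (intro integrable_mult_right integrable_real_indicator) auto
    show "AE x in lborel. norm (indicat_real K x *\<^sub>R f x) \<le> norm (B * indicat_real K x)"
    proof (rule AE_I2)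
      fix x
      show "norm (indicat_real K x *\<^sub>R f x) \<le> norm (B * indicat_real K x)"
        using B[of x] by (cases "x \<in> K") auto
    qed
  qed (use assms(1) KS in auto)
  then show "integrable (lebesgue_on K) f"
    using KS assms(1) by (simp add: integrable_restrict_space integrable_completion)
qed

lemma smooth_locally_integrable: "smooth f \<Longrightarrow> locally_integrable D f"
  by (intro locally_integrable_bounded smooth_borel_measurable compact_imp_bounded
      compact_continuous_image smooth_continuous_on)

lemma gradient_continuous_on: "smooth f \<Longrightarrow> continuous_on S (gradient f)"
  unfolding gradient_def
  by (intro continuous_intros smooth_continuous_on smooth_frechet_derivative)

lemma smooth_has_weak_gradient:
  assumes "D \<in> sets lebesgue" and "smooth f"
  shows "has_weak_gradient D f (gradient f)"
  unfolding has_weak_gradient_def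
proof (intro conjI ballI)
  show "locally_integrable D f"
    by (rule smooth_locally_integrable[OF assms(2)])
  show "locally_integrable D (gradient f)"
    by (intro locally_integrable_bounded gradient_measurable assms compact_imp_bounded
        compact_continuous_image gradient_continuous_on)
next
  fix \<psi> and b :: 'a assume \<psi>: "\<psi> \<in> test_functions D" and b: "b \<in> Basis"
  obtain K where K: "smooth \<psi>" "compact K" "K \<subseteq> D" "\<forall>x. x \<notin> K \<longrightarrow> \<psi> x = 0"
    using \<psi> by (rule test_functionsE)
  have "(\<integral>x. f x * frechet_derivative \<psi> (at x) b \<partial>lebesgue_on D) =
      (\<integral>x. f x * frechet_derivative \<psi> (at x) b \<partial>lborel)"
  proof (rule integrable_lebesgue_on_iff_lborel(2)[OF _ assms(1)])
    show "f x * frechet_derivative \<psi> (at x) b = 0" if "x \<notin> D" for x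
    proof -
      have "x \<notin> K" using K(3) that by auto
      then have "frechet_derivative \<psi> (at x) = (\<lambda>h. 0)"
        using frechet_derivative_eq_0_outside[OF K(2), of \<psi> x] K(4) by blast
      then show ?thesis by simp
    qed
  qed (intro smooth_borel_measurable smooth_mult smooth_frechet_derivative assms K)
  also have "\<dots> = - (\<integral>x. frechet_derivative f (at x) b * \<psi> x \<partial>lborel)"
    by (rule integral_by_parts_test[OF assms(2) \<psi>])
  also have "(\<integral>x. frechet_derivative f (at x) b * \<psi> x \<partial>lborel) =
      (\<integral>x. frechet_derivative f (at x) b * \<psi> x \<partial>lebesgue_on D)"
  proof (rule integrable_lebesgue_on_iff_lborel(2)[OF _ assms(1), symmetric])
    show "frechet_derivative f (at x) b * \<psi> x = 0" if "x \<notin> D" for x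
      using K(3,4) that by auto
  qed (intro smooth_borel_measurable smooth_mult smooth_frechet_derivative assms K)
  finally show "(\<integral>x. f x * frechet_derivative \<psi> (at x) b \<partial>lebesgue_on D) =
      - (\<integral>x. (gradient f x \<bullet> b) * \<psi> x \<partial>lebesgue_on D)"
    using b by (simp add: gradient_inner)
qed

lemma integrable_locally_integrable_mult:
  fixes g \<psi> :: "'a::euclidean_space \<Rightarrow> real"
  assumes "locally_integrable D g" and D: "D \<in> sets lebesgue"
    and "\<psi> \<in> borel_measurable borel" and "\<And>x. \<bar>\<psi> x\<bar> \<le> B"
    and K: "compact K" "K \<subseteq> D" "\<And>x. x \<notin> K \<Longrightarrow> \<psi> x = 0"
  shows "integrable (lebesgue_on D) (\<lambda>x. g x * \<psi> x)"
proof -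
  have KS: "K \<in> sets borel"
    using K by (auto intro: borel_closed compact_imp_closed)
  have "integrable (lebesgue_on K) g"
    using assms(1) K by (simp add: locally_integrable_def)
  then have g: "integrable lebesgue (\<lambda>x. indicator K x *\<^sub>R g x)"
    using KS by (simp add: integrable_restrict_space)
  have "integrable lebesgue (\<lambda>x. (indicator K x *\<^sub>R g x) * \<psi> x)"
  proof (rule Bochner_Integration.integrable_bound[where f="\<lambda>x. B * (indicator K x *\<^sub>R g x)"])
    show "(\<lambda>x. (indicator K x *\<^sub>R g x) * \<psi> x) \<in> borel_measurable lebesgue"
      using borel_measurable_integrable[OF g] assms(3)
        by (intro borel_measurable_times[OF _ measurable_completion]) auto
    show "AE x in lebesgue. norm (indicat_real K x *\<^sub>R g x * \<psi> x) \<le> norm (B * (indicat_real K x *\<^sub>R g x))"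
    proof (rule AE_I2)
      fix x
      have "\<bar>\<psi> x\<bar> \<le> \<bar>B\<bar>" using assms(4)[of x] by linarith
      then show "norm (indicat_real K x *\<^sub>R g x * \<psi> x) \<le> norm (B * (indicat_real K x *\<^sub>R g x))"
        by (simp add: abs_mult mult.commute mult_right_mono)
    qed
  qed (use g in simp)
  also have "(\<lambda>x. (indicator K x *\<^sub>R g x) * \<psi> x) = (\<lambda>x. indicator D x *\<^sub>R (g x * \<psi> x))"
  proof
    fix x show "(indicator K x *\<^sub>R g x) * \<psi> x = indicator D x *\<^sub>R (g x * \<psi> x)"
      using K by (cases "x \<in> K") (auto simp: indicator_def)
  qed
  finally show ?thesis
    using D by (simp add: integrable_restrict_space)
qed

text \<open>A product of steps of slope n rising inwards from the faces. All approximants vanish off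
  the open box, so the closed box serves as a common compact support; at an interior point every
  factor is 1 as soon as n times the distance to each face is at least 1.\<close>

lemma box_indicator_approx:
  fixes c d :: "'a::euclidean_space"
  assumes "cbox c d \<subseteq> D"
  obtains \<psi> :: "nat \<Rightarrow> 'a \<Rightarrow> real" where "\<And>n. \<psi> n \<in> test_functions D" "\<And>n x. \<bar>\<psi> n x\<bar> \<le> indicator (box c d) x"
    "\<And>x. (\<lambda>n. \<psi> n x) \<longlonglongrightarrow> indicator (box c d) x"
proof
  define \<psi> :: "nat \<Rightarrow> 'a \<Rightarrow> real" where "\<psi> n x =
    (\<Prod>i\<in>Basis. smooth_step (real n * (x \<bullet> i) + (- real n * (c \<bullet> i))) *
        smooth_step ((- real n) * (x \<bullet> i) + real n * (d \<bullet> i)))" for n x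
  have zero: "\<psi> n x = 0" if out: "x \<notin> box c d" for n x
  proof -
    from out obtain i where i: "i \<in> Basis" "x \<bullet> i \<le> c \<bullet> i \<or> d \<bullet> i \<le> x \<bullet> i"
      by (auto simp: box_def not_less)
    then have "smooth_step (real n * (x \<bullet> i) + (- real n * (c \<bullet> i))) *
        smooth_step ((- real n) * (x \<bullet> i) + real n * (d \<bullet> i)) = 0"
      using mult_left_mono[of "x \<bullet> i" "c \<bullet> i" "real n"] mult_left_mono[of "d \<bullet> i" "x \<bullet> i" "real n"]
      by (auto simp: smooth_step_eq_0)
    with i(1) show ?thesis by (auto simp: \<psi>_def)
  qed
  show "\<psi> n \<in> test_functions D" for n
  proof (rule test_functionsI[OF _ _ assms])
    have lin: "bounded_linear (\<lambda>x::'a. r * (x \<bullet> i))" for r i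
      by (intro bounded_linear_const_mult bounded_linear_inner_left)
    show "smooth (\<psi> n)"
      unfolding \<psi>_def
      by (intro smooth_prod smooth_mult smooth_affine[OF smooth_smooth_step lin])
    show "\<psi> n x = 0" if "x \<notin> cbox c d" for x
      using zero that box_subset_cbox by blast
  qed (rule compact_cbox)
  show "\<bar>\<psi> n x\<bar> \<le> indicator (box c d) x" for n x
  proof (cases "x \<in> box c d")
    case True
    have "\<bar>\<psi> n x\<bar> \<le> 1"
      unfolding \<psi>_def abs_prod
      by (intro prod_le_1) (auto simp: smooth_step_bounds abs_mult mult_le_one)
    with True show ?thesis by simp
  qed (simp add: zero)
  show "(\<lambda>n. \<psi> n x) \<longlonglongrightarrow> indicator (box c d) x" for x
  proof (cases "x \<in> box c d")
    case True
    have "(\<lambda>n. smooth_step (real n * (x \<bullet> i) + (- real n * (c \<bullet> i))) *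
        smooth_step ((- real n) * (x \<bullet> i) + real n * (d \<bullet> i))) \<longlonglongrightarrow> 1" if i: "i \<in> Basis" for i
    proof (rule tendsto_eventually)
      have *: "c \<bullet> i < x \<bullet> i" "x \<bullet> i < d \<bullet> i"
        using True i by (auto simp: box_def)
      obtain N :: nat where N: "real N \<ge> max (1 / (x \<bullet> i - c \<bullet> i)) (1 / (d \<bullet> i - x \<bullet> i))"
        using real_arch_simple by blast
      show "\<forall>\<^sub>F n in sequentially. smooth_step (real n * (x \<bullet> i) + (- real n * (c \<bullet> i))) *
        smooth_step ((- real n) * (x \<bullet> i) + real n * (d \<bullet> i)) = 1"
      proof (rule eventually_sequentiallyI[of N])
        fix n assume "N \<le> n"
        with N have "real n \<ge> 1 / (x \<bullet> i - c \<bullet> i)" "real n \<ge> 1 / (d \<bullet> i - x \<bullet> i)"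
          by (auto intro: order_trans)
        then have "real n * (x \<bullet> i - c \<bullet> i) \<ge> 1" "real n * (d \<bullet> i - x \<bullet> i) \<ge> 1"
          using * by (auto simp: divide_le_eq)
        then show "smooth_step (real n * (x \<bullet> i) + (- real n * (c \<bullet> i))) *
          smooth_step ((- real n) * (x \<bullet> i) + real n * (d \<bullet> i)) = 1"
          by (simp add: smooth_step_eq_1 algebra_simps)
      qed
    qed
    then have "(\<lambda>n. \<psi> n x) \<longlonglongrightarrow> (\<Prod>i\<in>(Basis::'a set). 1)"
      unfolding \<psi>_def by (rule tendsto_prod)
    with True show ?thesis by simp
  qed (simp add: zero)
qed

text \<open>Open boxes are stable under intersection and generate the Borel sets, so Dynkin's
  theorem carries the vanishing of the integral from boxes to Borel sets; the total integral takes
  care of complements. Lebesgue sets differ from Borel sets by null sets.\<close>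

lemma AE_eq_0_if_box_integrals_eq_0:
  fixes g :: "'a::euclidean_space \<Rightarrow> real"
  assumes g: "integrable lebesgue g" and box: "\<And>c d. (\<integral>x\<in>box c d. g x \<partial>lebesgue) = 0"
    and UNIV: "(\<integral>x. g x \<partial>lebesgue) = 0"
  shows "AE x in lebesgue. g x = 0"
proof -
  have set_int: "set_integrable lebesgue S g" if "S \<in> sets lebesgue" for S
    unfolding set_integrable_def using integrable_mult_indicator[OF that g] .
  have borel: "(\<integral>x\<in>S. g x \<partial>lebesgue) = 0" if "S \<in> sets borel" for S :: "'a set"
  proof -
    have sets: "sets borel = sigma_sets UNIV (range (\<lambda>(a, b). box a b :: 'a set))"
      by (subst borel_eq_box) (simp add: sets_measure_of)
    have stable: "Int_stable (range (\<lambda>(a, b). box a b :: 'a set))"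
      by (auto simp: Int_stable_def box_Int_box)
    have closed: "range (\<lambda>(a, b). box a b :: 'a set) \<subseteq> Pow UNIV" by simp
    from stable closed that[unfolded sets] show ?thesis
    proof (induction S rule: sigma_sets_induct_disjoint)
      case (basic A)
      then show ?case using box by auto
    next
      case empty
      then show ?case by (simp add: set_lebesgue_integral_def)
    next
      case (compl A)
      then have "A \<in> sets lebesgue"
        using sets by (metis sets_completionI_sets sets_lborel)
      then have "(\<integral>x\<in>A. g x \<partial>lebesgue) + (\<integral>x\<in>UNIV - A. g x \<partial>lebesgue) = (\<integral>x\<in>A \<union> (UNIV - A). g x \<partial>lebesgue)"
        by (intro set_integral_Un[symmetric] set_int) auto
      also have "\<dots> = 0" using UNIV by (simp add: set_lebesgue_integral_def)
      finally show ?case using compl by simp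
    next
      case (union A)
      have A: "A i \<in> sets lebesgue" for i
        using union(2) sets by (metis rangeI sets_completionI_sets sets_lborel subsetD)
      have "(\<integral>x\<in>(\<Union>i. A i). g x \<partial>lebesgue) = (\<Sum>i. \<integral>x\<in>A i. g x \<partial>lebesgue)"
        using union(1) A by (intro lebesgue_integral_countable_add set_int) (auto simp: disjoint_family_on_def)
      then show ?case using union(3) by simp
    qed
  qed
  show ?thesis
  proof (rule density_unique_real[OF g])
    fix A :: "'a set" assume A: "A \<in> sets lebesgue"
    then obtain S N N' where S: "A = S \<union> N" "N \<subseteq> N'" "N' \<in> null_sets lborel" "S \<in> sets lborel"
      by (rule sets_completionE)
    have N': "AE x in lebesgue. x \<notin> N'"
      using S(3) by (intro AE_not_in) (simp add: null_sets_completionI)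
    have "(\<integral>x\<in>A. g x \<partial>lebesgue) = (\<integral>x\<in>S. g x \<partial>lebesgue)"
      unfolding set_lebesgue_integral_def
    proof (rule integral_cong_AE)
      show "AE x in lebesgue. indicat_real A x *\<^sub>R g x = indicat_real S x *\<^sub>R g x"
        using N' by eventually_elim (use S in \<open>auto simp: indicator_def\<close>)
    qed (use A S borel_measurable_integrable[OF g] in
        \<open>auto intro!: borel_measurable_times borel_measurable_indicator\<close>)
    also have "\<dots> = 0" using borel S by simp
    finally show "(\<integral>x\<in>A. g x \<partial>lebesgue) = (\<integral>x\<in>A. 0 \<partial>lebesgue)"
      by (simp add: set_lebesgue_integral_def)
  qed simp
qed

text \<open>Localised to closed boxes inside D, where g is integrable; countably many of them cover
  D.\<close>

lemma fundamental_lemma: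
  fixes g :: "'a::euclidean_space \<Rightarrow> real"
  assumes D: "open D" and g: "locally_integrable D g"
    and eq0: "\<And>\<psi>. \<psi> \<in> test_functions D \<Longrightarrow> (\<integral>x. g x * \<psi> x \<partial>lebesgue_on D) = 0"
  shows "AE x in lebesgue_on D. g x = 0"
proof -
  have DS: "D \<in> sets lebesgue" using D by simp
  have box: "AE x in lebesgue. x \<in> cbox a b \<longrightarrow> g x = 0" if ab: "cbox a b \<subseteq> D" for a b
  proof -
    define g0 where "g0 x = indicator (cbox a b) x *\<^sub>R g x" for x
    have "integrable (lebesgue_on (cbox a b)) g"
      using g ab by (auto simp: locally_integrable_def)
    then have g0: "integrable lebesgue g0"
      by (simp add: integrable_restrict_space g0_def[abs_def])
    have sub: "(\<integral>x\<in>box c d. g0 x \<partial>lebesgue) = 0" if cd: "cbox c d \<subseteq> cbox a b" for c d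
    proof -
      obtain \<psi> :: "nat \<Rightarrow> 'a \<Rightarrow> real" where \<psi>: "\<And>n. \<psi> n \<in> test_functions D"
        "\<And>n x. \<bar>\<psi> n x\<bar> \<le> indicator (box c d) x" "\<And>x. (\<lambda>n. \<psi> n x) \<longlonglongrightarrow> indicator (box c d) x"
        using box_indicator_approx[of c d D] cd ab by (metis subset_trans)
      have "(\<lambda>n. \<integral>x. \<psi> n x *\<^sub>R g0 x \<partial>lebesgue) \<longlonglongrightarrow> (\<integral>x. indicator (box c d) x *\<^sub>R g0 x \<partial>lebesgue)"
      proof (rule integral_dominated_convergence[where w="\<lambda>x. norm (g0 x)"])
        show "AE x in lebesgue. (\<lambda>n. \<psi> n x *\<^sub>R g0 x) \<longlonglongrightarrow> indicat_real (box c d) x *\<^sub>R g0 x"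
          by (intro AE_I2 tendsto_intros \<psi>)
        show "AE x in lebesgue. norm (\<psi> n x *\<^sub>R g0 x) \<le> norm (g0 x)" for n
        proof (rule AE_I2)
          fix x
          have "\<bar>\<psi> n x\<bar> \<le> 1" using \<psi>(2)[of n x] indicator_le_1[of "box c d" x] by (metis order_trans)
          then show "norm (\<psi> n x *\<^sub>R g0 x) \<le> norm (g0 x)"
            by (simp add: abs_mult mult_left_le_one_le)
        qed
        show "(\<lambda>x. \<psi> n x *\<^sub>R g0 x) \<in> borel_measurable lebesgue" for n
          using borel_measurable_integrable[OF g0] smooth_borel_measurable[OF test_functions_smooth[OF \<psi>(1)]]
          by (intro borel_measurable_scaleR[OF measurable_completion]) auto
        show "(\<lambda>x. indicat_real (box c d) x *\<^sub>R g0 x) \<in> borel_measurable lebesgue"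
          using borel_measurable_integrable[OF g0] by (intro borel_measurable_scaleR borel_measurable_indicator) auto
      qed (use g0 in auto)
      moreover have "(\<integral>x. \<psi> n x *\<^sub>R g0 x \<partial>lebesgue) = 0" for n
      proof -
        have "(\<lambda>x. \<psi> n x *\<^sub>R g0 x) = (\<lambda>x. indicator D x *\<^sub>R (g x * \<psi> n x))"
        proof
          fix x
          show "\<psi> n x *\<^sub>R g0 x = indicator D x *\<^sub>R (g x * \<psi> n x)"
          proof (cases "x \<in> box c d")
            case True
            then have "x \<in> cbox a b" "x \<in> D"
              using cd ab box_subset_cbox by blast+
            then show ?thesis by (simp add: g0_def)
          next
            case False
            then have "\<psi> n x = 0" using \<psi>(2)[of n x] by simp
            then show ?thesis by simp
          qed
        qed
        then show ?thesis
          using eq0[OF \<psi>(1)[of n]] DS by (simp add: integral_restrict_space)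
      qed
      ultimately show ?thesis
        by (simp add: set_lebesgue_integral_def LIMSEQ_const_iff)
    qed
    \<comment> \<open>Only boxes whose closure lies in \<open>cbox a b\<close> can be reached by
      test functions, while the previous lemma asks for all boxes. Intersecting with the open box
      \<open>box a b\<close> reduces the general case to these, and changes integrals of
      \<open>g0\<close> only on the null frontier.\<close>
    have frontier: "AE x in lebesgue. x \<notin> cbox a b - box a b"
      using negligible_frontier_interval[of a b] by (intro AE_not_in) (simp add: negligible_iff_null_sets)
    have sub': "(\<integral>x\<in>S. g0 x \<partial>lebesgue) = (\<integral>x\<in>S \<inter> box a b. g0 x \<partial>lebesgue)" if "S \<in> sets lebesgue" for S
      unfolding set_lebesgue_integral_def
    proof (rule integral_cong_AE)
      show "AE x in lebesgue. indicat_real S x *\<^sub>R g0 x = indicat_real (S \<inter> box a b) x *\<^sub>R g0 x"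
        using frontier by eventually_elim (auto simp: indicator_def g0_def)
    qed (use that borel_measurable_integrable[OF g0] in
        \<open>auto intro!: borel_measurable_times borel_measurable_indicator\<close>)
    have "AE x in lebesgue. g0 x = 0"
    proof (rule AE_eq_0_if_box_integrals_eq_0[OF g0])
      fix c d :: 'a
      define e f :: 'a where "e = (\<Sum>i\<in>Basis. max (c \<bullet> i) (a \<bullet> i) *\<^sub>R i)"
        and "f = (\<Sum>i\<in>Basis. min (d \<bullet> i) (b \<bullet> i) *\<^sub>R i)"
      have eq: "box c d \<inter> box a b = box e f"
        by (simp add: box_Int_box e_def f_def)
      have "cbox e f \<subseteq> cbox a b"
        by (auto simp: e_def f_def mem_box)
      then show "(\<integral>x\<in>box c d. g0 x \<partial>lebesgue) = 0"
        using sub[of e f] sub'[of "box c d"] by (simp add: eq)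
    next
      have "(\<integral>x. g0 x \<partial>lebesgue) = (\<integral>x\<in>UNIV. g0 x \<partial>lebesgue)"
        by (simp add: set_lebesgue_integral_def)
      also have "\<dots> = 0"
        using sub'[of UNIV] sub[of a b] by simp
      finally show "(\<integral>x. g0 x \<partial>lebesgue) = 0" .
    qed
    then show ?thesis
      by eventually_elim (auto simp: g0_def indicator_def)
  qed
  obtain \<D> where \<D>: "countable \<D>" "\<D> \<subseteq> Pow D" "\<And>X. X \<in> \<D> \<Longrightarrow> \<exists>a b. X = cbox a b" "\<Union>\<D> = D"
    using open_countable_Union_open_cbox[OF D] by metis
  have "AE x in lebesgue. \<forall>X\<in>\<D>. x \<in> X \<longrightarrow> g x = 0"
    unfolding AE_ball_countable[OF \<D>(1)]
    using \<D>(2,3) box by (metis PowD subsetD)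
  then have "AE x in lebesgue. x \<in> D \<longrightarrow> g x = 0"
    by eventually_elim (use \<D>(4) in blast)
  then show ?thesis
    using DS by (simp add: AE_restrict_space_iff)
qed

section \<open>Uniqueness and linearity of weak gradients\<close>

lemma has_weak_gradient_unique:
  fixes w :: "'a::euclidean_space \<Rightarrow> real"
  assumes D: "open D" and G: "has_weak_gradient D w G" "has_weak_gradient D w G'"
  shows "AE x in lebesgue_on D. G x = G' x"
proof -
  have DS: "D \<in> sets lebesgue" using D by simp
  have li: "locally_integrable D (\<lambda>x. H x \<bullet> b)" if "has_weak_gradient D w H" for H and b :: 'a
    using that by (auto simp: has_weak_gradient_def locally_integrable_def)
  have "AE x in lebesgue_on D. G x \<bullet> b - G' x \<bullet> b = 0" if b: "b \<in> Basis" for b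
  proof (rule fundamental_lemma[OF D])
    show "locally_integrable D (\<lambda>x. G x \<bullet> b - G' x \<bullet> b)"
      using li[OF G(1), of b] li[OF G(2), of b] by (auto simp: locally_integrable_def)
    fix \<psi> assume \<psi>: "\<psi> \<in> test_functions D"
    obtain K where K: "smooth \<psi>" "compact K" "K \<subseteq> D" "\<forall>x. x \<notin> K \<longrightarrow> \<psi> x = 0"
      using \<psi> by (rule test_functionsE)
    obtain B where B: "\<And>x. \<bar>\<psi> x\<bar> \<le> B"
      using test_functions_bounded[OF \<psi>] by metis
    have int: "integrable (lebesgue_on D) (\<lambda>x. (H x \<bullet> b) * \<psi> x)" if "has_weak_gradient D w H" for H
      by (rule integrable_locally_integrable_mult[OF li[OF that] DS smooth_borel_measurable[OF K(1)] B K(2,3)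
            K(4)[rule_format]])
    have "(\<integral>x. (G x \<bullet> b) * \<psi> x \<partial>lebesgue_on D) = (\<integral>x. (G' x \<bullet> b) * \<psi> x \<partial>lebesgue_on D)"
      using G \<psi> b unfolding has_weak_gradient_def by force
    then show "(\<integral>x. (G x \<bullet> b - G' x \<bullet> b) * \<psi> x \<partial>lebesgue_on D) = 0"
      using int[OF G(1)] int[OF G(2)] by (simp add: left_diff_distrib)
  qed
  then have "AE x in lebesgue_on D. \<forall>b\<in>Basis. G x \<bullet> b - G' x \<bullet> b = 0"
    by (subst AE_ball_countable) (auto simp: countable_finite)
  then show ?thesis
    by eventually_elim (auto intro: euclidean_eqI)
qed

lemma has_weak_gradient_integrable:
  assumes "D \<in> sets lebesgue" and "has_weak_gradient D w G" and "\<psi> \<in> test_functions D"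
  shows "integrable (lebesgue_on D) (\<lambda>x. w x * frechet_derivative \<psi> (at x) b)"
    and "integrable (lebesgue_on D) (\<lambda>x. (G x \<bullet> b) * \<psi> x)"
proof -
  have *: "integrable (lebesgue_on D) (\<lambda>x. g x * \<psi> x)"
    if \<psi>: "\<psi> \<in> test_functions D" and g: "locally_integrable D g" for g \<psi> :: "'a \<Rightarrow> real"
  proof -
    obtain K where K: "smooth \<psi>" "compact K" "K \<subseteq> D" "\<forall>x. x \<notin> K \<longrightarrow> \<psi> x = 0"
      using \<psi> by (rule test_functionsE)
    obtain B where B: "\<And>x. \<bar>\<psi> x\<bar> \<le> B"
      using test_functions_bounded[OF \<psi>] by metis
    show ?thesis
      by (rule integrable_locally_integrable_mult[OF g assms(1) smooth_borel_measurable[OF K(1)] B K(2,3)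
            K(4)[rule_format]])
  qed
  show "integrable (lebesgue_on D) (\<lambda>x. w x * frechet_derivative \<psi> (at x) b)"
    using assms by (intro * test_functions_frechet_derivative) (auto simp: has_weak_gradient_def)
  have "locally_integrable D (\<lambda>x. G x \<bullet> b)"
    using assms(2) by (auto simp: has_weak_gradient_def locally_integrable_def)
  then show "integrable (lebesgue_on D) (\<lambda>x. (G x \<bullet> b) * \<psi> x)"
    using assms by (intro *) auto
qed

lemma has_weak_gradient_diff:
  assumes "D \<in> sets lebesgue" and "has_weak_gradient D w G" "has_weak_gradient D v H"
  shows "has_weak_gradient D (\<lambda>x. w x - v x) (\<lambda>x. G x - H x)"
  unfolding has_weak_gradient_def
proof (intro conjI ballI)
  show "locally_integrable D (\<lambda>x. w x - v x)" "locally_integrable D (\<lambda>x. G x - H x)"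
    using assms by (auto simp: has_weak_gradient_def locally_integrable_def)
  fix \<psi> and b :: 'a assume \<psi>: "\<psi> \<in> test_functions D" and b: "b \<in> Basis"
  note int = has_weak_gradient_integrable[OF assms(1,2) \<psi>, of b] has_weak_gradient_integrable[OF assms(1,3) \<psi>, of b]
  have "(\<integral>x. w x * frechet_derivative \<psi> (at x) b \<partial>lebesgue_on D) = - (\<integral>x. (G x \<bullet> b) * \<psi> x \<partial>lebesgue_on D)"
    "(\<integral>x. v x * frechet_derivative \<psi> (at x) b \<partial>lebesgue_on D) = - (\<integral>x. (H x \<bullet> b) * \<psi> x \<partial>lebesgue_on D)"
    using assms(2,3) \<psi> b by (auto simp: has_weak_gradient_def)
  with int show "(\<integral>x. (w x - v x) * frechet_derivative \<psi> (at x) b \<partial>lebesgue_on D) =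
      - (\<integral>x. ((G x - H x) \<bullet> b) * \<psi> x \<partial>lebesgue_on D)"
    by (simp add: left_diff_distrib inner_diff_left)
qed

section \<open>Weighted Sobolev spaces\<close>

text \<open>Value and gradient are kept as one vector, so that an energy form is a single bilinear
  form in L2. Test functions get a separate \<open>smooth_jet\<close> with the classical gradient:
  for them \<open>weak_grad\<close> is known only up to a null set.\<close>

definition jet :: "'a::euclidean_space set \<Rightarrow> ('a \<Rightarrow> real) \<Rightarrow> 'a \<Rightarrow> real \<times> 'a" where
  "jet D w x = (w x, weak_grad D w x)"

definition smooth_jet :: "('a::euclidean_space \<Rightarrow> real) \<Rightarrow> 'a \<Rightarrow> real \<times> 'a" where
  "smooth_jet w x = (w x, gradient w x)"

text \<open>\<open>E\<close> is the set in which supports of approximating functions live; it may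
  reach across a part of the boundary of D, as the cylinder's bottom y = 0, where no boundary
  condition is imposed. Assumption \<open>fin\<close> says that the weight is integrable up to that
  part. The three instances are the base, the half line and the cylinder.\<close>

locale weighted_domain =
  fixes M :: "'a::euclidean_space measure" and D E :: "'a set" and \<omega> :: "'a \<Rightarrow> real"
  assumes M_eq: "M = density (lebesgue_on D) (\<lambda>x. ennreal (\<omega> x))"
    and open_D: "open D" and D_sub_E: "D \<subseteq> E"
    and cont: "continuous_on D \<omega>" and pos: "x \<in> D \<Longrightarrow> 0 < \<omega> x"
    and fin: "compact K \<Longrightarrow> K \<subseteq> E \<Longrightarrow> integrable (lebesgue_on D) (\<lambda>x. indicator K x * \<omega> x)"
begin

lemma D_sets: "D \<in> sets lebesgue"
  using open_D by simp

lemma weight_measurable: "\<omega> \<in> borel_measurable (lebesgue_on D)"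
  by (rule continuous_imp_measurable_on_sets_lebesgue[OF cont D_sets])

lemma measurable_M_iff: "f \<in> borel_measurable M \<longleftrightarrow> f \<in> borel_measurable (lebesgue_on D)"
  unfolding M_eq by simp

lemma AE_M_iff: "(AE x in M. P x) \<longleftrightarrow> (AE x in lebesgue_on D. P x)"
proof -
  have "(AE x in M. P x) \<longleftrightarrow> (AE x in lebesgue_on D. 0 < \<omega> x \<longrightarrow> P x)"
    unfolding M_eq using weight_measurable by (subst AE_density) auto
  also have "\<dots> \<longleftrightarrow> (AE x in lebesgue_on D. P x)"
    using pos by (intro AE_cong) auto
  finally show ?thesis .
qed

lemma AE_weight_nonneg: "AE x in lebesgue_on D. 0 \<le> \<omega> x"
  using pos by (intro AE_I2) (auto intro: less_imp_le)

lemma integrable_M_iff: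
  fixes f :: "'a \<Rightarrow> real"
  assumes "f \<in> borel_measurable M"
  shows "integrable M f \<longleftrightarrow> integrable (lebesgue_on D) (\<lambda>x. \<omega> x * f x)"
  using integrable_density[of f "lebesgue_on D" \<omega>] assms weight_measurable AE_weight_nonneg
  unfolding measurable_M_iff by (simp add: M_eq)

lemma integral_M:
  fixes f :: "'a \<Rightarrow> real"
  assumes "f \<in> borel_measurable M"
  shows "integral\<^sup>L M f = (\<integral>x. \<omega> x * f x \<partial>lebesgue_on D)"
  using integral_density[of f "lebesgue_on D" \<omega>] assms weight_measurable AE_weight_nonneg
  unfolding measurable_M_iff by (simp add: M_eq)

lemma borel_measurable_M: "f \<in> borel_measurable borel \<Longrightarrow> f \<in> borel_measurable M"
  unfolding measurable_M_iff by (intro measurable_restrict_space1 measurable_completion) simp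

lemma integrable_indicator_compact:
  assumes "compact K" and "K \<subseteq> E"
  shows "integrable M (indicator K :: 'a \<Rightarrow> real)"
proof -
  have "(indicator K :: 'a \<Rightarrow> real) \<in> borel_measurable M"
    using assms by (intro borel_measurable_M borel_measurable_indicator) (simp add: borel_closed compact_imp_closed)
  then show ?thesis
    using fin[OF assms] by (simp add: integrable_M_iff mult.commute)
qed

lemma L2_compact_support:
  fixes f :: "'a \<Rightarrow> 'b::euclidean_space"
  assumes "f \<in> borel_measurable M" and K: "compact K" "K \<subseteq> E"
    and "\<And>x. x \<notin> K \<Longrightarrow> f x = 0" and "AE x in M. norm (f x) \<le> B"
  shows "f \<in> L2 M"
proof (rule L2I[OF assms(1)])
  show "integrable M (\<lambda>x. B\<^sup>2 * indicator K x)"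
    using integrable_indicator_compact[OF K] by simp
  show "AE x in M. (norm (f x))\<^sup>2 \<le> B\<^sup>2 * indicator K x"
    using assms(5)
  proof eventually_elim
    case (elim x)
    then show ?case
      using assms(4)[of x] power_mono[OF elim, of 2] by (cases "x \<in> K") auto
  qed
qed

lemma smooth_jet_L2:
  assumes "\<psi> \<in> test_functions E"
  shows "\<psi> \<in> L2 M" "gradient \<psi> \<in> L2 M" "smooth_jet \<psi> \<in> L2 M"
proof -
  obtain K where K: "smooth \<psi>" "compact K" "K \<subseteq> E" "\<forall>x. x \<notin> K \<longrightarrow> \<psi> x = 0"
    using assms by (rule test_functionsE)
  obtain B where B: "\<And>x. \<bar>\<psi> x\<bar> \<le> B"
    using test_functions_bounded[OF assms] by metis
  show 1: "\<psi> \<in> L2 M"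
    by (rule L2_compact_support[OF _ K(2,3), where B=B])
      (use K B in \<open>auto intro: borel_measurable_M smooth_borel_measurable\<close>)
  have "bounded (gradient \<psi> ` K)"
    by (intro compact_imp_bounded compact_continuous_image gradient_continuous_on K)
  then obtain B' where B': "\<And>x. x \<in> K \<Longrightarrow> norm (gradient \<psi> x) \<le> B'"
    by (auto simp: bounded_iff)
  have 0: "gradient \<psi> x = 0" if "x \<notin> K" for x
    using frechet_derivative_eq_0_outside[OF K(2) _ that, of \<psi>] K(4) by (simp add: gradient_def)
  have "norm (gradient \<psi> x) \<le> max B' 0" for x
    using B'[of x] 0[of x] by (cases "x \<in> K") auto
  then show 2: "gradient \<psi> \<in> L2 M"
    by (intro L2_compact_support[OF _ K(2,3), where B="max B' 0"])
      (use K 0 in \<open>auto intro: borel_measurable_M gradient_measurable\<close>)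
  show "smooth_jet \<psi> \<in> L2 M"
    unfolding smooth_jet_def[abs_def] by (rule L2_Pair[OF 1 2])
qed

text \<open>Dividing by the weight turns the unweighted integrals in the definition of a weak
  gradient into inner products in weighted L2 with a fixed function. The quotient is bounded because
  the weight is continuous and positive on the support, a compact subset of the open set D.\<close>

lemma quotient_L2:
  fixes \<zeta> :: "'a \<Rightarrow> real"
  assumes "\<zeta> \<in> test_functions D"
  shows "(\<lambda>x. \<zeta> x / \<omega> x) \<in> L2 M"
proof -
  obtain K where K: "smooth \<zeta>" "compact K" "K \<subseteq> D" "\<forall>x. x \<notin> K \<longrightarrow> \<zeta> x = 0"
    using assms by (rule test_functionsE)
  have "bounded ((\<lambda>x. \<zeta> x / \<omega> x) ` K)"
    using pos K by (intro compact_imp_bounded compact_continuous_image continuous_on_divide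
        smooth_continuous_on continuous_on_subset[OF cont]) (auto simp: less_le)
  then obtain B where B: "\<And>x. x \<in> K \<Longrightarrow> \<bar>\<zeta> x / \<omega> x\<bar> \<le> B"
    by (auto simp: bounded_iff)
  have "\<bar>\<zeta> x / \<omega> x\<bar> \<le> max B 0" for x
    using B[of x] K(4) by (cases "x \<in> K") (auto simp: le_max_iff_disj)
  then show ?thesis
    using K D_sub_E weight_measurable smooth_measurable_lebesgue_on[OF K(1)]
    by (intro L2_compact_support[OF _ K(2), where B="max B 0"])
      (auto simp: measurable_M_iff)
qed

lemma integral_test_eq_L2_inner:
  assumes "f \<in> borel_measurable M" and "\<zeta> \<in> borel_measurable borel"
  shows "(\<integral>x. f x * \<zeta> x \<partial>lebesgue_on D) = L2_inner M f (\<lambda>x. \<zeta> x / \<omega> x)"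
proof -
  have "L2_inner M f (\<lambda>x. \<zeta> x / \<omega> x) = (\<integral>x. \<omega> x * (f x * (\<zeta> x / \<omega> x)) \<partial>lebesgue_on D)"
    unfolding L2_inner_def using assms borel_measurable_M[OF assms(2)] weight_measurable
    by (intro integral_M) (auto simp: measurable_M_iff)
  also have "\<dots> = (\<integral>x. f x * \<zeta> x \<partial>lebesgue_on D)"
    using pos by (intro Bochner_Integration.integral_cong) (auto simp: less_le)
  finally show ?thesis by simp
qed

text \<open>On a compact subset of D the weight has a positive lower bound m, and norm (f x) \<le> 1
  + (norm (f x))^2.\<close>

lemma L2_locally_integrable:
  fixes f :: "'a \<Rightarrow> 'b::euclidean_space"
  assumes "f \<in> L2 M"
  shows "locally_integrable D f"
  unfolding locally_integrable_def
proof (intro allI impI)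
  fix K assume K: "compact K \<and> K \<subseteq> D"
  have f: "f \<in> borel_measurable (lebesgue_on D)"
    using L2D(1)[OF assms] by (simp add: measurable_M_iff)
  have KS: "K \<in> sets borel"
    using K by (auto intro: borel_closed compact_imp_closed)
  show "integrable (lebesgue_on K) f"
  proof (cases "K = {}")
    case False
    obtain m where m: "m > 0" "\<And>x. x \<in> K \<Longrightarrow> m \<le> \<omega> x"
    proof -
      obtain z where "z \<in> K" "\<forall>x\<in>K. \<omega> z \<le> \<omega> x"
        using continuous_attains_inf[of K \<omega>] K False continuous_on_subset[OF cont] by auto
      then show thesis using that[of "\<omega> z"] pos K by auto
    qed
    have w: "integrable (lebesgue_on D) (\<lambda>x. indicator K x * \<omega> x)"
      using fin[of K] K D_sub_E by auto
    have f2: "integrable (lebesgue_on D) (\<lambda>x. \<omega> x * (norm (f x))\<^sup>2)"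
      using L2D(2)[OF assms] L2D(1)[OF assms] by (subst (asm) integrable_M_iff) auto
    have "integrable (lebesgue_on D) (\<lambda>x. indicator K x *\<^sub>R f x)"
    proof (rule Bochner_Integration.integrable_bound[where
          f="\<lambda>x. (indicator K x * \<omega> x + \<omega> x * (norm (f x))\<^sup>2) / m"])
      show "integrable (lebesgue_on D) (\<lambda>x. (indicator K x * \<omega> x + \<omega> x * (norm (f x))\<^sup>2) / m)"
        using w f2 by simp
      show "(\<lambda>x. indicat_real K x *\<^sub>R f x) \<in> borel_measurable (lebesgue_on D)"
      proof (intro borel_measurable_scaleR f)
        show "indicat_real K \<in> borel_measurable (lebesgue_on D)"
          using KS by (intro measurable_restrict_space1 borel_measurable_indicator) auto
      qed
      show "AE x in lebesgue_on D. norm (indicat_real K x *\<^sub>R f x) \<le>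
          norm ((indicat_real K x * \<omega> x + \<omega> x * (norm (f x))\<^sup>2) / m)"
      proof (rule AE_I2)
        fix x assume "x \<in> space (lebesgue_on D)"
        then have x: "x \<in> D" by simp
        show "norm (indicat_real K x *\<^sub>R f x) \<le> norm ((indicat_real K x * \<omega> x + \<omega> x * (norm (f x))\<^sup>2) / m)"
        proof (cases "x \<in> K")
          case True
          have "2 * norm (f x) \<le> 1 + (norm (f x))\<^sup>2"
            using sum_squares_bound[of 1 "norm (f x)"] by simp
          then have "norm (f x) \<le> 1 + (norm (f x))\<^sup>2"
            using norm_ge_zero[of "f x"] by linarith
          also have "\<dots> \<le> (\<omega> x / m) * (1 + (norm (f x))\<^sup>2)"
            using m True mult_right_mono[of 1 "\<omega> x / m" "1 + (norm (f x))\<^sup>2"] by simp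
          also have "\<dots> = (indicat_real K x * \<omega> x + \<omega> x * (norm (f x))\<^sup>2) / m"
            using True by (simp add: field_simps)
          finally have "norm (f x) \<le> (indicat_real K x * \<omega> x + \<omega> x * (norm (f x))\<^sup>2) / m" .
          then have "norm (f x) \<le> norm ((indicat_real K x * \<omega> x + \<omega> x * (norm (f x))\<^sup>2) / m)"
            unfolding real_norm_def by (rule order_trans[OF _ abs_ge_self])
          then show ?thesis using True by simp
        qed simp
      qed
    qed
    then have "integrable lebesgue (\<lambda>x. indicator D x *\<^sub>R (indicator K x *\<^sub>R f x))"
      using D_sets by (simp add: integrable_restrict_space)
    also have "(\<lambda>x. indicator D x *\<^sub>R (indicator K x *\<^sub>R f x)) = (\<lambda>x. indicator K x *\<^sub>R f x)"
      using K by (auto simp: fun_eq_iff indicator_def)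
    finally show ?thesis
      using KS by (simp add: integrable_restrict_space)
  qed simp
qed

text \<open>Both sides of the defining identity are inner products with the functions of
  \<open>quotient_L2\<close>, hence continuous under convergence in weighted L2.\<close>

lemma has_weak_gradient_closed:
  assumes "\<And>j. has_weak_gradient D (fj j) (Gj j)" "\<And>j. fj j \<in> L2 M" "\<And>j. Gj j \<in> L2 M"
    and f: "f \<in> L2 M" "(\<lambda>j. L2_norm M (\<lambda>x. fj j x - f x)) \<longlonglongrightarrow> 0"
    and G: "G \<in> L2 M" "(\<lambda>j::nat. L2_norm M (\<lambda>x. Gj j x - G x)) \<longlonglongrightarrow> 0"
  shows "has_weak_gradient D f G"
  unfolding has_weak_gradient_def
proof (intro conjI ballI L2_locally_integrable f G)
  fix \<psi> and b :: 'a assume \<psi>: "\<psi> \<in> test_functions D" and b: "b \<in> Basis"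
  note \<psi>' = test_functions_frechet_derivative[OF \<psi>, of b]
  note m = smooth_borel_measurable[OF test_functions_smooth]
  have inner_L2: "(\<lambda>x. H x \<bullet> b) \<in> L2 M" if "H \<in> L2 M" for H
    by (rule L2_bounded_mult[OF that, of _ 1]) (use L2D(1)[OF that] b in \<open>auto simp: Basis_le_norm\<close>)
  have "(\<lambda>j. L2_inner M (fj j) (\<lambda>x. frechet_derivative \<psi> (at x) b / \<omega> x)) \<longlonglongrightarrow>
      L2_inner M f (\<lambda>x. frechet_derivative \<psi> (at x) b / \<omega> x)"
    by (intro L2_inner_tendsto f assms quotient_L2 \<psi>')
  moreover have "(\<lambda>j. - L2_inner M (\<lambda>x. Gj j x \<bullet> b) (\<lambda>x. \<psi> x / \<omega> x)) \<longlonglongrightarrow>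
      - L2_inner M (\<lambda>x. G x \<bullet> b) (\<lambda>x. \<psi> x / \<omega> x)"
  proof (intro tendsto_minus L2_inner_tendsto inner_L2 G assms quotient_L2 \<psi>)
    show "(\<lambda>j. L2_norm M (\<lambda>x. Gj j x \<bullet> b - G x \<bullet> b)) \<longlonglongrightarrow> 0"
    proof (rule L2_tendsto_mono[OF G(2), where C=1])
      show "AE x in M. norm (Gj j x \<bullet> b - G x \<bullet> b) \<le> 1 * norm (Gj j x - G x)" for j
        using b by (simp add: inner_diff_left[symmetric] Basis_le_norm)
      show "(\<lambda>x. Gj j x \<bullet> b - G x \<bullet> b) \<in> borel_measurable M" for j
        using L2D(1)[OF assms(3)[of j]] L2D(1)[OF G(1)] by auto
    qed (auto intro: L2_diff assms G)
  qed
  moreover have "L2_inner M (fj j) (\<lambda>x. frechet_derivative \<psi> (at x) b / \<omega> x) =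
      - L2_inner M (\<lambda>x. Gj j x \<bullet> b) (\<lambda>x. \<psi> x / \<omega> x)" for j
    using assms(1)[of j] \<psi> b L2D(1)[OF assms(2)[of j]] L2D(1)[OF inner_L2[OF assms(3)[of j]]] m[OF \<psi>] m[OF \<psi>']
    by (simp add: has_weak_gradient_def integral_test_eq_L2_inner[symmetric])
  ultimately have "L2_inner M f (\<lambda>x. frechet_derivative \<psi> (at x) b / \<omega> x) =
      - L2_inner M (\<lambda>x. G x \<bullet> b) (\<lambda>x. \<psi> x / \<omega> x)"
    using LIMSEQ_unique by simp
  then show "(\<integral>x. f x * frechet_derivative \<psi> (at x) b \<partial>lebesgue_on D) =
      - (\<integral>x. (G x \<bullet> b) * \<psi> x \<partial>lebesgue_on D)"
    using L2D(1)[OF f(1)] L2D(1)[OF inner_L2[OF G(1)]] m[OF \<psi>] m[OF \<psi>']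
    by (simp add: integral_test_eq_L2_inner)
qed

lemma weak_grad_eq:
  assumes "has_weak_gradient D w G"
  shows "has_weak_gradient D w (weak_grad D w)" and "AE x in M. weak_grad D w x = G x"
proof -
  show *: "has_weak_gradient D w (weak_grad D w)"
    unfolding weak_grad_def by (rule someI[of "has_weak_gradient D w", OF assms])
  show "AE x in M. weak_grad D w x = G x"
    unfolding AE_M_iff by (rule has_weak_gradient_unique[OF open_D * assms])
qed

text \<open>Completeness of Lebesgue measure. The gradient picked by \<open>weak_grad\<close> is
  compared with a square integrable one only almost everywhere, and inherits measurability this
  way.\<close>

lemma measurable_AE_eq:
  fixes f g :: "'a \<Rightarrow> 'b::euclidean_space"
  assumes "f \<in> borel_measurable M" and "AE x in M. f x = g x"
  shows "g \<in> borel_measurable M"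
proof -
  have "(\<lambda>x. indicator D x *\<^sub>R f x) \<in> borel_measurable lebesgue"
    using assms(1) D_sets by (simp add: measurable_M_iff borel_measurable_restrict_space_iff)
  moreover have "AE x in lebesgue. indicator D x *\<^sub>R f x = indicator D x *\<^sub>R g x"
    using assms(2) D_sets by (auto simp: AE_M_iff AE_restrict_space_iff indicator_def elim!: eventually_mono)
  ultimately have "(\<lambda>x. indicator D x *\<^sub>R g x) \<in> borel_measurable lebesgue"
    by (rule borel_measurable_AE)
  then show ?thesis
    using D_sets by (simp add: measurable_M_iff borel_measurable_restrict_space_iff)
qed

lemma L2_AE_eq:
  fixes f g :: "'a \<Rightarrow> 'b::euclidean_space"
  assumes "f \<in> L2 M" and "AE x in M. f x = g x"
  shows "g \<in> L2 M"
  by (rule L2_bounded_mult[OF assms(1) measurable_AE_eq[OF L2D(1)[OF assms(1)] assms(2)], of 1])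
    (use assms(2) in \<open>auto elim!: eventually_mono\<close>)

lemma H1_jet:
  assumes "w \<in> H1 M D"
  shows "has_weak_gradient D w (weak_grad D w)" "w \<in> L2 M" "weak_grad D w \<in> L2 M" "jet D w \<in> L2 M"
proof -
  obtain G where G: "G \<in> L2 M" "has_weak_gradient D w G" and w: "w \<in> L2 M"
    using assms by (auto simp: H1_def)
  show "has_weak_gradient D w (weak_grad D w)"
    by (rule weak_grad_eq(1)[OF G(2)])
  show "w \<in> L2 M" by (rule w)
  have "AE x in M. G x = weak_grad D w x"
    using weak_grad_eq(2)[OF G(2)] by eventually_elim simp
  then show *: "weak_grad D w \<in> L2 M"
    by (rule L2_AE_eq[OF G(1)])
  show "jet D w \<in> L2 M"
    unfolding jet_def[abs_def] by (rule L2_Pair[OF w *])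
qed

text \<open>The left side contains the weak gradient of a difference, a choice made independently of
  the gradients of its two terms. From here on distances are measured between jets instead.\<close>

lemma H1_norm_eq:
  assumes "\<psi> \<in> test_functions E" and "w \<in> H1 M D"
  shows "H1_norm M D (\<lambda>x. \<psi> x - w x) = L2_norm M (\<lambda>x. smooth_jet \<psi> x - jet D w x)"
proof -
  note \<psi> = smooth_jet_L2[OF assms(1)] and w = H1_jet[OF assms(2)]
  have g: "has_weak_gradient D (\<lambda>x. \<psi> x - w x) (\<lambda>x. gradient \<psi> x - weak_grad D w x)"
    by (intro has_weak_gradient_diff D_sets smooth_has_weak_gradient test_functions_smooth[OF assms(1)] w)
  have L: "(\<lambda>x. gradient \<psi> x - weak_grad D w x) \<in> L2 M"
    by (intro L2_diff \<psi> w)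
  have AE: "AE x in M. gradient \<psi> x - weak_grad D w x = weak_grad D (\<lambda>x. \<psi> x - w x) x"
    using weak_grad_eq(2)[OF g] by eventually_elim simp
  have "L2_norm M (weak_grad D (\<lambda>x. \<psi> x - w x)) = L2_norm M (\<lambda>x. gradient \<psi> x - weak_grad D w x)"
    by (rule L2_norm_cong_AE[OF L2D(1)[OF L2_AE_eq[OF L AE]] L2D(1)[OF L] weak_grad_eq(2)[OF g]])
  then show ?thesis
    unfolding H1_norm_def smooth_jet_def jet_def minus_prod_def fst_conv snd_conv
    using L2_norm_Pair[OF L2_diff[OF \<psi>(1) w(2)] L] by simp
qed

lemma H1_closureE:
  assumes "w \<in> H1_closure M D E"
  obtains \<psi> :: "nat \<Rightarrow> 'a \<Rightarrow> real" where "\<forall>j. \<psi> j \<in> test_functions E"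
    "(\<lambda>j. L2_norm M (\<lambda>x. smooth_jet (\<psi> j) x - jet D w x)) \<longlonglongrightarrow> 0"
proof -
  obtain \<psi> :: "nat \<Rightarrow> 'a \<Rightarrow> real" where "\<forall>j. \<psi> j \<in> test_functions E"
    "(\<lambda>j. H1_norm M D (\<lambda>x. \<psi> j x - w x)) \<longlonglongrightarrow> 0" and w: "w \<in> H1 M D"
    using assms by (auto simp: H1_closure_def)
  then show thesis
    using that[of \<psi>] by (simp add: H1_norm_eq)
qed

text \<open>Membership in the closure is obtained from a limit of smooth jets alone: the limit G is
  recognised as a weak gradient by closedness, so no derivative of w has to be known
  beforehand.\<close>

lemma H1_closureI:
  assumes \<psi>: "\<And>j. \<psi> j \<in> test_functions E" and w: "w \<in> L2 M" "G \<in> L2 M"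
    and lim: "(\<lambda>j::nat. L2_norm M (\<lambda>x. smooth_jet (\<psi> j) x - (w x, G x))) \<longlonglongrightarrow> 0"
  shows "w \<in> H1_closure M D E" and "AE x in M. weak_grad D w x = G x"
    and "(\<lambda>j. H1_norm M D (\<lambda>x. \<psi> j x - w x)) \<longlonglongrightarrow> 0"
proof -
  note L = smooth_jet_L2[OF \<psi>]
  have jL: "(\<lambda>x. smooth_jet (\<psi> j) x - (w x, G x)) \<in> L2 M" for j
    by (intro L2_diff L L2_Pair w)
  have g: "has_weak_gradient D w G"
  proof (rule has_weak_gradient_closed[OF _ L(1,2) w(1) _ w(2)])
    show "has_weak_gradient D (\<psi> j) (gradient (\<psi> j))" for j
      by (intro smooth_has_weak_gradient D_sets test_functions_smooth[OF \<psi>])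
    show "(\<lambda>j. L2_norm M (\<lambda>x. \<psi> j x - w x)) \<longlonglongrightarrow> 0"
    proof (rule L2_tendsto_mono[OF lim jL, where C=1])
      show "AE x in M. norm (\<psi> j x - w x) \<le> 1 * norm (smooth_jet (\<psi> j) x - (w x, G x))" for j
        by (auto simp: smooth_jet_def norm_Pair intro!: AE_I2)
      show "(\<lambda>x. \<psi> j x - w x) \<in> borel_measurable M" for j
        using L2D(1)[OF L(1)] L2D(1)[OF w(1)] by auto
    qed auto
    show "(\<lambda>j. L2_norm M (\<lambda>x. gradient (\<psi> j) x - G x)) \<longlonglongrightarrow> 0"
    proof (rule L2_tendsto_mono[OF lim jL, where C=1])
      show "AE x in M. norm (gradient (\<psi> j) x - G x) \<le> 1 * norm (smooth_jet (\<psi> j) x - (w x, G x))" for j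
        by (auto simp: smooth_jet_def norm_Pair intro!: AE_I2)
      show "(\<lambda>x. gradient (\<psi> j) x - G x) \<in> borel_measurable M" for j
        using L2D(1)[OF L(2)] L2D(1)[OF w(2)] by auto
    qed auto
  qed
  have H1: "w \<in> H1 M D"
    using w g by (auto simp: H1_def)
  show AE: "AE x in M. weak_grad D w x = G x"
    by (rule weak_grad_eq(2)[OF g])
  have "H1_norm M D (\<lambda>x. \<psi> j x - w x) = L2_norm M (\<lambda>x. smooth_jet (\<psi> j) x - (w x, G x))" for j
    unfolding H1_norm_eq[OF \<psi> H1]
  proof (rule L2_norm_cong_AE)
    show "AE x in M. smooth_jet (\<psi> j) x - jet D w x = smooth_jet (\<psi> j) x - (w x, G x)"
      using AE by eventually_elim (simp add: jet_def)
  qed (intro L2D(1) L2_diff L H1_jet[OF H1] L2_Pair w)+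
  with lim show *: "(\<lambda>j. H1_norm M D (\<lambda>x. \<psi> j x - w x)) \<longlonglongrightarrow> 0"
    by simp
  show "w \<in> H1_closure M D E"
    unfolding H1_closure_def using H1 \<psi> * by blast
qed

lemma test_functions_H1_closure:
  assumes "\<psi> \<in> test_functions E"
  shows "\<psi> \<in> H1_closure M D E" and "AE x in M. weak_grad D \<psi> x = gradient \<psi> x"
  using H1_closureI[of "\<lambda>_. \<psi>" \<psi> "gradient \<psi>"] smooth_jet_L2[OF assms] assms
  by (simp_all add: smooth_jet_def L2_norm_def)

end

section \<open>Energy forms\<close>

lemma L2_norm_tendsto:
  fixes f :: "'a \<Rightarrow> 'b::euclidean_space"
  assumes "f \<in> L2 M" "\<And>j. fj j \<in> L2 M" "(\<lambda>j. L2_norm M (\<lambda>x. fj j x - f x)) \<longlonglongrightarrow> 0"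
  shows "(\<lambda>j::nat. L2_norm M (fj j)) \<longlonglongrightarrow> L2_norm M f"
proof -
  have "(\<lambda>j. L2_form.form M (\<lambda>x. (\<bullet>)) (fj j) (fj j)) \<longlonglongrightarrow> L2_form.form M (\<lambda>x. (\<bullet>)) f f"
    by (intro L2_form.form_tendsto[OF L2_form_inner] assms)
  then show ?thesis
    unfolding L2_form.form_def[OF L2_form_inner] L2_norm_def
    by (intro tendsto_real_sqrt) (simp add: dot_square_norm)
qed

context L2_form
begin

lemma form_sum_left:
  assumes "\<And>i. i \<in> I \<Longrightarrow> e i \<in> L2 M" and "q \<in> L2 M" and "finite I"
  shows "form (\<lambda>x. \<Sum>i\<in>I. e i x) q = (\<Sum>i\<in>I. form (e i) q)"
  using assms(3,1)
proof (induction I rule: finite_induct)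
  case empty
  then show ?case using form_scale_left[of 0 "\<lambda>_. 0" q] by simp
next
  case (insert i I)
  then show ?case by (simp add: form_add_left L2_sum assms(2))
qed

lemma form_sum_right:
  assumes "\<And>i. i \<in> I \<Longrightarrow> e i \<in> L2 M" and "q \<in> L2 M" and "finite I"
  shows "form q (\<lambda>x. \<Sum>i\<in>I. e i x) = (\<Sum>i\<in>I. form q (e i))"
  using assms(3,1)
proof (induction I rule: finite_induct)
  case empty
  then show ?case using form_scale_right[of q 0 "\<lambda>_. 0"] by simp
next
  case (insert i I)
  then show ?case by (simp add: form_add_right L2_sum assms(2))
qed

end

context L2_inner_form
begin

text \<open>Condition \<open>proj\<close> says that \<open>e k\<close> is the orthogonal projection
  of p onto its own direction; the claim is then nonnegativity of the form at p minus the partial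
  sum.\<close>

lemma form_Bessel:
  assumes p: "p \<in> L2 M" and e: "\<And>k. e k \<in> L2 M"
    and ortho: "\<And>j k. j \<noteq> k \<Longrightarrow> form (e j) (e k) = 0"
    and proj: "\<And>k. form p (e k) = form (e k) (e k)"
  shows "(\<Sum>k<(N::nat). form (e k) (e k)) \<le> form p p"
proof -
  let ?S = "\<lambda>x. \<Sum>k<N. e k x"
  have S: "?S \<in> L2 M" by (intro L2_sum e)
  have pS: "form p ?S = (\<Sum>k<N. form (e k) (e k))"
    by (simp add: form_sum_right e p proj)
  have "form ?S ?S = (\<Sum>j<N. \<Sum>k<N. form (e j) (e k))"
    by (simp add: form_sum_left form_sum_right e S)
  also have "\<dots> = (\<Sum>j<N. \<Sum>k<N. if k = j then form (e k) (e k) else 0)"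
    by (intro sum.cong refl) (auto simp: ortho)
  also have "\<dots> = (\<Sum>k<N. form (e k) (e k))"
    by (intro sum.cong refl) simp
  finally have SS: "form ?S ?S = (\<Sum>k<N. form (e k) (e k))" .
  have "0 \<le> form (\<lambda>x. p x + (-1) *\<^sub>R ?S x) (\<lambda>x. p x + (-1) *\<^sub>R ?S x)"
    by (rule form_nonneg)
  then show ?thesis
    unfolding form_add_self[OF p S] by (simp add: pS SS)
qed

end

lemma energy_form:
  fixes L :: "'a \<Rightarrow> 'b::euclidean_space \<Rightarrow> 'b" and k :: "'a \<Rightarrow> real"
  assumes lin: "\<And>x. linear (L x)"
    and meas: "\<And>p. p \<in> borel_measurable M \<Longrightarrow> (\<lambda>x. L x (p x)) \<in> borel_measurable M"
      "k \<in> borel_measurable M"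
    and bound: "AE x in M. \<forall>u. norm (L x u) \<le> B1 * norm u" "AE x in M. 0 \<le> k x \<and> k x \<le> B2"
    and sym: "AE x in M. \<forall>u v. L x u \<bullet> v = L x v \<bullet> u"
    and nonneg: "AE x in M. \<forall>u. 0 \<le> L x u \<bullet> u"
    and "0 \<le> B1" "0 \<le> B2"
  shows "L2_inner_form M (\<lambda>x p q. L x (snd p) \<bullet> snd q + k x * fst p * fst q) (B1 + B2)"
proof
  show "bilinear (\<lambda>p q. L x (snd p) \<bullet> snd q + k x * fst p * fst q)" for x
    using lin[of x] unfolding bilinear_def
    by (auto simp: linear_iff inner_simps algebra_simps)
  show "(\<lambda>x. L x (snd (p x)) \<bullet> snd (q x) + k x * fst (p x) * fst (q x)) \<in> borel_measurable M"
    if p: "p \<in> borel_measurable M" "q \<in> borel_measurable M" for p q :: "'a \<Rightarrow> real \<times> 'b"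
  proof -
    have [measurable]: "(\<lambda>x. fst (p x)) \<in> borel_measurable M" "(\<lambda>x. snd (p x)) \<in> borel_measurable M"
      "(\<lambda>x. fst (q x)) \<in> borel_measurable M" "(\<lambda>x. snd (q x)) \<in> borel_measurable M"
      using p by (auto intro: measurable_compose[OF _ borel_measurable_continuous_onI[OF continuous_on_fst[OF continuous_on_id]]]
          measurable_compose[OF _ borel_measurable_continuous_onI[OF continuous_on_snd[OF continuous_on_id]]])
    note [measurable] = meas(2) meas(1)[of "\<lambda>x. snd (p x)"]
    show ?thesis by measurable
  qed
  show "AE x in M. \<forall>u v. \<bar>L x (snd u) \<bullet> snd v + k x * fst u * fst v\<bar> \<le> (B1 + B2) * norm u * norm v"
    using bound
  proof eventually_elim
    case (elim x)
    show ?case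
    proof (intro allI)
      fix u v :: "real \<times> 'b"
      have n: "\<bar>fst u\<bar> \<le> norm u" "\<bar>fst v\<bar> \<le> norm v" "norm (snd u) \<le> norm u" "norm (snd v) \<le> norm v"
        using norm_fst_le[of "fst u" "snd u"] norm_fst_le[of "fst v" "snd v"]
          norm_snd_le[of "snd u" "fst u"] norm_snd_le[of "snd v" "fst v"] by auto
      have "\<bar>L x (snd u) \<bullet> snd v\<bar> \<le> norm (L x (snd u)) * norm (snd v)"
        by (rule Cauchy_Schwarz_ineq2)
      also have "\<dots> \<le> (B1 * norm u) * norm v"
        using elim(1) n assms(8) by (intro mult_mono order_trans[OF elim(1)[rule_format]] mult_left_mono) auto
      finally have 1: "\<bar>L x (snd u) \<bullet> snd v\<bar> \<le> B1 * norm u * norm v" .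
      have "\<bar>k x * fst u * fst v\<bar> = k x * \<bar>fst u\<bar> * \<bar>fst v\<bar>"
        using elim(2) by (simp add: abs_mult)
      also have "\<dots> \<le> B2 * norm u * norm v"
        using elim(2) n assms(9) by (intro mult_mono) auto
      finally have "\<bar>k x * fst u * fst v\<bar> \<le> B2 * norm u * norm v" .
      with 1 show "\<bar>L x (snd u) \<bullet> snd v + k x * fst u * fst v\<bar> \<le> (B1 + B2) * norm u * norm v"
        by (simp add: algebra_simps)
    qed
  qed
  show "AE x in M. \<forall>u v. L x (snd u) \<bullet> snd v + k x * fst u * fst v = L x (snd v) \<bullet> snd u + k x * fst v * fst u"
    using sym by eventually_elim simp
  show "AE x in M. \<forall>u. 0 \<le> L x (snd u) \<bullet> snd u + k x * fst u * fst u"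
    using nonneg bound(2) by eventually_elim (auto simp: mult.assoc)
qed (use assms in auto)

lemma matrix_vector_mult_bounded:
  obtains K where "K \<ge> 0" "\<And>(A::real^'n^'n) x. norm (A *v x) \<le> K * norm A * norm x"
proof -
  have "bilinear (\<lambda>(A::real^'n^'n) x. A *v x)"
    unfolding bilinear_def
    by (auto simp: linear_iff matrix_vector_mult_add_rdistrib matrix_vector_right_distrib
        scaleR_matrix_vector_assoc matrix_vector_mult_scaleR)
  then have "bounded_bilinear (\<lambda>(A::real^'n^'n) x. A *v x)"
    by (simp add: bilinear_conv_bounded_bilinear)
  from bounded_bilinear.nonneg_bounded[OF this] show thesis
    using that by (auto simp: mult.commute mult.left_commute)
qed

lemma matrix_vector_mult_measurable:
  fixes A :: "'a \<Rightarrow> real^'n^'n"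
  assumes "A \<in> borel_measurable M" "p \<in> borel_measurable M"
  shows "(\<lambda>x. A x *v p x) \<in> borel_measurable M"
proof (rule borel_measurable_continuous_Pair[OF assms])
  show "continuous_on UNIV (\<lambda>x. fst x *v snd x :: real^'n)"
    unfolding matrix_vector_mult_def by (intro continuous_intros)
qed

section \<open>The operator on the base domain\<close>

locale dirichlet_domain =
  fixes \<Omega> :: "(real^'n) set" and A :: "real^'n \<Rightarrow> real^'n^'n" and c :: "real^'n \<Rightarrow> real"
    and lam :: "nat \<Rightarrow> real" and \<phi> :: "nat \<Rightarrow> real^'n \<Rightarrow> real"
  assumes open_dom: "open \<Omega>" and bounded_dom: "bounded \<Omega>"
    and coeffs: "admissible_coefficients \<Omega> A c"
    and eigen: "dirichlet_eigenpairs \<Omega> A c lam \<phi>"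
begin

abbreviation "\<mu> \<equiv> lebesgue_on \<Omega>"

lemma dom_sets: "\<Omega> \<in> sets lebesgue"
  using open_dom by simp

lemma dom_lmeasurable: "\<Omega> \<in> lmeasurable"
  using open_dom bounded_dom by (rule lmeasurable_open[rotated])

sublocale base: weighted_domain \<mu> \<Omega> \<Omega> "\<lambda>_. 1"
proof
  show "\<mu> = density \<mu> (\<lambda>x. ennreal 1)" by (simp add: density_1)
  show "integrable \<mu> (\<lambda>x. indicator K x * 1 :: real)" if "compact K" "K \<subseteq> \<Omega>" for K
  proof -
    have "K \<in> sets \<mu>"
      using that dom_sets by (auto simp: sets_restrict_space_iff compact_imp_closed)
    moreover have "emeasure \<mu> K < \<infinity>"
      using that dom_sets fmeasurableD2[OF lmeasurable_compact[OF that(1)]]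
      by (subst emeasure_restrict_space) (auto simp: less_top)
    ultimately show ?thesis
      by simp
  qed
qed (use open_dom in auto)

lemma A_continuous: "continuous_on \<Omega> A"
  using coeffs lipschitz_on_continuous_on unfolding admissible_coefficients_def by blast

lemma A_symmetric: "x \<in> \<Omega> \<Longrightarrow> (A x *v u) \<bullet> v = (A x *v v) \<bullet> u"
proof -
  assume "x \<in> \<Omega>"
  then have "transpose (A x) = A x"
    using coeffs unfolding admissible_coefficients_def by blast
  then have "(A x *v u) \<bullet> v = (u v* A x) \<bullet> v"
    using transpose_matrix_vector[of "A x" u] by simp
  also have "\<dots> = (A x *v v) \<bullet> u"
    by (subst dot_lmul_matrix) (rule inner_commute)
  finally show ?thesis .
qed

lemma A_elliptic: obtains a where "a > 0" "\<And>x u. x \<in> \<Omega> \<Longrightarrow> a * (norm u)\<^sup>2 \<le> (A x *v u) \<bullet> u"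
  using coeffs unfolding admissible_coefficients_def by blast

lemma A_bounded: obtains B where "B \<ge> 0" "\<And>x u. x \<in> \<Omega> \<Longrightarrow> norm (A x *v u) \<le> B * norm u"
proof -
  obtain L where "L-lipschitz_on \<Omega> A"
    using coeffs unfolding admissible_coefficients_def by blast
  then have "bounded (A ` \<Omega>)"
    using bounded_dom bounded_uniformly_continuous_image lipschitz_on_uniformly_continuous by blast
  then obtain B0 where B0: "\<And>x. x \<in> \<Omega> \<Longrightarrow> norm (A x) \<le> B0"
    by (auto simp: bounded_iff)
  obtain K where K: "K \<ge> 0" "\<And>(A::real^'n^'n) x. norm (A *v x) \<le> K * norm A * norm x"
    using matrix_vector_mult_bounded by blast
  show thesis
  proof
    show "K * \<bar>B0\<bar> \<ge> 0" using K by simp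
    show "norm (A x *v u) \<le> K * \<bar>B0\<bar> * norm u" if "x \<in> \<Omega>" for x u
    proof -
      have "norm (A x) \<le> \<bar>B0\<bar>" using B0[OF that] by linarith
      then have "K * norm (A x) * norm u \<le> K * \<bar>B0\<bar> * norm u"
        using K by (intro mult_right_mono mult_left_mono) auto
      with K(2)[of "A x" u] show ?thesis by linarith
    qed
  qed
qed

lemma c_measurable: "c \<in> borel_measurable \<mu>"
  using coeffs unfolding admissible_coefficients_def by blast

lemma c_bounds: obtains B where "B \<ge> 0" "AE x in \<mu>. 0 \<le> c x \<and> c x \<le> B"
proof -
  obtain B where B: "AE x in \<mu>. \<bar>c x\<bar> \<le> B" and c: "AE x in \<mu>. 0 \<le> c x"
    using coeffs unfolding admissible_coefficients_def by blast
  have "AE x in \<mu>. 0 \<le> c x \<and> c x \<le> \<bar>B\<bar>"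
    using B c by eventually_elim auto
  then show thesis using that[of "\<bar>B\<bar>"] by simp
qed

definition base_density :: "real^'n \<Rightarrow> real \<times> (real^'n) \<Rightarrow> real \<times> (real^'n) \<Rightarrow> real" where
  "base_density x p q = (A x *v snd p) \<bullet> snd q + c x * fst p * fst q"

lemma base_inner_form: "\<exists>C. L2_inner_form \<mu> base_density C"
proof -
  obtain B1 where B1: "B1 \<ge> 0" "\<And>x u. x \<in> \<Omega> \<Longrightarrow> norm (A x *v u) \<le> B1 * norm u"
    using A_bounded by blast
  obtain B2 where B2: "B2 \<ge> 0" "AE x in \<mu>. 0 \<le> c x \<and> c x \<le> B2"
    using c_bounds by blast
  have "L2_inner_form \<mu> (\<lambda>x p q. (A x *v snd p) \<bullet> snd q + c x * fst p * fst q) (B1 + B2)"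
  proof (rule energy_form)
    show "(\<lambda>x. A x *v p x) \<in> borel_measurable \<mu>" if "p \<in> borel_measurable \<mu>" for p
      using that continuous_imp_measurable_on_sets_lebesgue[OF A_continuous dom_sets]
      by (rule matrix_vector_mult_measurable[rotated])
    obtain a where a: "a > 0" "\<And>x u. x \<in> \<Omega> \<Longrightarrow> a * (norm u)\<^sup>2 \<le> (A x *v u) \<bullet> u"
      using A_elliptic by blast
    then have "0 \<le> (A x *v u) \<bullet> u" if "x \<in> \<Omega>" for x u
      using order_trans[OF _ a(2)[OF that]] a(1) by simp
    then show "AE x in \<mu>. \<forall>u. 0 \<le> (A x *v u) \<bullet> u"
      by (intro AE_I2) auto
  qed (use B1 B2 c_measurable A_symmetric in auto)
  then show ?thesis
    unfolding base_density_def[abs_def] by blast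
qed

text \<open>The bound of the form is known only to exist; a chosen constant makes the form available
  as a sublocale.\<close>

definition "base_const = (SOME C. L2_inner_form \<mu> base_density C)"

sublocale bf: L2_inner_form \<mu> base_density base_const
  unfolding base_const_def by (rule someI_ex[OF base_inner_form])

lemma phi_H10: "\<phi> k \<in> H10 \<Omega>"
  using eigen unfolding dirichlet_eigenpairs_def by blast

lemma H10_H1: "w \<in> H10 \<Omega> \<Longrightarrow> w \<in> H1 \<mu> \<Omega>"
  unfolding H10_def H1_closure_def by blast

sublocale basis: L2_basis \<mu> \<phi>
proof
  show "\<phi> k \<in> L2 \<mu>" for k
    using base.H1_jet(2)[OF H10_H1[OF phi_H10]] .
qed (use eigen in \<open>auto simp: dirichlet_eigenpairs_def\<close>)

lemma lam_mono: "j \<le> k \<Longrightarrow> lam j \<le> lam k"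
  using eigen unfolding dirichlet_eigenpairs_def mono_def by blast

lemma phi_eigen:
  assumes "v \<in> H10 \<Omega>"
  shows "bf.form (jet \<Omega> (\<phi> k)) (jet \<Omega> v) = lam k * L2_inner \<mu> (\<phi> k) v"
  using eigen assms unfolding dirichlet_eigenpairs_def bf.form_def base_density_def jet_def by simp

lemma test_H10: "v \<in> test_functions \<Omega> \<Longrightarrow> v \<in> H10 \<Omega>"
  unfolding H10_def by (rule base.test_functions_H1_closure)

lemma form_smooth_jet:
  assumes "v \<in> test_functions \<Omega>" and "p \<in> L2 \<mu>"
  shows "bf.form p (smooth_jet v) = bf.form p (jet \<Omega> v)"
proof (rule bf.form_cong_AE)
  show "AE x in \<mu>. smooth_jet v x = jet \<Omega> v x"
    using base.test_functions_H1_closure(2)[OF assms(1)] by eventually_elim (simp add: smooth_jet_def jet_def)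
qed (use assms(2) base.smooth_jet_L2[OF assms(1)] base.H1_jet(4)[OF H10_H1[OF test_H10[OF assms(1)]]] in
    \<open>auto intro: L2D(1)\<close>)

lemma phi_eigen_test:
  assumes "v \<in> test_functions \<Omega>"
  shows "bf.form (jet \<Omega> (\<phi> k)) (smooth_jet v) = lam k * L2_inner \<mu> (\<phi> k) v"
  using phi_eigen[OF test_H10[OF assms]] form_smooth_jet[OF assms base.H1_jet(4)[OF H10_H1[OF phi_H10]]]
  by simp

text \<open>Integrating by parts with the coordinate function x \<bullet> b, whose derivative along
  b is 1, writes the squared norm of v as -2 times the inner product of (x \<bullet> b) v with the
  derivative of v along b. The factor x \<bullet> b is bounded by R on the domain.\<close>

lemma Poincare_test:
  assumes R: "\<And>x. x \<in> \<Omega> \<Longrightarrow> norm x \<le> R" and v: "v \<in> test_functions \<Omega>"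
  shows "L2_norm \<mu> v \<le> 2 * \<bar>R\<bar> * L2_norm \<mu> (gradient v)"
proof (cases "L2_norm \<mu> v = 0")
  case False
  obtain b :: "real^'n" where b: "b \<in> Basis" using nonempty_Basis by blast
  note sv = test_functions_smooth[OF v] and L = base.smooth_jet_L2[OF v]
  let ?f = "\<lambda>x. (x \<bullet> b) * v x"
  have sf: "smooth ?f" by (intro smooth_mult smooth_inner sv)
  have fb: "gradient ?f x \<bullet> b = (x \<bullet> b) * (gradient v x \<bullet> b) + v x" for x
  proof -
    have "frechet_derivative (\<lambda>x::real^'n. x \<bullet> b) (at x) b = 1"
      using fun_cong[OF frechet_derivative_at[OF bounded_linear_imp_has_derivative[OF bounded_linear_inner_left]], of _ b]
        b by (metis inner_same_Basis)
    then show ?thesis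
      using b frechet_derivative_mult[OF smooth_inner[of b] sv, of x b] by (simp add: gradient_inner)
  qed
  have gb: "(\<lambda>x. gradient v x \<bullet> b) \<in> L2 \<mu>"
    by (rule L2_bounded_mult[OF L(2), of _ 1]) (use L2D(1)[OF L(2)] b in \<open>auto simp: Basis_le_norm\<close>)
  have xb: "\<bar>x \<bullet> b\<bar> \<le> \<bar>R\<bar>" if "x \<in> \<Omega>" for x
    using Basis_le_norm[OF b, of x] R[OF that] by linarith
  have xm: "(\<lambda>x. x \<bullet> b) \<in> borel_measurable \<mu>"
    by (rule smooth_measurable_lebesgue_on[OF smooth_inner])
  have xv: "(\<lambda>x. (x \<bullet> b) * v x) \<in> L2 \<mu>"
  proof (rule L2_bounded_mult[OF L(1)])
    show "AE x in \<mu>. norm ((x \<bullet> b) * v x) \<le> \<bar>R\<bar> * norm (v x)"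
      using xb by (intro AE_I2) (auto simp: abs_mult intro: mult_right_mono)
  qed (use xm L2D(1)[OF L(1)] in measurable)
  note int = L2_inner_integrable[OF xv gb] L2_inner_integrable[OF L(1) L(1)]
  have "(\<integral>x. ?f x * frechet_derivative v (at x) b \<partial>\<mu>) = - (\<integral>x. (gradient ?f x \<bullet> b) * v x \<partial>\<mu>)"
    using smooth_has_weak_gradient[OF dom_sets sf] v b unfolding has_weak_gradient_def by blast
  also have "(\<integral>x. (gradient ?f x \<bullet> b) * v x \<partial>\<mu>) = (\<integral>x. ?f x * (gradient v x \<bullet> b) + v x * v x \<partial>\<mu>)"
    unfolding fb by (intro Bochner_Integration.integral_cong) (auto simp: algebra_simps)
  also have "\<dots> = (\<integral>x. ?f x * (gradient v x \<bullet> b) \<partial>\<mu>) + (L2_norm \<mu> v)\<^sup>2"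
    using int L2_inner_self[of \<mu> v] by (simp add: L2_inner_def)
  finally have "(L2_norm \<mu> v)\<^sup>2 = - 2 * L2_inner \<mu> ?f (\<lambda>x. gradient v x \<bullet> b)"
    using b by (simp add: gradient_inner L2_inner_def)
  also have "\<dots> \<le> 2 * (L2_norm \<mu> ?f * L2_norm \<mu> (\<lambda>x. gradient v x \<bullet> b))"
    using L2_inner_bound[OF xv gb] by linarith
  also have "\<dots> \<le> 2 * ((\<bar>R\<bar> * L2_norm \<mu> v) * (1 * L2_norm \<mu> (gradient v)))"
  proof (intro mult_left_mono mult_mono)
    show "L2_norm \<mu> ?f \<le> \<bar>R\<bar> * L2_norm \<mu> v"
    proof (rule L2_norm_mono[OF L(1)])
      show "AE x in \<mu>. norm ((x \<bullet> b) * v x) \<le> \<bar>R\<bar> * norm (v x)"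
        using xb by (intro AE_I2) (auto simp: abs_mult intro: mult_right_mono)
    qed (use L2D(1)[OF xv] in auto)
    show "L2_norm \<mu> (\<lambda>x. gradient v x \<bullet> b) \<le> 1 * L2_norm \<mu> (gradient v)"
      by (rule L2_norm_mono[OF L(2)]) (use L2D(1)[OF gb] b in \<open>auto simp: Basis_le_norm\<close>)
  qed (auto simp: L2_norm_nonneg)
  finally have "L2_norm \<mu> v * L2_norm \<mu> v \<le> (2 * \<bar>R\<bar> * L2_norm \<mu> (gradient v)) * L2_norm \<mu> v"
    by (simp add: power2_eq_square mult_ac)
  then show ?thesis
    using False L2_norm_nonneg[of \<mu> v] by simp
qed (simp add: L2_norm_nonneg)

lemma form_coercive:
  assumes a: "\<And>x u. x \<in> \<Omega> \<Longrightarrow> a * (norm u)\<^sup>2 \<le> (A x *v u) \<bullet> u"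
    and w: "w \<in> L2 \<mu>" "G \<in> L2 \<mu>"
  shows "a * (L2_norm \<mu> G)\<^sup>2 \<le> bf.form (\<lambda>x. (w x, G x)) (\<lambda>x. (w x, G x))"
proof -
  have "(\<integral>x. a * (norm (G x))\<^sup>2 \<partial>\<mu>) \<le> bf.form (\<lambda>x. (w x, G x)) (\<lambda>x. (w x, G x))"
    unfolding bf.form_def
  proof (rule integral_mono_AE)
    obtain B where "AE x in \<mu>. 0 \<le> c x \<and> c x \<le> B" using c_bounds by blast
    then have "AE x in \<mu>. x \<in> \<Omega> \<and> 0 \<le> c x"
      using AE_space[of \<mu>] by eventually_elim auto
    then show "AE x in \<mu>. a * (norm (G x))\<^sup>2 \<le> base_density x (w x, G x) (w x, G x)"
    proof eventually_elim
      case (elim x)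
      then have "0 \<le> c x * (w x * w x)" by simp
      moreover have "a * (norm (G x))\<^sup>2 \<le> (A x *v G x) \<bullet> G x" using a elim by blast
      ultimately show ?case
        unfolding base_density_def fst_conv snd_conv mult.assoc by linarith
    qed
    show "integrable \<mu> (\<lambda>x. base_density x (w x, G x) (w x, G x))"
      by (intro bf.integrable_form L2_Pair w)
  qed (use L2D(2)[OF w(2)] in auto)
  then show ?thesis by (simp add: L2_norm_sq)
qed

text \<open>An eigenvalue is the energy of its normalised eigenfunction, which ellipticity bounds
  below by the gradient. Poincare's inequality, carried over by density, excludes a vanishing
  gradient.\<close>

lemma lam_pos: "0 < lam k"
proof -
  obtain R where R: "\<And>x. x \<in> \<Omega> \<Longrightarrow> norm x \<le> R"
    using bounded_dom by (auto simp: bounded_iff)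
  obtain a where a: "a > 0" "\<And>x u. x \<in> \<Omega> \<Longrightarrow> a * (norm u)\<^sup>2 \<le> (A x *v u) \<bullet> u"
    using A_elliptic by blast
  note H1 = base.H1_jet[OF H10_H1[OF phi_H10[of k]]]
  obtain \<psi> :: "nat \<Rightarrow> real^'n \<Rightarrow> real" where \<psi>': "\<forall>j. \<psi> j \<in> test_functions \<Omega>"
    and lim: "(\<lambda>j. L2_norm \<mu> (\<lambda>x. smooth_jet (\<psi> j) x - jet \<Omega> (\<phi> k) x)) \<longlonglongrightarrow> 0"
    by (rule base.H1_closureE[OF phi_H10[unfolded H10_def, of k]])
  note \<psi> = \<psi>'[rule_format] lim
  note L = base.smooth_jet_L2[OF \<psi>(1)]
  have jL: "(\<lambda>x. smooth_jet (\<psi> j) x - jet \<Omega> (\<phi> k) x) \<in> L2 \<mu>" for j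
    by (intro L2_diff L H1)
  have "(\<lambda>j. L2_norm \<mu> (\<lambda>x. \<psi> j x - \<phi> k x)) \<longlonglongrightarrow> 0"
  proof (rule L2_tendsto_mono[OF \<psi>(2) jL, where C=1])
    show "(\<lambda>x. \<psi> j x - \<phi> k x) \<in> borel_measurable \<mu>" for j
      by (intro L2D(1) L2_diff L H1)
  qed (auto simp: smooth_jet_def jet_def norm_Pair intro!: AE_I2)
  then have l1: "(\<lambda>j. L2_norm \<mu> (\<psi> j)) \<longlonglongrightarrow> L2_norm \<mu> (\<phi> k)"
    by (rule L2_norm_tendsto[OF H1(2) L(1)])
  have "(\<lambda>j. L2_norm \<mu> (\<lambda>x. gradient (\<psi> j) x - weak_grad \<Omega> (\<phi> k) x)) \<longlonglongrightarrow> 0"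
  proof (rule L2_tendsto_mono[OF \<psi>(2) jL, where C=1])
    show "(\<lambda>x. gradient (\<psi> j) x - weak_grad \<Omega> (\<phi> k) x) \<in> borel_measurable \<mu>" for j
      by (intro L2D(1) L2_diff L H1)
  qed (auto simp: smooth_jet_def jet_def norm_Pair intro!: AE_I2)
  then have l2: "(\<lambda>j. L2_norm \<mu> (gradient (\<psi> j))) \<longlonglongrightarrow> L2_norm \<mu> (weak_grad \<Omega> (\<phi> k))"
    by (rule L2_norm_tendsto[OF H1(3) L(2)])
  have "L2_norm \<mu> (\<phi> k) \<le> 2 * \<bar>R\<bar> * L2_norm \<mu> (weak_grad \<Omega> (\<phi> k))"
    by (rule LIMSEQ_le[OF l1 tendsto_mult_left[OF l2]]) (use Poincare_test[OF R \<psi>(1)] in auto)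
  moreover have n1: "(L2_norm \<mu> (\<phi> k))\<^sup>2 = 1"
    using basis.ortho[of k k] by (simp add: L2_inner_self)
  moreover have "L2_norm \<mu> (\<phi> k) = 1"
    using n1 L2_norm_nonneg[of \<mu> "\<phi> k"] by (simp add: power2_eq_1_iff)
  ultimately have "L2_norm \<mu> (weak_grad \<Omega> (\<phi> k)) \<noteq> 0"
    by auto
  then have "0 < a * (L2_norm \<mu> (weak_grad \<Omega> (\<phi> k)))\<^sup>2"
    using a(1) by simp
  also have "\<dots> \<le> bf.form (jet \<Omega> (\<phi> k)) (jet \<Omega> (\<phi> k))"
    using form_coercive[OF a(2) H1(2,3)] by (simp add: jet_def[abs_def])
  also have "\<dots> = lam k"
    using phi_eigen[OF phi_H10, of k k] basis.ortho[of k k] by simp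
  finally show ?thesis .
qed

text \<open>The projections onto the eigenfunctions have energies
  \<open>lam k * (r k)\<^sup>2\<close>. Bessel's inequality in the energy form bounds their sum by
  the energy of v, and Parseval's identity in L2 evaluates the sum after each eigenvalue is lowered
  to the first.\<close>

lemma spectral_gap:
  assumes v: "v \<in> test_functions \<Omega>"
  shows "lam 0 * (L2_norm \<mu> v)\<^sup>2 \<le> bf.form (smooth_jet v) (smooth_jet v)"
proof -
  note H1 = base.H1_jet[OF H10_H1[OF phi_H10]]
  define r where "r k = L2_inner \<mu> v (\<phi> k)" for k
  define e where "e k x = r k *\<^sub>R jet \<Omega> (\<phi> k) x" for k x
  have e: "e k \<in> L2 \<mu>" for k
    unfolding e_def by (intro L2_scaleR H1)
  note vL = base.smooth_jet_L2[OF v]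
  have ee: "bf.form (e j) (e k) = (if j = k then lam k * (r k)\<^sup>2 else 0)" for j k
    unfolding e_def
    by (simp add: bf.form_scale_left bf.form_scale_right phi_eigen[OF phi_H10] basis.ortho power2_eq_square)
  have "bf.form (smooth_jet v) (e k) = bf.form (e k) (smooth_jet v)" for k
    by (rule bf.form_sym[OF vL(3) e])
  then have ve: "bf.form (smooth_jet v) (e k) = bf.form (e k) (e k)" for k
    unfolding ee unfolding e_def
    by (simp add: bf.form_scale_left phi_eigen_test[OF v] r_def power2_eq_square L2_inner_commute[of \<mu> v])
  have "(\<Sum>k<N. lam 0 * (r k)\<^sup>2) \<le> bf.form (smooth_jet v) (smooth_jet v)" for N
  proof -
    have "(\<Sum>k<N. lam 0 * (r k)\<^sup>2) \<le> (\<Sum>k<N. bf.form (e k) (e k))"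
      by (intro sum_mono) (simp add: ee lam_mono mult_right_mono)
    also have "\<dots> \<le> bf.form (smooth_jet v) (smooth_jet v)"
      by (rule bf.form_Bessel[OF vL(3) e]) (auto simp: ee ve)
    finally show ?thesis .
  qed
  moreover have "(\<lambda>N. \<Sum>k<N. lam 0 * (r k)\<^sup>2) \<longlonglongrightarrow> lam 0 * (L2_norm \<mu> v)\<^sup>2"
    using sums_mult[OF basis.Parseval[OF vL(1)], of "lam 0"] by (simp add: sums_def r_def)
  ultimately show ?thesis
    by (meson LIMSEQ_le_const2)
qed

end

section \<open>Fubini's theorem for Lebesgue measurable functions\<close>

text \<open>Lebesgue measure on a product is the completion of the product measure, not the product
  of the completed factors. Statements about products therefore pass through Borel null sets and
  Borel representatives.\<close>

lemma AE_lebesgue_null: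
  assumes "AE x in lebesgue. P x"
  obtains N where "N \<in> sets borel" "AE x in lborel. x \<notin> N" "\<forall>x. x \<notin> N \<longrightarrow> P x"
proof -
  have "AE x in lborel. P x"
    using assms by (simp add: AE_completion_iff)
  then obtain N where N: "N \<in> null_sets lborel" "{x \<in> space lborel. \<not> P x} \<subseteq> N"
    by (auto simp: eventually_ae_filter)
  then show thesis
    using that[of N] AE_not_in[OF N(1)] null_setsD2[OF N(1)] by auto
qed

lemma AE_lebesgue_prod:
  fixes P :: "'a::euclidean_space \<times> 'b::euclidean_space \<Rightarrow> bool"
  assumes "AE z in lebesgue. P z"
  shows "AE y in lborel. AE x in lebesgue. P (x, y)"
proof -
  obtain N where N: "N \<in> sets borel" "AE x in lborel. x \<notin> N" "\<forall>x. x \<notin> N \<longrightarrow> P x"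
    using AE_lebesgue_null[OF assms] .
  have "AE z in lborel \<Otimes>\<^sub>M lborel. z \<notin> N"
    unfolding lborel_prod by (rule N(2))
  then have "AE x in lborel. AE y in lborel. (x, y) \<notin> N"
    by (rule lborel_pair.AE_pair)
  moreover have "{z \<in> space (lborel \<Otimes>\<^sub>M lborel). (fst z, snd z) \<notin> N} \<in> sets (lborel \<Otimes>\<^sub>M lborel)"
    using N(1) unfolding lborel_prod by simp
  ultimately have "AE y in lborel. AE x in lborel. (x, y) \<notin> N"
    using lborel_pair.AE_commute[of "\<lambda>x y. (x, y) \<notin> N"] by simp
  then show ?thesis
    by eventually_elim (use N(3) in \<open>auto simp: AE_completion_iff elim!: eventually_mono\<close>)
qed

lemma AE_lebesgue_fst:
  fixes P :: "'a::euclidean_space \<Rightarrow> bool"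
  assumes "AE x in lebesgue. P x"
  shows "AE z in lebesgue. P (fst (z :: 'a \<times> 'b::euclidean_space))"
proof -
  obtain N where N: "N \<in> sets borel" "AE x in lborel. x \<notin> N" "\<forall>x. x \<notin> N \<longrightarrow> P x"
    using AE_lebesgue_null[OF assms] .
  have "AE z in lborel \<Otimes>\<^sub>M (lborel :: 'b measure). fst z \<notin> N"
  proof (rule lborel_pair.AE_pair_measure)
    show "{z \<in> space (lborel \<Otimes>\<^sub>M (lborel :: 'b measure)). fst z \<notin> N} \<in> sets (lborel \<Otimes>\<^sub>M lborel)"
      using N(1) by measurable
    show "AE x in lborel. AE y in (lborel :: 'b measure). fst (x, y) \<notin> N"
      using N(2) by eventually_elim simp
  qed
  then have "AE z in (lborel :: ('a \<times> 'b) measure). P (fst z)"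
    unfolding lborel_prod by eventually_elim (use N(3) in auto)
  then show ?thesis by (simp add: AE_completion_iff)
qed

lemma AE_lebesgue_snd:
  fixes P :: "'b::euclidean_space \<Rightarrow> bool"
  assumes "AE x in lebesgue. P x"
  shows "AE z in lebesgue. P (snd (z :: 'a::euclidean_space \<times> 'b))"
proof -
  obtain N where N: "N \<in> sets borel" "AE x in lborel. x \<notin> N" "\<forall>x. x \<notin> N \<longrightarrow> P x"
    using AE_lebesgue_null[OF assms] .
  have "AE z in (lborel :: 'a measure) \<Otimes>\<^sub>M lborel. snd z \<notin> N"
  proof (rule lborel_pair.AE_pair_measure)
    show "{z \<in> space ((lborel :: 'a measure) \<Otimes>\<^sub>M lborel). snd z \<notin> N} \<in> sets (lborel \<Otimes>\<^sub>M lborel)"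
      using N(1) by measurable
    show "AE x in (lborel :: 'a measure). AE y in lborel. snd (x, y) \<notin> N"
      using N(2) by simp
  qed
  then have "AE z in (lborel :: ('a \<times> 'b) measure). P (snd z)"
    unfolding lborel_prod by eventually_elim (use N(3) in auto)
  then show ?thesis by (simp add: AE_completion_iff)
qed

lemma borel_measurable_fst_lborel: "f \<in> borel_measurable borel \<Longrightarrow>
    (\<lambda>z::'a::euclidean_space \<times> 'b::euclidean_space. f (fst z)) \<in> borel_measurable borel"
  by (rule measurable_compose[OF borel_measurable_continuous_onI]) (intro continuous_intros)

lemma borel_measurable_snd_lborel: "f \<in> borel_measurable borel \<Longrightarrow>
    (\<lambda>z::'a::euclidean_space \<times> 'b::euclidean_space. f (snd z)) \<in> borel_measurable borel"
  by (rule measurable_compose[OF borel_measurable_continuous_onI]) (intro continuous_intros)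

lemma lebesgue_real_borel_rep:
  fixes f :: "'a::euclidean_space \<Rightarrow> real"
  assumes "f \<in> borel_measurable lebesgue"
  obtains f' where "f' \<in> borel_measurable borel" "AE x in lebesgue. f x = f' x"
  using completion_ex_borel_measurable_real[OF assms] by (auto simp: AE_completion_iff)

lemma lebesgue_measurable_fst:
  fixes f :: "'a::euclidean_space \<Rightarrow> 'c::euclidean_space"
  assumes "f \<in> borel_measurable lebesgue"
  shows "(\<lambda>z::'a \<times> 'b::euclidean_space. f (fst z)) \<in> borel_measurable lebesgue"
proof -
  have real: "(\<lambda>z::'a \<times> 'b. g (fst z)) \<in> borel_measurable lebesgue"
    if g: "g \<in> borel_measurable lebesgue" for g :: "'a \<Rightarrow> real"
  proof -
    obtain g' where g': "g' \<in> borel_measurable borel" "AE x in lebesgue. g x = g' x"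
      using lebesgue_real_borel_rep[OF g] .
    have "(\<lambda>z::'a \<times> 'b. g' (fst z)) \<in> borel_measurable lebesgue"
      by (intro measurable_completion) (simp add: borel_measurable_fst_lborel g'(1))
    moreover have "AE z in lebesgue. g' (fst z) = g (fst (z::'a \<times> 'b))"
      using AE_lebesgue_fst[OF g'(2)] by eventually_elim simp
    ultimately show ?thesis by (rule borel_measurable_AE)
  qed
  show ?thesis
    using assms by (subst borel_measurable_euclidean_space) (auto intro!: real)
qed

lemma integrable_lebesgue_prod:
  fixes f :: "'a::euclidean_space \<Rightarrow> real" and g :: "'b::euclidean_space \<Rightarrow> real"
  assumes f: "integrable lebesgue f" and g: "integrable lebesgue g"
  shows "integrable lebesgue (\<lambda>z. f (fst z) * g (snd z))"
proof -
  obtain f' where f': "f' \<in> borel_measurable borel" "AE x in lebesgue. f x = f' x"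
    using lebesgue_real_borel_rep[OF borel_measurable_integrable[OF f]] .
  obtain g' where g': "g' \<in> borel_measurable borel" "AE x in lebesgue. g x = g' x"
    using lebesgue_real_borel_rep[OF borel_measurable_integrable[OF g]] .
  have "integrable lebesgue f'"
    using f f' by (subst integrable_cong_AE[of _ _ f]) (auto intro: measurable_completion elim!: eventually_mono)
  then have if': "integrable lborel f'"
    using f'(1) by (simp add: integrable_completion)
  have "integrable lebesgue g'"
    using g g' by (subst integrable_cong_AE[of _ _ g]) (auto intro: measurable_completion elim!: eventually_mono)
  then have ig': "integrable lborel g'"
    using g'(1) by (simp add: integrable_completion)
  have m: "(\<lambda>z. f' (fst z) * g' (snd z)) \<in> borel_measurable borel"
    by (intro borel_measurable_times borel_measurable_fst_lborel borel_measurable_snd_lborel f' g')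
  have "integrable (lborel \<Otimes>\<^sub>M lborel) (\<lambda>z. f' (fst z) * g' (snd z))"
  proof (rule lborel_pair.Fubini_integrable)
    show "(\<lambda>z. f' (fst z) * g' (snd z)) \<in> borel_measurable (lborel \<Otimes>\<^sub>M lborel)"
      unfolding lborel_prod using m by simp
    show "integrable lborel (\<lambda>x. \<integral>y. norm (f' (fst (x, y)) * g' (snd (x, y))) \<partial>lborel)"
      using if' ig' by (simp add: abs_mult)
    show "AE x in lborel. integrable lborel (\<lambda>y. f' (fst (x, y)) * g' (snd (x, y)))"
      using ig' by simp
  qed
  then have "integrable lebesgue (\<lambda>z. f' (fst z) * g' (snd z))"
    using m by (simp add: lborel_prod integrable_completion)
  moreover have "AE z in lebesgue. f' (fst z) * g' (snd z) = f (fst z) * g (snd (z :: 'a \<times> 'b))"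
    using AE_lebesgue_fst[OF f'(2)] AE_lebesgue_snd[OF g'(2)] by eventually_elim simp
  ultimately show ?thesis
    using integrable_cong_AE_imp borel_measurable_AE borel_measurable_integrable
    by (metis (mono_tags, lifting) AE_cong)
qed

text \<open>The inner integral runs over the first factor because cross sections of the cylinder at
  fixed height are wanted. Slices of F are integrable only for almost every height, those at which F
  agrees with its Borel representative almost everywhere on the slice.\<close>

lemma lebesgue_Fubini:
  fixes F :: "'a::euclidean_space \<times> 'b::euclidean_space \<Rightarrow> real"
  assumes F: "integrable lebesgue F"
  shows "AE y in lebesgue. integrable lebesgue (\<lambda>x. F (x, y))"
    and "integrable lebesgue (\<lambda>y. \<integral>x. F (x, y) \<partial>lebesgue)"
    and "(\<integral>z. F z \<partial>lebesgue) = (\<integral>y. (\<integral>x. F (x, y) \<partial>lebesgue) \<partial>lebesgue)"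
proof -
  obtain F' where F': "F' \<in> borel_measurable borel" "AE z in lebesgue. F z = F' z"
    using lebesgue_real_borel_rep[OF borel_measurable_integrable[OF F]] .
  have "AE z in lebesgue. F' z = F z"
    using F'(2) by eventually_elim simp
  then have "integrable lebesgue F'"
    using F F' by (subst integrable_cong_AE[of _ _ F]) (auto intro: measurable_completion)
  then have int: "integrable (lborel \<Otimes>\<^sub>M lborel) (\<lambda>(x, y). F' (x, y))"
    using F'(1) by (simp add: integrable_completion lborel_prod)
  have sec: "(\<lambda>x. F' (x, y)) \<in> borel_measurable borel" for y
    using F'(1) by (rule measurable_compose[rotated]) (auto intro!: borel_measurable_continuous_onI continuous_intros)
  have AE: "AE y in lborel. AE x in lebesgue. F (x, y) = F' (x, y)"
    by (rule AE_lebesgue_prod[OF F'(2)])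
  have meas: "(\<lambda>x. F (x, y)) \<in> borel_measurable lebesgue" if "AE x in lebesgue. F (x, y) = F' (x, y)" for y
  proof (rule borel_measurable_AE)
    show "(\<lambda>x. F' (x, y)) \<in> borel_measurable lebesgue"
      by (intro measurable_completion) (simp add: sec)
    show "AE x in lebesgue. F' (x, y) = F (x, y)"
      using that by eventually_elim simp
  qed
  have eq: "AE y in lborel. (\<integral>x. F (x, y) \<partial>lebesgue) = (\<integral>x. F' (x, y) \<partial>lborel)"
    using AE
  proof eventually_elim
    case (elim y)
    have "(\<integral>x. F (x, y) \<partial>lebesgue) = (\<integral>x. F' (x, y) \<partial>lebesgue)"
      by (intro integral_cong_AE meas elim measurable_completion) (simp add: sec)
    then show ?case by (simp add: integral_completion sec)
  qed
  have "AE y in lborel. integrable lborel (\<lambda>x. F' (x, y))"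
    using lborel_pair.AE_integrable_snd[OF int] by simp
  then have "AE y in lborel. integrable lebesgue (\<lambda>x. F (x, y))"
    using AE
  proof eventually_elim
    case (elim y)
    then have "integrable lebesgue (\<lambda>x. F' (x, y))"
      by (simp add: integrable_completion sec)
    then show ?case
      using elim(2) meas[OF elim(2)] by (subst integrable_cong_AE[where g="\<lambda>x. F' (x, y)"])
        (auto intro: measurable_completion sec)
  qed
  then show "AE y in lebesgue. integrable lebesgue (\<lambda>x. F (x, y))"
    by (simp add: AE_completion_iff)
  have int2: "integrable lborel (\<lambda>y. \<integral>x. F' (x, y) \<partial>lborel)"
    using lborel_pair.integrable_snd[OF int] by simp
  have int3: "integrable lebesgue (\<lambda>y. \<integral>x. F' (x, y) \<partial>lborel)"
    using int2 by (simp add: integrable_completion borel_measurable_integrable)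
  have eq': "AE y in lebesgue. (\<integral>x. F' (x, y) \<partial>lborel) = (\<integral>x. F (x, y) \<partial>lebesgue)"
    using eq unfolding AE_completion_iff by eventually_elim simp
  have m: "(\<lambda>y. \<integral>x. F (x, y) \<partial>lebesgue) \<in> borel_measurable lebesgue"
    by (rule borel_measurable_AE[OF borel_measurable_integrable[OF int3] eq'])
  show "integrable lebesgue (\<lambda>y. \<integral>x. F (x, y) \<partial>lebesgue)"
    by (rule integrable_cong_AE_imp[OF int3 m eq'])
  have "(\<integral>z. F z \<partial>lebesgue) = (\<integral>z. F' z \<partial>lebesgue)"
    by (rule integral_cong_AE[OF borel_measurable_integrable[OF F] measurable_completion F'(2)]) (simp add: F')
  also have "\<dots> = (\<integral>(x, y). F' (x, y) \<partial>(lborel \<Otimes>\<^sub>M lborel))"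
    by (simp add: integral_completion F' lborel_prod)
  also have "\<dots> = (\<integral>y. (\<integral>x. F' (x, y) \<partial>lborel) \<partial>lborel)"
    using lborel_pair.integral_snd[OF int] by simp
  also have "\<dots> = (\<integral>y. (\<integral>x. F' (x, y) \<partial>lborel) \<partial>lebesgue)"
    using int2 by (simp add: integral_completion borel_measurable_integrable)
  also have "\<dots> = (\<integral>y. (\<integral>x. F (x, y) \<partial>lebesgue) \<partial>lebesgue)"
    by (intro integral_cong_AE m eq' borel_measurable_integrable int3)
  finally show "(\<integral>z. F z \<partial>lebesgue) = (\<integral>y. (\<integral>x. F (x, y) \<partial>lebesgue) \<partial>lebesgue)" .
qed

section \<open>The weighted cylinder\<close>

locale dirichlet_cylinder = dirichlet_domain \<Omega> A c lam \<phi>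
  for \<Omega> :: "(real^'n) set" and A c lam \<phi> +
  fixes s :: real
  assumes s_pos: "0 < s" and s_less: "s < 1"
begin

abbreviation "\<alpha> \<equiv> 1 - 2 * s"

definition \<nu> :: "real measure" where
  "\<nu> = density (lebesgue_on {0<..}) (\<lambda>y. ennreal (y powr \<alpha>))"

abbreviation "cyl \<equiv> cylinder \<Omega>"
abbreviation "N \<equiv> weighted \<alpha> cyl"

text \<open>Integrability at the origin is \<alpha> > -1, that is, s < 1.\<close>

lemma weight_integrable: "integrable lebesgue (\<lambda>y. indicator {0<..R} y * y powr \<alpha>)"
proof (cases "R \<ge> 0")
  case True
  have "(\<lambda>y. y powr \<alpha>) integrable_on {0<..R}"
    using True s_less by (intro integrable_on_powr_from_0') auto
  then have "(\<lambda>y. y powr \<alpha>) absolutely_integrable_on {0<..R}"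
    by (rule nonnegative_absolutely_integrable_1) simp
  then show ?thesis by (simp add: set_integrable_def)
next
  case False
  then have "{0<..R} = {}" by auto
  then show ?thesis by simp
qed

sublocale line: weighted_domain \<nu> "{0<..}" UNIV "\<lambda>y. y powr \<alpha>"
proof
  show "integrable (lebesgue_on {0<..}) (\<lambda>y. indicator K y * y powr \<alpha>)" if K: "compact K" for K :: "real set"
  proof -
    obtain R where R: "\<And>y. y \<in> K \<Longrightarrow> \<bar>y\<bar> \<le> R"
      using compact_imp_bounded[OF K] by (auto simp: bounded_iff)
    have "integrable lebesgue (\<lambda>y. indicator K y *\<^sub>R (indicator {0<..R} y * y powr \<alpha>))"
      using K by (intro integrable_mult_indicator weight_integrable) (simp add: compact_imp_closed)
    also have "(\<lambda>y. indicator K y *\<^sub>R (indicator {0<..R} y * y powr \<alpha>)) =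
        (\<lambda>y. indicator {0<..} y *\<^sub>R (indicator K y * y powr \<alpha>))"
      using R by (auto simp: fun_eq_iff indicator_def abs_le_iff)
    finally show ?thesis by (simp add: integrable_restrict_space)
  qed
qed (auto simp: \<nu>_def intro!: continuous_intros)

lemma cyl_open: "open cyl"
  unfolding cylinder_def using open_dom by (intro open_Times) auto

lemma cyl_sets: "cyl \<in> sets lebesgue"
  using cyl_open by simp

lemma mem_cyl: "z \<in> cyl \<longleftrightarrow> fst z \<in> \<Omega> \<and> 0 < snd z"
  by (cases z) (auto simp: cylinder_def)

lemma indicator_cyl: "indicator cyl z = (indicator \<Omega> (fst z) * indicator {0<..} (snd z) :: real)"
  by (auto simp: indicator_def mem_cyl)

lemma integrable_tensor_aux:
  assumes "integrable \<mu> f" and g: "integrable \<nu> g"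
  shows "integrable (lebesgue_on cyl) (\<lambda>z. snd z powr \<alpha> * (f (fst z) * g (snd z)))"
proof -
  have gm: "g \<in> borel_measurable \<nu>" using g by simp
  have "integrable lebesgue (\<lambda>x. indicator \<Omega> x * f x)"
    using assms(1) dom_sets by (simp add: integrable_restrict_space)
  moreover have "integrable lebesgue (\<lambda>y. indicator {0<..} y * (y powr \<alpha> * g y))"
    using g by (simp add: line.integrable_M_iff[OF gm] integrable_restrict_space)
  ultimately have "integrable lebesgue (\<lambda>z. (indicator \<Omega> (fst z) * f (fst z)) * (indicator {0<..} (snd z) * (snd z powr \<alpha> * g (snd z))))"
    by (rule integrable_lebesgue_prod)
  also have "(\<lambda>z. (indicator \<Omega> (fst z) * f (fst z)) * (indicator {0<..} (snd z) * (snd z powr \<alpha> * g (snd z)))) =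
      (\<lambda>z. indicator cyl z *\<^sub>R (snd z powr \<alpha> * (f (fst z) * g (snd z))))"
    by (auto simp: indicator_cyl fun_eq_iff)
  finally show ?thesis
    using cyl_sets by (simp add: integrable_restrict_space)
qed

lemma integrable_indicator_dom: "integrable \<mu> (\<lambda>x. 1 :: real)"
proof -
  have "finite_measure \<mu>" by (rule finite_measure_lebesgue_on[OF dom_lmeasurable])
  then interpret finite_measure \<mu> .
  show ?thesis by simp
qed

sublocale cylN: weighted_domain N cyl "\<Omega> \<times> UNIV" "\<lambda>z. snd z powr \<alpha>"
proof
  show "integrable (lebesgue_on cyl) (\<lambda>z. indicator K z * snd z powr \<alpha>)"
    if K: "compact K" "K \<subseteq> \<Omega> \<times> UNIV" for K
  proof -
    have KS: "K \<in> sets borel" using K by (simp add: compact_imp_closed)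
    have "compact (snd ` K)"
      using K by (intro compact_continuous_image) (auto intro!: continuous_intros)
    then have "integrable \<nu> (indicator (snd ` K) :: real \<Rightarrow> real)"
      by (rule line.integrable_indicator_compact) simp
    then have int: "integrable (lebesgue_on cyl) (\<lambda>z. snd z powr \<alpha> * (1 * indicator (snd ` K) (snd z)))"
      by (rule integrable_tensor_aux[OF integrable_indicator_dom])
    show ?thesis
    proof (rule Bochner_Integration.integrable_bound[OF int])
      have "(\<lambda>z::(real^'n) \<times> real. snd z powr \<alpha>) \<in> borel_measurable borel"
        by (intro borel_measurable_snd_lborel) measurable
      then show "(\<lambda>z. indicat_real K z * snd z powr \<alpha>) \<in> borel_measurable (lebesgue_on cyl)"
        using KS by (intro measurable_restrict_space1 measurable_completion borel_measurable_times
            borel_measurable_indicator) auto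
      show "AE z in lebesgue_on cyl. norm (indicat_real K z * snd z powr \<alpha>) \<le>
          norm (snd z powr \<alpha> * (1 * indicat_real (snd ` K) (snd z)))"
        by (intro AE_I2) (auto simp: indicator_def)
    qed
  qed
  show "continuous_on cyl (\<lambda>z. snd z powr \<alpha>)"
    by (intro continuous_intros) (auto simp: mem_cyl)
qed (auto simp: weighted_def cyl_open mem_cyl)

lemma integrable_tensor:
  fixes f :: "real^'n \<Rightarrow> real" and g :: "real \<Rightarrow> real"
  assumes f: "integrable \<mu> f" and g: "integrable \<nu> g"
    and "(\<lambda>z. f (fst z) * g (snd z)) \<in> borel_measurable N"
  shows "integrable N (\<lambda>z. f (fst z) * g (snd z))"
  using integrable_tensor_aux[OF f g] by (simp add: cylN.integrable_M_iff[OF assms(3)])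

lemma AE_fst:
  assumes "AE x in \<mu>. P x"
  shows "AE z in N. P (fst z)"
proof -
  have "AE x in lebesgue. x \<in> \<Omega> \<longrightarrow> P x"
    using assms dom_sets by (simp add: AE_restrict_space_iff)
  from AE_lebesgue_fst[OF this] have "AE z in lebesgue. z \<in> cyl \<longrightarrow> P (fst z)"
    by eventually_elim (auto simp: mem_cyl)
  then show ?thesis
    using cyl_sets by (simp add: cylN.AE_M_iff AE_restrict_space_iff)
qed

lemma measurable_fst_N:
  fixes f :: "real^'n \<Rightarrow> 'c::euclidean_space"
  assumes "f \<in> borel_measurable \<mu>"
  shows "(\<lambda>z. f (fst z)) \<in> borel_measurable N"
proof -
  have "(\<lambda>x. indicator \<Omega> x *\<^sub>R f x) \<in> borel_measurable lebesgue"
    using assms dom_sets by (simp add: borel_measurable_restrict_space_iff)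
  from lebesgue_measurable_fst[OF this, where 'b=real]
  have "(\<lambda>z::(real^'n) \<times> real. indicator \<Omega> (fst z) *\<^sub>R f (fst z)) \<in> borel_measurable N"
    unfolding cylN.measurable_M_iff by (rule measurable_restrict_space1)
  moreover have "AE z in N. indicator \<Omega> (fst z) *\<^sub>R f (fst z) = f (fst z)"
    using AE_space[of "lebesgue_on cyl"] unfolding cylN.AE_M_iff
    by eventually_elim (simp add: mem_cyl)
  ultimately show ?thesis
    by (rule cylN.measurable_AE_eq)
qed

lemma measurable_snd_N:
  "q \<in> borel_measurable borel \<Longrightarrow> (\<lambda>z. q (snd z)) \<in> borel_measurable N"
  by (intro cylN.borel_measurable_M borel_measurable_snd_lborel)

lemma Fubini_N:
  fixes F :: "(real^'n) \<times> real \<Rightarrow> real"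
  assumes F: "integrable N F"
  shows "AE y in \<nu>. integrable \<mu> (\<lambda>x. F (x, y))"
    and "integrable \<nu> (\<lambda>y. \<integral>x. F (x, y) \<partial>\<mu>)"
    and "(\<integral>z. F z \<partial>N) = (\<integral>y. (\<integral>x. F (x, y) \<partial>\<mu>) \<partial>\<nu>)"
proof -
  have Fm: "F \<in> borel_measurable N" using F by simp
  let ?F = "\<lambda>z. indicator cyl z *\<^sub>R (snd z powr \<alpha> * F z)"
  have F': "integrable lebesgue ?F"
    using F cyl_sets by (simp add: cylN.integrable_M_iff[OF Fm] integrable_restrict_space)
  note Fub = lebesgue_Fubini[OF F']
  have pos: "y powr \<alpha> \<noteq> 0" if "0 < y" for y :: real
    using that by simp
  have "AE y in lebesgue. y \<in> {0<..} \<longrightarrow> integrable \<mu> (\<lambda>x. F (x, y))"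
    using Fub(1)
  proof eventually_elim
    case (elim y)
    show ?case
    proof
      assume y: "y \<in> {0<..}"
      then have "integrable lebesgue (\<lambda>x. y powr \<alpha> * (indicator \<Omega> x *\<^sub>R F (x, y)))"
        using elim by (simp add: indicator_cyl mult_ac)
      then show "integrable \<mu> (\<lambda>x. F (x, y))"
        using pos y dom_sets by (simp add: integrable_restrict_space)
    qed
  qed
  then show "AE y in \<nu>. integrable \<mu> (\<lambda>x. F (x, y))"
    by (simp add: line.AE_M_iff AE_restrict_space_iff)
  have eq: "(\<integral>x. ?F (x, y) \<partial>lebesgue) = indicator {0<..} y *\<^sub>R (y powr \<alpha> * (\<integral>x. F (x, y) \<partial>\<mu>))" for y
  proof -
    have "(\<integral>x. ?F (x, y) \<partial>lebesgue) = (\<integral>x. (indicator {0<..} y * y powr \<alpha>) * (indicator \<Omega> x *\<^sub>R F (x, y)) \<partial>lebesgue)"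
      by (intro Bochner_Integration.integral_cong) (auto simp: indicator_cyl)
    then show ?thesis
      using dom_sets by (simp add: integral_restrict_space)
  qed
  have int: "integrable (lebesgue_on {0<..}) (\<lambda>y. y powr \<alpha> * (\<integral>x. F (x, y) \<partial>\<mu>))"
    using Fub(2) unfolding eq by (simp add: integrable_restrict_space)
  \<comment> \<open>Fubini yields measurability only of the weighted slice integral; the weight,
    positive on the half line, is divided out.\<close>
  have "(\<lambda>y. y powr \<alpha> * (\<integral>x. F (x, y) \<partial>\<mu>) / y powr \<alpha>) \<in> borel_measurable (lebesgue_on {0<..})"
    using borel_measurable_integrable[OF int] line.weight_measurable by (rule borel_measurable_divide)
  then have m: "(\<lambda>y. \<integral>x. F (x, y) \<partial>\<mu>) \<in> borel_measurable \<nu>"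
    unfolding line.measurable_M_iff
    by (rule measurable_cong[THEN iffD1, rotated]) auto
  show "integrable \<nu> (\<lambda>y. \<integral>x. F (x, y) \<partial>\<mu>)"
    using int by (simp add: line.integrable_M_iff[OF m])
  show "(\<integral>z. F z \<partial>N) = (\<integral>y. (\<integral>x. F (x, y) \<partial>\<mu>) \<partial>\<nu>)"
    using Fub(3) unfolding eq
    by (simp add: cylN.integral_M[OF Fm] line.integral_M[OF m] integral_restrict_space cyl_sets)
qed

lemma L2_tensor:
  fixes p :: "real^'n \<Rightarrow> 'c::euclidean_space"
  assumes p: "p \<in> L2 \<mu>" and r: "r \<in> L2 \<nu>" "r \<in> borel_measurable borel"
  shows "(\<lambda>z. r (snd z) *\<^sub>R p (fst z)) \<in> L2 N"
    and "L2_norm N (\<lambda>z. r (snd z) *\<^sub>R p (fst z)) = L2_norm \<nu> r * L2_norm \<mu> p"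
proof -
  have m: "(\<lambda>z. r (snd z) *\<^sub>R p (fst z)) \<in> borel_measurable N"
    by (intro borel_measurable_scaleR measurable_snd_N r measurable_fst_N L2D(1)[OF p])
  have "(\<lambda>z. (norm (p (fst z)))\<^sup>2 * (norm (r (snd z)))\<^sup>2) \<in> borel_measurable N"
    using measurable_snd_N[OF r(2)] measurable_fst_N[OF L2D(1)[OF p]] by measurable
  from integrable_tensor[OF L2D(2)[OF p] L2D(2)[OF r(1)] this]
  have int: "integrable N (\<lambda>z. (norm (p (fst z)))\<^sup>2 * (norm (r (snd z)))\<^sup>2)" .
  have eq: "(norm (r (snd z) *\<^sub>R p (fst z)))\<^sup>2 = (norm (p (fst z)))\<^sup>2 * (norm (r (snd z)))\<^sup>2" for z
    by (simp add: power_mult_distrib)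
  show "(\<lambda>z. r (snd z) *\<^sub>R p (fst z)) \<in> L2 N"
    unfolding L2_def mem_Collect_eq eq using m int by blast
  have "(\<integral>z. (norm (r (snd z) *\<^sub>R p (fst z)))\<^sup>2 \<partial>N) = (\<integral>y. (\<integral>x. (norm (p x))\<^sup>2 \<partial>\<mu>) * (norm (r y))\<^sup>2 \<partial>\<nu>)"
    unfolding eq using Fubini_N(3)[OF int] by simp
  then show "L2_norm N (\<lambda>z. r (snd z) *\<^sub>R p (fst z)) = L2_norm \<nu> r * L2_norm \<mu> p"
    by (simp add: L2_norm_def real_sqrt_mult mult.commute)
qed

end

section \<open>Tensor products and modes\<close>

lemma smooth_slice_fst:
  fixes f :: "'a::euclidean_space \<times> 'b::euclidean_space \<Rightarrow> real"
  assumes "smooth f"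
  shows "smooth (\<lambda>x. f (x, y))"
proof -
  have "bounded_linear (\<lambda>x::'a. (x, 0::'b))"
    by (intro bounded_linear_Pair bounded_linear_ident bounded_linear_zero)
  from smooth_affine[OF assms this, of "(0, y)"] show ?thesis by simp
qed

lemma gradient_cmult:
  assumes "smooth f"
  shows "gradient (\<lambda>x. r * f x) x = r *\<^sub>R gradient f x"
proof -
  have "gradient (\<lambda>x::'a. r) x = 0"
    by (simp add: gradient_def)
  then show ?thesis
    using gradient_mult[OF smooth_const assms, of r x] by simp
qed

lemma gradient_prod:
  fixes f :: "'a::euclidean_space \<times> real \<Rightarrow> real"
  assumes f: "smooth f"
  shows "gradient f (x, y) = (gradient (\<lambda>x. f (x, y)) x, frechet_derivative f (at (x, y)) (0, 1))"
proof -
  let ?D = "frechet_derivative f (at (x, y))"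
  have D: "(f has_derivative ?D) (at (x, y))"
    by (rule smooth_has_derivative[OF f])
  have "((\<lambda>x. (x, y)) has_derivative (\<lambda>h. (h, 0))) (at x)"
    by (auto intro!: derivative_eq_intros)
  from this D have "((\<lambda>x. f (x, y)) has_derivative (\<lambda>h. ?D (h, 0))) (at x)"
    by (rule has_derivative_compose)
  then have sl: "frechet_derivative (\<lambda>x. f (x, y)) (at x) = (\<lambda>h. ?D (h, 0))"
    by (metis frechet_derivative_at)
  have "gradient f (x, y) \<bullet> v = (gradient (\<lambda>x. f (x, y)) x, ?D (0, 1)) \<bullet> v" for v
  proof (cases v)
    case (Pair u t)
    have lin: "linear ?D" using D has_derivative_linear by blast
    have "?D (u, t) = ?D ((u, 0) + t *\<^sub>R (0, 1))" by simp
    also have "\<dots> = ?D (u, 0) + t * ?D (0, 1)"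
      by (simp only: linear_add[OF lin] linear_cmul[OF lin] real_scaleR_def)
    finally show ?thesis
      by (simp add: Pair gradient_inner_smooth[OF f] gradient_inner_smooth[OF smooth_slice_fst[OF f]] sl)
  qed
  then show ?thesis by (metis vector_eq_rdot)
qed

lemma test_functions_slice:
  fixes f :: "'a::euclidean_space \<times> 'b::euclidean_space \<Rightarrow> real"
  assumes "f \<in> test_functions (D \<times> UNIV)"
  shows "(\<lambda>x. f (x, y)) \<in> test_functions D"
proof -
  obtain K where K: "smooth f" "compact K" "K \<subseteq> D \<times> UNIV" "\<forall>x. x \<notin> K \<longrightarrow> f x = 0"
    using assms by (rule test_functionsE)
  show ?thesis
  proof (rule test_functionsI[OF smooth_slice_fst[OF K(1)]])
    show "compact (fst ` K)"
      using K by (intro compact_continuous_image) (auto intro!: continuous_intros)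
    show "f (x, y) = 0" if "x \<notin> fst ` K" for x
      using that K(4) by force
  qed (use K in auto)
qed

lemma test_functions_tensor:
  fixes \<theta> :: "'a::euclidean_space \<Rightarrow> real" and q :: "'b::euclidean_space \<Rightarrow> real"
  assumes "\<theta> \<in> test_functions D" and "q \<in> test_functions D'"
  shows "(\<lambda>z. \<theta> (fst z) * q (snd z)) \<in> test_functions (D \<times> D')"
proof -
  obtain K where K: "smooth \<theta>" "compact K" "K \<subseteq> D" "\<forall>x. x \<notin> K \<longrightarrow> \<theta> x = 0"
    using assms(1) by (rule test_functionsE)
  obtain K' where K': "smooth q" "compact K'" "K' \<subseteq> D'" "\<forall>x. x \<notin> K' \<longrightarrow> q x = 0"
    using assms(2) by (rule test_functionsE)
  show ?thesis
  proof (rule test_functionsI)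
    show "smooth (\<lambda>z. \<theta> (fst z) * q (snd z))"
      by (intro smooth_mult smooth_linear[OF K(1)] smooth_linear[OF K'(1)] bounded_linear_fst bounded_linear_snd)
    show "compact (K \<times> K')" by (intro compact_Times K K')
    show "\<theta> (fst z) * q (snd z) = 0" if "z \<notin> K \<times> K'" for z
      using that K(4) K'(4) by (cases z) auto
  qed (use K K' in auto)
qed

lemma frechet_derivative_tensor:
  fixes \<theta> :: "'a::euclidean_space \<Rightarrow> real" and q :: "real \<Rightarrow> real"
  assumes \<theta>: "smooth \<theta>" and q: "smooth q"
  shows "frechet_derivative (\<lambda>z. \<theta> (fst z) * q (snd z)) (at (x, y)) (0, 1) = \<theta> x * deriv q y"
proof -
  let ?f = "\<lambda>z. \<theta> (fst z) * q (snd z)"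
  have f: "smooth ?f"
    by (intro smooth_mult smooth_linear[OF \<theta>] smooth_linear[OF q] bounded_linear_fst bounded_linear_snd)
  have 1: "((\<lambda>t. \<theta> x * q (y + t)) has_real_derivative frechet_derivative ?f (at (x, y)) (0, 1)) (at 0)"
    using smooth_line_derivative[OF f, of "(x, y)" "(0, 1)" 0] by simp
  have "((\<lambda>t. q (y + t)) has_real_derivative deriv q y) (at 0)"
    using smooth_deriv(1)[OF q, of y] DERIV_shift[of q "deriv q y" 0 y] by (simp add: add.commute)
  then have "((\<lambda>t. \<theta> x * q (y + t)) has_real_derivative \<theta> x * deriv q y) (at 0)"
    by (rule DERIV_cmult)
  with 1 show ?thesis by (rule DERIV_unique)
qed

text \<open>The jet of q(y) w(x), expressed through the jet p of w. Being an operation on jets it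
  applies to test functions and to the merely weakly differentiable eigenfunctions alike.\<close>

definition tensor_jet :: "('a \<Rightarrow> real \<times> 'a) \<Rightarrow> (real \<Rightarrow> real) \<Rightarrow> 'a \<times> real \<Rightarrow> real \<times> ('a::euclidean_space \<times> real)" where
  "tensor_jet p q z = (q (snd z) * fst (p (fst z)),
     (q (snd z) *\<^sub>R snd (p (fst z)), deriv q (snd z) * fst (p (fst z))))"

lemma smooth_jet_tensor:
  assumes "smooth \<theta>" and "smooth q"
  shows "smooth_jet (\<lambda>z. \<theta> (fst z) * q (snd z)) = tensor_jet (smooth_jet \<theta>) q"
proof
  fix z :: "'a \<times> real"
  have f: "smooth (\<lambda>z::'a \<times> real. \<theta> (fst z) * q (snd z))"
    by (intro smooth_mult smooth_linear[OF assms(1)] smooth_linear[OF assms(2)] bounded_linear_fst bounded_linear_snd)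
  have g: "gradient (\<lambda>x. \<theta> (fst (x, y)) * q (snd (x, y))) x = q y *\<^sub>R gradient \<theta> x" for x y
    using gradient_cmult[OF assms(1), of "q y" x] by (simp add: mult.commute)
  show "smooth_jet (\<lambda>z. \<theta> (fst z) * q (snd z)) z = tensor_jet (smooth_jet \<theta>) q z"
  proof (cases z)
    case (Pair x y)
    show ?thesis
      unfolding Pair smooth_jet_def tensor_jet_def gradient_prod[OF f] frechet_derivative_tensor[OF assms] g
      by (simp add: mult.commute)
  qed
qed

lemma test_functions_deriv:
  fixes q :: "real \<Rightarrow> real"
  assumes "q \<in> test_functions D"
  shows "deriv q \<in> test_functions D"
proof -
  note d = smooth_deriv[OF test_functions_smooth[OF assms]]
  have "frechet_derivative q (at y) 1 = deriv q y" for y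
    using fun_cong[OF frechet_derivative_at[OF d(1)[unfolded has_field_derivative_def]], of y 1] by simp
  then show ?thesis
    using test_functions_frechet_derivative[OF assms, of 1] by simp
qed

section \<open>Tensor products and traces on the cylinder\<close>

context dirichlet_cylinder
begin

lemma line_test_L2: "q \<in> test_functions UNIV \<Longrightarrow> q \<in> L2 \<nu>"
  by (rule line.smooth_jet_L2(1))

text \<open>The factor of domination: at every point the norm of \<open>tensor_jet p q\<close> is at
  most this weight times the norm of p.\<close>

definition tensor_weight :: "(real \<Rightarrow> real) \<Rightarrow> real \<Rightarrow> real" where
  "tensor_weight q y = sqrt ((q y)\<^sup>2 + (deriv q y)\<^sup>2)"

lemma tensor_weight_L2:
  assumes "q \<in> test_functions UNIV"
  shows "tensor_weight q \<in> L2 \<nu>" "tensor_weight q \<in> borel_measurable borel"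
proof -
  note d = test_functions_deriv[OF assms]
  note m = smooth_borel_measurable[OF test_functions_smooth]
  show *: "tensor_weight q \<in> borel_measurable borel"
    unfolding tensor_weight_def[abs_def] using m[OF assms] m[OF d] by measurable
  have "(\<lambda>y. (q y, deriv q y)) \<in> L2 \<nu>"
    by (intro L2_Pair line_test_L2 assms d)
  then show "tensor_weight q \<in> L2 \<nu>"
    by (rule L2_bounded_mult[where C=1])
      (auto simp: tensor_weight_def norm_Pair line.borel_measurable_M[OF *])
qed

lemma tensor_jet_L2:
  assumes p: "p \<in> L2 \<mu>" and q: "q \<in> test_functions UNIV"
  shows "tensor_jet p q \<in> L2 N" and "L2_norm N (tensor_jet p q) \<le> L2_norm \<nu> (tensor_weight q) * L2_norm \<mu> p"
proof -
  note d = test_functions_deriv[OF q] and w = tensor_weight_L2[OF q]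
  note m = smooth_borel_measurable[OF test_functions_smooth]
  note T = L2_tensor[OF p w]
  have f: "(\<lambda>x. fst (p x)) \<in> borel_measurable \<mu>" "(\<lambda>x. snd (p x)) \<in> borel_measurable \<mu>"
    using L2D(1)[OF p]
    by (auto intro: measurable_compose[OF _ borel_measurable_continuous_onI[OF continuous_on_fst[OF continuous_on_id]]]
          measurable_compose[OF _ borel_measurable_continuous_onI[OF continuous_on_snd[OF continuous_on_id]]])
  have meas: "tensor_jet p q \<in> borel_measurable N"
    unfolding tensor_jet_def[abs_def]
    by (intro borel_measurable_Pair borel_measurable_times borel_measurable_scaleR
        measurable_snd_N m[OF q] m[OF d] measurable_fst_N f)
  have bound: "norm (tensor_jet p q z) \<le> norm (tensor_weight q (snd z) *\<^sub>R p (fst z))" for z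
  proof (rule power2_le_imp_le)
    let ?a = "q (snd z)" and ?b = "deriv q (snd z)" and ?w = "fst (p (fst z))" and ?G = "snd (p (fst z))"
    have "(norm (tensor_jet p q z))\<^sup>2 = ?a\<^sup>2 * ?w\<^sup>2 + (?a\<^sup>2 * (norm ?G)\<^sup>2 + ?b\<^sup>2 * ?w\<^sup>2)"
      by (simp add: tensor_jet_def norm_Pair power_mult_distrib)
    also have "\<dots> \<le> (?a\<^sup>2 + ?b\<^sup>2) * (?w\<^sup>2 + (norm ?G)\<^sup>2)"
      by (simp add: algebra_simps)
    also have "\<dots> = (norm (tensor_weight q (snd z) *\<^sub>R p (fst z)))\<^sup>2"
      by (simp add: tensor_weight_def power_mult_distrib norm_prod_def distrib_left)
    finally show "(norm (tensor_jet p q z))\<^sup>2 \<le> (norm (tensor_weight q (snd z) *\<^sub>R p (fst z)))\<^sup>2" .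
  qed simp
  show "tensor_jet p q \<in> L2 N"
    by (rule L2_bounded_mult[OF T(1) meas, of 1]) (use bound in auto)
  show "L2_norm N (tensor_jet p q) \<le> L2_norm \<nu> (tensor_weight q) * L2_norm \<mu> p"
    using L2_norm_mono[OF T(1) meas, of 1] bound unfolding T(2) by simp
qed

lemma tensor_jet_diff: "tensor_jet (\<lambda>x. p x - p' x) q z = tensor_jet p q z - tensor_jet p' q z"
  by (simp add: tensor_jet_def algebra_simps)

lemma tensor_jet_tendsto:
  assumes "p \<in> L2 \<mu>" "\<And>j. pj j \<in> L2 \<mu>" "(\<lambda>j. L2_norm \<mu> (\<lambda>x. pj j x - p x)) \<longlonglongrightarrow> 0"
    and q: "q \<in> test_functions UNIV"
  shows "(\<lambda>j::nat. L2_norm N (\<lambda>z. tensor_jet (pj j) q z - tensor_jet p q z)) \<longlonglongrightarrow> 0"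
proof (rule tendsto_sandwich[OF _ _ tendsto_const])
  show "(\<lambda>j. L2_norm \<nu> (tensor_weight q) * L2_norm \<mu> (\<lambda>x. pj j x - p x)) \<longlonglongrightarrow> 0"
    by (rule tendsto_mult_right_zero[OF assms(3)])
  show "\<forall>\<^sub>F j in sequentially. L2_norm N (\<lambda>z. tensor_jet (pj j) q z - tensor_jet p q z) \<le>
      L2_norm \<nu> (tensor_weight q) * L2_norm \<mu> (\<lambda>x. pj j x - p x)"
    unfolding tensor_jet_diff[symmetric] using tensor_jet_L2(2)[OF L2_diff[OF assms(2,1)] q] by simp
qed (simp add: L2_norm_nonneg)

lemma HL_eq: "HL \<alpha> \<Omega> = H1_closure N cyl (\<Omega> \<times> UNIV)"
  by (simp add: HL_def)

lemma HL_norm_eq: "HL_norm \<alpha> \<Omega> = H1_norm N cyl"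
  by (simp add: HL_norm_def)

lemma has_trace_closure:
  assumes \<psi>: "\<And>j. \<psi> j \<in> test_functions (\<Omega> \<times> UNIV)" and w: "w \<in> L2 N" "G \<in> L2 N"
    and lim: "(\<lambda>j::nat. L2_norm N (\<lambda>x. smooth_jet (\<psi> j) x - (w x, G x))) \<longlonglongrightarrow> 0"
    and v: "v \<in> L2 \<mu>" "(\<lambda>j. L2_norm \<mu> (\<lambda>x. \<psi> j (x, 0) - v x)) \<longlonglongrightarrow> 0"
  shows "has_trace \<alpha> \<Omega> w v" and "AE z in N. jet cyl w z = (w z, G z)"
proof -
  note H = cylN.H1_closureI[OF \<psi> w lim]
  show "has_trace \<alpha> \<Omega> w v"
    unfolding has_trace_def HL_eq HL_norm_eq using H(1,3) v \<psi> by blast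
  show "AE z in N. jet cyl w z = (w z, G z)"
    using H(2) by eventually_elim (simp add: jet_def)
qed

lemma has_traceE:
  assumes "has_trace \<alpha> \<Omega> w v"
  obtains \<psi> where "\<forall>j. \<psi> j \<in> test_functions (\<Omega> \<times> UNIV)"
    "(\<lambda>j::nat. L2_norm N (\<lambda>x. smooth_jet (\<psi> j) x - jet cyl w x)) \<longlonglongrightarrow> 0"
    "(\<lambda>j. L2_norm \<mu> (\<lambda>x. \<psi> j (x, 0) - v x)) \<longlonglongrightarrow> 0"
proof -
  have w: "w \<in> H1 N cyl"
    using assms unfolding has_trace_def HL_eq H1_closure_def by blast
  obtain \<psi> where \<psi>: "\<forall>j. \<psi> j \<in> test_functions (\<Omega> \<times> UNIV)"
    "(\<lambda>j::nat. H1_norm N cyl (\<lambda>x. \<psi> j x - w x)) \<longlonglongrightarrow> 0"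
    "(\<lambda>j. L2_norm \<mu> (\<lambda>x. \<psi> j (x, 0) - v x)) \<longlonglongrightarrow> 0"
    using assms unfolding has_trace_def HL_norm_eq by blast
  then have "(\<lambda>j. L2_norm N (\<lambda>x. smooth_jet (\<psi> j) x - jet cyl w x)) \<longlonglongrightarrow> 0"
    using cylN.H1_norm_eq[OF _ w] by simp
  with \<psi> that show thesis by blast
qed

lemma has_trace_L2: "has_trace \<alpha> \<Omega> w v \<Longrightarrow> jet cyl w \<in> L2 N" "has_trace \<alpha> \<Omega> w v \<Longrightarrow> v \<in> L2 \<mu>"
  using cylN.H1_jet(4)[of w] unfolding has_trace_def HL_eq H1_closure_def by blast+

text \<open>Makes eigenfunction times cut-off an admissible test function: v is approximated by test
  functions on the base and the products converge because \<open>tensor_jet\<close> is bounded in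
  its first argument.\<close>

lemma has_trace_tensor:
  assumes v: "v \<in> H10 \<Omega>" and q: "q \<in> test_functions UNIV"
  shows "has_trace \<alpha> \<Omega> (\<lambda>z. q (snd z) * v (fst z)) (\<lambda>x. q 0 * v x)"
    and "AE z in N. jet cyl (\<lambda>z. q (snd z) * v (fst z)) z = tensor_jet (jet \<Omega> v) q z"
proof -
  note H = base.H1_jet[OF H10_H1[OF v]]
  obtain \<theta> :: "nat \<Rightarrow> real^'n \<Rightarrow> real" where \<theta>': "\<forall>j. \<theta> j \<in> test_functions \<Omega>"
    and lim: "(\<lambda>j. L2_norm \<mu> (\<lambda>x. smooth_jet (\<theta> j) x - jet \<Omega> v x)) \<longlonglongrightarrow> 0"
    by (rule base.H1_closureE[OF v[unfolded H10_def]])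
  note \<theta> = \<theta>'[rule_format]
  let ?\<psi> = "\<lambda>j z. \<theta> j (fst z) * q (snd z)"
  let ?G = "\<lambda>z. (q (snd z) *\<^sub>R weak_grad \<Omega> v (fst z), deriv q (snd z) * v (fst z))"
  have tj: "tensor_jet (jet \<Omega> v) q z = (q (snd z) * v (fst z), ?G z)" for z
    by (simp add: tensor_jet_def jet_def)
  have \<psi>: "?\<psi> j \<in> test_functions (\<Omega> \<times> UNIV)" for j
    by (rule test_functions_tensor[OF \<theta> q])
  note TL = tensor_jet_L2(1)[OF H(4) q]
  have wL: "(\<lambda>z. q (snd z) * v (fst z)) \<in> L2 N"
  proof (rule L2_bounded_mult[OF TL])
    show "(\<lambda>z. q (snd z) * v (fst z)) \<in> borel_measurable N"
      by (intro borel_measurable_times measurable_snd_N smooth_borel_measurable[OF test_functions_smooth[OF q]]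
        measurable_fst_N L2D(1) H)
    show "AE z in N. norm (q (snd z) * v (fst z)) \<le> 1 * norm (tensor_jet (jet \<Omega> v) q z)"
      unfolding tj mult_1 by (intro AE_I2 norm_fst_le)
  qed
  have GL: "?G \<in> L2 N"
  proof (rule L2_bounded_mult[OF TL])
    show "?G \<in> borel_measurable N"
      by (intro borel_measurable_Pair borel_measurable_times borel_measurable_scaleR
        measurable_snd_N smooth_borel_measurable[OF test_functions_smooth[OF q]]
        smooth_borel_measurable[OF test_functions_smooth[OF test_functions_deriv[OF q]]]
        measurable_fst_N L2D(1) H)
    show "AE z in N. norm (?G z) \<le> 1 * norm (tensor_jet (jet \<Omega> v) q z)"
      unfolding tj mult_1 by (intro AE_I2 norm_snd_le)
  qed
  have l1: "(\<lambda>j. L2_norm N (\<lambda>z. smooth_jet (?\<psi> j) z - (q (snd z) * v (fst z), ?G z))) \<longlonglongrightarrow> 0"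
    using tensor_jet_tendsto[OF H(4) base.smooth_jet_L2(3)[OF \<theta>] lim q]
    unfolding tj smooth_jet_tensor[OF test_functions_smooth[OF \<theta>] test_functions_smooth[OF q]] .
  have vL: "(\<lambda>x. q 0 * v x) \<in> L2 \<mu>" by (rule L2_cmult[OF H(2)])
  have l2: "(\<lambda>j. L2_norm \<mu> (\<lambda>x. ?\<psi> j (x, 0) - q 0 * v x)) \<longlonglongrightarrow> 0"
  proof (rule L2_tendsto_mono[OF lim])
    show "(\<lambda>x. smooth_jet (\<theta> j) x - jet \<Omega> v x) \<in> L2 \<mu>" for j
      by (intro L2_diff base.smooth_jet_L2 \<theta> H)
    show "(\<lambda>x. ?\<psi> j (x, 0) - q 0 * v x) \<in> borel_measurable \<mu>" for j
      using L2D(1)[OF L2_diff[OF L2_cmult[OF base.smooth_jet_L2(1)[OF \<theta>[of j]], of "q 0"] vL]]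
      by (simp add: mult.commute)
    show "AE x in \<mu>. norm (?\<psi> j (x, 0) - q 0 * v x) \<le> \<bar>q 0\<bar> * norm (smooth_jet (\<theta> j) x - jet \<Omega> v x)" for j
    proof (rule AE_I2)
      fix x
      have "norm (?\<psi> j (x, 0) - q 0 * v x) = \<bar>q 0\<bar> * \<bar>\<theta> j x - v x\<bar>"
        by (simp add: abs_mult[symmetric] algebra_simps)
      also have "\<dots> \<le> \<bar>q 0\<bar> * norm (smooth_jet (\<theta> j) x - jet \<Omega> v x)"
        using norm_fst_le[of "\<theta> j x - v x" "gradient (\<theta> j) x - weak_grad \<Omega> v x"]
        by (intro mult_left_mono) (auto simp: smooth_jet_def jet_def)
      finally show "norm (?\<psi> j (x, 0) - q 0 * v x) \<le> \<bar>q 0\<bar> * norm (smooth_jet (\<theta> j) x - jet \<Omega> v x)" .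
    qed
  qed simp
  show "has_trace \<alpha> \<Omega> (\<lambda>z. q (snd z) * v (fst z)) (\<lambda>x. q 0 * v x)"
    by (rule has_trace_closure(1)[OF \<psi> wL GL l1 vL l2])
  show "AE z in N. jet cyl (\<lambda>z. q (snd z) * v (fst z)) z = tensor_jet (jet \<Omega> v) q z"
    using has_trace_closure(2)[OF \<psi> wL GL l1 vL l2] by (simp add: tj)
qed

definition cyl_density where
  "cyl_density z p q = diag_ext A z (snd p) \<bullet> snd q + c (fst z) * fst p * fst q"

lemma diag_ext_measurable:
  assumes p: "p \<in> borel_measurable N"
  shows "(\<lambda>z. diag_ext A z (p z)) \<in> borel_measurable N"
proof -
  have [measurable]: "(\<lambda>z. A (fst z)) \<in> borel_measurable N"
    by (rule measurable_fst_N[OF continuous_imp_measurable_on_sets_lebesgue[OF A_continuous dom_sets]])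
  have f: "(\<lambda>z. fst (p z)) \<in> borel_measurable N" "(\<lambda>z. snd (p z)) \<in> borel_measurable N"
    using p
    by (auto intro: measurable_compose[OF _ borel_measurable_continuous_onI[OF continuous_on_fst[OF continuous_on_id]]]
          measurable_compose[OF _ borel_measurable_continuous_onI[OF continuous_on_snd[OF continuous_on_id]]])
  show ?thesis
    unfolding diag_ext_def by (intro borel_measurable_Pair matrix_vector_mult_measurable f) simp
qed

lemma AE_cyl: "AE z in N. fst z \<in> \<Omega> \<and> 0 < snd z"
  unfolding cylN.AE_M_iff using AE_space[of "lebesgue_on cyl"] by eventually_elim (simp add: mem_cyl)

lemma cyl_c_bounds: obtains B where "B \<ge> 0" "AE z in N. 0 \<le> c (fst z) \<and> c (fst z) \<le> B"
proof -
  obtain B where "B \<ge> 0" "AE x in \<mu>. 0 \<le> c x \<and> c x \<le> B"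
    by (rule c_bounds)
  then show thesis
    by (intro that[of B] AE_fst)
qed

lemma cyl_inner_form: "\<exists>C. L2_inner_form N cyl_density C"
proof -
  obtain B1 where B1: "B1 \<ge> 0" "\<And>x u. x \<in> \<Omega> \<Longrightarrow> norm (A x *v u) \<le> B1 * norm u"
    using A_bounded by blast
  obtain B2 where B2: "B2 \<ge> 0" "AE z in N. 0 \<le> c (fst z) \<and> c (fst z) \<le> B2"
    by (rule cyl_c_bounds)
  obtain a where a: "a > 0" "\<And>x u. x \<in> \<Omega> \<Longrightarrow> a * (norm u)\<^sup>2 \<le> (A x *v u) \<bullet> u"
    using A_elliptic by blast
  have "L2_inner_form N (\<lambda>x p q. diag_ext A x (snd p) \<bullet> snd q + c (fst x) * fst p * fst q) ((B1 + 1) + B2)"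
  proof (rule energy_form)
    show "linear (diag_ext A z)" for z
      by (auto simp: linear_iff diag_ext_def matrix_vector_right_distrib matrix_vector_mult_scaleR)
    show "(\<lambda>z. c (fst z)) \<in> borel_measurable N"
      by (rule measurable_fst_N[OF c_measurable])
    show "AE z in N. \<forall>u. norm (diag_ext A z u) \<le> (B1 + 1) * norm u"
      using AE_cyl
    proof eventually_elim
      case (elim z)
      show ?case
      proof
        fix u :: "(real^'n) \<times> real"
        have "norm (diag_ext A z u) \<le> norm (A (fst z) *v fst u) + norm (snd u)"
          unfolding diag_ext_def by (rule norm_Pair_le)
        also have "\<dots> \<le> B1 * norm u + norm u"
          using B1(2)[of "fst z" "fst u"] elim norm_fst_le[of "fst u" "snd u"] norm_snd_le[of "snd u" "fst u"]
            mult_left_mono[of "norm (fst u)" "norm u" B1] B1(1) by auto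
        finally show "norm (diag_ext A z u) \<le> (B1 + 1) * norm u" by (simp add: algebra_simps)
      qed
    qed
    show "AE z in N. \<forall>u v. diag_ext A z u \<bullet> v = diag_ext A z v \<bullet> u"
      using AE_cyl by eventually_elim (auto simp: diag_ext_def inner_prod_def A_symmetric)
    show "AE z in N. \<forall>u. 0 \<le> diag_ext A z u \<bullet> u"
      using AE_cyl
    proof eventually_elim
      case (elim z)
      show ?case
      proof
        fix u :: "(real^'n) \<times> real"
        have "0 \<le> (A (fst z) *v fst u) \<bullet> fst u"
          using order_trans[OF _ a(2)[of "fst z" "fst u"]] a(1) elim by simp
        then show "0 \<le> diag_ext A z u \<bullet> u"
          by (simp add: diag_ext_def inner_prod_def)
      qed
    qed
  qed (use B1 B2 diag_ext_measurable in auto)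
  then show ?thesis
    unfolding cyl_density_def[abs_def] by blast
qed

definition "cyl_const = (SOME C. L2_inner_form N cyl_density C)"

sublocale cf: L2_inner_form N cyl_density cyl_const
  unfolding cyl_const_def by (rule someI_ex[OF cyl_inner_form])

lemma a_form_eq: "a_form \<Omega> A c s w v = 1 / d_const s * cf.form (jet cyl w) (jet cyl v)"
  by (simp add: a_form_def cf.form_def cyl_density_def jet_def)

section \<open>Fourier modes over the cross sections\<close>

definition mode :: "nat \<Rightarrow> ((real^'n) \<times> real \<Rightarrow> real) \<Rightarrow> real \<Rightarrow> real" where
  "mode k \<psi> y = L2_inner \<mu> (\<lambda>x. \<psi> (x, y)) (\<phi> k)"

abbreviation dy :: "((real^'n) \<times> real \<Rightarrow> real) \<Rightarrow> (real^'n) \<times> real \<Rightarrow> real" where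
  "dy \<psi> z \<equiv> frechet_derivative \<psi> (at z) (0, 1)"

lemma slice_L2: "\<psi> \<in> test_functions (\<Omega> \<times> UNIV) \<Longrightarrow> (\<lambda>x. \<psi> (x, y)) \<in> L2 \<mu>"
  by (rule base.smooth_jet_L2(1)[OF test_functions_slice])

lemma phi_integrable: "integrable \<mu> (\<lambda>x. \<bar>\<phi> k x\<bar>)"
proof -
  have "(\<lambda>x. 1 :: real) \<in> L2 \<mu>"
    using integrable_indicator_dom by (simp add: L2_def)
  from L2_prod_integrable[OF basis.phi_L2[of k] this] show ?thesis by simp
qed

text \<open>Differentiation under the integral. The difference quotients are bounded by a Lipschitz
  constant of \<psi> in y times the eigenfunction, which is integrable because the base has finite
  measure.\<close>

lemma mode_has_derivative:
  assumes \<psi>: "\<psi> \<in> test_functions (\<Omega> \<times> UNIV)"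
  shows "(mode k \<psi> has_real_derivative mode k (dy \<psi>) y) (at y)"
proof -
  note s\<psi> = test_functions_smooth[OF \<psi>] and d\<psi> = test_functions_frechet_derivative[OF \<psi>, of "(0, 1)"]
  obtain B where B: "\<And>z. \<bar>dy \<psi> z\<bar> \<le> B" "0 \<le> B"
    using test_functions_bounded[OF d\<psi>] by metis
  have line: "((\<lambda>t. \<psi> (x, t)) has_real_derivative dy \<psi> (x, t)) (at t)" for x t
    using smooth_line_derivative[OF s\<psi>, of "(x, 0)" "(0, 1)" t] by simp
  have lip: "\<bar>\<psi> (x, y + h) - \<psi> (x, y)\<bar> \<le> B * \<bar>h\<bar>" for x h
    using field_differentiable_bound[of UNIV "\<lambda>t. \<psi> (x, t)" "\<lambda>t. dy \<psi> (x, t)" B "y + h" y] line B by simp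
  note m = L2D(1)[OF slice_L2[OF \<psi>]] L2D(1)[OF slice_L2[OF d\<psi>]] L2D(1)[OF basis.phi_L2]
  have "((\<lambda>h. (mode k \<psi> (y + h) - mode k \<psi> y) / h) \<longlongrightarrow> mode k (dy \<psi>) y) (at 0)"
    unfolding tendsto_at_iff_sequentially
  proof (intro allI impI)
    fix X :: "nat \<Rightarrow> real" assume X: "\<forall>i. X i \<in> UNIV - {0}" "X \<longlonglongrightarrow> 0"
    let ?Q = "\<lambda>i x. (\<psi> (x, y + X i) - \<psi> (x, y)) / X i * \<phi> k x"
    have Q: "(mode k \<psi> (y + X i) - mode k \<psi> y) / X i = (\<integral>x. ?Q i x \<partial>\<mu>)" for i
    proof -
      have "mode k \<psi> (y + X i) - mode k \<psi> y = L2_inner \<mu> (\<lambda>x. \<psi> (x, y + X i) - \<psi> (x, y)) (\<phi> k)"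
        by (simp add: mode_def L2_inner_diff slice_L2[OF \<psi>] basis.phi_L2)
      then show ?thesis by (simp add: L2_inner_def)
    qed
    have "(\<lambda>i. \<integral>x. ?Q i x \<partial>\<mu>) \<longlonglongrightarrow> (\<integral>x. dy \<psi> (x, y) * \<phi> k x \<partial>\<mu>)"
    proof (rule integral_dominated_convergence[where w="\<lambda>x. B * \<bar>\<phi> k x\<bar>"])
      show "AE x in \<mu>. (\<lambda>i. ?Q i x) \<longlonglongrightarrow> dy \<psi> (x, y) * \<phi> k x"
      proof (intro AE_I2 tendsto_mult tendsto_const)
        fix x
        have "((\<lambda>h. (\<psi> (x, y + h) - \<psi> (x, y)) / h) \<longlongrightarrow> dy \<psi> (x, y)) (at 0)"
          using line[of x y] by (simp add: DERIV_def)
        then show "(\<lambda>i. (\<psi> (x, y + X i) - \<psi> (x, y)) / X i) \<longlonglongrightarrow> dy \<psi> (x, y)"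
          using X unfolding tendsto_at_iff_sequentially comp_def by blast
      qed
      show "AE x in \<mu>. norm (?Q i x) \<le> B * \<bar>\<phi> k x\<bar>" for i
      proof (rule AE_I2)
        fix x
        have "\<bar>X i\<bar> > 0" using X by auto
        then have "\<bar>\<psi> (x, y + X i) - \<psi> (x, y)\<bar> / \<bar>X i\<bar> \<le> B"
          using lip[of x "X i"] by (simp add: divide_le_eq)
        then have "\<bar>\<psi> (x, y + X i) - \<psi> (x, y)\<bar> / \<bar>X i\<bar> * \<bar>\<phi> k x\<bar> \<le> B * \<bar>\<phi> k x\<bar>"
          by (rule mult_right_mono) simp
        then show "norm (?Q i x) \<le> B * \<bar>\<phi> k x\<bar>"
          by (simp add: abs_mult)
      qed
    qed (use m phi_integrable in \<open>auto\<close>)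
    then show "((\<lambda>h. (mode k \<psi> (y + h) - mode k \<psi> y) / h) \<circ> X) \<longlonglongrightarrow> mode k (dy \<psi>) y"
      unfolding comp_def Q by (simp add: mode_def L2_inner_def)
  qed
  then show ?thesis by (simp add: DERIV_def)
qed

text \<open>The derivative of a mode is the mode of \<open>dy \<psi>\<close>, again a test function,
  so the induction on the order of differentiability closes.\<close>

lemma mode_test:
  assumes \<psi>: "\<psi> \<in> test_functions (\<Omega> \<times> UNIV)"
  shows "mode k \<psi> \<in> test_functions UNIV" and "deriv (mode k \<psi>) y = mode k (dy \<psi>) y"
proof -
  have C: "C_k n (mode k \<psi>)" if "\<psi> \<in> test_functions (\<Omega> \<times> UNIV)" for n \<psi>
    using that
  proof (induction n arbitrary: \<psi>)
    case 0
    then show ?case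
      using mode_has_derivative by (auto intro!: continuous_at_imp_continuous_on DERIV_isCont)
  next
    case (Suc n)
    then show ?case
      by (intro C_k_real_SucI[OF mode_has_derivative[OF Suc.prems]] Suc.IH test_functions_frechet_derivative)
  qed
  obtain K where K: "smooth \<psi>" "compact K" "K \<subseteq> \<Omega> \<times> UNIV" "\<forall>x. x \<notin> K \<longrightarrow> \<psi> x = 0"
    using \<psi> by (rule test_functionsE)
  show "mode k \<psi> \<in> test_functions UNIV"
  proof (rule test_functionsI)
    show "smooth (mode k \<psi>)" using C[OF \<psi>] by (simp add: smooth_def)
    show "compact (snd ` K)"
      using K by (intro compact_continuous_image) (auto intro!: continuous_intros)
    show "mode k \<psi> y = 0" if "y \<notin> snd ` K" for y
    proof -
      have "\<psi> (x, y) = 0" for x using that K(4) by force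
      then show ?thesis by (simp add: mode_def L2_inner_def)
    qed
  qed simp
  show "deriv (mode k \<psi>) y = mode k (dy \<psi>) y"
    by (rule DERIV_imp_deriv[OF mode_has_derivative[OF \<psi>]])
qed

text \<open>The energy form of the ordinary differential operator -(y^\<alpha> p')' + lam k
  y^\<alpha> p on the half line, to which the cylinder form reduces on the k-th mode.\<close>

definition line_form :: "nat \<Rightarrow> (real \<Rightarrow> real) \<Rightarrow> (real \<Rightarrow> real) \<Rightarrow> real" where
  "line_form k p q = (\<integral>y. deriv p y * deriv q y + lam k * (p y * q y) \<partial>\<nu>)"

abbreviation mode_jet :: "nat \<Rightarrow> (real \<Rightarrow> real) \<Rightarrow> (real^'n) \<times> real \<Rightarrow> real \<times> ((real^'n) \<times> real)" where
  "mode_jet k q \<equiv> tensor_jet (jet \<Omega> (\<phi> k)) q"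

lemma mode_jet_L2: "q \<in> test_functions UNIV \<Longrightarrow> mode_jet k q \<in> L2 N"
  by (rule tensor_jet_L2(1)[OF base.H1_jet(4)[OF H10_H1[OF phi_H10]]])

text \<open>On each horizontal slice the weak eigenvalue equation, tested with the slice of \<psi>,
  replaces the terms in A and c by lam k times the mode; the vertical derivative passes to the mode.
  Fubini's theorem then integrates over the heights.\<close>

lemma form_test_mode:
  assumes \<psi>: "\<psi> \<in> test_functions (\<Omega> \<times> UNIV)" and q: "q \<in> test_functions UNIV"
  shows "cf.form (smooth_jet \<psi>) (mode_jet k q) = line_form k (mode k \<psi>) q"
proof -
  note H = base.H1_jet[OF H10_H1[OF phi_H10[of k]]]
  note d\<psi> = test_functions_frechet_derivative[OF \<psi>, of "(0, 1)"]
  let ?F = "\<lambda>z. cyl_density z (smooth_jet \<psi> z) (mode_jet k q z)"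
  have int: "integrable N ?F"
    by (rule cf.integrable_form[OF cylN.smooth_jet_L2(3)[OF \<psi>] mode_jet_L2[OF q]])
  have inner: "(\<integral>x. ?F (x, y) \<partial>\<mu>) = deriv (mode k \<psi>) y * deriv q y + lam k * (mode k \<psi> y * q y)" for y
  proof -
    let ?v = "\<lambda>x. \<psi> (x, y)"
    have v: "?v \<in> test_functions \<Omega>" by (rule test_functions_slice[OF \<psi>])
    note vL = base.smooth_jet_L2[OF v]
    have eq: "?F (x, y) = q y * base_density x (smooth_jet ?v x) (jet \<Omega> (\<phi> k) x) + deriv q y * (dy \<psi> (x, y) * \<phi> k x)" for x
      by (simp add: cyl_density_def base_density_def smooth_jet_def jet_def tensor_jet_def
          gradient_prod[OF test_functions_smooth[OF \<psi>]] diag_ext_def algebra_simps)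
    have "(\<integral>x. ?F (x, y) \<partial>\<mu>) = q y * bf.form (smooth_jet ?v) (jet \<Omega> (\<phi> k)) + deriv q y * mode k (dy \<psi>) y"
      unfolding eq bf.form_def mode_def L2_inner_def
      using bf.integrable_form[OF vL(3) H(4)] L2_inner_integrable[OF slice_L2[OF d\<psi>] H(2), of y] by simp
    moreover have "bf.form (smooth_jet ?v) (jet \<Omega> (\<phi> k)) = lam k * mode k \<psi> y"
      using bf.form_sym[OF vL(3) H(4)] phi_eigen_test[OF v, of k] by (simp add: mode_def L2_inner_commute)
    ultimately show ?thesis
      by (simp add: mode_test(2)[OF \<psi>])
  qed
  show ?thesis
    using Fubini_N(3)[OF int] unfolding inner by (simp add: cf.form_def line_form_def)
qed

end

section \<open>Modes of solutions\<close>

lemma power_weight_integrable: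
  fixes g :: "real \<Rightarrow> real"
  assumes "\<beta> > -1" and g: "g \<in> borel_measurable borel" "\<And>y. \<bar>g y\<bar> \<le> B" "\<And>y. y > R \<Longrightarrow> g y = 0"
  shows "integrable lborel (\<lambda>y. indicator {0<..} y * y powr \<beta> * g y)"
proof -
  have "(\<lambda>y. y powr \<beta>) integrable_on {0<..max R 0}"
    using assms(1) by (intro integrable_on_powr_from_0') auto
  then have "(\<lambda>y. y powr \<beta>) absolutely_integrable_on {0<..max R 0}"
    by (rule nonnegative_absolutely_integrable_1) simp
  then have "integrable lborel (\<lambda>y. indicator {0<..max R 0} y * y powr \<beta>)"
    by (simp add: set_integrable_def integrable_completion)
  then have int: "integrable lborel (\<lambda>y. B * (indicator {0<..max R 0} y * y powr \<beta>))"
    by (rule integrable_mult_right)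
  show ?thesis
  proof (rule Bochner_Integration.integrable_bound[OF int])
    show "(\<lambda>y. indicator {0<..} y * y powr \<beta> * g y) \<in> borel_measurable lborel"
      using g(1) by measurable
    show "AE y in lborel. norm (indicator {0<..} y * y powr \<beta> * g y) \<le> norm (B * (indicator {0<..max R 0} y * y powr \<beta>))"
    proof (rule AE_I2)
      fix y
      show "norm (indicator {0<..} y * y powr \<beta> * g y) \<le> norm (B * (indicator {0<..max R 0} y * y powr \<beta>))"
      proof (cases "0 < y \<and> y \<le> R")
        case True
        have "\<bar>g y\<bar> \<le> \<bar>B\<bar>" using g(2)[of y] by linarith
        with True show ?thesis by (simp add: abs_mult mult.commute mult_right_mono)
      next
        case False
        then have "indicator {0<..} y * y powr \<beta> * g y = 0"
          using g(3)[of y] by (auto simp: indicator_def)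
        then show ?thesis by (simp only: norm_zero norm_ge_zero)
      qed
    qed
  qed
qed

lemma power_weight_scaling:
  fixes g :: "real \<Rightarrow> real"
  assumes "\<kappa> > 0"
  shows "(\<integral>y. indicator {0<..} y * y powr \<beta> * g (\<kappa> * y) \<partial>lborel) =
    \<kappa> powr (- (\<beta> + 1)) * (\<integral>y. indicator {0<..} y * y powr \<beta> * g y \<partial>lborel)"
proof -
  have "(\<integral>y. indicator {0<..} y * y powr \<beta> * g y \<partial>lborel) =
      \<kappa> * (\<integral>y. indicator {0<..} (\<kappa> * y) * (\<kappa> * y) powr \<beta> * g (\<kappa> * y) \<partial>lborel)"
    using lborel_integral_real_affine[of \<kappa> "\<lambda>y. indicator {0<..} y * y powr \<beta> * g y" 0] assms by simp
  also have "(\<lambda>y. indicator {0<..} (\<kappa> * y) * (\<kappa> * y) powr \<beta> * g (\<kappa> * y)) =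
      (\<lambda>y. \<kappa> powr \<beta> * (indicator {0<..} y * y powr \<beta> * g (\<kappa> * y)))"
  proof
    fix y show "indicator {0<..} (\<kappa> * y) * (\<kappa> * y) powr \<beta> * g (\<kappa> * y) =
      \<kappa> powr \<beta> * (indicator {0<..} y * y powr \<beta> * g (\<kappa> * y))"
      using assms by (cases "0 < y") (auto simp: powr_mult zero_less_mult_iff)
  qed
  finally have "(\<integral>y. indicator {0<..} y * y powr \<beta> * g y \<partial>lborel) =
      \<kappa> powr (\<beta> + 1) * (\<integral>y. indicator {0<..} y * y powr \<beta> * g (\<kappa> * y) \<partial>lborel)"
    using assms by (simp add: powr_add)
  moreover have "\<kappa> powr (- (\<beta> + 1)) * \<kappa> powr (\<beta> + 1) = 1"
    using assms by (simp only: powr_add[symmetric]) simp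
  ultimately show ?thesis
    by (simp only: mult.assoc[symmetric] mult_1)
qed

text \<open>Equal to 1 on [-1, 1] and to 0 outside (-2, 2).\<close>

definition bump :: "real \<Rightarrow> real" where
  "bump y = smooth_step (y + 2) * smooth_step (- y + 2)"

lemma smooth_bump: "smooth bump"
proof -
  have "smooth (\<lambda>y. smooth_step (y + 2))"
    by (rule smooth_affine[OF smooth_smooth_step bounded_linear_ident])
  moreover have "smooth (\<lambda>y. smooth_step ((- y) + 2))"
    by (rule smooth_affine[OF smooth_smooth_step]) (simp add: bounded_linear_minus bounded_linear_ident)
  ultimately show ?thesis
    unfolding bump_def[abs_def] by (intro smooth_mult) simp_all
qed

lemma bump_scaled_test:
  assumes "\<kappa> > 0"
  shows "(\<lambda>y. bump (\<kappa> * y)) \<in> test_functions UNIV" and "deriv (\<lambda>y. bump (\<kappa> * y)) y = \<kappa> * deriv bump (\<kappa> * y)"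
proof -
  have s: "smooth (\<lambda>y. bump (\<kappa> * y))"
    by (rule smooth_linear[OF smooth_bump bounded_linear_mult_right])
  show "(\<lambda>y. bump (\<kappa> * y)) \<in> test_functions UNIV"
  proof (rule test_functionsI[OF s compact_Icc])
    fix y assume "y \<notin> {- 2 / \<kappa>..2 / \<kappa>}"
    then have "\<kappa> * y + 2 \<le> 0 \<or> - (\<kappa> * y) + 2 \<le> 0"
      using assms by (auto simp: field_simps not_le)
    then show "bump (\<kappa> * y) = 0"
      by (auto simp: bump_def smooth_step_eq_0)
  qed simp
  have "((\<lambda>y. bump (\<kappa> * y)) has_real_derivative deriv bump (\<kappa> * y) * \<kappa>) (at y)"
    by (rule DERIV_chain2[OF smooth_deriv(1)[OF smooth_bump]]) (auto intro!: derivative_eq_intros)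
  then show "deriv (\<lambda>y. bump (\<kappa> * y)) y = \<kappa> * deriv bump (\<kappa> * y)"
    by (simp add: DERIV_imp_deriv mult.commute)
qed

lemma bump_test: "bump \<in> test_functions UNIV"
  using bump_scaled_test(1)[of 1] by simp

lemma bump_0: "bump 0 = 1"
  by (simp add: bump_def smooth_step_eq_1)

lemma bump_eq_0: "y \<ge> 2 \<Longrightarrow> bump y = 0"
  by (simp add: bump_def smooth_step_eq_0)

context L2_inner_form
begin

lemma form_projection_le:
  assumes "p \<in> L2 M" "q \<in> L2 M" and "form p q = form q q"
  shows "form q q \<le> form p p"
proof -
  have "(form q q)\<^sup>2 \<le> form p p * form q q"
    using form_Cauchy_Schwarz[OF assms(1,2)] assms(3) by simp
  then show ?thesis
    using form_nonneg[of q] form_nonneg[of p] by (cases "form q q = 0") (auto simp: power2_eq_square)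
qed

text \<open>Only \<open>pj\<close> converges; of \<open>qj\<close> nothing but a bound on its energy
  is asked, and Cauchy-Schwarz in the form suffices. This permits testing with modes of an
  approximating sequence, whose limit is never formed.\<close>

lemma form_diff_tendsto_0:
  assumes p: "p \<in> L2 M" "\<And>j. pj j \<in> L2 M" "(\<lambda>j. L2_norm M (\<lambda>x. pj j x - p x)) \<longlonglongrightarrow> 0"
    and q: "\<And>j. qj j \<in> L2 M" "\<And>j. form (qj j) (qj j) \<le> e j" "e \<longlonglongrightarrow> l"
  shows "(\<lambda>j::nat. form (pj j) (qj j) - form p (qj j)) \<longlonglongrightarrow> 0"
proof -
  let ?d = "\<lambda>j x. pj j x - p x"
  have d: "?d j \<in> L2 M" for j by (intro L2_diff p)
  have eq: "form (pj j) (qj j) - form p (qj j) = form (?d j) (qj j)" for j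
    by (simp add: form_diff_left p q)
  have "(\<lambda>j. (form (?d j) (qj j))\<^sup>2) \<longlonglongrightarrow> 0"
  proof (rule tendsto_sandwich[OF _ _ tendsto_const])
    have "(form (?d j) (qj j))\<^sup>2 \<le> (C * (L2_norm M (?d j) * L2_norm M (?d j))) * e j" for j
    proof -
      have "(form (?d j) (qj j))\<^sup>2 \<le> form (?d j) (?d j) * form (qj j) (qj j)"
        by (rule form_Cauchy_Schwarz[OF d q(1)])
      also have "\<dots> \<le> (C * (L2_norm M (?d j) * L2_norm M (?d j))) * e j"
        using form_bound[OF d d, of j j] form_nonneg[of "?d j"] form_nonneg[of "qj j"] q(2)[of j]
        by (intro mult_mono) auto
      finally show ?thesis .
    qed
    then show "\<forall>\<^sub>F j in sequentially. (form (?d j) (qj j))\<^sup>2 \<le> (C * (L2_norm M (?d j) * L2_norm M (?d j))) * e j"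
      by simp
    have "(\<lambda>j. (C * (L2_norm M (?d j) * L2_norm M (?d j))) * e j) \<longlonglongrightarrow> (C * (0 * 0)) * l"
      by (intro tendsto_intros p q)
    then show "(\<lambda>j. (C * (L2_norm M (?d j) * L2_norm M (?d j))) * e j) \<longlonglongrightarrow> 0"
      by simp
  qed simp
  then have "(\<lambda>j. sqrt ((form (?d j) (qj j))\<^sup>2)) \<longlonglongrightarrow> sqrt 0"
    by (rule tendsto_real_sqrt)
  then show ?thesis
    unfolding eq by (simp add: tendsto_rabs_zero_iff)
qed

end

section \<open>The energy of a single mode on the half line\<close>

context dirichlet_cylinder
begin

lemma integral_line:
  assumes "h \<in> borel_measurable borel"
  shows "(\<integral>y. h y \<partial>\<nu>) = (\<integral>y. indicator {0<..} y * y powr \<alpha> * h y \<partial>lborel)"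
    and "integrable \<nu> h \<longleftrightarrow> integrable lborel (\<lambda>y. indicator {0<..} y * y powr \<alpha> * h y)"
proof -
  have m: "h \<in> borel_measurable \<nu>" by (rule line.borel_measurable_M[OF assms])
  have b: "(\<lambda>y. indicator {0<..} y * (y powr \<alpha> * h y)) \<in> borel_measurable borel"
    using assms by measurable
  show "(\<integral>y. h y \<partial>\<nu>) = (\<integral>y. indicator {0<..} y * y powr \<alpha> * h y \<partial>lborel)"
    using b by (simp add: line.integral_M[OF m] integral_restrict_space integral_completion mult.assoc)
  show "integrable \<nu> h \<longleftrightarrow> integrable lborel (\<lambda>y. indicator {0<..} y * y powr \<alpha> * h y)"
    using b by (simp add: line.integrable_M_iff[OF m] integrable_restrict_space integrable_completion mult.assoc)
qed

lemma line_form_eq: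
  assumes "p \<in> test_functions UNIV" "q \<in> test_functions UNIV"
  shows "line_form k p q = L2_inner \<nu> (deriv p) (deriv q) + lam k * L2_inner \<nu> p q"
  unfolding line_form_def L2_inner_def
  using L2_inner_integrable[OF line_test_L2[OF test_functions_deriv[OF assms(1)]] line_test_L2[OF test_functions_deriv[OF assms(2)]]]
    L2_inner_integrable[OF line_test_L2[OF assms(1)] line_test_L2[OF assms(2)]]
  by simp

lemma line_form_commute: "line_form k p q = line_form k q p"
  by (simp add: line_form_def mult.commute)

lemma line_form_cmult:
  assumes "smooth p"
  shows "line_form k (\<lambda>y. r * p y) q = r * line_form k p q"
proof -
  have "deriv (\<lambda>y. r * p y) y = r * deriv p y" for y
    by (rule DERIV_imp_deriv[OF DERIV_cmult[OF smooth_deriv(1)[OF assms]]])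
  then have "deriv (\<lambda>y. r * p y) y * deriv q y + lam k * (r * p y * q y) =
      r * (deriv p y * deriv q y + lam k * (p y * q y))" for y
    by (simp add: algebra_simps)
  then show ?thesis by (simp add: line_form_def)
qed

lemma sqrt_lam: "sqrt (lam k) > 0" "(sqrt (lam k))\<^sup>2 = lam k" "sqrt (lam k) powr (2 * r) = lam k powr r"
proof -
  have *: "0 < lam k" by (rule lam_pos)
  then show "sqrt (lam k) > 0" "(sqrt (lam k))\<^sup>2 = lam k" by simp_all
  from * show "sqrt (lam k) powr (2 * r) = lam k powr r"
    by (simp add: powr_half_sqrt[symmetric] powr_powr)
qed

text \<open>Testing with a cut-off at the natural length scale \<open>lam k powr (-1/2)\<close> of the mode.\<close>

lemma scaled_bump_energy:
  "\<exists>C0>0. \<forall>k. line_form k (\<lambda>y. bump (sqrt (lam k) * y)) (\<lambda>y. bump (sqrt (lam k) * y)) \<le> C0 * lam k powr s"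
proof -
  let ?g = "\<lambda>y. (deriv bump y)\<^sup>2 + (bump y)\<^sup>2"
  define C where "C = (\<integral>y. indicator {0<..} y * y powr \<alpha> * ?g y \<partial>lborel)"
  note m = smooth_borel_measurable[OF smooth_bump] smooth_borel_measurable[OF smooth_deriv(2)[OF smooth_bump]]
  have "line_form k (\<lambda>y. bump (sqrt (lam k) * y)) (\<lambda>y. bump (sqrt (lam k) * y)) = lam k powr s * C" for k
  proof -
    let ?\<kappa> = "sqrt (lam k)"
    have expand: "\<kappa> * a * (\<kappa> * a) + l * (b * b) = \<kappa>\<^sup>2 * (a\<^sup>2 + b\<^sup>2)" if "\<kappa>\<^sup>2 = l" for \<kappa> a b l :: real
      unfolding that[symmetric] by (simp add: power2_eq_square algebra_simps)
    have "line_form k (\<lambda>y. bump (?\<kappa> * y)) (\<lambda>y. bump (?\<kappa> * y)) = (\<integral>y. ?\<kappa>\<^sup>2 * ?g (?\<kappa> * y) \<partial>\<nu>)"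
      unfolding line_form_def bump_scaled_test(2)[OF sqrt_lam(1)]
      by (intro Bochner_Integration.integral_cong refl expand sqrt_lam(2))
    also have "\<dots> = lam k * (\<integral>y. ?g (?\<kappa> * y) \<partial>\<nu>)"
      by (simp add: lam_pos less_imp_le)
    also have "(\<integral>y. ?g (?\<kappa> * y) \<partial>\<nu>) = (\<integral>y. indicator {0<..} y * y powr \<alpha> * ?g (?\<kappa> * y) \<partial>lborel)"
      by (rule integral_line(1)) (use m in measurable)
    also have "\<dots> = ?\<kappa> powr (- (\<alpha> + 1)) * C"
      unfolding C_def by (rule power_weight_scaling[OF sqrt_lam(1)])
    \<comment> \<open>Since \<alpha> + 1 = 2 (1 - s) and the scale is the root of lam k, the
      substitution contributes lam k to the power s - 1; the factor lam k in front raises it to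
      s.\<close>
    also have "?\<kappa> powr (- (\<alpha> + 1)) = lam k powr (s - 1)"
      using sqrt_lam(3)[of k "s - 1"] by (simp add: algebra_simps)
    also have "lam k * (lam k powr (s - 1) * C) = lam k powr s * C"
      using lam_pos[of k] by (simp add: powr_diff)
    finally show ?thesis .
  qed
  \<comment> \<open>Passing to \<open>\<bar>C\<bar> + 1\<close> gives a positive constant without
    evaluating the integral.\<close>
  moreover have "lam k powr s * C \<le> (\<bar>C\<bar> + 1) * lam k powr s" for k
    using mult_right_mono[of C "\<bar>C\<bar> + 1" "lam k powr s"] by (simp add: mult.commute)
  ultimately have "\<forall>k. line_form k (\<lambda>y. bump (sqrt (lam k) * y)) (\<lambda>y. bump (sqrt (lam k) * y)) \<le> (\<bar>C\<bar> + 1) * lam k powr s"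
    by simp
  then show ?thesis
    by (intro exI[of _ "\<bar>C\<bar> + 1"] conjI) (linarith, assumption)
qed

text \<open>With a cut-off q at the scale of the mode, -p(0) is the integral of (p q)'.
  Cauchy-Schwarz splits the weight as y^\<alpha> on p and p' and y^(-\<alpha>) on the cut-off; the
  latter is integrable at 0 because s > 0, and scaling produces the power of lam k.\<close>

lemma line_trace_inequality:
  "\<exists>C1>0. \<forall>k p. p \<in> test_functions UNIV \<longrightarrow> lam k powr s * (p 0)\<^sup>2 \<le> C1 * line_form k p p"
proof -
  let ?I = "\<lambda>g :: real \<Rightarrow> real. \<integral>y. indicator {0<..} y * y powr (- \<alpha>) * g y \<partial>lborel"
  \<comment> \<open>The bump vanishes from 2 on, so truncating at 3 does not change it; the
    truncation provides an explicit bound on the support for any test function f.\<close>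
  let ?w = "\<lambda>f y :: real. (indicator {..3} y * f y)\<^sup>2 :: real"
  define c1 where "c1 = ?I (?w bump)"
  define c2 where "c2 = ?I (?w (deriv bump))"
  have main: "lam k powr s * (p 0)\<^sup>2 \<le> (2 * (\<bar>c1\<bar> + \<bar>c2\<bar>) + 1) * line_form k p p"
    if p: "p \<in> test_functions UNIV" for k p
  proof -
    define \<kappa> where "\<kappa> = sqrt (lam k)"
    have \<kappa>: "\<kappa> > 0" "\<kappa>\<^sup>2 = lam k" using sqrt_lam[of k] by (auto simp: \<kappa>_def)
    define q where "q y = bump (\<kappa> * y)" for y
    note sp = test_functions_smooth[OF p]
    have q: "q \<in> test_functions UNIV" and dq: "deriv q y = \<kappa> * deriv bump (\<kappa> * y)" for y
      using bump_scaled_test[OF \<kappa>(1)] by (auto simp: q_def[abs_def])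
    note sq = test_functions_smooth[OF q]
    \<comment> \<open>The factor y^(-\<alpha>) cancels the weight in inner products, and in the
      squared norm it leaves the dual weight, as y^\<alpha> (y^(-\<alpha>))^2 =
      y^(-\<alpha>).\<close>
    have weighted: "(\<lambda>y. indicator {..3} (\<kappa> * y) * f (\<kappa> * y) * y powr (- \<alpha>)) \<in> L2 \<nu>"
      "(L2_norm \<nu> (\<lambda>y. indicator {..3} (\<kappa> * y) * f (\<kappa> * y) * y powr (- \<alpha>)))\<^sup>2 = lam k powr (- s) * ?I (?w f)"
      if f: "f \<in> test_functions UNIV" for f
    proof -
      note mf = smooth_borel_measurable[OF test_functions_smooth[OF f]]
      obtain B where B: "\<And>y. \<bar>f y\<bar> \<le> B" "0 \<le> B" using test_functions_bounded[OF f] by metis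
      have wm: "?w f \<in> borel_measurable borel" using mf by measurable
      have "integrable lborel (\<lambda>y. indicator {0<..} y * y powr (- \<alpha>) * ?w f (\<kappa> * y))"
        (is "integrable lborel ?h")
      proof (rule power_weight_integrable)
        show "(\<lambda>y. ?w f (\<kappa> * y)) \<in> borel_measurable borel" using wm by measurable
        show "\<bar>?w f (\<kappa> * y)\<bar> \<le> B\<^sup>2" for y
          using power_mono[OF B(1)[of "\<kappa> * y"], of 2] B(2) by (auto simp: indicator_def)
        show "?w f (\<kappa> * y) = 0" if "y > 3 / \<kappa>" for y
          using that \<kappa> by (auto simp: indicator_def field_simps)
      qed (use s_pos in simp)
      then have int: "integrable lborel ?h" .
      have eq: "indicator {0<..} y * y powr \<alpha> * (norm (indicator {..3} (\<kappa> * y) * f (\<kappa> * y) * y powr (- \<alpha>)))\<^sup>2 =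
          indicator {0<..} y * y powr (- \<alpha>) * ?w f (\<kappa> * y)" for y
      proof (cases "0 < y")
        case True
        have "y powr \<alpha> * (y powr (- \<alpha>))\<^sup>2 = y powr (- \<alpha>)"
          using True by (simp add: power2_eq_square powr_add[symmetric])
        then show ?thesis
          using True by (simp add: power_mult_distrib mult_ac)
      qed simp
      have bm: "(\<lambda>y. indicator {..3} (\<kappa> * y) * f (\<kappa> * y) * y powr (- \<alpha>)) \<in> borel_measurable borel"
        using mf by measurable
      from bm have nm: "(\<lambda>y. (norm (indicator {..3} (\<kappa> * y) * f (\<kappa> * y) * y powr (- \<alpha>)))\<^sup>2) \<in> borel_measurable borel"
        by measurable
      have "integrable \<nu> (\<lambda>y. (norm (indicator {..3} (\<kappa> * y) * f (\<kappa> * y) * y powr (- \<alpha>)))\<^sup>2)"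
        unfolding integral_line(2)[OF nm] eq by (rule int)
      with bm show "(\<lambda>y. indicator {..3} (\<kappa> * y) * f (\<kappa> * y) * y powr (- \<alpha>)) \<in> L2 \<nu>"
        unfolding L2_def using line.borel_measurable_M[OF bm] by blast
      have "(L2_norm \<nu> (\<lambda>y. indicator {..3} (\<kappa> * y) * f (\<kappa> * y) * y powr (- \<alpha>)))\<^sup>2 = ?I (\<lambda>y. ?w f (\<kappa> * y))"
        unfolding L2_norm_sq unfolding integral_line(1)[OF nm] eq ..
      also have "\<dots> = \<kappa> powr (- (- \<alpha> + 1)) * ?I (?w f)"
        by (rule power_weight_scaling[OF \<kappa>(1)])
      \<comment> \<open>Here 1 - \<alpha> = 2 s.\<close>
      also have "\<kappa> powr (- (- \<alpha> + 1)) = lam k powr (- s)"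
        using sqrt_lam(3)[of k "- s"] by (simp add: \<kappa>_def)
      finally show "(L2_norm \<nu> (\<lambda>y. indicator {..3} (\<kappa> * y) * f (\<kappa> * y) * y powr (- \<alpha>)))\<^sup>2 = lam k powr (- s) * ?I (?w f)" .
    qed
    let ?a = "\<lambda>y. indicator {..3} (\<kappa> * y) * bump (\<kappa> * y) * y powr (- \<alpha>)"
    let ?b = "\<lambda>y. indicator {..3} (\<kappa> * y) * deriv bump (\<kappa> * y) * y powr (- \<alpha>)"
    note wa = weighted[OF bump_test] and wb = weighted[OF test_functions_deriv[OF bump_test]]
    note pL = line_test_L2[OF p] and dpL = line_test_L2[OF test_functions_deriv[OF p]]
    \<comment> \<open>A point beyond the support of q, so that only the boundary term at 0 survives
      in the fundamental theorem.\<close>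
    define R where "R = 3 / \<kappa>"
    have R: "0 < R" "q R = 0" using \<kappa> by (auto simp: R_def q_def bump_eq_0)
    note [measurable] = smooth_borel_measurable[OF sp] smooth_borel_measurable[OF smooth_deriv(2)[OF sp]]
      smooth_borel_measurable[OF smooth_bump] smooth_borel_measurable[OF smooth_deriv(2)[OF smooth_bump]]
      smooth_borel_measurable[OF sq] smooth_borel_measurable[OF smooth_deriv(2)[OF sq]]
    have FTC: "(\<integral>y. indicator {0..R} y *\<^sub>R (p y * deriv q y + deriv p y * q y) \<partial>lborel) = p R * q R - p 0 * q 0"
    proof (rule integral_FTC_Icc)
      show "((\<lambda>y. p y * q y) has_vector_derivative p y * deriv q y + deriv p y * q y) (at y within {0..R})" for y
        using DERIV_mult[OF smooth_deriv(1)[OF sp] smooth_deriv(1)[OF sq], of y]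
        by (simp add: has_real_derivative_iff_has_vector_derivative[symmetric] add.commute mult.commute
            has_field_derivative_at_within)
      show "continuous_on {0..R} (\<lambda>y. p y * deriv q y + deriv p y * q y)"
        by (intro continuous_intros smooth_continuous_on sp sq smooth_deriv)
    qed (use R in simp)
    \<comment> \<open>The weights cancel for y > 0, so the two inner products add up to the integral
      of (p q)'; the integrands differ at most at the single point y = 0.\<close>
    have "L2_inner \<nu> (deriv p) ?a + \<kappa> * L2_inner \<nu> p ?b = (\<integral>y. deriv p y * ?a y + \<kappa> * (p y * ?b y) \<partial>\<nu>)"
      unfolding L2_inner_def using L2_inner_integrable[OF dpL wa(1)] L2_inner_integrable[OF pL wb(1)] by simp
    also have "\<dots> = (\<integral>y. indicator {0<..} y * y powr \<alpha> * (deriv p y * ?a y + \<kappa> * (p y * ?b y)) \<partial>lborel)"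
      by (rule integral_line(1)) measurable
    also have "\<dots> = (\<integral>y. indicator {0..R} y *\<^sub>R (p y * deriv q y + deriv p y * q y) \<partial>lborel)"
    proof (rule integral_cong_AE)
      have "AE y in lborel. y \<noteq> (0::real)" by (rule AE_lborel_singleton)
      then show "AE y in lborel. indicator {0<..} y * y powr \<alpha> * (deriv p y * ?a y + \<kappa> * (p y * ?b y)) =
          indicator {0..R} y *\<^sub>R (p y * deriv q y + deriv p y * q y)"
      proof eventually_elim
        case (elim y)
        show ?case
        proof (cases "0 < y")
          case True
          have c: "y powr \<alpha> * (y powr (- \<alpha>)) = 1" using True by (simp add: powr_add[symmetric])
          have ind: "indicator {..3} (\<kappa> * y) = (indicator {0..R} y :: real)"
            using True \<kappa> by (auto simp: indicator_def R_def field_simps)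
          have "indicator {0<..} y * y powr \<alpha> * (deriv p y * ?a y + \<kappa> * (p y * ?b y)) =
              (y powr \<alpha> * (y powr (- \<alpha>))) * (indicator {..3} (\<kappa> * y) * (deriv p y * bump (\<kappa> * y) + \<kappa> * (p y * deriv bump (\<kappa> * y))))"
            using True by (simp add: algebra_simps)
          then show ?thesis
            unfolding c ind dq q_def by (simp add: algebra_simps)
        qed (use elim in auto)
      qed
    qed measurable
    also have "\<dots> = - p 0"
      using FTC R by (simp add: q_def bump_0)
    finally have "(p 0)\<^sup>2 = (L2_inner \<nu> (deriv p) ?a + \<kappa> * L2_inner \<nu> p ?b)\<^sup>2"
      by simp
    also have "\<dots> \<le> 2 * ((L2_inner \<nu> (deriv p) ?a)\<^sup>2 + (\<kappa> * L2_inner \<nu> p ?b)\<^sup>2)"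
      using sum_squares_bound[of "L2_inner \<nu> (deriv p) ?a" "\<kappa> * L2_inner \<nu> p ?b"] by (simp add: power2_sum)
    also have "\<dots> \<le> 2 * ((L2_norm \<nu> (deriv p))\<^sup>2 * (lam k powr (- s) * c1) + lam k * ((L2_norm \<nu> p)\<^sup>2 * (lam k powr (- s) * c2)))"
    proof -
      have "(L2_inner \<nu> (deriv p) ?a)\<^sup>2 \<le> (L2_norm \<nu> (deriv p) * L2_norm \<nu> ?a)\<^sup>2"
        using L2_inner_bound[OF dpL wa(1)] by (intro abs_le_square_iff[THEN iffD1]) (simp add: L2_norm_nonneg)
      then have 1: "(L2_inner \<nu> (deriv p) ?a)\<^sup>2 \<le> (L2_norm \<nu> (deriv p))\<^sup>2 * (lam k powr (- s) * c1)"
        unfolding power_mult_distrib wa(2) c1_def .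
      have "(L2_inner \<nu> p ?b)\<^sup>2 \<le> (L2_norm \<nu> p * L2_norm \<nu> ?b)\<^sup>2"
        using L2_inner_bound[OF pL wb(1)] by (intro abs_le_square_iff[THEN iffD1]) (simp add: L2_norm_nonneg)
      then have "(L2_inner \<nu> p ?b)\<^sup>2 \<le> (L2_norm \<nu> p)\<^sup>2 * (lam k powr (- s) * c2)"
        unfolding power_mult_distrib wb(2) c2_def .
      then have 2: "(\<kappa> * L2_inner \<nu> p ?b)\<^sup>2 \<le> lam k * ((L2_norm \<nu> p)\<^sup>2 * (lam k powr (- s) * c2))"
        unfolding power_mult_distrib \<kappa>(2) by (intro mult_left_mono) (simp_all add: lam_pos less_imp_le)
      from 1 2 show ?thesis by simp
    qed
    also have "\<dots> \<le> lam k powr (- s) * ((2 * (\<bar>c1\<bar> + \<bar>c2\<bar>) + 1) * line_form k p p)"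
    proof -
      have lf: "line_form k p p = (L2_norm \<nu> (deriv p))\<^sup>2 + lam k * (L2_norm \<nu> p)\<^sup>2"
        by (simp add: line_form_eq[OF p p] L2_inner_self)
      have n: "0 \<le> (L2_norm \<nu> (deriv p))\<^sup>2" "0 \<le> lam k * (L2_norm \<nu> p)\<^sup>2"
        by (simp_all add: lam_pos less_imp_le)
      have "2 * ((L2_norm \<nu> (deriv p))\<^sup>2 * c1 + (lam k * (L2_norm \<nu> p)\<^sup>2) * c2) \<le>
          (2 * (\<bar>c1\<bar> + \<bar>c2\<bar>) + 1) * ((L2_norm \<nu> (deriv p))\<^sup>2 + lam k * (L2_norm \<nu> p)\<^sup>2)"
        (is "2 * (?x * c1 + ?y * c2) \<le> _")
      proof -
        have "?x * c1 \<le> ?x * (\<bar>c1\<bar> + \<bar>c2\<bar>)" "?y * c2 \<le> ?y * (\<bar>c1\<bar> + \<bar>c2\<bar>)"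
          using n by (intro mult_left_mono; simp)+
        then have "2 * (?x * c1 + ?y * c2) \<le> 2 * (?x * (\<bar>c1\<bar> + \<bar>c2\<bar>) + ?y * (\<bar>c1\<bar> + \<bar>c2\<bar>))"
          by (rule mult_left_mono[OF add_mono]) simp
        also have "\<dots> = 2 * (\<bar>c1\<bar> + \<bar>c2\<bar>) * (?x + ?y)"
          by (simp only: distrib_right[symmetric]) (simp only: mult_ac)
        also have "\<dots> \<le> (2 * (\<bar>c1\<bar> + \<bar>c2\<bar>) + 1) * (?x + ?y)"
          using n by (intro mult_right_mono) linarith+
        finally show ?thesis .
      qed
      then have "lam k powr (- s) * (2 * ((L2_norm \<nu> (deriv p))\<^sup>2 * c1 + (lam k * (L2_norm \<nu> p)\<^sup>2) * c2)) \<le>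
          lam k powr (- s) * ((2 * (\<bar>c1\<bar> + \<bar>c2\<bar>) + 1) * line_form k p p)"
        unfolding lf by (intro mult_left_mono) auto
      then show ?thesis by (simp add: algebra_simps)
    qed
    finally have "lam k powr s * (p 0)\<^sup>2 \<le> lam k powr s * (lam k powr (- s) * ((2 * (\<bar>c1\<bar> + \<bar>c2\<bar>) + 1) * line_form k p p))"
      by (intro mult_left_mono) auto
    also have "\<dots> = (2 * (\<bar>c1\<bar> + \<bar>c2\<bar>) + 1) * line_form k p p"
      using lam_pos[of k] by (simp add: mult.assoc[symmetric] powr_add[symmetric])
    finally show ?thesis .
  qed
  show ?thesis
    by (rule exI[of _ "2 * (\<bar>c1\<bar> + \<bar>c2\<bar>) + 1"]) (use main in auto)
qed

text \<open>\<open>form_test_mode\<close> with the weak eigenfunction \<open>\<phi> j\<close> in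
  place of a test function, reached by approximation. The mode of the product is an inner product of
  eigenfunctions, so orthonormality decouples different modes.\<close>

lemma form_mode_mode:
  assumes p: "p \<in> test_functions UNIV" and q: "q \<in> test_functions UNIV"
  shows "cf.form (mode_jet j p) (mode_jet k q) = (if j = k then line_form k p q else 0)"
proof -
  note H = base.H1_jet[OF H10_H1[OF phi_H10]]
  obtain \<theta> :: "nat \<Rightarrow> real^'n \<Rightarrow> real" where \<theta>': "\<forall>i. \<theta> i \<in> test_functions \<Omega>"
    and lim: "(\<lambda>i. L2_norm \<mu> (\<lambda>x. smooth_jet (\<theta> i) x - jet \<Omega> (\<phi> j) x)) \<longlonglongrightarrow> 0"
    by (rule base.H1_closureE[OF phi_H10[unfolded H10_def, of j]])
  note \<theta> = \<theta>'[rule_format]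
  note s = test_functions_smooth
  have "(\<lambda>i. cf.form (tensor_jet (smooth_jet (\<theta> i)) p) (mode_jet k q)) \<longlonglongrightarrow> cf.form (mode_jet j p) (mode_jet k q)"
  proof (rule cf.form_tendsto)
    show "(\<lambda>i. L2_norm N (\<lambda>x. tensor_jet (smooth_jet (\<theta> i)) p x - mode_jet j p x)) \<longlonglongrightarrow> 0"
      by (rule tensor_jet_tendsto[OF H(4) base.smooth_jet_L2(3)[OF \<theta>] lim p])
    show "tensor_jet (smooth_jet (\<theta> i)) p \<in> L2 N" for i
      by (rule tensor_jet_L2(1)[OF base.smooth_jet_L2(3)[OF \<theta>] p])
  qed (use mode_jet_L2 p q in \<open>auto simp: L2_norm_def\<close>)
  moreover have "cf.form (tensor_jet (smooth_jet (\<theta> i)) p) (mode_jet k q) = L2_inner \<mu> (\<theta> i) (\<phi> k) * line_form k p q" for i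
  proof -
    have "cf.form (tensor_jet (smooth_jet (\<theta> i)) p) (mode_jet k q) = line_form k (mode k (\<lambda>z. \<theta> i (fst z) * p (snd z))) q"
      unfolding smooth_jet_tensor[OF s[OF \<theta>] s[OF p], symmetric]
      by (rule form_test_mode[OF test_functions_tensor[OF \<theta> p] q])
    also have "mode k (\<lambda>z. \<theta> i (fst z) * p (snd z)) = (\<lambda>y. L2_inner \<mu> (\<theta> i) (\<phi> k) * p y)"
      by (auto simp: mode_def L2_inner_def mult_ac)
    finally show ?thesis by (simp add: line_form_cmult[OF s[OF p]])
  qed
  moreover have "(\<lambda>i. L2_inner \<mu> (\<theta> i) (\<phi> k) * line_form k p q) \<longlonglongrightarrow> L2_inner \<mu> (\<phi> j) (\<phi> k) * line_form k p q"
  proof (intro tendsto_mult_right L2_inner_tendsto H basis.phi_L2 base.smooth_jet_L2 \<theta>)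
    show "(\<lambda>i. L2_norm \<mu> (\<lambda>x. \<theta> i x - \<phi> j x)) \<longlonglongrightarrow> 0"
    proof (rule L2_tendsto_mono[OF lim, where C=1])
      show "(\<lambda>x. smooth_jet (\<theta> i) x - jet \<Omega> (\<phi> j) x) \<in> L2 \<mu>" for i
        by (intro L2_diff base.smooth_jet_L2 \<theta> H)
      show "(\<lambda>x. \<theta> i x - \<phi> j x) \<in> borel_measurable \<mu>" for i
        by (intro L2D(1) L2_diff base.smooth_jet_L2 \<theta> H)
    qed (auto simp: smooth_jet_def jet_def norm_Pair intro!: AE_I2)
  qed
  ultimately show ?thesis
    using LIMSEQ_unique by (fastforce simp: basis.ortho)
qed

text \<open>Each mode jet is the energy projection of \<psi> onto its mode, hence Bessel's
  inequality.\<close>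

lemma mode_energy_le:
  assumes \<psi>: "\<psi> \<in> test_functions (\<Omega> \<times> UNIV)"
  shows "(\<Sum>k<n. line_form k (mode k \<psi>) (mode k \<psi>)) \<le> cf.form (smooth_jet \<psi>) (smooth_jet \<psi>)"
proof -
  note t = mode_test(1)[OF \<psi>]
  have "(\<Sum>k<n. cf.form (mode_jet k (mode k \<psi>)) (mode_jet k (mode k \<psi>))) \<le> cf.form (smooth_jet \<psi>) (smooth_jet \<psi>)"
    by (rule cf.form_Bessel[OF cylN.smooth_jet_L2(3)[OF \<psi>] mode_jet_L2[OF t]])
      (simp_all add: form_mode_mode[OF t t] form_test_mode[OF \<psi> t])
  then show ?thesis by (simp add: form_mode_mode[OF t t])
qed

text \<open>Supplies the uniform energy bound demanded of the test functions in
  \<open>mode_form_tendsto\<close> below.\<close>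

lemma single_mode_energy_le:
  assumes \<psi>: "\<psi> \<in> test_functions (\<Omega> \<times> UNIV)"
  shows "line_form k (mode k \<psi>) (mode k \<psi>) \<le> cf.form (smooth_jet \<psi>) (smooth_jet \<psi>)"
  using cf.form_projection_le[OF cylN.smooth_jet_L2(3)[OF \<psi>] mode_jet_L2[OF mode_test(1)[OF \<psi>]], of k k]
  by (simp add: form_mode_mode form_test_mode mode_test(1) \<psi>)

section \<open>Traces and conormal derivatives, mode by mode\<close>

lemma trace_mode_tendsto:
  assumes "has_trace \<alpha> \<Omega> W u" and "\<forall>j. \<psi> j \<in> test_functions (\<Omega> \<times> UNIV)"
    and "(\<lambda>j. L2_norm \<mu> (\<lambda>x. \<psi> j (x, 0) - u x)) \<longlonglongrightarrow> 0"
  shows "(\<lambda>j. mode k (\<psi> j) 0) \<longlonglongrightarrow> L2_inner \<mu> u (\<phi> k)"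
  unfolding mode_def
  by (rule L2_inner_tendsto[OF has_trace_L2(2)[OF assms(1)] slice_L2[OF assms(2)[rule_format]] assms(3) basis.phi_L2])

text \<open>The trace inequality is applied to every mode of an approximating test function. Only
  finitely many modes are summed, so the approximation can be removed term by term with a bound
  uniform in n.\<close>

lemma trace_summable_bound:
  assumes C1: "\<And>k p. p \<in> test_functions UNIV \<Longrightarrow> lam k powr s * (p 0)\<^sup>2 \<le> C1 * line_form k p p" "C1 > 0"
    and tr: "has_trace \<alpha> \<Omega> W u"
  shows "(\<Sum>k<n. lam k powr s * (L2_inner \<mu> u (\<phi> k))\<^sup>2) \<le> C1 * cf.form (jet cyl W) (jet cyl W)"
proof -
  obtain \<psi> where \<psi>: "\<forall>j. \<psi> j \<in> test_functions (\<Omega> \<times> UNIV)"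
    and lim: "(\<lambda>j::nat. L2_norm N (\<lambda>x. smooth_jet (\<psi> j) x - jet cyl W x)) \<longlonglongrightarrow> 0"
    and lim0: "(\<lambda>j. L2_norm \<mu> (\<lambda>x. \<psi> j (x, 0) - u x)) \<longlonglongrightarrow> 0"
    by (rule has_traceE[OF tr])
  note \<psi>' = \<psi>[rule_format]
  have "(\<lambda>j. \<Sum>k<n. lam k powr s * (mode k (\<psi> j) 0)\<^sup>2) \<longlonglongrightarrow> (\<Sum>k<n. lam k powr s * (L2_inner \<mu> u (\<phi> k))\<^sup>2)"
    by (intro tendsto_intros trace_mode_tendsto[OF tr \<psi> lim0])
  moreover have "(\<lambda>j. C1 * cf.form (smooth_jet (\<psi> j)) (smooth_jet (\<psi> j))) \<longlonglongrightarrow> C1 * cf.form (jet cyl W) (jet cyl W)"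
    by (intro tendsto_intros cf.form_tendsto cylN.smooth_jet_L2 has_trace_L2(1)[OF tr] \<psi>' lim)
  moreover have "(\<Sum>k<n. lam k powr s * (mode k (\<psi> j) 0)\<^sup>2) \<le> C1 * cf.form (smooth_jet (\<psi> j)) (smooth_jet (\<psi> j))" for j
  proof -
    have "(\<Sum>k<n. lam k powr s * (mode k (\<psi> j) 0)\<^sup>2) \<le> (\<Sum>k<n. C1 * line_form k (mode k (\<psi> j)) (mode k (\<psi> j)))"
      by (intro sum_mono C1 mode_test \<psi>')
    also have "\<dots> \<le> C1 * cf.form (smooth_jet (\<psi> j)) (smooth_jet (\<psi> j))"
      unfolding sum_distrib_left[symmetric] using C1(2) mode_energy_le[OF \<psi>'] by (intro mult_left_mono) auto
    finally show ?thesis .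
  qed
  ultimately show ?thesis by (meson LIMSEQ_le)
qed

text \<open>The number m is the weak form of the flux, minus the limit of y^\<alpha> W_k'(y) as y
  tends to 0, where W_k is the k-th mode. Dependence on q through q(0) alone expresses that the mode
  solves its equation for y > 0. The factor \<open>1 / d_const s\<close> of \<open>a_form\<close> is
  left out.\<close>

definition has_conormal :: "((real^'n) \<times> real \<Rightarrow> real) \<Rightarrow> nat \<Rightarrow> real \<Rightarrow> bool" where
  "has_conormal W k m \<longleftrightarrow>
     (\<forall>q\<in>test_functions UNIV. cf.form (jet cyl W) (mode_jet k q) = m * q 0)"

text \<open>The test functions may vary with j, provided that their energies stay bounded and their
  values at 0 converge. Taking for them the modes of a second approximating sequence evaluates the
  pairing of two limits, or of one limit with itself.\<close>

lemma mode_form_tendsto: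
  assumes W: "jet cyl W \<in> L2 N" "has_conormal W k m"
    and \<psi>: "\<And>j. \<psi> j \<in> test_functions (\<Omega> \<times> UNIV)"
    and lim: "(\<lambda>j::nat. L2_norm N (\<lambda>x. smooth_jet (\<psi> j) x - jet cyl W x)) \<longlonglongrightarrow> 0"
    and q: "\<And>j. q j \<in> test_functions UNIV" "\<And>j. line_form k (q j) (q j) \<le> e j" "e \<longlonglongrightarrow> l"
    and q0: "(\<lambda>j. q j 0) \<longlonglongrightarrow> r"
  shows "(\<lambda>j. line_form k (mode k (\<psi> j)) (q j)) \<longlonglongrightarrow> m * r"
proof -
  have "(\<lambda>j. cf.form (smooth_jet (\<psi> j)) (mode_jet k (q j)) - cf.form (jet cyl W) (mode_jet k (q j))) \<longlonglongrightarrow> 0"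
    by (rule cf.form_diff_tendsto_0[OF W(1) cylN.smooth_jet_L2(3)[OF \<psi>] lim mode_jet_L2[OF q(1)] _ q(3)])
      (simp add: form_mode_mode q)
  then have "(\<lambda>j. line_form k (mode k (\<psi> j)) (q j) - m * q j 0) \<longlonglongrightarrow> 0"
    using W(2) q(1) by (simp add: form_test_mode[OF \<psi> q(1)] has_conormal_def)
  moreover have "(\<lambda>j. m * q j 0) \<longlonglongrightarrow> m * r"
    by (intro tendsto_intros q0)
  ultimately have "(\<lambda>j. (line_form k (mode k (\<psi> j)) (q j) - m * q j 0) + m * q j 0) \<longlonglongrightarrow> 0 + m * r"
    by (rule tendsto_add)
  then show ?thesis by simp
qed

text \<open>The symmetric quantity \<open>line_form k\<close> of the modes of two approximating
  sequences has its limit computed twice, once from the flux of W and once from that of W'. Hence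
  the ratio of flux to trace is the same for all W.\<close>

lemma conormal_symmetric:
  assumes W: "has_trace \<alpha> \<Omega> W u" "has_conormal W k m"
    and W': "has_trace \<alpha> \<Omega> W' u'" "has_conormal W' k m'"
  shows "m * L2_inner \<mu> u' (\<phi> k) = m' * L2_inner \<mu> u (\<phi> k)"
proof -
  obtain \<psi> where \<psi>: "\<forall>j. \<psi> j \<in> test_functions (\<Omega> \<times> UNIV)"
    and lim: "(\<lambda>j::nat. L2_norm N (\<lambda>x. smooth_jet (\<psi> j) x - jet cyl W x)) \<longlonglongrightarrow> 0"
    and lim0: "(\<lambda>j. L2_norm \<mu> (\<lambda>x. \<psi> j (x, 0) - u x)) \<longlonglongrightarrow> 0"
    by (rule has_traceE[OF W(1)])
  obtain \<psi>' where \<psi>': "\<forall>j. \<psi>' j \<in> test_functions (\<Omega> \<times> UNIV)"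
    and lim': "(\<lambda>j::nat. L2_norm N (\<lambda>x. smooth_jet (\<psi>' j) x - jet cyl W' x)) \<longlonglongrightarrow> 0"
    and lim0': "(\<lambda>j. L2_norm \<mu> (\<lambda>x. \<psi>' j (x, 0) - u' x)) \<longlonglongrightarrow> 0"
    by (rule has_traceE[OF W'(1)])
  have e: "(\<lambda>j. cf.form (smooth_jet (\<psi> j)) (smooth_jet (\<psi> j))) \<longlonglongrightarrow> cf.form (jet cyl W) (jet cyl W)"
    by (intro cf.form_tendsto cylN.smooth_jet_L2 has_trace_L2(1)[OF W(1)] \<psi>[rule_format] lim)
  have e': "(\<lambda>j. cf.form (smooth_jet (\<psi>' j)) (smooth_jet (\<psi>' j))) \<longlonglongrightarrow> cf.form (jet cyl W') (jet cyl W')"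
    by (intro cf.form_tendsto cylN.smooth_jet_L2 has_trace_L2(1)[OF W'(1)] \<psi>'[rule_format] lim')
  have "(\<lambda>j. line_form k (mode k (\<psi> j)) (mode k (\<psi>' j))) \<longlonglongrightarrow> m * L2_inner \<mu> u' (\<phi> k)"
    by (rule mode_form_tendsto[OF has_trace_L2(1)[OF W(1)] W(2) \<psi>[rule_format] lim mode_test(1)[OF \<psi>'[rule_format]]
          single_mode_energy_le[OF \<psi>'[rule_format]] e' trace_mode_tendsto[OF W'(1) \<psi>' lim0']])
  moreover have "(\<lambda>j. line_form k (mode k (\<psi>' j)) (mode k (\<psi> j))) \<longlonglongrightarrow> m' * L2_inner \<mu> u (\<phi> k)"
    by (rule mode_form_tendsto[OF has_trace_L2(1)[OF W'(1)] W'(2) \<psi>'[rule_format] lim' mode_test(1)[OF \<psi>[rule_format]]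
          single_mode_energy_le[OF \<psi>[rule_format]] e trace_mode_tendsto[OF W(1) \<psi> lim0]])
  then have "(\<lambda>j. line_form k (mode k (\<psi> j)) (mode k (\<psi>' j))) \<longlonglongrightarrow> m' * L2_inner \<mu> u (\<phi> k)"
    by (simp add: line_form_commute[of k "mode k (\<psi>' _)"])
  ultimately show ?thesis by (rule LIMSEQ_unique)
qed

text \<open>Testing with the modes of the approximating sequence itself shows that flux times trace
  is a limit of energies. Testing with the scaled bump, which is 1 at 0, recovers m, and
  Cauchy-Schwarz compares the two.\<close>

lemma conormal_bounds:
  assumes C0: "line_form k (\<lambda>y. bump (sqrt (lam k) * y)) (\<lambda>y. bump (sqrt (lam k) * y)) \<le> C0 * lam k powr s"
    and W: "has_trace \<alpha> \<Omega> W u" "has_conormal W k m"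
  shows "0 \<le> m * L2_inner \<mu> u (\<phi> k)" and "m\<^sup>2 \<le> (m * L2_inner \<mu> u (\<phi> k)) * (C0 * lam k powr s)"
proof -
  obtain \<psi> where \<psi>': "\<forall>j. \<psi> j \<in> test_functions (\<Omega> \<times> UNIV)"
    and lim: "(\<lambda>j::nat. L2_norm N (\<lambda>x. smooth_jet (\<psi> j) x - jet cyl W x)) \<longlonglongrightarrow> 0"
    and lim0: "(\<lambda>j. L2_norm \<mu> (\<lambda>x. \<psi> j (x, 0) - u x)) \<longlonglongrightarrow> 0"
    by (rule has_traceE[OF W(1)])
  note \<psi> = \<psi>'[rule_format]
  note t = mode_test(1)[OF \<psi>, of k]
  define q where "q y = bump (sqrt (lam k) * y)" for y
  have q: "q \<in> test_functions UNIV" "q 0 = 1" "line_form k q q \<le> C0 * lam k powr s"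
    using bump_scaled_test(1)[OF sqrt_lam(1), of k] C0 by (auto simp: q_def[abs_def] bump_0)
  have e: "(\<lambda>j. cf.form (smooth_jet (\<psi> j)) (smooth_jet (\<psi> j))) \<longlonglongrightarrow> cf.form (jet cyl W) (jet cyl W)"
    by (intro cf.form_tendsto cylN.smooth_jet_L2 has_trace_L2(1)[OF W(1)] \<psi> lim)
  have l1: "(\<lambda>j. line_form k (mode k (\<psi> j)) (mode k (\<psi> j))) \<longlonglongrightarrow> m * L2_inner \<mu> u (\<phi> k)"
    by (rule mode_form_tendsto[OF has_trace_L2(1)[OF W(1)] W(2) \<psi> lim t
          single_mode_energy_le[OF \<psi>] e trace_mode_tendsto[OF W(1) \<psi>' lim0]])
  have l2: "(\<lambda>j. line_form k (mode k (\<psi> j)) q) \<longlonglongrightarrow> m * 1"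
    by (rule mode_form_tendsto[OF has_trace_L2(1)[OF W(1)] W(2) \<psi> lim q(1) order_refl tendsto_const])
      (simp add: q)
  have nn: "0 \<le> line_form k (mode k (\<psi> j)) (mode k (\<psi> j))" for j
    using cf.form_nonneg[of "mode_jet k (mode k (\<psi> j))"] by (simp add: form_mode_mode t)
  show nonneg: "0 \<le> m * L2_inner \<mu> u (\<phi> k)"
    by (rule LIMSEQ_le_const[OF l1]) (use nn in auto)
  have "m\<^sup>2 \<le> (m * L2_inner \<mu> u (\<phi> k)) * line_form k q q"
  proof (rule LIMSEQ_le)
    show "(\<lambda>j. (line_form k (mode k (\<psi> j)) q)\<^sup>2) \<longlonglongrightarrow> m\<^sup>2"
      using tendsto_power[OF l2, of 2] by simp
    show "(\<lambda>j. line_form k (mode k (\<psi> j)) (mode k (\<psi> j)) * line_form k q q) \<longlonglongrightarrow> (m * L2_inner \<mu> u (\<phi> k)) * line_form k q q"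
      by (intro tendsto_intros l1)
    have "(line_form k (mode k (\<psi> j)) q)\<^sup>2 \<le> line_form k (mode k (\<psi> j)) (mode k (\<psi> j)) * line_form k q q" for j
      using cf.form_Cauchy_Schwarz[OF mode_jet_L2[OF t[of j]] mode_jet_L2[OF q(1)], of k k]
      by (simp add: form_mode_mode t q)
    then show "\<exists>N. \<forall>n\<ge>N. (line_form k (mode k (\<psi> n)) q)\<^sup>2 \<le> line_form k (mode k (\<psi> n)) (mode k (\<psi> n)) * line_form k q q"
      by auto
  qed
  also have "\<dots> \<le> (m * L2_inner \<mu> u (\<phi> k)) * (C0 * lam k powr s)"
    by (rule mult_left_mono[OF q(3) nonneg])
  finally show "m\<^sup>2 \<le> (m * L2_inner \<mu> u (\<phi> k)) * (C0 * lam k powr s)" .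
qed

end

section \<open>Weak derivatives in time\<close>

lemma smooth_sin_cos: "smooth (sin :: real \<Rightarrow> real)" "smooth (cos :: real \<Rightarrow> real)"
proof -
  have "C_k k (sin :: real \<Rightarrow> real) \<and> C_k k (cos :: real \<Rightarrow> real)" for k
  proof (induction k)
    case 0
    show ?case by (auto intro: continuous_intros)
  next
    case (Suc k)
    have "C_k (Suc k) (sin :: real \<Rightarrow> real)"
      using Suc by (intro C_k_real_SucI[OF DERIV_sin]) auto
    moreover have "C_k k (\<lambda>x::real. (-1) * sin x)"
      using Suc by (intro C_k_mult C_k_const) auto
    then have "C_k (Suc k) (cos :: real \<Rightarrow> real)"
      by (intro C_k_real_SucI[OF DERIV_cos]) simp
    ultimately show ?case by blast
  qed
  then show "smooth (sin :: real \<Rightarrow> real)" "smooth (cos :: real \<Rightarrow> real)"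
    by (auto simp: smooth_def)
qed

text \<open>Local integrability speaks of compact subsets only; the open interval is exhausted by
  compact ones.\<close>

lemma locally_integrable_measurable:
  fixes r :: "real \<Rightarrow> real"
  assumes "locally_integrable {0<..<T} r"
  shows "r \<in> borel_measurable (lebesgue_on {0<..<T})"
proof -
  let ?K = "\<lambda>n::nat. {1 / (real n + 1)..T - 1 / (real n + 1)}"
  have "(\<lambda>x. indicator {0<..<T} x *\<^sub>R r x) \<in> borel_measurable lebesgue"
  proof (rule borel_measurable_LIMSEQ_real)
    show "(\<lambda>x. indicator (?K n) x *\<^sub>R r x) \<in> borel_measurable lebesgue" for n
    proof -
      have "integrable (lebesgue_on (?K n)) r"
      proof -
        have pos: "0 < 1 / (real n + 1)" by simp
        have "?K n \<subseteq> {0<..<T}"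
          unfolding subset_eq atLeastAtMost_iff greaterThanLessThan_iff using pos by (intro ballI, unfold atLeastAtMost_iff) linarith
        then show ?thesis
          using assms unfolding locally_integrable_def by (meson compact_Icc)
      qed
      then show ?thesis
        by (auto simp: integrable_restrict_space dest: borel_measurable_integrable)
    qed
    show "(\<lambda>n. indicator (?K n) x *\<^sub>R r x) \<longlonglongrightarrow> indicator {0<..<T} x *\<^sub>R r x" for x
    proof (rule tendsto_eventually)
      show "\<forall>\<^sub>F n in sequentially. indicator (?K n) x *\<^sub>R r x = indicator {0<..<T} x *\<^sub>R r x"
      proof (cases "x \<in> {0<..<T}")
        case True
        then have "0 < min x (T - x)" by auto
        moreover have "(\<lambda>n. 1 / (real n + 1)) \<longlonglongrightarrow> 0"
          using LIMSEQ_inverse_real_of_nat by (simp add: inverse_eq_divide add.commute)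
        ultimately have "\<forall>\<^sub>F n in sequentially. 1 / (real n + 1) < min x (T - x)"
          by (rule order_tendstoD(2)[rotated])
        then show ?thesis
          by eventually_elim (use True in \<open>auto simp: indicator_def\<close>)
      next
        case False
        have "x \<notin> ?K n" for n
        proof -
          have "0 < 1 / (real n + 1)" by simp
          then show ?thesis
            using False unfolding atLeastAtMost_iff greaterThanLessThan_iff by linarith
        qed
        with False show ?thesis by simp
      qed
    qed
  qed
  then show ?thesis by (simp add: borel_measurable_restrict_space_iff)
qed

lemma smooth_step_deriv_integral: "(\<integral>u. deriv smooth_step u \<partial>lborel) = 1"
  and smooth_step_deriv_eq_0: "u \<notin> {0..1} \<Longrightarrow> deriv smooth_step u = 0"
  and smooth_step_deriv_integrable: "integrable lborel (deriv smooth_step)"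
proof -
  note d = smooth_deriv[OF smooth_smooth_step]
  have zero: "deriv smooth_step u = 0" if "u \<notin> {0..1}" for u
  proof (cases "u < 0")
    case True
    have "(smooth_step has_real_derivative 0) (at u)"
      by (rule DERIV_cong_ev[OF refl _ refl, THEN iffD1, OF _ DERIV_const[of 0]])
        (use True in \<open>auto simp: smooth_step_eq_0 intro!: eventually_nhds_in_open[of "{..<0}", THEN eventually_mono]\<close>)
    then show ?thesis by (rule DERIV_imp_deriv)
  next
    case False
    with that have "u > 1" by auto
    have "(smooth_step has_real_derivative 0) (at u)"
      by (rule DERIV_cong_ev[OF refl _ refl, THEN iffD1, OF _ DERIV_const[of 1]])
        (use \<open>u > 1\<close> in \<open>auto simp: smooth_step_eq_1 intro!: eventually_nhds_in_open[of "{1<..}", THEN eventually_mono]\<close>)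
    then show ?thesis by (rule DERIV_imp_deriv)
  qed
  then show "u \<notin> {0..1} \<Longrightarrow> deriv smooth_step u = 0" .
  have eq: "(\<lambda>u. indicator {0..1} u *\<^sub>R deriv smooth_step u) = deriv smooth_step"
    using zero by (auto simp: indicator_def fun_eq_iff)
  have "integrable lborel (\<lambda>u. indicator {0..1} u *\<^sub>R deriv smooth_step u)"
    by (intro borel_integrable_compact smooth_continuous_on d) simp
  then show "integrable lborel (deriv smooth_step)" unfolding eq .
  have "(\<integral>u. indicator {0..1} u *\<^sub>R deriv smooth_step u \<partial>lborel) = smooth_step 1 - smooth_step 0"
    by (rule integral_FTC_Icc)
      (auto intro!: smooth_continuous_on d has_field_derivative_at_within
        simp: has_real_derivative_iff_has_vector_derivative[symmetric])
  then show "(\<integral>u. deriv smooth_step u \<partial>lborel) = 1"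
    unfolding eq by (simp add: smooth_step_eq_0 smooth_step_eq_1)
qed

text \<open>The substitution u = (n + 1) x + e n shows an approximate identity at pt. The offset
  decides where its support lies: offset -1 places it strictly to the right of pt, between distances
  1/(n + 1) and 2/(n + 1); offset 0 lets it start at pt.\<close>

lemma smooth_step_deriv_concentrates:
  fixes H :: "real \<Rightarrow> real"
  assumes H: "continuous_on UNIV H" and e: "\<And>n. e n = off - real (Suc n) * pt"
  shows "(\<lambda>n. \<integral>x. H x * (real (Suc n) * deriv smooth_step (real (Suc n) * x + e n)) \<partial>lborel) \<longlonglongrightarrow> H pt"
proof -
  note d = smooth_deriv[OF smooth_smooth_step] and i = smooth_step_deriv_integrable
  have eq: "(\<integral>x. H x * (real (Suc n) * deriv smooth_step (real (Suc n) * x + e n)) \<partial>lborel) =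
      (\<integral>u. H (pt + (u - off) / real (Suc n)) * deriv smooth_step u \<partial>lborel)" for n
  proof -
    have "real (Suc n) * (pt - off / real (Suc n) + (1 / real (Suc n)) * u) + e n = u" for u
    proof -
      have "m * (pt - off / m + (1 / m) * u) + (off - m * pt) = u" if "m > 0" for m :: real
        using that by (simp add: field_simps)
      from this[of "real (Suc n)"] show ?thesis by (simp only: e)
    qed
    then have "(\<integral>x. H x * (real (Suc n) * deriv smooth_step (real (Suc n) * x + e n)) \<partial>lborel) =
      (1 / real (Suc n)) * (\<integral>u. H (pt - off / real (Suc n) + (1 / real (Suc n)) * u) * (real (Suc n) * deriv smooth_step u) \<partial>lborel)"
      by (subst lborel_integral_real_affine[of "1 / real (Suc n)" _ "pt - off / real (Suc n)"]) auto
    also have "\<dots> = (\<integral>u. (1 / real (Suc n)) * (H (pt - off / real (Suc n) + (1 / real (Suc n)) * u) * (real (Suc n) * deriv smooth_step u)) \<partial>lborel)"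
      by (simp only: integral_mult_right_zero)
    also have "\<dots> = (\<integral>u. H (pt + (u - off) / real (Suc n)) * deriv smooth_step u \<partial>lborel)"
    proof (rule Bochner_Integration.integral_cong[OF refl])
      have "1 / m * (H (pt - off / m + 1 / m * u) * (m * d)) = H (pt + (u - off) / m) * d" if "m > 0" for m d u :: real
      proof -
        have eq: "pt - off / m + 1 / m * u = pt + (u - off) / m" by (simp add: diff_divide_distrib)
        show ?thesis unfolding eq using that by simp
      qed
      then show "(1 / real (Suc n)) * (H (pt - off / real (Suc n) + (1 / real (Suc n)) * u) * (real (Suc n) * deriv smooth_step u)) =
          H (pt + (u - off) / real (Suc n)) * deriv smooth_step u" for u
        using of_nat_0_less_iff zero_less_Suc by blast
    qed
    finally show ?thesis .
  qed
  have Hm: "H \<in> borel_measurable borel" by (rule borel_measurable_continuous_onI[OF H])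
  have "compact (H ` {pt - (1 + \<bar>off\<bar>)..pt + (1 + \<bar>off\<bar>)})"
    by (intro compact_continuous_image continuous_on_subset[OF H]) auto
  then obtain B where B': "\<forall>x\<in>{pt - (1 + \<bar>off\<bar>)..pt + (1 + \<bar>off\<bar>)}. \<bar>H x\<bar> \<le> B"
    by (auto simp: bounded_iff dest!: compact_imp_bounded)
  note B = B'[rule_format]
  have "(\<lambda>n. \<integral>u. H (pt + (u - off) / real (Suc n)) * deriv smooth_step u \<partial>lborel) \<longlonglongrightarrow> (\<integral>u. H pt * deriv smooth_step u \<partial>lborel)"
  proof (rule integral_dominated_convergence[where w="\<lambda>u. B * \<bar>deriv smooth_step u\<bar>"])
    show "AE u in lborel. (\<lambda>n. H (pt + (u - off) / real (Suc n)) * deriv smooth_step u) \<longlonglongrightarrow> H pt * deriv smooth_step u"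
    proof (intro AE_I2 tendsto_mult tendsto_const)
      fix u
      have "(\<lambda>n. pt + (u - off) * inverse (real (Suc n))) \<longlonglongrightarrow> pt + (u - off) * 0"
        by (intro tendsto_intros LIMSEQ_inverse_real_of_nat)
      then have "(\<lambda>n. pt + (u - off) / real (Suc n)) \<longlonglongrightarrow> pt"
        by (simp add: divide_inverse)
      then show "(\<lambda>n. H (pt + (u - off) / real (Suc n))) \<longlonglongrightarrow> H pt"
        using H by (intro isCont_tendsto_compose[of pt H]) (auto simp: continuous_on_eq_continuous_at)
    qed
    show "AE u in lborel. norm (H (pt + (u - off) / real (Suc n)) * deriv smooth_step u) \<le> B * \<bar>deriv smooth_step u\<bar>" for n
    proof (rule AE_I2)
      fix u
      show "norm (H (pt + (u - off) / real (Suc n)) * deriv smooth_step u) \<le> B * \<bar>deriv smooth_step u\<bar>"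
      proof (cases "u \<in> {0..1}")
        case True
        have "\<bar>(u - off) / real (Suc n)\<bar> \<le> \<bar>u - off\<bar>"
          by (simp add: divide_le_eq mult_le_cancel_left1)
        also have "\<dots> \<le> 1 + \<bar>off\<bar>" using True by auto
        finally have "pt + (u - off) / real (Suc n) \<in> {pt - (1 + \<bar>off\<bar>)..pt + (1 + \<bar>off\<bar>)}"
          by (simp only: abs_le_iff atLeastAtMost_iff) linarith
        from B[OF this] show ?thesis by (simp add: abs_mult mult_right_mono)
      qed (simp add: smooth_step_deriv_eq_0)
    qed
  qed (use i Hm smooth_borel_measurable[OF d(2)] in \<open>auto\<close>)
  then show ?thesis
    unfolding eq using smooth_step_deriv_integral by simp
qed

lemma integrable_continuous_open_interval:
  fixes g :: "real \<Rightarrow> real"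
  assumes "continuous_on {0..T} g"
  shows "integrable (lebesgue_on {0<..<T}) g"
proof -
  have "integrable lborel (\<lambda>x. indicator {0..T} x *\<^sub>R g x)"
    using assms by (intro borel_integrable_compact) auto
  then have "integrable lebesgue (\<lambda>x. indicator {0..T} x *\<^sub>R g x)"
    by (simp add: integrable_completion borel_measurable_integrable)
  then have "integrable lebesgue (\<lambda>x. indicator {0<..<T} x *\<^sub>R (indicator {0..T} x *\<^sub>R g x))"
    by (rule integrable_mult_indicator[rotated]) simp
  also have "(\<lambda>x. indicator {0<..<T} x *\<^sub>R (indicator {0..T} x *\<^sub>R g x)) = (\<lambda>x. indicator {0<..<T} x *\<^sub>R g x)"
    by (auto simp: indicator_def fun_eq_iff)
  finally show ?thesis by (simp add: integrable_restrict_space)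
qed

text \<open>Integration by parts on (0, b) for a function that has only a weak derivative on (0, T)
  and a continuous representative on the closed interval. S is multiplied by smooth approximations
  of the indicator of (0, b]; their derivatives concentrate at 0 and b and produce the boundary
  values of P.\<close>

lemma weak_derivative_multiplier:
  fixes p p' P S :: "real \<Rightarrow> real"
  assumes w: "has_weak_gradient {0<..<T} p p'" and p': "integrable (lebesgue_on {0<..<T}) p'"
    and P: "continuous_on {0..T} P" "AE t in lebesgue_on {0<..<T}. p t = P t"
    and S: "smooth S" and b: "0 < b" "b < T"
  shows "P b * S b - P 0 * S 0 =
    (\<integral>x. indicator {0<..b} x * (p' x * S x + P x * deriv S x) \<partial>lebesgue_on {0<..<T})"
proof -
  let ?L = "lebesgue_on {0<..<T}"
  \<comment> \<open>Clamping the argument extends P continuously to the whole line, as the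
    concentration lemma requires.\<close>
  define PP where "PP x = P (max 0 (min T x))" for x
  have PP: "continuous_on UNIV PP"
    unfolding PP_def using b
    by (intro continuous_on_compose2[OF P(1)] continuous_intros) auto
  have PPe: "PP x = P x" if "x \<in> {0..T}" for x
    using that by (auto simp: PP_def max_def min_def)
  note dS = smooth_deriv[OF S]
  \<comment> \<open>The first ramp rises on [1/(n + 1), 2/(n + 1)], away from 0; the second one,
    subtracted, lies on [b, b + 1/(n + 1)]. The difference has compact support in (0, T) once n is
    large.\<close>
  define \<zeta> where "\<zeta> n x = smooth_step (real (Suc n) * x + (-1)) - smooth_step (real (Suc n) * x + (0 - real (Suc n) * b))" for n x
  define \<zeta>' where "\<zeta>' n x = real (Suc n) * deriv smooth_step (real (Suc n) * x + (-1)) -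
      real (Suc n) * deriv smooth_step (real (Suc n) * x + (0 - real (Suc n) * b))" for n x
  have \<zeta>_smooth: "smooth (\<zeta> n)" for n
    unfolding \<zeta>_def by (intro smooth_diff smooth_affine[OF smooth_smooth_step] bounded_linear_mult_right)
  have \<zeta>_deriv: "(\<zeta> n has_real_derivative \<zeta>' n x) (at x)" for n x
  proof -
    have "((\<lambda>x. smooth_step (real (Suc n) * x + e)) has_real_derivative deriv smooth_step (real (Suc n) * x + e) * real (Suc n)) (at x)" for e
      by (rule DERIV_chain2[OF smooth_deriv(1)[OF smooth_smooth_step]]) (auto intro!: derivative_eq_intros)
    from DERIV_diff[OF this[of "-1"] this[of "0 - real (Suc n) * b"]] show ?thesis
      unfolding \<zeta>_def[abs_def] \<zeta>'_def by (simp only: mult.commute)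
  qed
  have \<zeta>_bound: "\<bar>\<zeta> n x\<bar> \<le> 1" for n x
    using smooth_step_bounds[of "real (Suc n) * x + (-1)"] smooth_step_bounds[of "real (Suc n) * x + (0 - real (Suc n) * b)"]
    by (auto simp: \<zeta>_def)
  \<comment> \<open>The condition that n is large: the upper ramp ends before T, and the lower one
    starts before b, so that beyond the upper ramp both are complete and cancel.\<close>
  define G where "G n \<longleftrightarrow> 1 / real (Suc n) < min b (T - b)" for n
  have G_ev: "\<forall>\<^sub>F n in sequentially. G n"
    unfolding G_def using LIMSEQ_inverse_real_of_nat b
    by (intro order_tendstoD(2)) (auto simp: inverse_eq_divide)
  have out: "real (Suc n) * x + (-1) \<notin> {0..1} \<and> real (Suc n) * x + (0 - real (Suc n) * b) \<notin> {0..1} \<and> \<zeta> n x = 0"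
    if n: "G n" and x: "x \<notin> {1 / real (Suc n)..b + 1 / real (Suc n)}" for n x
  proof (cases "x < 1 / real (Suc n)")
    case True
    then have 1: "real (Suc n) * x + (-1) < 0" by (simp add: field_simps)
    have "x < b" using True n by (auto simp: G_def)
    then have 2: "real (Suc n) * x + (0 - real (Suc n) * b) < 0"
      using mult_strict_left_mono[of x b "real (Suc n)"] by simp
    from 1 2 show ?thesis by (simp add: \<zeta>_def smooth_step_eq_0)
  next
    case False
    with x have "b + 1 / real (Suc n) < x" by auto
    then have "real (Suc n) * (b + 1 / real (Suc n)) < real (Suc n) * x"
      by (intro mult_strict_left_mono) auto
    then have 2: "1 < real (Suc n) * x + (0 - real (Suc n) * b)"
      by (simp add: distrib_left)
    have "1 < real (Suc n) * b" using n by (simp add: G_def field_simps)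
    with 2 have 1: "1 < real (Suc n) * x + (-1)" by linarith
    from 1 2 show ?thesis by (simp add: \<zeta>_def smooth_step_eq_1)
  qed
  have \<zeta>'_zero: "\<zeta>' n x = 0" if "G n" "x \<notin> {1 / real (Suc n)..b + 1 / real (Suc n)}" for n x
    unfolding \<zeta>'_def using out[OF that]
      smooth_step_deriv_eq_0[of "real (Suc n) * x + (-1)"]
      smooth_step_deriv_eq_0[of "real (Suc n) * x + (0 - real (Suc n) * b)"]
    by (metis diff_self mult_zero_right)
  have sub: "{1 / real (Suc n)..b + 1 / real (Suc n)} \<subseteq> {0<..<T}" if "G n" for n
  proof
    fix x assume "x \<in> {1 / real (Suc n)..b + 1 / real (Suc n)}"
    moreover have "0 < 1 / real (Suc n)" "b + 1 / real (Suc n) < T" using that by (auto simp: G_def)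
    ultimately show "x \<in> {0<..<T}" unfolding atLeastAtMost_iff greaterThanLessThan_iff by linarith
  qed
  have cont_int: "integrable ?L g" if "continuous_on UNIV g" for g :: "real \<Rightarrow> real"
    by (rule integrable_continuous_open_interval[OF continuous_on_subset[OF that]]) simp
  have \<zeta>'_cont: "continuous_on UNIV (\<zeta>' n)" for n
    unfolding \<zeta>'_def
    by (intro continuous_intros continuous_on_compose2[OF smooth_continuous_on[OF smooth_deriv(2)[OF smooth_smooth_step], of UNIV]]) auto
  have cS: "continuous_on UNIV S" "continuous_on UNIV (deriv S)" "continuous_on UNIV (\<zeta> n)" for n
    by (intro smooth_continuous_on S dS \<zeta>_smooth)+
  have mb: "g \<in> borel_measurable ?L" if "continuous_on UNIV g" for g :: "real \<Rightarrow> real"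
    using cont_int[OF that] by simp
  define A where "A n = (\<integral>x. (PP x * deriv S x) * \<zeta> n x \<partial>?L)" for n
  define B where "B n = (\<integral>x. (PP x * S x) * \<zeta>' n x \<partial>?L)" for n
  define D where "D n = (\<integral>x. (p' x * S x) * \<zeta> n x \<partial>?L)" for n
  have AB: "A n + B n = - D n" if n: "G n" for n
  proof -
    let ?\<psi> = "\<lambda>x. S x * \<zeta> n x"
    have t: "?\<psi> \<in> test_functions {0<..<T}"
      by (rule test_functionsI[OF smooth_mult[OF S \<zeta>_smooth] compact_Icc sub[OF n]]) (use out[OF n] in auto)
    have "(?\<psi> has_real_derivative (deriv S x * \<zeta> n x + \<zeta>' n x * S x)) (at x)" for x
      by (rule DERIV_mult[OF dS(1) \<zeta>_deriv])
    then have fd: "frechet_derivative ?\<psi> (at x) 1 = deriv S x * \<zeta> n x + \<zeta>' n x * S x" for x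
      using fun_cong[OF frechet_derivative_at[of ?\<psi> _ x], of "(*) (deriv S x * \<zeta> n x + \<zeta>' n x * S x)" 1]
      by (simp add: has_field_derivative_def)
    have "(\<integral>x. p x * frechet_derivative ?\<psi> (at x) 1 \<partial>?L) = - (\<integral>x. (p' x \<bullet> 1) * ?\<psi> x \<partial>?L)"
      using w t unfolding has_weak_gradient_def by (auto simp: Basis_real_def)
    moreover have "(\<integral>x. (p' x \<bullet> 1) * ?\<psi> x \<partial>?L) = D n"
      unfolding D_def by (intro Bochner_Integration.integral_cong) (auto simp: mult_ac)
    moreover have "(\<integral>x. p x * frechet_derivative ?\<psi> (at x) 1 \<partial>?L) = (\<integral>x. (PP x * deriv S x) * \<zeta> n x + (PP x * S x) * \<zeta>' n x \<partial>?L)"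
    proof (rule integral_cong_AE)
      have "p \<in> borel_measurable ?L"
        using w by (intro locally_integrable_measurable) (auto simp: has_weak_gradient_def)
      then show "(\<lambda>x. p x * frechet_derivative ?\<psi> (at x) 1) \<in> borel_measurable ?L"
        unfolding fd by (rule borel_measurable_times[OF _ mb]) (intro continuous_intros cS \<zeta>'_cont)
      show "(\<lambda>x. (PP x * deriv S x) * \<zeta> n x + (PP x * S x) * \<zeta>' n x) \<in> borel_measurable ?L"
        by (intro mb continuous_intros PP cS \<zeta>'_cont)
      show "AE x in ?L. p x * frechet_derivative ?\<psi> (at x) 1 = (PP x * deriv S x) * \<zeta> n x + (PP x * S x) * \<zeta>' n x"
        using P(2) AE_space[of ?L]
      proof eventually_elim
        case (elim x)
        then have "p x = PP x" using PPe[of x] by simp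
        then show ?case unfolding fd by (simp add: algebra_simps)
      qed
    qed
    moreover have "\<dots> = A n + B n"
      unfolding A_def B_def
      by (intro Bochner_Integration.integral_add cont_int continuous_intros PP cS \<zeta>'_cont)
    ultimately show ?thesis by simp
  qed
  have \<zeta>_lim: "(\<lambda>n. \<zeta> n x) \<longlonglongrightarrow> indicator {0<..b} x" if x: "0 < x" for x
  proof (rule tendsto_eventually)
    have large: "\<forall>\<^sub>F n in sequentially. r \<le> real (Suc n) * e" if "e > 0" for r e :: real
    proof -
      have "filterlim (\<lambda>n. real (Suc n) * e) at_top sequentially"
        using that by (intro filterlim_at_top_mult_tendsto_pos[OF tendsto_const] filterlim_compose[OF filterlim_real_sequentially filterlim_Suc])
      then show ?thesis by (auto simp: filterlim_at_top)
    qed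
    show "\<forall>\<^sub>F n in sequentially. \<zeta> n x = indicator {0<..b} x"
    proof (cases "x \<le> b")
      case True
      from large[OF x, of 2] show ?thesis
      proof eventually_elim
        case (elim n)
        have "real (Suc n) * x + (0 - real (Suc n) * b) \<le> 0"
          using mult_left_mono[OF True, of "real (Suc n)"] by simp
        moreover have "1 \<le> real (Suc n) * x + (-1)" using elim by simp
        ultimately show ?case
          using x True by (simp only: \<zeta>_def smooth_step_eq_0 smooth_step_eq_1) simp
      qed
    next
      case False
      then have "x - b > 0" by simp
      from large[OF x, of 2] large[OF this, of 1] show ?thesis
      proof eventually_elim
        case (elim n)
        have "1 \<le> real (Suc n) * x + (0 - real (Suc n) * b)"
          using elim(2) by (simp add: right_diff_distrib)
        moreover have "1 \<le> real (Suc n) * x + (-1)" using elim(1) by simp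
        ultimately show ?case
          using x False by (simp only: \<zeta>_def smooth_step_eq_1) simp
      qed
    qed
  qed
  have dct: "(\<lambda>n. \<integral>x. g x * \<zeta> n x \<partial>?L) \<longlonglongrightarrow> (\<integral>x. g x * indicator {0<..b} x \<partial>?L)" if g: "integrable ?L g" for g
  proof (rule integral_dominated_convergence[where w="\<lambda>x. norm (g x)"])
    have [measurable]: "indicator {0<..b} \<in> borel_measurable ?L"
      by (intro measurable_restrict_space1 borel_measurable_indicator) simp
    show "(\<lambda>x. g x * indicator {0<..b} x) \<in> borel_measurable ?L"
      using borel_measurable_integrable[OF g] by measurable
    show "(\<lambda>x. g x * \<zeta> n x) \<in> borel_measurable ?L" for n
      by (rule borel_measurable_times[OF borel_measurable_integrable[OF g] mb[OF cS(3)]])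
    show "AE x in ?L. (\<lambda>n. g x * \<zeta> n x) \<longlonglongrightarrow> g x * indicator {0<..b} x"
      by (intro AE_I2 tendsto_mult tendsto_const \<zeta>_lim) auto
    show "AE x in ?L. norm (g x * \<zeta> n x) \<le> norm (g x)" for n
      using \<zeta>_bound by (intro AE_I2) (simp add: abs_mult mult_left_le)
  qed (use g in simp)
  have intA: "integrable ?L (\<lambda>x. PP x * deriv S x)"
    by (intro cont_int continuous_intros PP cS)
  have "compact (S ` {0..T})"
    by (intro compact_continuous_image continuous_on_subset[OF cS(1)]) auto
  then obtain K where K: "\<forall>x\<in>{0..T}. \<bar>S x\<bar> \<le> K"
    by (auto simp: bounded_iff dest!: compact_imp_bounded)
  have intD: "integrable ?L (\<lambda>x. p' x * S x)"
  proof (rule Bochner_Integration.integrable_bound[of _ "\<lambda>x. K * p' x"])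
    show "(\<lambda>x. p' x * S x) \<in> borel_measurable ?L"
      by (rule borel_measurable_times[OF borel_measurable_integrable[OF p'] mb[OF cS(1)]])
    show "AE x in ?L. norm (p' x * S x) \<le> norm (K * p' x)"
    proof (rule AE_I2)
      fix x assume "x \<in> space ?L"
      then have "x \<in> {0..T}" by auto
      then have "\<bar>S x\<bar> \<le> \<bar>K\<bar>" using bspec[OF K, of x] by linarith
      then show "norm (p' x * S x) \<le> norm (K * p' x)"
        by (simp add: abs_mult mult.commute mult_right_mono)
    qed
  qed (use p' in simp)
  \<comment> \<open>The rising ramp contributes the value at 0 with a plus sign, the falling ramp
    the value at b with a minus sign.\<close>
  have B_lim: "B \<longlonglongrightarrow> PP 0 * S 0 - PP b * S b"
  proof -
    let ?H = "\<lambda>x. PP x * S x"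
    have H: "continuous_on UNIV ?H" by (intro continuous_intros PP cS)
    let ?I = "\<lambda>e n. \<integral>x. ?H x * (real (Suc n) * deriv smooth_step (real (Suc n) * x + e)) \<partial>lborel"
    have "(\<lambda>n. ?I (-1) n) \<longlonglongrightarrow> ?H 0"
      by (rule smooth_step_deriv_concentrates[OF H, where off="-1"]) simp
    moreover have "(\<lambda>n. ?I (0 - real (Suc n) * b) n) \<longlonglongrightarrow> ?H b"
      by (rule smooth_step_deriv_concentrates[OF H, where off=0]) simp
    ultimately have "(\<lambda>n. ?I (-1) n - ?I (0 - real (Suc n) * b) n) \<longlonglongrightarrow> ?H 0 - ?H b"
      by (rule tendsto_diff)
    moreover have "\<forall>\<^sub>F n in sequentially. ?I (-1) n - ?I (0 - real (Suc n) * b) n = B n"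
      using G_ev
    proof eventually_elim
      case (elim n)
      have int: "integrable lborel (\<lambda>x. ?H x * (real (Suc n) * deriv smooth_step (real (Suc n) * x + e)))" for e
      proof -
        have "integrable lborel (\<lambda>x. indicator {- e / real (Suc n)..(1 - e) / real (Suc n)} x *\<^sub>R
            (?H x * (real (Suc n) * deriv smooth_step (real (Suc n) * x + e))))"
          by (intro borel_integrable_compact compact_Icc continuous_intros continuous_on_subset[OF PP]
              continuous_on_subset[OF cS(1)]
              continuous_on_compose2[OF smooth_continuous_on[OF smooth_deriv(2)[OF smooth_smooth_step], of UNIV]]) auto
        also have "(\<lambda>x. indicator {- e / real (Suc n)..(1 - e) / real (Suc n)} x *\<^sub>R
            (?H x * (real (Suc n) * deriv smooth_step (real (Suc n) * x + e)))) =
            (\<lambda>x. ?H x * (real (Suc n) * deriv smooth_step (real (Suc n) * x + e)))"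
        proof
          fix x
          show "indicator {- e / real (Suc n)..(1 - e) / real (Suc n)} x *\<^sub>R
            (?H x * (real (Suc n) * deriv smooth_step (real (Suc n) * x + e))) =
            ?H x * (real (Suc n) * deriv smooth_step (real (Suc n) * x + e))"
          proof (cases "x \<in> {- e / real (Suc n)..(1 - e) / real (Suc n)}")
            case False
            then have "real (Suc n) * x + e \<notin> {0..1}"
              by (simp add: field_simps)
            then have "deriv smooth_step (real (Suc n) * x + e) = 0" by (rule smooth_step_deriv_eq_0)
            then show ?thesis by simp
          qed simp
        qed
        finally show ?thesis .
      qed
      have "?I (-1) n - ?I (0 - real (Suc n) * b) n = (\<integral>x. ?H x * \<zeta>' n x \<partial>lborel)"
        unfolding \<zeta>'_def right_diff_distrib
        by (rule Bochner_Integration.integral_diff[symmetric, OF int int])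
      also have "\<dots> = (\<integral>x. ?H x * \<zeta>' n x \<partial>?L)"
      proof (rule integrable_lebesgue_on_iff_lborel(2)[symmetric])
        show "(\<lambda>x. ?H x * \<zeta>' n x) \<in> borel_measurable borel"
          by (intro borel_measurable_continuous_onI continuous_on_mult H \<zeta>'_cont)
        show "?H x * \<zeta>' n x = 0" if "x \<notin> {0<..<T}" for x
        proof -
          have "x \<notin> {1 / real (Suc n)..b + 1 / real (Suc n)}" using sub[OF elim] that by blast
          from \<zeta>'_zero[OF elim this] show ?thesis by simp
        qed
      qed simp
      finally show ?case by (simp add: B_def)
    qed
    ultimately show ?thesis by (rule Lim_transform_eventually)
  qed
  have "(\<lambda>n. A n + B n) \<longlonglongrightarrow> (\<integral>x. (PP x * deriv S x) * indicator {0<..b} x \<partial>?L) + (PP 0 * S 0 - PP b * S b)"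
    using dct[OF intA] unfolding A_def[symmetric] by (intro tendsto_add B_lim)
  moreover have "(\<lambda>n. - D n) \<longlonglongrightarrow> - (\<integral>x. (p' x * S x) * indicator {0<..b} x \<partial>?L)"
    using dct[OF intD] unfolding D_def[symmetric] by (rule tendsto_minus)
  then have "(\<lambda>n. A n + B n) \<longlonglongrightarrow> - (\<integral>x. (p' x * S x) * indicator {0<..b} x \<partial>?L)"
    by (rule Lim_transform_eventually) (use G_ev in \<open>auto elim!: eventually_mono simp: AB\<close>)
  ultimately have "(\<integral>x. (PP x * deriv S x) * indicator {0<..b} x \<partial>?L) + (PP 0 * S 0 - PP b * S b) =
      - (\<integral>x. (p' x * S x) * indicator {0<..b} x \<partial>?L)"
    by (rule LIMSEQ_unique)
  then have "PP b * S b - PP 0 * S 0 = (\<integral>x. (p' x * S x) * indicator {0<..b} x \<partial>?L) + (\<integral>x. (PP x * deriv S x) * indicator {0<..b} x \<partial>?L)"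
    by simp
  also have "\<dots> = (\<integral>x. (p' x * S x) * indicator {0<..b} x + (PP x * deriv S x) * indicator {0<..b} x \<partial>?L)"
  proof (rule Bochner_Integration.integral_add[symmetric])
    have "integrable ?L (\<lambda>x. g x * indicator {0<..b} x)" if g: "integrable ?L g" for g :: "real \<Rightarrow> real"
    proof (rule Bochner_Integration.integrable_bound[OF g])
      have [measurable]: "indicator {0<..b} \<in> borel_measurable ?L"
        by (intro measurable_restrict_space1 borel_measurable_indicator) simp
      show "(\<lambda>x. g x * indicator {0<..b} x) \<in> borel_measurable ?L"
        using borel_measurable_integrable[OF g] by measurable
    qed (auto simp: indicator_def)
    then show "integrable ?L (\<lambda>x. (p' x * S x) * indicator {0<..b} x)"
      "integrable ?L (\<lambda>x. (PP x * deriv S x) * indicator {0<..b} x)"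
      using intA intD by blast+
  qed
  also have "\<dots> = (\<integral>x. indicator {0<..b} x * (p' x * S x + P x * deriv S x) \<partial>?L)"
    by (intro Bochner_Integration.integral_cong) (auto simp: PPe algebra_simps)
  finally show ?thesis
    using PPe[of b] PPe[of 0] b by simp
qed

text \<open>Duhamel's formula for \<open>p'' + \<kappa> p = F\<close>, obtained from the multipliers
  \<open>cos (\<omega> (t - x))\<close> and \<open>sin (\<omega> (t - x))\<close> with \<open>\<omega>\<^sup>2 = \<kappa>\<close>.\<close>

lemma wave_mode_bound:
  fixes p q r F P Q :: "real \<Rightarrow> real"
  assumes w1: "has_weak_gradient {0<..<T} p q" and w2: "has_weak_gradient {0<..<T} q r"
    and P: "continuous_on {0..T} P" "AE t in lebesgue_on {0<..<T}. p t = P t"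
    and Q: "continuous_on {0..T} Q" "AE t in lebesgue_on {0<..<T}. q t = Q t"
    and r: "integrable (lebesgue_on {0<..<T}) r"
    and F: "F \<in> L2 (lebesgue_on {0<..<T})" "AE t in lebesgue_on {0<..<T}. r t = F t - \<kappa> * P t"
    and \<kappa>: "0 \<le> \<kappa>" and t: "0 < t" "t < T"
  shows "\<kappa> * (P t)\<^sup>2 \<le> 3 * (\<kappa> * (P 0)\<^sup>2 + (Q 0)\<^sup>2 + T * (L2_norm (lebesgue_on {0<..<T}) F)\<^sup>2)"
proof -
  let ?L = "lebesgue_on {0<..<T}"
  define \<omega> where "\<omega> = sqrt \<kappa>"
  have \<omega>: "\<omega>\<^sup>2 = \<kappa>" using \<kappa> by (simp add: \<omega>_def)
  \<comment> \<open>The multipliers satisfy S1' = \<omega> S2 and S2' = - \<omega> S1, with S1 = 1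
    and S2 = 0 at time t. So P(t) appears in the first identity while the unknown velocity Q(t)
    drops out of the second.\<close>
  define S1 where "S1 x = cos ((- \<omega>) * x + \<omega> * t)" for x
  define S2 where "S2 x = sin ((- \<omega>) * x + \<omega> * t)" for x
  have s: "smooth S1" "smooth S2"
    unfolding S1_def S2_def by (intro smooth_affine smooth_sin_cos bounded_linear_mult_right)+
  have dS1: "deriv S1 x = \<omega> * S2 x" for x
    unfolding S1_def[abs_def] S2_def by (rule DERIV_imp_deriv) (auto intro!: derivative_eq_intros)
  have dS2: "deriv S2 x = - \<omega> * S1 x" for x
    unfolding S2_def[abs_def] S1_def by (rule DERIV_imp_deriv) (auto intro!: derivative_eq_intros)
  have qm: "q \<in> borel_measurable ?L"
    using w1 w2 by (intro locally_integrable_measurable) (auto simp: has_weak_gradient_def)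
  have qi: "integrable ?L q"
    by (rule integrable_cong_AE_imp[OF integrable_continuous_open_interval[OF Q(1)] qm])
      (use Q(2) in \<open>auto elim!: eventually_mono\<close>)
  let ?ind = "indicator {0<..t} :: real \<Rightarrow> real"
  have [measurable]: "?ind \<in> borel_measurable ?L"
    by (intro measurable_restrict_space1 borel_measurable_indicator) simp
  have int: "integrable ?L (\<lambda>x. ?ind x * (g x * S x))"
    if g: "integrable ?L g" and S: "S \<in> borel_measurable borel" "\<And>x. \<bar>S x\<bar> \<le> 1" for g S
  proof (rule Bochner_Integration.integrable_bound[OF g])
    have "S \<in> borel_measurable ?L"
      by (intro measurable_restrict_space1 measurable_completion) (simp add: S)
    then show "(\<lambda>x. ?ind x * (g x * S x)) \<in> borel_measurable ?L"
      using borel_measurable_integrable[OF g] by measurable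
    show "AE x in ?L. norm (?ind x * (g x * S x)) \<le> norm (g x)"
      using S(2) by (intro AE_I2) (auto simp: abs_mult indicator_def mult_left_le)
  qed
  have b: "\<bar>S1 x\<bar> \<le> 1" "\<bar>S2 x\<bar> \<le> 1" for x
    by (auto simp: S1_def S2_def)
  note sm = smooth_borel_measurable[OF s(1)] smooth_borel_measurable[OF s(2)]
  note Pi = integrable_continuous_open_interval[OF P(1)] and Qi = integrable_continuous_open_interval[OF Q(1)]
  note i1 = int[OF qi sm(1) b(1)] int[OF Pi sm(2) b(2)] int[OF r sm(2) b(2)] int[OF Qi sm(1) b(1)]
  have "P t * S1 t - P 0 * S1 0 = (\<integral>x. ?ind x * (q x * S1 x + P x * deriv S1 x) \<partial>?L)"
    by (rule weak_derivative_multiplier[OF w1 qi P s(1) t])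
  also have "\<dots> = (\<integral>x. ?ind x * (q x * S1 x) + \<omega> * (?ind x * (P x * S2 x)) \<partial>?L)"
    by (intro Bochner_Integration.integral_cong) (auto simp: dS1 algebra_simps)
  also have "\<dots> = (\<integral>x. ?ind x * (q x * S1 x) \<partial>?L) + \<omega> * (\<integral>x. ?ind x * (P x * S2 x) \<partial>?L)"
    using i1 by simp
  also have "(\<integral>x. ?ind x * (q x * S1 x) \<partial>?L) = (\<integral>x. ?ind x * (Q x * S1 x) \<partial>?L)"
    by (intro integral_cong_AE borel_measurable_integrable i1) (use Q(2) in \<open>auto elim!: eventually_mono\<close>)
  finally have e1: "P t - P 0 * S1 0 = (\<integral>x. ?ind x * (Q x * S1 x) \<partial>?L) + \<omega> * (\<integral>x. ?ind x * (P x * S2 x) \<partial>?L)"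
    by (simp add: S1_def)
  have "Q t * S2 t - Q 0 * S2 0 = (\<integral>x. ?ind x * (r x * S2 x + Q x * deriv S2 x) \<partial>?L)"
    by (rule weak_derivative_multiplier[OF w2 r Q s(2) t])
  also have "\<dots> = (\<integral>x. ?ind x * (r x * S2 x) - \<omega> * (?ind x * (Q x * S1 x)) \<partial>?L)"
    by (intro Bochner_Integration.integral_cong) (auto simp: dS2 algebra_simps)
  also have "\<dots> = (\<integral>x. ?ind x * (r x * S2 x) \<partial>?L) - \<omega> * (\<integral>x. ?ind x * (Q x * S1 x) \<partial>?L)"
    using i1 by simp
  finally have e2: "- Q 0 * S2 0 = (\<integral>x. ?ind x * (r x * S2 x) \<partial>?L) - \<omega> * (\<integral>x. ?ind x * (Q x * S1 x) \<partial>?L)"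
    by (simp add: S2_def)
  have one: "(\<lambda>x. 1 :: real) \<in> L2 ?L" "(L2_norm ?L (\<lambda>x. 1 :: real))\<^sup>2 = T"
    using integrable_continuous_open_interval[of T "\<lambda>x. 1"] t
    by (auto simp: L2_def L2_norm_sq measure_restrict_space)
  have Fi: "integrable ?L F"
    using L2_inner_integrable[OF F(1) one(1)] by simp
  have "(\<integral>x. ?ind x * (r x * S2 x) \<partial>?L) = (\<integral>x. ?ind x * (F x * S2 x) - \<omega>\<^sup>2 * (?ind x * (P x * S2 x)) \<partial>?L)"
  proof (rule integral_cong_AE)
    show "(\<lambda>x. ?ind x * (r x * S2 x)) \<in> borel_measurable ?L"
      by (rule borel_measurable_integrable[OF i1(3)])
    show "(\<lambda>x. ?ind x * (F x * S2 x) - \<omega>\<^sup>2 * (?ind x * (P x * S2 x))) \<in> borel_measurable ?L"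
      using borel_measurable_integrable[OF i1(2)] borel_measurable_integrable[OF int[OF Fi sm(2) b(2)]]
      by (intro borel_measurable_diff borel_measurable_times[OF borel_measurable_const])
    show "AE x in ?L. ?ind x * (r x * S2 x) = ?ind x * (F x * S2 x) - \<omega>\<^sup>2 * (?ind x * (P x * S2 x))"
      using F(2)
    proof eventually_elim
      case (elim x)
      show ?case unfolding elim \<omega> by (simp add: algebra_simps)
    qed
  qed
  also have "\<dots> = (\<integral>x. ?ind x * (F x * S2 x) \<partial>?L) - \<omega>\<^sup>2 * (\<integral>x. ?ind x * (P x * S2 x) \<partial>?L)"
    using i1 int[OF Fi sm(2) b(2)] by simp
  finally have e3: "(\<integral>x. ?ind x * (r x * S2 x) \<partial>?L) = (\<integral>x. ?ind x * (F x * S2 x) \<partial>?L) - \<omega>\<^sup>2 * (\<integral>x. ?ind x * (P x * S2 x) \<partial>?L)" .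
  define J where "J = (\<integral>x. ?ind x * (F x * S2 x) \<partial>?L)"
  \<comment> \<open>Multiplied by \<omega>, the first identity combines with the second so that the
    integrals over Q and over P both cancel. Nothing is divided by \<omega>, so \<kappa> = 0 is
    covered.\<close>
  have "\<omega> * P t = \<omega> * (P t - P 0 * S1 0) + \<omega> * (P 0 * S1 0)" by (simp add: algebra_simps)
  also have "\<omega> * (P t - P 0 * S1 0) = J + Q 0 * S2 0"
    unfolding e1 using e2 unfolding e3 J_def[symmetric] by (simp add: algebra_simps power2_eq_square)
  finally have main: "\<omega> * P t = J + Q 0 * S2 0 + \<omega> * (P 0 * S1 0)" .
  have J: "J\<^sup>2 \<le> T * (L2_norm ?L F)\<^sup>2"
  proof -
    have "\<bar>J\<bar> \<le> (\<integral>x. norm (?ind x * (F x * S2 x)) \<partial>?L)"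
      unfolding J_def real_norm_def[symmetric] by (rule integral_norm_bound)
    also have "\<dots> \<le> (\<integral>x. norm (F x) * norm (1 :: real) \<partial>?L)"
    proof (rule integral_mono)
      show "integrable ?L (\<lambda>x. norm (?ind x * (F x * S2 x)))"
        by (rule integrable_norm[OF int[OF Fi sm(2) b(2)]])
      show "integrable ?L (\<lambda>x. norm (F x) * norm (1 :: real))"
        using Fi by simp
      show "norm (?ind x * (F x * S2 x)) \<le> norm (F x) * norm (1 :: real)" for x
        using b(2)[of x] by (auto simp: abs_mult indicator_def mult_left_le)
    qed
    also have "\<dots> \<le> L2_norm ?L F * L2_norm ?L (\<lambda>x. 1 :: real)"
      by (rule L2_Cauchy_Schwarz[OF F(1) one(1)])
    finally have "J\<^sup>2 \<le> (L2_norm ?L F * L2_norm ?L (\<lambda>x. 1 :: real))\<^sup>2"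
      by (simp add: abs_le_square_iff[symmetric] L2_norm_nonneg)
    then show ?thesis by (simp add: power_mult_distrib one(2) mult.commute)
  qed
  have three: "(a + b + c)\<^sup>2 \<le> 3 * (a\<^sup>2 + b\<^sup>2 + c\<^sup>2)" for a b c :: real
    using sum_squares_bound[of a b] sum_squares_bound[of a c] sum_squares_bound[of b c]
    by (simp add: power2_eq_square algebra_simps)
  have "\<kappa> * (P t)\<^sup>2 = (\<omega> * P t)\<^sup>2"
    by (simp add: power_mult_distrib \<omega>)
  also have "\<dots> \<le> 3 * (J\<^sup>2 + (Q 0 * S2 0)\<^sup>2 + (\<omega> * (P 0 * S1 0))\<^sup>2)"
    unfolding main by (rule three)
  also have "\<dots> \<le> 3 * (T * (L2_norm ?L F)\<^sup>2 + (Q 0)\<^sup>2 + \<kappa> * (P 0)\<^sup>2)"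
  proof -
    have "(Q 0 * S2 0)\<^sup>2 \<le> (Q 0)\<^sup>2"
      using abs_square_le_1[of "S2 0"] b(2)[of 0] by (simp add: power_mult_distrib mult_left_le)
    moreover have "(\<omega> * (P 0 * S1 0))\<^sup>2 \<le> \<kappa> * (P 0)\<^sup>2"
      using abs_square_le_1[of "S1 0"] b(1)[of 0] \<kappa>
      by (simp add: power_mult_distrib \<omega> mult_left_mono mult_left_le)
    ultimately show ?thesis using J by simp
  qed
  finally show ?thesis by (simp add: algebra_simps)
qed

section \<open>The energy of weak solutions\<close>

lemma sums_tail_tendsto_0:
  fixes a :: "nat \<Rightarrow> real"
  assumes "summable a"
  shows "(\<lambda>j. if j < n then 0 else a j) sums (suminf a - (\<Sum>j<n. a j))"
    and "(\<lambda>n. suminf a - (\<Sum>j<n. a j)) \<longlonglongrightarrow> 0"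
proof -
  have "(\<lambda>j. if j \<in> {..<n} then a j else 0) sums (\<Sum>j\<in>{..<n}. a j)"
    by (rule sums_If_finite_set) simp
  from sums_diff[OF summable_sums[OF assms] this]
  show "(\<lambda>j. if j < n then 0 else a j) sums (suminf a - (\<Sum>j<n. a j))"
    by (rule sums_cong[THEN iffD1, rotated]) auto
  show "(\<lambda>n. suminf a - (\<Sum>j<n. a j)) \<longlonglongrightarrow> 0"
    using tendsto_diff[OF tendsto_const[of "suminf a"] summable_LIMSEQ[OF assms]] by simp
qed

section \<open>The scale \<open>HH s\<close>, its dual and expansions in the eigenbasis\<close>

context dirichlet_cylinder
begin

abbreviation "HHs \<equiv> HH \<Omega> lam \<phi> s"
abbreviation "nrm \<equiv> HH_norm \<Omega> lam \<phi> s"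
abbreviation "HHd \<equiv> HH_dual \<Omega> lam \<phi> s"
abbreviation "dnrm \<equiv> HH_dual_norm \<Omega> lam \<phi> s"
abbreviation cf_k :: "(real^'n \<Rightarrow> real) \<Rightarrow> nat \<Rightarrow> real" where "cf_k w k \<equiv> L2_inner \<mu> w (\<phi> k)"

lemma HHs_iff: "w \<in> HHs \<longleftrightarrow> w \<in> L2 \<mu> \<and> summable (\<lambda>k. lam k powr s * (cf_k w k)\<^sup>2)"
  by (simp add: HH_def)

lemma nrm_sq: "w \<in> HHs \<Longrightarrow> (nrm w)\<^sup>2 = (\<Sum>k. lam k powr s * (cf_k w k)\<^sup>2)"
  by (simp add: HHs_iff HH_norm_def suminf_nonneg)

lemma nrm_nonneg: "0 \<le> nrm w" if "w \<in> HHs"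
  using that by (simp add: HHs_iff HH_norm_def suminf_nonneg)

lemma coeff_scale_phi: "cf_k (\<lambda>x. r * \<phi> k x) j = (if j = k then r else 0)"
  by (simp add: L2_inner_cmult basis.ortho)

lemma scaled_phi_HH: "(\<lambda>x. r * \<phi> k x) \<in> HHs" "nrm (\<lambda>x. r * \<phi> k x) = \<bar>r\<bar> * sqrt (lam k powr s)"
proof -
  have "(\<lambda>j. if j = k then lam j powr s * r\<^sup>2 else 0) sums (lam k powr s * r\<^sup>2)"
    by (rule sums_single)
  then have *: "(\<lambda>j. lam j powr s * (cf_k (\<lambda>x. r * \<phi> k x) j)\<^sup>2) sums (lam k powr s * r\<^sup>2)"
    by (rule sums_cong[THEN iffD1, rotated]) (auto simp: coeff_scale_phi)
  then show "(\<lambda>x. r * \<phi> k x) \<in> HHs"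
    by (auto simp: HHs_iff L2_cmult basis.phi_L2 sums_summable)
  show "nrm (\<lambda>x. r * \<phi> k x) = \<bar>r\<bar> * sqrt (lam k powr s)"
    unfolding HH_norm_def sums_unique[OF *, symmetric] by (simp add: real_sqrt_mult)
qed

lemma phi_HH: "\<phi> k \<in> HHs" "nrm (\<phi> k) = sqrt (lam k powr s)" "0 < nrm (\<phi> k)"
  using scaled_phi_HH[of 1 k] lam_pos[of k] by simp_all

lemma partial_sum_HH: "(\<lambda>x. \<Sum>k<n. r k * \<phi> k x) \<in> HHs"
proof -
  have "summable (\<lambda>j. lam j powr s * (cf_k (\<lambda>x. \<Sum>k<n. r k * \<phi> k x) j)\<^sup>2)"
    by (rule summable_finite[of "{..<n}"]) (auto simp: basis.coeff_partial_sum)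
  then show ?thesis by (simp add: HHs_iff basis.partial_sum_L2)
qed

lemma HHd_linear:
  assumes "F \<in> HHd" "u \<in> HHs" "v \<in> HHs"
  shows "F (\<lambda>x. a * u x + b * v x) = a * F u + b * F v"
  using assms unfolding HH_dual_def dual_space_def by blast

lemma HHd_bound:
  assumes "F \<in> HHd"
  obtains B where "0 \<le> B" "\<forall>v\<in>HHs. \<bar>F v\<bar> \<le> B * nrm v"
proof -
  obtain B where B: "\<forall>v\<in>HHs. \<bar>F v\<bar> \<le> B * nrm v"
    using assms unfolding HH_dual_def dual_space_def by blast
  have "\<forall>v\<in>HHs. \<bar>F v\<bar> \<le> \<bar>B\<bar> * nrm v"
  proof
    fix v assume v: "v \<in> HHs"
    have "B * nrm v \<le> \<bar>B\<bar> * nrm v" using nrm_nonneg[OF v] by (intro mult_right_mono) auto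
    with B v show "\<bar>F v\<bar> \<le> \<bar>B\<bar> * nrm v" by force
  qed
  then show thesis using that[of "\<bar>B\<bar>"] by simp
qed

lemma HHd_scale_phi:
  assumes "F \<in> HHd"
  shows "F (\<lambda>x. r * \<phi> k x) = r * F (\<phi> k)"
  using HHd_linear[OF assms phi_HH(1) phi_HH(1), of r k 0 k] by simp

lemma HHd_zero: "F \<in> HHd \<Longrightarrow> F (\<lambda>x. 0) = 0"
  using HHd_scale_phi[of F 0 0] by simp

lemma HHd_partial_sum:
  assumes "F \<in> HHd"
  shows "F (\<lambda>x. \<Sum>k<n. r k * \<phi> k x) = (\<Sum>k<n. r k * F (\<phi> k))"
proof (induction n)
  case 0
  then show ?case by (simp add: HHd_zero[OF assms])
next
  case (Suc n)
  then show ?case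
    using HHd_linear[OF assms partial_sum_HH[where n=n and r=r] phi_HH(1)[of n], of 1 "r n"] by simp
qed

lemma HHd_phi_bound:
  assumes "F \<in> HHd"
  shows "\<bar>F (\<phi> k)\<bar> \<le> dnrm F * nrm (\<phi> k)"
proof -
  obtain B where B: "0 \<le> B" "\<forall>v\<in>HHs. \<bar>F v\<bar> \<le> B * nrm v"
    by (rule HHd_bound[OF assms])
  let ?v = "\<lambda>x. (1 / nrm (\<phi> k)) * \<phi> k x"
  have v: "?v \<in> HHs" "nrm ?v \<le> 1"
    using scaled_phi_HH[of "1 / nrm (\<phi> k)" k] phi_HH(3)[of k] by (auto simp: phi_HH(2)[of k])
  \<comment> \<open>The dual norm is a supremum of reals, which bounds its members only if the set
    is bounded above; boundedness of F provides this.\<close>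
  have "bdd_above ((\<lambda>v. \<bar>F v\<bar>) ` {v \<in> HHs. nrm v \<le> 1})"
  proof (rule bdd_aboveI2)
    fix v assume v: "v \<in> {v \<in> HHs. nrm v \<le> 1}"
    then have "\<bar>F v\<bar> \<le> B * nrm v" using B by blast
    also have "\<dots> \<le> B * 1" using v B by (intro mult_left_mono) auto
    finally show "\<bar>F v\<bar> \<le> B" by simp
  qed
  then have "\<bar>F ?v\<bar> \<le> dnrm F"
    unfolding HH_dual_norm_def dual_norm_def using v by (intro cSUP_upper) auto
  then have "\<bar>F (\<phi> k)\<bar> / nrm (\<phi> k) \<le> dnrm F"
    unfolding HHd_scale_phi[OF assms] using phi_HH(3)[of k] by (simp add: abs_mult)
  then show ?thesis
    using phi_HH(3)[of k] by (simp add: divide_le_eq)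
qed

lemma HHd_diff:
  assumes "F \<in> HHd" "G \<in> HHd"
  shows "(\<lambda>w. F w - G w) \<in> HHd"
proof -
  obtain B where B: "0 \<le> B" "\<forall>v\<in>HHs. \<bar>F v\<bar> \<le> B * nrm v" by (rule HHd_bound[OF assms(1)])
  obtain B' where B': "0 \<le> B'" "\<forall>v\<in>HHs. \<bar>G v\<bar> \<le> B' * nrm v" by (rule HHd_bound[OF assms(2)])
  have "\<bar>F v - G v\<bar> \<le> (B + B') * nrm v" if "v \<in> HHs" for v
  proof -
    have "\<bar>F v\<bar> \<le> B * nrm v" "\<bar>G v\<bar> \<le> B' * nrm v" using B B' that by auto
    then show ?thesis by (simp add: distrib_right)
  qed
  moreover have "F (\<lambda>x. a * u x + b * v x) - G (\<lambda>x. a * u x + b * v x) = a * (F u - G u) + b * (F v - G v)"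
    if "u \<in> HHs" "v \<in> HHs" for u v a b
    using HHd_linear[OF assms(1) that] HHd_linear[OF assms(2) that] by (simp add: algebra_simps)
  ultimately show ?thesis
    unfolding HH_dual_def dual_space_def by blast
qed

text \<open>Every eigenvalue is at least the first one, which is positive.\<close>

lemma L2_norm_le_nrm:
  assumes "w \<in> HHs"
  shows "(L2_norm \<mu> w)\<^sup>2 \<le> lam 0 powr (- s) * (nrm w)\<^sup>2"
proof -
  have w: "w \<in> L2 \<mu>" "summable (\<lambda>k. lam k powr s * (cf_k w k)\<^sup>2)" using assms by (auto simp: HHs_iff)
  have le: "(cf_k w k)\<^sup>2 \<le> lam 0 powr (- s) * (lam k powr s * (cf_k w k)\<^sup>2)" for k
  proof -
    have "lam 0 powr s \<le> lam k powr s"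
      using lam_mono[of 0 k] lam_pos[of 0] s_pos by (intro powr_mono2) auto
    then have "1 \<le> lam 0 powr (- s) * lam k powr s"
      using lam_pos[of 0] by (simp add: powr_minus field_simps)
    then have "1 * (cf_k w k)\<^sup>2 \<le> (lam 0 powr (- s) * lam k powr s) * (cf_k w k)\<^sup>2"
      by (intro mult_right_mono) auto
    then show ?thesis by (simp add: mult.assoc)
  qed
  have "(L2_norm \<mu> w)\<^sup>2 = (\<Sum>k. (cf_k w k)\<^sup>2)"
    using sums_unique[OF basis.Parseval[OF w(1)]] .
  also have "\<dots> \<le> (\<Sum>k. lam 0 powr (- s) * (lam k powr s * (cf_k w k)\<^sup>2))"
    by (intro suminf_le le sums_summable[OF basis.Parseval[OF w(1)]] summable_mult w(2))
  also have "\<dots> = lam 0 powr (- s) * (nrm w)\<^sup>2"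
    by (simp add: suminf_mult[OF w(2)] nrm_sq[OF assms])
  finally show ?thesis .
qed

lemma L2_inner_HHd:
  assumes w0: "w0 \<in> L2 \<mu>"
  shows "L2_inner \<mu> w0 \<in> HHd"
  unfolding HH_dual_def dual_space_def
proof (intro CollectI conjI ballI allI exI[of _ "L2_norm \<mu> w0 * sqrt (lam 0 powr (- s))"])
  fix u v a b assume "u \<in> HHs" "v \<in> HHs"
  then show "L2_inner \<mu> w0 (\<lambda>x. a * u x + b * v x) = a * L2_inner \<mu> w0 u + b * L2_inner \<mu> w0 v"
    by (simp add: HHs_iff L2_inner_commute[of \<mu> w0] L2_inner_add L2_inner_cmult L2_cmult w0)
next
  fix v assume v: "v \<in> HHs"
  have "L2_norm \<mu> v \<le> sqrt (lam 0 powr (- s) * (nrm v)\<^sup>2)"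
    by (rule real_le_rsqrt[OF L2_norm_le_nrm[OF v]])
  also have "\<dots> = sqrt (lam 0 powr (- s)) * nrm v"
    by (simp add: real_sqrt_mult nrm_nonneg[OF v])
  finally have n: "L2_norm \<mu> v \<le> sqrt (lam 0 powr (- s)) * nrm v" .
  have "\<bar>L2_inner \<mu> w0 v\<bar> \<le> L2_norm \<mu> w0 * L2_norm \<mu> v"
    using v by (intro L2_inner_bound w0) (simp add: HHs_iff)
  also have "\<dots> \<le> L2_norm \<mu> w0 * (sqrt (lam 0 powr (- s)) * nrm v)"
    by (intro mult_left_mono n L2_norm_nonneg)
  finally show "\<bar>L2_inner \<mu> w0 v\<bar> \<le> L2_norm \<mu> w0 * sqrt (lam 0 powr (- s)) * nrm v"
    by (simp add: mult.assoc)
qed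

text \<open>F is continuous in the norm of \<open>HH s\<close>, so the remainder of the expansion is
  measured there: its squared norm is the tail of the series defining the norm of u.\<close>

lemma HHd_expansion:
  assumes F: "F \<in> HHd" and u: "u \<in> HHs"
  shows "(\<lambda>k. cf_k u k * F (\<phi> k)) sums F u"
proof -
  obtain B where B: "0 \<le> B" "\<forall>v\<in>HHs. \<bar>F v\<bar> \<le> B * nrm v" by (rule HHd_bound[OF F])
  let ?a = "\<lambda>k. lam k powr s * (cf_k u k)\<^sup>2"
  have uL: "u \<in> L2 \<mu>" "summable ?a" using u by (auto simp: HHs_iff)
  note tail = sums_tail_tendsto_0[OF uL(2)]
  define S where "S n x = (\<Sum>k<n. cf_k u k * \<phi> k x)" for n x
  have S: "S n \<in> HHs" "S n \<in> L2 \<mu>" for n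
    unfolding S_def by (rule partial_sum_HH, rule basis.partial_sum_L2)
  \<comment> \<open>The coefficients 1 and -1 are kept to match the form in which linearity is
    stated in \<open>dual_space\<close>.\<close>
  define R where "R n x = 1 * u x + (-1) * S n x" for n x
  have Req: "R n = (\<lambda>x. u x - S n x)" for n by (auto simp: R_def)
  have cR: "cf_k (R n) j = (if j < n then 0 else cf_k u j)" for n j
    unfolding Req L2_inner_diff[OF uL(1) S(2) basis.phi_L2]
    unfolding S_def basis.coeff_partial_sum by simp
  have sR: "(\<lambda>j. lam j powr s * (cf_k (R n) j)\<^sup>2) sums (suminf ?a - (\<Sum>j<n. ?a j))" for n
    using tail(1)[of n] by (rule sums_cong[THEN iffD1, rotated]) (simp add: cR)
  have RHH: "R n \<in> HHs" for n
    unfolding HHs_iff using sums_summable[OF sR] L2_diff[OF uL(1) S(2)] by (simp add: Req)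
  have nR: "nrm (R n) = sqrt (suminf ?a - (\<Sum>j<n. ?a j))" for n
    unfolding HH_norm_def using sums_unique[OF sR[of n]] by simp
  have "(\<lambda>n. F (R n)) \<longlonglongrightarrow> 0"
  proof (rule Lim_null_comparison)
    show "\<forall>\<^sub>F n in sequentially. norm (F (R n)) \<le> B * sqrt (suminf ?a - (\<Sum>j<n. ?a j))"
      using B RHH by (simp add: nR[symmetric])
    have "(\<lambda>n. B * sqrt (suminf ?a - (\<Sum>j<n. ?a j))) \<longlonglongrightarrow> B * sqrt 0"
      by (intro tendsto_intros tail(2))
    then show "(\<lambda>n. B * sqrt (suminf ?a - (\<Sum>j<n. ?a j))) \<longlonglongrightarrow> 0" by simp
  qed
  moreover have "F (R n) = F u - (\<Sum>k<n. cf_k u k * F (\<phi> k))" for n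
  proof -
    have "F (R n) = 1 * F u + (-1) * F (S n)"
      unfolding R_def by (rule HHd_linear[OF F u S(1)])
    moreover have "F (S n) = (\<Sum>k<n. cf_k u k * F (\<phi> k))"
      unfolding S_def by (rule HHd_partial_sum[OF F])
    ultimately show ?thesis by simp
  qed
  ultimately have "(\<lambda>n. F u - (\<Sum>k<n. cf_k u k * F (\<phi> k))) \<longlonglongrightarrow> 0" by simp
  from tendsto_diff[OF tendsto_const[of "F u"] this] show ?thesis
    by (simp add: sums_def)
qed

lemma d_const_pos: "0 < d_const s"
  unfolding d_const_def using s_pos s_less by (intro divide_pos_pos mult_pos_pos Gamma_real_pos) auto

text \<open>\<open>F\<close> is the functional \<open>f(t) - \<partial>\<^sub>t\<^sup>2 tr U(t)\<close> at a fixed time.\<close>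

lemma harmonic_conormal:
  assumes F: "F \<in> HHd" and tr: "has_trace \<alpha> \<Omega> W u"
    and eq: "\<forall>v w. has_trace \<alpha> \<Omega> v w \<longrightarrow> a_form \<Omega> A c s W v = F w"
  shows "has_conormal W k (d_const s * F (\<phi> k))"
    and "(\<lambda>k. (d_const s * F (\<phi> k)) * cf_k u k) sums cf.form (jet cyl W) (jet cyl W)"
proof -
  note WL = has_trace_L2(1)[OF tr]
  have form: "cf.form (jet cyl W) (jet cyl v) = d_const s * F w" if "has_trace \<alpha> \<Omega> v w" for v w
    using eq that d_const_pos unfolding a_form_eq by (simp add: field_simps)
  show "has_conormal W k (d_const s * F (\<phi> k))"
    unfolding has_conormal_def
  proof
    fix q :: "real \<Rightarrow> real" assume q: "q \<in> test_functions UNIV"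
    note T = has_trace_tensor[OF phi_H10[of k] q]
    have "cf.form (jet cyl W) (mode_jet k q) = cf.form (jet cyl W) (jet cyl (\<lambda>z. q (snd z) * \<phi> k (fst z)))"
      by (rule cf.form_cong_AE[OF L2D(1)[OF WL] L2D(1)[OF mode_jet_L2[OF q]] L2D(1)[OF WL] L2D(1)[OF has_trace_L2(1)[OF T(1)]]])
        (use T(2) in \<open>auto elim!: eventually_mono\<close>)
    also have "\<dots> = d_const s * F (\<lambda>x. q 0 * \<phi> k x)" by (rule form[OF T(1)])
    also have "\<dots> = d_const s * F (\<phi> k) * q 0" by (simp add: HHd_scale_phi[OF F])
    finally show "cf.form (jet cyl W) (mode_jet k q) = d_const s * F (\<phi> k) * q 0" .
  qed
  obtain C1 where C1: "C1 > 0" "\<forall>k p. p \<in> test_functions UNIV \<longrightarrow> lam k powr s * (p 0)\<^sup>2 \<le> C1 * line_form k p p"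
    using line_trace_inequality by blast
  \<comment> \<open>The trace of W must lie in \<open>HH s\<close> before the functional F can be
    expanded on it; then W itself serves as test function and its energy becomes the series of flux
    times trace.\<close>
  have "summable (\<lambda>k. lam k powr s * (cf_k u k)\<^sup>2)"
    by (rule summableI_nonneg_bounded) (use trace_summable_bound[OF _ C1(1) tr] C1(2) in auto)
  then have u: "u \<in> HHs" using has_trace_L2(2)[OF tr] by (simp add: HHs_iff)
  have "(\<lambda>k. d_const s * (cf_k u k * F (\<phi> k))) sums (d_const s * F u)"
    by (rule sums_mult[OF HHd_expansion[OF F u]])
  then show "(\<lambda>k. (d_const s * F (\<phi> k)) * cf_k u k) sums cf.form (jet cyl W) (jet cyl W)"
    unfolding form[OF tr] by (simp only: mult_ac)
qed

text \<open>The trace is determined only for almost every time. Its continuous representative gives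
  continuous coefficients, since a coefficient is bounded by the norm, and a genuine value at time
  0.\<close>

lemma initial_value_L2:
  assumes "has_initial_value T (L2 \<mu>) (L2_norm \<mu>) u g" and g: "g \<in> L2 \<mu>"
    and u: "AE t in lebesgue_on {0<..<T}. u t \<in> L2 \<mu>" and T: "0 < T"
  obtains P where "continuous_on {0..T} P" "AE t in lebesgue_on {0<..<T}. cf_k (u t) k = P t"
    "P 0 = cf_k g k"
proof -
  obtain v where v: "\<forall>t\<in>{0..T}. v t \<in> L2 \<mu>"
    "AE t in lebesgue_on {0<..<T}. L2_norm \<mu> (\<lambda>x. u t x - v t x) = 0"
    "\<forall>t\<in>{0..T}. ((\<lambda>\<tau>. L2_norm \<mu> (\<lambda>x. v \<tau> x - v t x)) \<longlongrightarrow> 0) (at t within {0..T})"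
    "L2_norm \<mu> (\<lambda>x. v 0 x - g x) = 0"
    using assms(1) unfolding has_initial_value_def by blast
  have n1: "L2_norm \<mu> (\<phi> k) = 1"
    using basis.ortho[of k k] L2_norm_nonneg[of \<mu> "\<phi> k"] by (simp add: L2_inner_self power2_eq_1_iff)
  have bnd: "\<bar>cf_k w k - cf_k w' k\<bar> \<le> L2_norm \<mu> (\<lambda>x. w x - w' x)" if "w \<in> L2 \<mu>" "w' \<in> L2 \<mu>" for w w'
    using L2_inner_bound[OF L2_diff[OF that] basis.phi_L2[of k]] n1
    by (simp add: L2_inner_diff[OF that basis.phi_L2])
  show thesis
  proof (rule that[of "\<lambda>t. cf_k (v t) k"])
    show "continuous_on {0..T} (\<lambda>t. cf_k (v t) k)"
      unfolding continuous_on
    proof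
      fix t assume t: "t \<in> {0..T}"
      show "((\<lambda>t. cf_k (v t) k) \<longlongrightarrow> cf_k (v t) k) (at t within {0..T})"
      proof (rule LIM_zero_cancel, rule Lim_null_comparison)
        show "((\<lambda>\<tau>. L2_norm \<mu> (\<lambda>x. v \<tau> x - v t x)) \<longlongrightarrow> 0) (at t within {0..T})" using v(3) t by blast
        show "\<forall>\<^sub>F \<tau> in at t within {0..T}. norm (cf_k (v \<tau>) k - cf_k (v t) k) \<le> L2_norm \<mu> (\<lambda>x. v \<tau> x - v t x)"
          using bnd v(1) t by (auto simp: eventually_at_filter)
      qed
    qed
    show "AE t in lebesgue_on {0<..<T}. cf_k (u t) k = cf_k (v t) k"
      using v(2) u AE_space[of "lebesgue_on {0<..<T}"]
    proof eventually_elim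
      case (elim t)
      then have "v t \<in> L2 \<mu>" using v(1) by auto
      from bnd[OF elim(2) this] elim(1) show ?case by simp
    qed
    show "cf_k (v 0) k = cf_k g k"
      using bnd[of "v 0" g] v(1,4) g T by auto
  qed
qed

text \<open>The velocity is continuous only as a functional on \<open>HH s\<close>; its coefficients
  are the values at the eigenfunctions, controlled by the dual norm times the norm of the
  eigenfunction.\<close>

lemma initial_value_dual:
  assumes "has_initial_value T HHd dnrm G G0" and G0: "G0 \<in> HHd"
    and G: "AE t in lebesgue_on {0<..<T}. G t \<in> HHd" and T: "0 < T"
  obtains Q where "continuous_on {0..T} Q" "AE t in lebesgue_on {0<..<T}. G t (\<phi> k) = Q t"
    "Q 0 = G0 (\<phi> k)"
proof -
  obtain v where v: "\<forall>t\<in>{0..T}. v t \<in> HHd"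
    "AE t in lebesgue_on {0<..<T}. dnrm (\<lambda>x. G t x - v t x) = 0"
    "\<forall>t\<in>{0..T}. ((\<lambda>\<tau>. dnrm (\<lambda>x. v \<tau> x - v t x)) \<longlongrightarrow> 0) (at t within {0..T})"
    "dnrm (\<lambda>x. v 0 x - G0 x) = 0"
    using assms(1) unfolding has_initial_value_def by blast
  have bnd: "\<bar>w (\<phi> k) - w' (\<phi> k)\<bar> \<le> dnrm (\<lambda>x. w x - w' x) * nrm (\<phi> k)" if "w \<in> HHd" "w' \<in> HHd" for w w'
    using HHd_phi_bound[OF HHd_diff[OF that]] .
  show thesis
  proof (rule that[of "\<lambda>t. v t (\<phi> k)"])
    show "continuous_on {0..T} (\<lambda>t. v t (\<phi> k))"
      unfolding continuous_on
    proof
      fix t assume t: "t \<in> {0..T}"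
      show "((\<lambda>t. v t (\<phi> k)) \<longlongrightarrow> v t (\<phi> k)) (at t within {0..T})"
      proof (rule LIM_zero_cancel, rule Lim_null_comparison)
        show "((\<lambda>\<tau>. dnrm (\<lambda>x. v \<tau> x - v t x) * nrm (\<phi> k)) \<longlongrightarrow> 0) (at t within {0..T})"
          using v(3) t by (intro tendsto_mult_left_zero) blast
        show "\<forall>\<^sub>F \<tau> in at t within {0..T}. norm (v \<tau> (\<phi> k) - v t (\<phi> k)) \<le> dnrm (\<lambda>x. v \<tau> x - v t x) * nrm (\<phi> k)"
          using bnd v(1) t by (auto simp: eventually_at_filter)
      qed
    qed
    show "AE t in lebesgue_on {0<..<T}. G t (\<phi> k) = v t (\<phi> k)"
      using v(2) G AE_space[of "lebesgue_on {0<..<T}"]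
    proof eventually_elim
      case (elim t)
      then have "v t \<in> HHd" using v(1) by auto
      from bnd[OF elim(2) this] elim(1) show ?case by simp
    qed
    show "v 0 (\<phi> k) = G0 (\<phi> k)"
      using bnd[of "v 0" G0] v(1,4) G0 T by auto
  qed
qed

text \<open>A single time t0 with nonzero flux fixes \<kappa> as the ratio of flux to trace;
  symmetry transports it to all other times, and both bounds follow from
  \<open>conormal_bounds\<close> at t0. If the flux vanishes at all times of I, then \<kappa> = 0
  serves.\<close>

lemma conormal_proportional:
  assumes C0: "\<And>k. line_form k (\<lambda>y. bump (sqrt (lam k) * y)) (\<lambda>y. bump (sqrt (lam k) * y)) \<le> C0 * lam k powr s" "C0 > 0"
    and W: "\<And>t. t \<in> I \<Longrightarrow> has_trace \<alpha> \<Omega> (W t) (u t)" "\<And>t. t \<in> I \<Longrightarrow> has_conormal (W t) k (m t)"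
  obtains \<kappa> where "0 \<le> \<kappa>" "\<kappa> \<le> C0 * lam k powr s" "\<forall>t\<in>I. m t = \<kappa> * cf_k (u t) k"
proof (cases "\<exists>t0\<in>I. m t0 \<noteq> 0")
  case True
  then obtain t0 where t0: "t0 \<in> I" "m t0 \<noteq> 0" by blast
  note b = conormal_bounds[OF C0(1) W(1)[OF t0(1)] W(2)[OF t0(1)]]
  \<comment> \<open>With a vanishing coefficient the second bound would force the flux to vanish
    too.\<close>
  have u0: "cf_k (u t0) k \<noteq> 0"
    using b(2) t0(2) by auto
  define \<kappa> where "\<kappa> = m t0 / cf_k (u t0) k"
  have "m t0 = \<kappa> * cf_k (u t0) k" using u0 by (simp add: \<kappa>_def)
  then have k: "0 \<le> \<kappa> * (cf_k (u t0) k)\<^sup>2" "\<kappa>\<^sup>2 * (cf_k (u t0) k)\<^sup>2 \<le> \<kappa> * (cf_k (u t0) k)\<^sup>2 * (C0 * lam k powr s)"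
    using b by (auto simp: power2_eq_square mult_ac)
  have sq: "0 < (cf_k (u t0) k)\<^sup>2" using u0 by simp
  have k0: "0 \<le> \<kappa>" using k(1) sq by (simp add: zero_le_mult_iff)
  have kne: "\<kappa> \<noteq> 0" using t0(2) u0 by (simp add: \<kappa>_def)
  have "(\<kappa> * (cf_k (u t0) k)\<^sup>2) * \<kappa> \<le> (\<kappa> * (cf_k (u t0) k)\<^sup>2) * (C0 * lam k powr s)"
    using k(2) by (simp add: power2_eq_square mult_ac)
  moreover have "0 < \<kappa> * (cf_k (u t0) k)\<^sup>2" using k0 kne sq by simp
  ultimately have "\<kappa> \<le> C0 * lam k powr s" by (rule mult_left_le_imp_le)
  moreover have "\<forall>t\<in>I. m t = \<kappa> * cf_k (u t) k"
  proof
    fix t assume t: "t \<in> I"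
    have "m t * cf_k (u t0) k = m t0 * cf_k (u t) k"
      by (rule conormal_symmetric[OF W(1)[OF t] W(2)[OF t] W(1)[OF t0(1)] W(2)[OF t0(1)]])
    then show "m t = \<kappa> * cf_k (u t) k" using u0 by (simp add: \<kappa>_def field_simps)
  qed
  ultimately show thesis using that[of \<kappa>] k0 by blast
next
  case False
  then show thesis using that[of 0] C0(2) by simp
qed

text \<open>Collects what the decay estimate uses at almost every time. A test function of zero
  trace is invisible to both the second time derivative and f, which gives the orthogonality; the
  energy bound comes from summing the wave estimates of the modes.\<close>

lemma solution_energy:
  assumes T: "0 < T"
  shows "\<exists>K>0. \<forall>f g h U. f \<in> Bochner_L2 T (L2 \<mu>) (L2_norm \<mu>) \<longrightarrow> g \<in> HHs \<longrightarrow> h \<in> L2 \<mu> \<longrightarrow>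
    weak_solution \<Omega> A c lam \<phi> s T f g h U \<longrightarrow>
    (AE t in lebesgue_on {0<..<T}. (\<exists>u. has_trace \<alpha> \<Omega> (U t) u) \<and>
      (\<forall>v. has_trace \<alpha> \<Omega> v (\<lambda>x. 0) \<longrightarrow> cf.form (jet cyl (U t)) (jet cyl v) = 0) \<and>
      cf.form (jet cyl (U t)) (jet cyl (U t)) \<le>
        K * (Bochner_L2_norm T (L2_norm \<mu>) f + nrm g + L2_norm \<mu> h)\<^sup>2)"
proof -
  let ?d = "d_const s" and ?L = "lebesgue_on {0<..<T}"
  note d = d_const_pos
  obtain C0 where C0: "C0 > 0"
    "\<forall>k. line_form k (\<lambda>y. bump (sqrt (lam k) * y)) (\<lambda>y. bump (sqrt (lam k) * y)) \<le> C0 * lam k powr s"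
    using scaled_bump_energy by blast
  \<comment> \<open>The 3 comes from \<open>wave_mode_bound\<close>. \<open>C0\<close> accounts for
    g through the bound on the proportionality constants, \<open>?d\<close> for h, and
    \<open>?d * T\<close> for f.\<close>
  define K where "K = 3 * (C0 + ?d + ?d * T)"
  have "AE t in ?L. (\<exists>u. has_trace \<alpha> \<Omega> (U t) u) \<and>
      (\<forall>v. has_trace \<alpha> \<Omega> v (\<lambda>x. 0) \<longrightarrow> cf.form (jet cyl (U t)) (jet cyl v) = 0) \<and>
      cf.form (jet cyl (U t)) (jet cyl (U t)) \<le>
        K * (Bochner_L2_norm T (L2_norm \<mu>) f + nrm g + L2_norm \<mu> h)\<^sup>2"
    if f: "f \<in> Bochner_L2 T (L2 \<mu>) (L2_norm \<mu>)" and g: "g \<in> HHs" and h: "h \<in> L2 \<mu>"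
      and sol: "weak_solution \<Omega> A c lam \<phi> s T f g h U" for f g h U
  proof -
    obtain u u1 u2 where u: "AE t in ?L. has_trace \<alpha> \<Omega> (U t) (u t)"
      and u1: "u1 \<in> Bochner_Linf T (L2 \<mu>) (L2_norm \<mu>)"
      and w1: "\<forall>w\<in>L2 \<mu>. has_weak_gradient {0<..<T} (\<lambda>t. L2_inner \<mu> (u t) w) (\<lambda>t. L2_inner \<mu> (u1 t) w)"
      and u2: "u2 \<in> Bochner_L2 T HHd dnrm"
      and w2: "\<forall>w\<in>HHs. has_weak_gradient {0<..<T} (\<lambda>t. L2_inner \<mu> (u1 t) w) (\<lambda>t. u2 t w)"
      and iv0: "has_initial_value T (L2 \<mu>) (L2_norm \<mu>) u g"
      and iv1: "has_initial_value T HHd dnrm (\<lambda>t. L2_inner \<mu> (u1 t)) (L2_inner \<mu> h)"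
      and eq: "AE t in ?L. \<forall>v w. has_trace \<alpha> \<Omega> v w \<longrightarrow> u2 t w + a_form \<Omega> A c s (U t) v = L2_inner \<mu> (f t) w"
      using sol unfolding weak_solution_def by blast
    have u2d: "AE t in ?L. u2 t \<in> HHd" and u1L: "AE t in ?L. u1 t \<in> L2 \<mu>" and fL: "AE t in ?L. f t \<in> L2 \<mu>"
      using u2 u1 f unfolding Bochner_L2_def Bochner_Linf_def strongly_measurable_def by blast+
    have fi: "integrable ?L (\<lambda>t. (L2_norm \<mu> (f t))\<^sup>2)" and u2i: "integrable ?L (\<lambda>t. (dnrm (u2 t))\<^sup>2)"
      using f u2 unfolding Bochner_L2_def by blast+
    have uL: "AE t in ?L. u t \<in> L2 \<mu>"
      using u by eventually_elim (rule has_trace_L2(2))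
    have gL: "g \<in> L2 \<mu>" using g by (simp add: HHs_iff)
    define F where "F t w = L2_inner \<mu> (f t) w - u2 t w" for t w
    \<comment> \<open>One set of full measure on which the equation holds against all test
      functions; the constants of all modes are chosen relative to it.\<close>
    define I where "I = {t. has_trace \<alpha> \<Omega> (U t) (u t) \<and> F t \<in> HHd \<and>
        (\<forall>v w. has_trace \<alpha> \<Omega> v w \<longrightarrow> a_form \<Omega> A c s (U t) v = F t w)}"
    have AE_I: "AE t in ?L. t \<in> I"
      using u u2d fL eq
    proof eventually_elim
      case (elim t)
      have "F t \<in> HHd"
        unfolding F_def by (intro HHd_diff L2_inner_HHd elim)
      moreover have "a_form \<Omega> A c s (U t) v = F t w" if "has_trace \<alpha> \<Omega> v w" for v w
        using elim(4) that unfolding F_def by force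
      ultimately show ?case unfolding I_def using elim(1) by blast
    qed
    have tr: "has_trace \<alpha> \<Omega> (U t) (u t)" and con: "has_conormal (U t) k (?d * F t (\<phi> k))"
      and ser: "(\<lambda>k. (?d * F t (\<phi> k)) * cf_k (u t) k) sums cf.form (jet cyl (U t)) (jet cyl (U t))"
      if "t \<in> I" for t k
      using that harmonic_conormal[of "F t" "U t" "u t"] unfolding I_def by blast+
    have zero: "cf.form (jet cyl (U t)) (jet cyl v) = 0" if "t \<in> I" "has_trace \<alpha> \<Omega> v (\<lambda>x. 0)" for t v
    proof -
      have "a_form \<Omega> A c s (U t) v = F t (\<lambda>x. 0)" "F t \<in> HHd"
        using that unfolding I_def by blast+
      then show ?thesis using d HHd_zero[of "F t"] by (simp add: a_form_eq)
    qed
    \<comment> \<open>Here \<open>F t\<close> stands for f minus the second time derivative. The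
      mode equation thus becomes u_k'' + (m k / d) u_k = f_k with a coefficient independent of
      time.\<close>
    have "\<forall>k. \<exists>\<kappa>. 0 \<le> \<kappa> \<and> \<kappa> \<le> C0 * lam k powr s \<and> (\<forall>t\<in>I. ?d * F t (\<phi> k) = \<kappa> * cf_k (u t) k)"
    proof
      fix k
      show "\<exists>\<kappa>. 0 \<le> \<kappa> \<and> \<kappa> \<le> C0 * lam k powr s \<and> (\<forall>t\<in>I. ?d * F t (\<phi> k) = \<kappa> * cf_k (u t) k)"
        by (rule conormal_proportional[where k=k and I=I, OF C0(2)[rule_format] C0(1) tr con]) blast+
    qed
    then obtain m where m: "\<And>k. 0 \<le> m k" "\<And>k. m k \<le> C0 * lam k powr s"
      "\<And>k t. t \<in> I \<Longrightarrow> ?d * F t (\<phi> k) = m k * cf_k (u t) k"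
      by metis
    have "\<forall>k. \<exists>P. continuous_on {0..T} P \<and> (AE t in ?L. cf_k (u t) k = P t) \<and> P 0 = cf_k g k"
    proof
      fix k
      obtain P where "continuous_on {0..T} P" "AE t in ?L. cf_k (u t) k = P t" "P 0 = cf_k g k"
        by (rule initial_value_L2[OF iv0 gL uL T])
      then show "\<exists>P. continuous_on {0..T} P \<and> (AE t in ?L. cf_k (u t) k = P t) \<and> P 0 = cf_k g k" by blast
    qed
    then obtain P where P: "\<And>k. continuous_on {0..T} (P k)" "\<And>k. AE t in ?L. cf_k (u t) k = P k t" "\<And>k. P k 0 = cf_k g k"
      by metis
    have u1d: "AE t in ?L. L2_inner \<mu> (u1 t) \<in> HHd"
      using u1L by eventually_elim (rule L2_inner_HHd)
    have "\<forall>k. \<exists>Q. continuous_on {0..T} Q \<and> (AE t in ?L. cf_k (u1 t) k = Q t) \<and> Q 0 = cf_k h k"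
    proof
      fix k
      obtain Q where "continuous_on {0..T} Q" "AE t in ?L. cf_k (u1 t) k = Q t" "Q 0 = cf_k h k"
        by (rule initial_value_dual[OF iv1 L2_inner_HHd[OF h] u1d T])
      then show "\<exists>Q. continuous_on {0..T} Q \<and> (AE t in ?L. cf_k (u1 t) k = Q t) \<and> Q 0 = cf_k h k" by blast
    qed
    then obtain Q where Q: "\<And>k. continuous_on {0..T} (Q k)" "\<And>k. AE t in ?L. cf_k (u1 t) k = Q k t" "\<And>k. Q k 0 = cf_k h k"
      by metis
    define r where "r k t = u2 t (\<phi> k)" for k t
    have W1: "has_weak_gradient {0<..<T} (\<lambda>t. cf_k (u t) k) (\<lambda>t. cf_k (u1 t) k)" for k
      using w1 basis.phi_L2 by blast
    have W2: "has_weak_gradient {0<..<T} (\<lambda>t. cf_k (u1 t) k) (r k)" for k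
      using w2 phi_HH(1) unfolding r_def by blast
    have rm: "r k \<in> borel_measurable ?L" for k
      using W2[of k] by (intro locally_integrable_measurable) (simp add: has_weak_gradient_def)
    have one: "integrable ?L (\<lambda>t. 1 :: real)"
      by (rule integrable_continuous_open_interval) simp
    \<comment> \<open>A dual norm that is square integrable in time is integrable on the bounded
      interval, by x \<le> 1 + x^2.\<close>
    have ri: "integrable ?L (r k)" for k
    proof (rule Bochner_Integration.integrable_bound[of _ "\<lambda>t. nrm (\<phi> k) * (1 + (dnrm (u2 t))\<^sup>2)"])
      show "integrable ?L (\<lambda>t. nrm (\<phi> k) * (1 + (dnrm (u2 t))\<^sup>2))"
        by (intro integrable_mult_right Bochner_Integration.integrable_add one u2i)
      show "AE t in ?L. norm (r k t) \<le> norm (nrm (\<phi> k) * (1 + (dnrm (u2 t))\<^sup>2))"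
        using u2d
      proof eventually_elim
        case (elim t)
        have "2 * dnrm (u2 t) \<le> 1 + (dnrm (u2 t))\<^sup>2"
          using sum_squares_bound[of 1 "dnrm (u2 t)"] by simp
        moreover have "0 \<le> 1 + (dnrm (u2 t))\<^sup>2" by simp
        ultimately have "dnrm (u2 t) \<le> 1 + (dnrm (u2 t))\<^sup>2" by linarith
        then have "dnrm (u2 t) * nrm (\<phi> k) \<le> (1 + (dnrm (u2 t))\<^sup>2) * nrm (\<phi> k)"
          using phi_HH(3)[of k] by (intro mult_right_mono) auto
        with HHd_phi_bound[OF elim, of k] have "\<bar>r k t\<bar> \<le> (1 + (dnrm (u2 t))\<^sup>2) * nrm (\<phi> k)"
          unfolding r_def by linarith
        then show ?case
          using phi_HH(3)[of k] by (simp add: mult.commute)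
      qed
    qed (rule rm)
    \<comment> \<open>Almost everywhere this is the coefficient of \<open>f t\<close>, but in this
      form it is visibly measurable in t.\<close>
    define H where "H k t = r k t + (m k / ?d) * P k t" for k t
    have Hm: "H k \<in> borel_measurable ?L" for k
      unfolding H_def
      using rm borel_measurable_integrable[OF integrable_continuous_open_interval[OF P(1)]] by measurable
    have Heq: "AE t in ?L. \<forall>k. H k t = cf_k (f t) k"
      unfolding AE_all_countable
    proof
      fix k
      show "AE t in ?L. H k t = cf_k (f t) k"
        using AE_I P(2)[of k]
      proof eventually_elim
        case (elim t)
        have "?d * (cf_k (f t) k - r k t) = m k * P k t"
          using m(3)[OF elim(1), of k] elim(2) by (simp add: F_def r_def)
        then show ?case using d by (simp add: H_def field_simps)
      qed
    qed
    have HL2: "H k \<in> L2 ?L" for k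
    proof (rule L2I[OF Hm fi])
      show "AE t in ?L. (norm (H k t))\<^sup>2 \<le> (L2_norm \<mu> (f t))\<^sup>2"
        using Heq fL
      proof eventually_elim
        case (elim t)
        have "(cf_k (f t) k)\<^sup>2 \<le> (\<Sum>j<Suc k. (cf_k (f t) j)\<^sup>2)"
          by (simp add: sum_nonneg)
        also have "\<dots> \<le> (L2_norm \<mu> (f t))\<^sup>2" by (rule basis.Bessel[OF elim(2)])
        finally show ?case using elim(1) by simp
      qed
    qed
    \<comment> \<open>Bessel's inequality at each time, integrated: the forcing terms of all modes
      together cost no more than f.\<close>
    have Hsum: "(\<Sum>k<n. (L2_norm ?L (H k))\<^sup>2) \<le> (Bochner_L2_norm T (L2_norm \<mu>) f)\<^sup>2" for n
    proof -
      have "(\<Sum>k<n. (L2_norm ?L (H k))\<^sup>2) = (\<integral>t. (\<Sum>k<n. (norm (H k t))\<^sup>2) \<partial>?L)"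
        unfolding L2_norm_sq using L2D(2)[OF HL2] by (intro Bochner_Integration.integral_sum[symmetric]) auto
      also have "\<dots> \<le> (\<integral>t. (L2_norm \<mu> (f t))\<^sup>2 \<partial>?L)"
      proof (rule integral_mono_AE)
        show "integrable ?L (\<lambda>t. \<Sum>k<n. (norm (H k t))\<^sup>2)"
          using L2D(2)[OF HL2] by (intro Bochner_Integration.integrable_sum) auto
        show "AE t in ?L. (\<Sum>k<n. (norm (H k t))\<^sup>2) \<le> (L2_norm \<mu> (f t))\<^sup>2"
          using Heq fL by eventually_elim (use basis.Bessel in simp)
      qed (rule fi)
      finally show ?thesis by (simp add: Bochner_L2_norm_def)
    qed
    \<comment> \<open>\<open>wave_mode_bound\<close> with spring constant \<open>m k / ?d\<close>,
      which is nonnegative by the choice of \<open>m\<close>.\<close>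
    have mode: "m k / ?d * (P k t)\<^sup>2 \<le> 3 * (m k / ?d * (cf_k g k)\<^sup>2 + (cf_k h k)\<^sup>2 + T * (L2_norm ?L (H k))\<^sup>2)"
      if "0 < t" "t < T" for k t
    proof -
      have "AE t in ?L. r k t = H k t - (m k / ?d) * P k t"
        by (simp add: H_def)
      from wave_mode_bound[OF W1 W2 P(1,2) Q(1,2) ri HL2 this _ that] m(1)[of k] d
      show ?thesis by (simp add: P(3) Q(3))
    qed
    define \<Lambda> where "\<Lambda> = Bochner_L2_norm T (L2_norm \<mu>) f + nrm g + L2_norm \<mu> h"
    have bound: "(\<Sum>k<n. m k * (P k t)\<^sup>2) \<le> K * \<Lambda>\<^sup>2" if t: "0 < t" "t < T" for n t
    proof -
      have "(\<Sum>k<n. m k * (P k t)\<^sup>2) = ?d * (\<Sum>k<n. m k / ?d * (P k t)\<^sup>2)"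
        using d by (simp add: sum_distrib_left)
      also have "\<dots> \<le> ?d * (\<Sum>k<n. 3 * (m k / ?d * (cf_k g k)\<^sup>2 + (cf_k h k)\<^sup>2 + T * (L2_norm ?L (H k))\<^sup>2))"
        using d mode[OF t] by (intro mult_left_mono sum_mono) auto
      also have "\<dots> = 3 * ((\<Sum>k<n. m k * (cf_k g k)\<^sup>2) + ?d * (\<Sum>k<n. (cf_k h k)\<^sup>2) + ?d * (T * (\<Sum>k<n. (L2_norm ?L (H k))\<^sup>2)))"
        using d by (simp add: sum_distrib_left sum.distrib algebra_simps)
      \<comment> \<open>Only the term of g uses \<open>m k \<le> C0 * lam k powr s\<close>; the sums
        for h and f are bounded by Bessel.\<close>
      also have "\<dots> \<le> 3 * (C0 * (nrm g)\<^sup>2 + ?d * (L2_norm \<mu> h)\<^sup>2 + ?d * (T * (Bochner_L2_norm T (L2_norm \<mu>) f)\<^sup>2))"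
      proof -
        have sg: "summable (\<lambda>k. lam k powr s * (cf_k g k)\<^sup>2)" using g by (simp add: HHs_iff)
        have "(\<Sum>k<n. m k * (cf_k g k)\<^sup>2) \<le> (\<Sum>k<n. C0 * (lam k powr s * (cf_k g k)\<^sup>2))"
          using m(2) by (intro sum_mono) (simp add: mult.assoc[symmetric] mult_right_mono)
        also have "\<dots> = C0 * (\<Sum>k<n. lam k powr s * (cf_k g k)\<^sup>2)"
          by (simp add: sum_distrib_left)
        also have "\<dots> \<le> C0 * (nrm g)\<^sup>2"
          unfolding nrm_sq[OF g] using C0(1) by (intro mult_left_mono sum_le_suminf sg) auto
        finally have 1: "(\<Sum>k<n. m k * (cf_k g k)\<^sup>2) \<le> C0 * (nrm g)\<^sup>2" .
        have 2: "?d * (\<Sum>k<n. (cf_k h k)\<^sup>2) \<le> ?d * (L2_norm \<mu> h)\<^sup>2"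
          using d basis.Bessel[OF h] by (intro mult_left_mono) auto
        have 3: "?d * (T * (\<Sum>k<n. (L2_norm ?L (H k))\<^sup>2)) \<le> ?d * (T * (Bochner_L2_norm T (L2_norm \<mu>) f)\<^sup>2)"
          using d T Hsum by (intro mult_left_mono) auto
        show ?thesis by (rule mult_left_mono[OF add_mono[OF add_mono[OF 1 2] 3]]) simp
      qed
      also have "\<dots> \<le> 3 * (C0 * \<Lambda>\<^sup>2 + ?d * \<Lambda>\<^sup>2 + ?d * (T * \<Lambda>\<^sup>2))"
      proof -
        have nn: "0 \<le> Bochner_L2_norm T (L2_norm \<mu>) f" "0 \<le> nrm g" "0 \<le> L2_norm \<mu> h"
          using nrm_nonneg[OF g] L2_norm_nonneg[of \<mu> h] by (auto simp: Bochner_L2_norm_def)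
        then have "(nrm g)\<^sup>2 \<le> \<Lambda>\<^sup>2" "(L2_norm \<mu> h)\<^sup>2 \<le> \<Lambda>\<^sup>2" "(Bochner_L2_norm T (L2_norm \<mu>) f)\<^sup>2 \<le> \<Lambda>\<^sup>2"
          unfolding \<Lambda>_def by (intro power_mono; linarith)+
        then show ?thesis
          using C0(1) d T by (intro mult_left_mono add_mono) auto
      qed
      also have "\<dots> = K * \<Lambda>\<^sup>2" by (simp add: K_def algebra_simps)
      finally show ?thesis .
    qed
    have "AE t in ?L. \<forall>k. cf_k (u t) k = P k t"
      unfolding AE_all_countable using P(2) by blast
    with AE_I AE_space[of ?L] show ?thesis
    proof eventually_elim
      case (elim t)
      then have t: "0 < t" "t < T" by auto
      \<comment> \<open>The energy at time t is the series of flux times trace, whose terms are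
        \<open>m k * (P k t)\<^sup>2\<close>; partial sums bounded uniformly in n suffice.\<close>
      have "(\<lambda>n. \<Sum>k<n. (?d * F t (\<phi> k)) * cf_k (u t) k) \<longlonglongrightarrow> cf.form (jet cyl (U t)) (jet cyl (U t))"
        using ser[OF elim(1)] by (simp add: sums_def)
      moreover have "(?d * F t (\<phi> k)) * cf_k (u t) k = m k * (P k t)\<^sup>2" for k
        using m(3)[OF elim(1), of k] elim(3) by (simp add: power2_eq_square)
      ultimately have "cf.form (jet cyl (U t)) (jet cyl (U t)) \<le> K * \<Lambda>\<^sup>2"
        using bound[OF t] by (intro LIMSEQ_le_const2) auto
      then show ?case
        using tr[OF elim(1)] zero[OF elim(1)] unfolding \<Lambda>_def by blast
    qed
  qed
  moreover have "K > 0"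
    unfolding K_def using C0(1) d T by (simp add: add_pos_pos)
  ultimately show ?thesis by blast
qed

end

section \<open>Exponential decay\<close>

context dirichlet_cylinder
begin

text \<open>Only the part of the energy along the cross sections, with weight \<eta>^2: this is what
  the spectral gap of the slices bounds below. The vertical derivative is accounted for
  separately.\<close>

definition base_weighted :: "(real \<Rightarrow> real) \<Rightarrow> (real^'n) \<times> real \<Rightarrow>
    real \<times> ((real^'n) \<times> real) \<Rightarrow> real \<times> ((real^'n) \<times> real) \<Rightarrow> real" where
  "base_weighted \<eta> z p q = (\<eta> (snd z))\<^sup>2 * ((A (fst z) *v fst (snd p)) \<bullet> fst (snd q) + c (fst z) * fst p * fst q)"

lemma base_weighted_form:
  assumes \<eta>: "\<eta> \<in> borel_measurable borel" "\<And>y. \<bar>\<eta> y\<bar> \<le> B"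
  shows "\<exists>C. L2_form N (base_weighted \<eta>) C"
proof -
  obtain B1 where B1: "B1 \<ge> 0" "\<And>x u. x \<in> \<Omega> \<Longrightarrow> norm (A x *v u) \<le> B1 * norm u"
    using A_bounded by blast
  obtain B2 where B2: "B2 \<ge> 0" "AE z in N. 0 \<le> c (fst z) \<and> c (fst z) \<le> B2"
    by (rule cyl_c_bounds)
  obtain a where a: "a > 0" "\<And>x u. x \<in> \<Omega> \<Longrightarrow> a * (norm u)\<^sup>2 \<le> (A x *v u) \<bullet> u"
    using A_elliptic by blast
  have sq: "(\<eta> y)\<^sup>2 \<le> B\<^sup>2" for y
    using power_mono[OF \<eta>(2)[of y], of 2] by simp
  let ?L = "\<lambda>(z :: (real^'n) \<times> real) (u :: (real^'n) \<times> real). ((\<eta> (snd z))\<^sup>2 *\<^sub>R (A (fst z) *v fst u), 0 :: real)"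
  have [measurable]: "(\<lambda>z. \<eta> (snd z)) \<in> borel_measurable N"
    by (rule measurable_snd_N[OF \<eta>(1)])
  have "L2_inner_form N (\<lambda>z p q. ?L z (snd p) \<bullet> snd q + ((\<eta> (snd z))\<^sup>2 * c (fst z)) * fst p * fst q) (B\<^sup>2 * B1 + B\<^sup>2 * B2)"
  proof (rule energy_form[where L="?L" and k="\<lambda>z. (\<eta> (snd z))\<^sup>2 * c (fst z)"])
    show "linear (?L z)" for z
      by (auto simp: linear_iff matrix_vector_right_distrib matrix_vector_mult_scaleR algebra_simps)
    show "(\<lambda>z. ?L z (p z)) \<in> borel_measurable N" if p: "p \<in> borel_measurable N" for p
    proof -
      have [measurable]: "(\<lambda>z. A (fst z)) \<in> borel_measurable N"
        by (rule measurable_fst_N[OF continuous_imp_measurable_on_sets_lebesgue[OF A_continuous dom_sets]])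
      have f: "(\<lambda>z. fst (p z)) \<in> borel_measurable N"
        using p by (rule measurable_compose[OF _ borel_measurable_continuous_onI[OF continuous_on_fst[OF continuous_on_id]]])
      have [measurable]: "(\<lambda>z. A (fst z) *v fst (p z)) \<in> borel_measurable N"
        by (intro matrix_vector_mult_measurable f) simp
      show ?thesis by (intro borel_measurable_Pair) measurable
    qed
    show "(\<lambda>z. (\<eta> (snd z))\<^sup>2 * c (fst z)) \<in> borel_measurable N"
      using measurable_fst_N[OF c_measurable] by measurable
    show "AE z in N. \<forall>u. norm (?L z u) \<le> B\<^sup>2 * B1 * norm u"
      using AE_cyl
    proof eventually_elim
      case (elim z)
      show ?case
      proof
        fix u :: "(real^'n) \<times> real"
        have "norm (A (fst z) *v fst u) \<le> B1 * norm u"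
          using B1 elim norm_fst_le[of "fst u" "snd u"] mult_left_mono[of "norm (fst u)" "norm u" B1]
          by (auto intro: order_trans)
        then have "(\<eta> (snd z))\<^sup>2 * norm (A (fst z) *v fst u) \<le> B\<^sup>2 * (B1 * norm u)"
          using sq by (intro mult_mono) auto
        then show "norm (?L z u) \<le> B\<^sup>2 * B1 * norm u" by (simp add: norm_Pair mult.assoc)
      qed
    qed
    show "AE z in N. 0 \<le> (\<eta> (snd z))\<^sup>2 * c (fst z) \<and> (\<eta> (snd z))\<^sup>2 * c (fst z) \<le> B\<^sup>2 * B2"
      using B2(2) by eventually_elim (auto intro!: mult_mono sq)
    show "AE z in N. \<forall>u v. ?L z u \<bullet> v = ?L z v \<bullet> u"
      using AE_cyl by eventually_elim (auto simp: inner_prod_def A_symmetric)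
    show "AE z in N. \<forall>u. 0 \<le> ?L z u \<bullet> u"
      using AE_cyl
    proof eventually_elim
      case (elim z)
      have "0 \<le> (A (fst z) *v v) \<bullet> v" for v
        using order_trans[OF _ a(2)[of "fst z" v]] a(1) elim by simp
      then show ?case by (auto simp: inner_prod_def)
    qed
  qed (use B1 B2 in auto)
  moreover have "(\<lambda>z p q. ?L z (snd p) \<bullet> snd q + ((\<eta> (snd z))\<^sup>2 * c (fst z)) * fst p * fst q) = base_weighted \<eta>"
    by (auto simp: fun_eq_iff base_weighted_def inner_prod_def algebra_simps)
  ultimately show ?thesis by (auto simp: L2_inner_form_def)
qed

text \<open>The weight depends on the height alone, so it is a constant factor on each slice; the
  spectral gap is applied there and integrated over the heights.\<close>

lemma weighted_gap_test:
  assumes \<eta>: "\<eta> \<in> borel_measurable borel" "\<And>y. \<bar>\<eta> y\<bar> \<le> B"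
    and \<psi>: "\<psi> \<in> test_functions (\<Omega> \<times> UNIV)"
  shows "lam 0 * (L2_norm N (\<lambda>z. \<eta> (snd z) * \<psi> z))\<^sup>2 \<le> (\<integral>z. base_weighted \<eta> z (smooth_jet \<psi> z) (smooth_jet \<psi> z) \<partial>N)"
proof -
  obtain C where "L2_form N (base_weighted \<eta>) C" using base_weighted_form[OF \<eta>] by blast
  then interpret wf: L2_form N "base_weighted \<eta>" C .
  note \<psi>L = cylN.smooth_jet_L2[OF \<psi>]
  have int2: "integrable N (\<lambda>z. base_weighted \<eta> z (smooth_jet \<psi> z) (smooth_jet \<psi> z))"
    by (rule wf.integrable_form[OF \<psi>L(3) \<psi>L(3)])
  have \<eta>\<psi>: "(\<lambda>z. \<eta> (snd z) * \<psi> z) \<in> L2 N"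
  proof (rule L2_bounded_mult[OF \<psi>L(1)])
    show "(\<lambda>z. \<eta> (snd z) * \<psi> z) \<in> borel_measurable N"
      using measurable_snd_N[OF \<eta>(1)] L2D(1)[OF \<psi>L(1)] by measurable
    show "AE z in N. norm (\<eta> (snd z) * \<psi> z) \<le> B * norm (\<psi> z)"
      using \<eta>(2) by (intro AE_I2) (auto simp: abs_mult intro!: mult_right_mono)
  qed
  note int1 = L2D(2)[OF \<eta>\<psi>]
  have slice: "(\<integral>x. base_weighted \<eta> (x, y) (smooth_jet \<psi> (x, y)) (smooth_jet \<psi> (x, y)) \<partial>\<mu>) =
      (\<eta> y)\<^sup>2 * bf.form (smooth_jet (\<lambda>x. \<psi> (x, y))) (smooth_jet (\<lambda>x. \<psi> (x, y)))" for y
    unfolding bf.form_def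
    by (simp add: base_weighted_def base_density_def smooth_jet_def gradient_prod[OF test_functions_smooth[OF \<psi>]])
  have slice': "(\<integral>x. (norm (\<eta> (snd (x, y)) * \<psi> (x, y)))\<^sup>2 \<partial>\<mu>) = (\<eta> y)\<^sup>2 * (L2_norm \<mu> (\<lambda>x. \<psi> (x, y)))\<^sup>2" for y
    by (simp add: L2_norm_sq power_mult_distrib)
  have "lam 0 * (L2_norm N (\<lambda>z. \<eta> (snd z) * \<psi> z))\<^sup>2 = (\<integral>y. lam 0 * ((\<eta> y)\<^sup>2 * (L2_norm \<mu> (\<lambda>x. \<psi> (x, y)))\<^sup>2) \<partial>\<nu>)"
    unfolding L2_norm_sq[of N] Fubini_N(3)[OF int1] slice' by simp
  also have "\<dots> \<le> (\<integral>y. (\<eta> y)\<^sup>2 * bf.form (smooth_jet (\<lambda>x. \<psi> (x, y))) (smooth_jet (\<lambda>x. \<psi> (x, y))) \<partial>\<nu>)"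
  proof (rule integral_mono)
    show "integrable \<nu> (\<lambda>y. lam 0 * ((\<eta> y)\<^sup>2 * (L2_norm \<mu> (\<lambda>x. \<psi> (x, y)))\<^sup>2))"
      using Fubini_N(2)[OF int1] unfolding slice' by simp
    show "integrable \<nu> (\<lambda>y. (\<eta> y)\<^sup>2 * bf.form (smooth_jet (\<lambda>x. \<psi> (x, y))) (smooth_jet (\<lambda>x. \<psi> (x, y))))"
      using Fubini_N(2)[OF int2] unfolding slice .
    show "lam 0 * ((\<eta> y)\<^sup>2 * (L2_norm \<mu> (\<lambda>x. \<psi> (x, y)))\<^sup>2) \<le>
        (\<eta> y)\<^sup>2 * bf.form (smooth_jet (\<lambda>x. \<psi> (x, y))) (smooth_jet (\<lambda>x. \<psi> (x, y)))" for y
      using mult_left_mono[OF spectral_gap[OF test_functions_slice[OF \<psi>, of y]], of "(\<eta> y)\<^sup>2"]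
      by (simp add: mult_ac)
  qed
  also have "\<dots> = (\<integral>z. base_weighted \<eta> z (smooth_jet \<psi> z) (smooth_jet \<psi> z) \<partial>N)"
    unfolding Fubini_N(3)[OF int2] slice ..
  finally show ?thesis .
qed

lemma weighted_gap:
  assumes \<eta>: "\<eta> \<in> borel_measurable borel" "\<And>y. \<bar>\<eta> y\<bar> \<le> B"
    and tr: "has_trace \<alpha> \<Omega> W u"
  shows "lam 0 * (L2_norm N (\<lambda>z. \<eta> (snd z) * W z))\<^sup>2 \<le> (\<integral>z. base_weighted \<eta> z (jet cyl W z) (jet cyl W z) \<partial>N)"
    and "(\<lambda>z. \<eta> (snd z) * W z) \<in> L2 N"
    and "integrable N (\<lambda>z. base_weighted \<eta> z (jet cyl W z) (jet cyl W z))"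
proof -
  obtain C where "L2_form N (base_weighted \<eta>) C" using base_weighted_form[OF \<eta>] by blast
  then interpret wf: L2_form N "base_weighted \<eta>" C .
  obtain \<psi> where \<psi>': "\<forall>j. \<psi> j \<in> test_functions (\<Omega> \<times> UNIV)"
    and lim: "(\<lambda>j::nat. L2_norm N (\<lambda>x. smooth_jet (\<psi> j) x - jet cyl W x)) \<longlonglongrightarrow> 0"
    and "(\<lambda>j. L2_norm \<mu> (\<lambda>x. \<psi> j (x, 0) - u x)) \<longlonglongrightarrow> 0"
    by (rule has_traceE[OF tr])
  note \<psi> = \<psi>'[rule_format]
  note WL = has_trace_L2(1)[OF tr]
  have W: "W \<in> L2 N"
    using cylN.H1_jet(2)[of W] tr unfolding has_trace_def HL_eq H1_closure_def by blast
  have mult: "(\<lambda>z. \<eta> (snd z) * w z) \<in> L2 N" if w: "w \<in> L2 N" for w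
  proof (rule L2_bounded_mult[OF w])
    show "(\<lambda>z. \<eta> (snd z) * w z) \<in> borel_measurable N"
      using measurable_snd_N[OF \<eta>(1)] L2D(1)[OF w] by measurable
    show "AE z in N. norm (\<eta> (snd z) * w z) \<le> B * norm (w z)"
      using \<eta>(2) by (intro AE_I2) (auto simp: abs_mult intro!: mult_right_mono)
  qed
  show "(\<lambda>z. \<eta> (snd z) * W z) \<in> L2 N" by (rule mult[OF W])
  show "integrable N (\<lambda>z. base_weighted \<eta> z (jet cyl W z) (jet cyl W z))"
    by (rule wf.integrable_form[OF WL WL])
  have "(\<lambda>j. L2_norm N (\<lambda>z. \<eta> (snd z) * \<psi> j z)) \<longlonglongrightarrow> L2_norm N (\<lambda>z. \<eta> (snd z) * W z)"
  proof (rule L2_norm_tendsto[OF mult[OF W] mult[OF cylN.smooth_jet_L2(1)[OF \<psi>]]])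
    show "(\<lambda>j. L2_norm N (\<lambda>z. \<eta> (snd z) * \<psi> j z - \<eta> (snd z) * W z)) \<longlonglongrightarrow> 0"
    proof (rule L2_tendsto_mono[OF lim])
      show "(\<lambda>x. smooth_jet (\<psi> j) x - jet cyl W x) \<in> L2 N" for j
        by (intro L2_diff cylN.smooth_jet_L2 \<psi> WL)
      show "(\<lambda>z. \<eta> (snd z) * \<psi> j z - \<eta> (snd z) * W z) \<in> borel_measurable N" for j
        by (intro L2D(1) L2_diff mult W cylN.smooth_jet_L2 \<psi>)
      show "AE z in N. norm (\<eta> (snd z) * \<psi> j z - \<eta> (snd z) * W z) \<le> \<bar>B\<bar> * norm (smooth_jet (\<psi> j) z - jet cyl W z)" for j
      proof (rule AE_I2)
        fix z
        have "norm (\<eta> (snd z) * \<psi> j z - \<eta> (snd z) * W z) = \<bar>\<eta> (snd z)\<bar> * \<bar>\<psi> j z - W z\<bar>"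
          by (simp add: abs_mult[symmetric] algebra_simps)
        also have "\<dots> \<le> \<bar>B\<bar> * norm (smooth_jet (\<psi> j) z - jet cyl W z)"
          using \<eta>(2)[of "snd z"] norm_fst_le[of "\<psi> j z - W z" "gradient (\<psi> j) z - weak_grad cyl W z"]
          by (intro mult_mono) (auto simp: smooth_jet_def jet_def)
        finally show "norm (\<eta> (snd z) * \<psi> j z - \<eta> (snd z) * W z) \<le> \<bar>B\<bar> * norm (smooth_jet (\<psi> j) z - jet cyl W z)" .
      qed
    qed simp
  qed
  then have "(\<lambda>j. lam 0 * (L2_norm N (\<lambda>z. \<eta> (snd z) * \<psi> j z))\<^sup>2) \<longlonglongrightarrow> lam 0 * (L2_norm N (\<lambda>z. \<eta> (snd z) * W z))\<^sup>2"
    by (intro tendsto_intros)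
  moreover have "(\<lambda>j. wf.form (smooth_jet (\<psi> j)) (smooth_jet (\<psi> j))) \<longlonglongrightarrow> wf.form (jet cyl W) (jet cyl W)"
    by (intro wf.form_tendsto cylN.smooth_jet_L2 WL \<psi> lim)
  ultimately show "lam 0 * (L2_norm N (\<lambda>z. \<eta> (snd z) * W z))\<^sup>2 \<le> (\<integral>z. base_weighted \<eta> z (jet cyl W z) (jet cyl W z) \<partial>N)"
    using weighted_gap_test[OF \<eta> \<psi>] unfolding wf.form_def[symmetric] by (meson LIMSEQ_le)
qed

text \<open>If test functions approximate W, their products with \<eta>^2 are again test functions
  and vanish at y = 0. They converge because multiplication by \<eta>^2 acts on jets as a bounded
  linear map at each point; boundedness of \<eta> and its derivative is used here.\<close>

lemma cutoff_zero_trace: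
  assumes \<eta>: "smooth \<eta>" "\<And>y. \<bar>\<eta> y\<bar> \<le> B" "\<And>y. \<bar>deriv \<eta> y\<bar> \<le> B'" "\<eta> 0 = 0"
    and tr: "has_trace \<alpha> \<Omega> W u"
  shows "\<exists>v. has_trace \<alpha> \<Omega> v (\<lambda>x. 0) \<and> (AE z in N. jet cyl v z = ((\<eta> (snd z))\<^sup>2 * W z,
      ((\<eta> (snd z))\<^sup>2 *\<^sub>R fst (weak_grad cyl W z),
        (\<eta> (snd z))\<^sup>2 * snd (weak_grad cyl W z) + 2 * \<eta> (snd z) * deriv \<eta> (snd z) * W z)))"
proof -
  obtain \<psi> where \<psi>': "\<forall>j. \<psi> j \<in> test_functions (\<Omega> \<times> UNIV)"
    and lim: "(\<lambda>j::nat. L2_norm N (\<lambda>x. smooth_jet (\<psi> j) x - jet cyl W x)) \<longlonglongrightarrow> 0"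
    and "(\<lambda>j. L2_norm \<mu> (\<lambda>x. \<psi> j (x, 0) - u x)) \<longlonglongrightarrow> 0"
    by (rule has_traceE[OF tr])
  note \<psi> = \<psi>'[rule_format]
  have H1: "W \<in> H1 N cyl"
    using tr unfolding has_trace_def HL_eq H1_closure_def by blast
  note W = cylN.H1_jet[OF H1]
  note d\<eta> = smooth_deriv[OF \<eta>(1)]
  \<comment> \<open>The product rule as a linear map on jets.\<close>
  define E where "E z p = ((\<eta> (snd z))\<^sup>2 * fst p, ((\<eta> (snd z))\<^sup>2 *\<^sub>R fst (snd p),
      (\<eta> (snd z))\<^sup>2 * snd (snd p) + 2 * \<eta> (snd z) * deriv \<eta> (snd z) * fst p))"
    for z :: "(real^'n) \<times> real" and p :: "real \<times> ((real^'n) \<times> real)"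
  \<comment> \<open>One summand for each component, the vertical one contributing also the
    derivative of \<eta>^2.\<close>
  define C where "C = B\<^sup>2 + (B\<^sup>2 + (B\<^sup>2 + 2 * \<bar>B\<bar> * \<bar>B'\<bar>))"
  have E_diff: "E z (p - q) = E z p - E z q" for z p q
    by (simp add: E_def algebra_simps)
  have E_bound: "norm (E z p) \<le> C * norm p" for z p
  proof -
    have sq: "\<bar>(\<eta> (snd z))\<^sup>2\<bar> \<le> B\<^sup>2"
      using power_mono[OF \<eta>(2)[of "snd z"], of 2] by simp
    have pr: "\<bar>2 * \<eta> (snd z) * deriv \<eta> (snd z)\<bar> \<le> 2 * \<bar>B\<bar> * \<bar>B'\<bar>"
      using \<eta>(2)[of "snd z"] \<eta>(3)[of "snd z"] by (auto simp: abs_mult intro!: mult_mono)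
    have n: "\<bar>fst p\<bar> \<le> norm p" "norm (fst (snd p)) \<le> norm p" "\<bar>snd (snd p)\<bar> \<le> norm p"
    proof -
      have "norm (snd p) \<le> norm p" using norm_snd_le[of "snd p" "fst p"] by simp
      then show "\<bar>fst p\<bar> \<le> norm p" "norm (fst (snd p)) \<le> norm p" "\<bar>snd (snd p)\<bar> \<le> norm p"
        using norm_fst_le[of "fst p" "snd p"] norm_fst_le[of "fst (snd p)" "snd (snd p)"]
          norm_snd_le[of "snd (snd p)" "fst (snd p)"] by auto
    qed
    have "norm (E z p) \<le> norm ((\<eta> (snd z))\<^sup>2 * fst p) + (norm ((\<eta> (snd z))\<^sup>2 *\<^sub>R fst (snd p)) +
        norm ((\<eta> (snd z))\<^sup>2 * snd (snd p) + 2 * \<eta> (snd z) * deriv \<eta> (snd z) * fst p))"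
      unfolding E_def by (intro order_trans[OF norm_Pair_le] add_left_mono norm_Pair_le)
    also have "\<dots> \<le> B\<^sup>2 * norm p + (B\<^sup>2 * norm p + (B\<^sup>2 * norm p + 2 * \<bar>B\<bar> * \<bar>B'\<bar> * norm p))"
    proof (intro add_mono order_trans[OF norm_triangle_ineq])
      show "norm ((\<eta> (snd z))\<^sup>2 * fst p) \<le> B\<^sup>2 * norm p"
        unfolding real_norm_def abs_mult by (intro mult_mono sq n) auto
      show "norm ((\<eta> (snd z))\<^sup>2 *\<^sub>R fst (snd p)) \<le> B\<^sup>2 * norm p"
        unfolding norm_scaleR by (intro mult_mono sq n) auto
      show "norm ((\<eta> (snd z))\<^sup>2 * snd (snd p)) \<le> B\<^sup>2 * norm p"
        unfolding real_norm_def abs_mult[of "(\<eta> (snd z))\<^sup>2"] by (intro mult_mono sq n) auto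
      show "norm (2 * \<eta> (snd z) * deriv \<eta> (snd z) * fst p) \<le> 2 * \<bar>B\<bar> * \<bar>B'\<bar> * norm p"
        unfolding real_norm_def abs_mult[of "2 * \<eta> (snd z) * deriv \<eta> (snd z)"] by (intro mult_mono pr n) auto
    qed
    finally show ?thesis by (simp add: C_def algebra_simps)
  qed
  have C: "0 \<le> C" by (simp add: C_def)
  have E_meas: "(\<lambda>z. E z (p z)) \<in> borel_measurable N" if p: "p \<in> borel_measurable N" for p
  proof -
    have [measurable]: "(\<lambda>z. \<eta> (snd z)) \<in> borel_measurable N" "(\<lambda>z. deriv \<eta> (snd z)) \<in> borel_measurable N"
      by (intro measurable_snd_N smooth_borel_measurable \<eta> d\<eta>)+
    note fs = measurable_compose[OF _ borel_measurable_continuous_onI[OF continuous_on_fst[OF continuous_on_id]]]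
      measurable_compose[OF _ borel_measurable_continuous_onI[OF continuous_on_snd[OF continuous_on_id]]]
    have [measurable]: "(\<lambda>z. fst (p z)) \<in> borel_measurable N" using p by (rule fs(1))
    have sp: "(\<lambda>z. snd (p z)) \<in> borel_measurable N" using p by (rule fs(2))
    have [measurable]: "(\<lambda>z. fst (snd (p z))) \<in> borel_measurable N" "(\<lambda>z. snd (snd (p z))) \<in> borel_measurable N"
      using fs(1)[OF sp] fs(2)[OF sp] by auto
    show ?thesis
      unfolding E_def by (intro borel_measurable_Pair) measurable
  qed
  have E_L2: "(\<lambda>z. E z (p z)) \<in> L2 N" if p: "p \<in> L2 N" for p
    by (rule L2_bounded_mult[OF p E_meas[OF L2D(1)[OF p]], of C]) (use E_bound in \<open>simp add: AE_I2\<close>)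
  let ?\<chi> = "\<lambda>j z. (\<eta> (snd z) * \<eta> (snd z)) * \<psi> j z"
  have s2: "smooth (\<lambda>z::(real^'n) \<times> real. \<eta> (snd z) * \<eta> (snd z))"
    by (intro smooth_mult smooth_linear[OF \<eta>(1)] bounded_linear_snd)
  have \<chi>: "?\<chi> j \<in> test_functions (\<Omega> \<times> UNIV)" for j
    by (rule test_functions_mult[OF \<psi> s2])
  have g2: "gradient (\<lambda>z::(real^'n) \<times> real. \<eta> (snd z) * \<eta> (snd z)) z = (0, 2 * \<eta> (snd z) * deriv \<eta> (snd z))" for z
  proof -
    have s: "smooth (\<lambda>y. \<eta> y * \<eta> y)" by (intro smooth_mult \<eta>)
    have "deriv (\<lambda>y. \<eta> y * \<eta> y) y = 2 * \<eta> y * deriv \<eta> y" for y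
      using DERIV_imp_deriv[OF DERIV_mult[OF d\<eta>(1) d\<eta>(1)], of y] by simp
    then have "frechet_derivative (\<lambda>z::(real^'n) \<times> real. \<eta> (snd z) * \<eta> (snd z)) (at (x, y)) (0, 1) = 2 * \<eta> y * deriv \<eta> y" for x y
      using frechet_derivative_tensor[OF smooth_const s, of 1 x y] by simp
    moreover have "gradient (\<lambda>x::real^'n. \<eta> (snd (x, y)) * \<eta> (snd (x, y))) x = 0" for x y
      by (simp add: gradient_def)
    ultimately show ?thesis
      by (cases z) (simp only: gradient_prod[OF s2] snd_conv)
  qed
  have jet\<chi>: "smooth_jet (?\<chi> j) z = E z (smooth_jet (\<psi> j) z)" for j z
  proof -
    have "gradient (?\<chi> j) z = (\<eta> (snd z) * \<eta> (snd z)) *\<^sub>R gradient (\<psi> j) z + \<psi> j z *\<^sub>R (0, 2 * \<eta> (snd z) * deriv \<eta> (snd z))"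
      unfolding gradient_mult[OF s2 test_functions_smooth[OF \<psi>]] g2 ..
    then show ?thesis
      by (cases "gradient (\<psi> j) z") (simp add: smooth_jet_def E_def power2_eq_square mult_ac)
  qed
  define w where "w z = fst (E z (jet cyl W z))" for z
  define G where "G z = snd (E z (jet cyl W z))" for z
  have EW: "(\<lambda>z. E z (jet cyl W z)) \<in> L2 N" by (rule E_L2[OF W(4)])
  have wL: "w \<in> L2 N" and GL: "G \<in> L2 N"
  proof -
    note fs = measurable_compose[OF _ borel_measurable_continuous_onI[OF continuous_on_fst[OF continuous_on_id]]]
      measurable_compose[OF _ borel_measurable_continuous_onI[OF continuous_on_snd[OF continuous_on_id]]]
    have m: "w \<in> borel_measurable N" "G \<in> borel_measurable N"
      unfolding w_def[abs_def] G_def[abs_def] using fs(1)[OF L2D(1)[OF EW]] fs(2)[OF L2D(1)[OF EW]] by auto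
    have nf: "\<bar>fst p\<bar> \<le> norm p" "norm (snd p) \<le> norm p" for p :: "real \<times> ((real^'n) \<times> real)"
      using norm_fst_le[of "fst p" "snd p"] norm_snd_le[of "snd p" "fst p"] by simp_all
    show "w \<in> L2 N"
      by (rule L2_bounded_mult[OF EW m(1), of 1])
        (simp add: w_def nf AE_I2)
    show "G \<in> L2 N"
      by (rule L2_bounded_mult[OF EW m(2), of 1])
        (simp add: G_def nf AE_I2)
  qed
  have wG: "(w z, G z) = E z (jet cyl W z)" for z by (simp add: w_def G_def)
  have l1: "(\<lambda>j. L2_norm N (\<lambda>z. smooth_jet (?\<chi> j) z - (w z, G z))) \<longlonglongrightarrow> 0"
    unfolding jet\<chi> wG E_diff[symmetric]
  proof (rule L2_tendsto_mono[OF lim _ _ _ C])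
    show jL: "(\<lambda>x. smooth_jet (\<psi> j) x - jet cyl W x) \<in> L2 N" for j
      by (intro L2_diff cylN.smooth_jet_L2 \<psi> W)
    show "(\<lambda>z. E z (smooth_jet (\<psi> j) z - jet cyl W z)) \<in> borel_measurable N" for j
      by (rule E_meas[OF L2D(1)[OF jL]])
  qed (use E_bound in auto)
  have l2: "(\<lambda>j. L2_norm \<mu> (\<lambda>x. ?\<chi> j (x, 0) - 0)) \<longlonglongrightarrow> 0"
    by (simp add: \<eta>(4) L2_norm_def)
  note H = has_trace_closure[OF \<chi> wL GL l1 L2_zero l2]
  show ?thesis
    by (rule exI[of _ w]) (use H in \<open>auto simp: wG E_def jet_def elim!: eventually_mono\<close>)
qed

text \<open>The weight is the saturated exponential 1/(\<epsilon> + exp(-\<gamma> y)) with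
  \<epsilon> = exp(-\<gamma> Y), switched on between y = 1/2 and y = 1. It grows at logarithmic rate
  at most \<gamma>, stays below exp(\<gamma> Y), and beyond Y has reached at least half of that
  value. The switching costs the constant D, which must not depend on Y.\<close>

lemma agmon_weight:
  fixes \<gamma> Y :: real
  assumes \<gamma>: "0 < \<gamma>"
  shows "\<exists>D\<ge>0. \<forall>Y\<ge>1. \<exists>\<eta> B B'. smooth \<eta> \<and> (\<forall>y. \<bar>\<eta> y\<bar> \<le> B) \<and> (\<forall>y. \<bar>deriv \<eta> y\<bar> \<le> B') \<and> \<eta> 0 = 0 \<and>
    (\<forall>y>1. \<bar>deriv \<eta> y\<bar> \<le> \<gamma> * \<eta> y \<and> 0 \<le> \<eta> y) \<and> (\<forall>y\<le>1. 2 * \<bar>\<eta> y * deriv \<eta> y\<bar> \<le> D) \<and>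
    (\<forall>y>Y. exp (\<gamma> * Y) / 2 \<le> \<eta> y)"
proof -
  note ds = smooth_deriv[OF smooth_smooth_step]
  have "bounded (deriv smooth_step ` {0..1})"
    by (intro compact_imp_bounded compact_continuous_image smooth_continuous_on ds) simp
  then obtain M where M': "\<forall>u\<in>{0..1}. \<bar>deriv smooth_step u\<bar> \<le> M"
    by (auto simp: bounded_iff)
  have M: "\<bar>deriv smooth_step u\<bar> \<le> \<bar>M\<bar>" for u
    using bspec[OF M', of u] smooth_step_deriv_eq_0[of u] by (cases "u \<in> {0..1}") auto
  \<comment> \<open>For y \<le> 1 the saturated exponential is at most exp \<gamma>; this bounds
    \<eta>, and with \<open>2 * \<bar>M\<bar>\<close> from the switch it bounds the derivative of
    \<eta>.\<close>
  define D where "D = 2 * (exp \<gamma> * (2 * \<bar>M\<bar> * exp \<gamma> + \<gamma> * exp \<gamma>))"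
  have "\<exists>\<eta> B B'. smooth \<eta> \<and> (\<forall>y. \<bar>\<eta> y\<bar> \<le> B) \<and> (\<forall>y. \<bar>deriv \<eta> y\<bar> \<le> B') \<and> \<eta> 0 = 0 \<and>
    (\<forall>y>1. \<bar>deriv \<eta> y\<bar> \<le> \<gamma> * \<eta> y \<and> 0 \<le> \<eta> y) \<and> (\<forall>y\<le>1. 2 * \<bar>\<eta> y * deriv \<eta> y\<bar> \<le> D) \<and>
    (\<forall>y>Y. exp (\<gamma> * Y) / 2 \<le> \<eta> y)" if Y: "1 \<le> Y" for Y
  proof -
    define \<epsilon> where "\<epsilon> = exp (- (\<gamma> * Y))"
    have \<epsilon>: "0 < \<epsilon>" by (simp add: \<epsilon>_def)
    define \<rho> where "\<rho> y = inverse (\<epsilon> + exp ((- \<gamma>) * y))" for y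
    define \<sigma> where "\<sigma> y = smooth_step (2 * y + (-1))" for y
    define \<eta> where "\<eta> y = \<sigma> y * \<rho> y" for y
    have den: "0 < \<epsilon> + exp ((- \<gamma>) * y)" for y using \<epsilon> by (simp add: add_pos_pos)
    have sexp: "smooth (\<lambda>y. \<epsilon> + exp ((- \<gamma>) * y))"
      by (intro smooth_add smooth_const smooth_linear[OF smooth_exp bounded_linear_mult_right])
    have s\<rho>: "smooth \<rho>"
      unfolding \<rho>_def using den by (intro smooth_inverse sexp) (simp add: less_le)
    have s\<sigma>: "smooth \<sigma>"
      unfolding \<sigma>_def by (intro smooth_affine[OF smooth_smooth_step bounded_linear_mult_right])
    have s\<eta>: "smooth \<eta>" unfolding \<eta>_def by (intro smooth_mult s\<sigma> s\<rho>)
    define \<rho>' where "\<rho>' y = \<gamma> * exp ((- \<gamma>) * y) * (\<rho> y * \<rho> y)" for y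
    have d\<rho>: "(\<rho> has_real_derivative \<rho>' y) (at y)" for y
      unfolding \<rho>_def[abs_def] \<rho>'_def \<rho>_def
      by (rule derivative_eq_intros refl | use den[of y] in \<open>force simp: field_simps\<close>)+
    have d\<sigma>: "(\<sigma> has_real_derivative deriv smooth_step (2 * y + (-1)) * 2) (at y)" for y
      unfolding \<sigma>_def by (rule DERIV_chain2[OF ds(1)]) (auto intro!: derivative_eq_intros)
    have d\<eta>: "deriv \<eta> y = deriv smooth_step (2 * y + (-1)) * 2 * \<rho> y + \<rho>' y * \<sigma> y" for y
      unfolding \<eta>_def[abs_def] by (rule DERIV_imp_deriv[OF DERIV_mult[OF d\<sigma> d\<rho>]])
    have \<rho>_pos: "0 < \<rho> y" for y unfolding \<rho>_def using den by simp
    have \<rho>_le: "\<rho> y \<le> inverse \<epsilon>" for y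
      unfolding \<rho>_def using \<epsilon> by (intro le_imp_inverse_le) auto
    have e\<rho>: "exp ((- \<gamma>) * y) * \<rho> y \<le> 1" for y
      unfolding \<rho>_def using den[of y] \<epsilon> by (simp add: field_simps)
    have \<rho>': "0 \<le> \<rho>' y" "\<rho>' y \<le> \<gamma> * \<rho> y" for y
    proof -
      show "0 \<le> \<rho>' y" unfolding \<rho>'_def using \<gamma> \<rho>_pos[of y] by simp
      have "(exp ((- \<gamma>) * y) * \<rho> y) * (\<gamma> * \<rho> y) \<le> 1 * (\<gamma> * \<rho> y)"
        using \<gamma> \<rho>_pos[of y] by (intro mult_right_mono e\<rho>) auto
      then show "\<rho>' y \<le> \<gamma> * \<rho> y" unfolding \<rho>'_def by (simp add: mult_ac)
    qed
    have \<sigma>b: "0 \<le> \<sigma> y" "\<sigma> y \<le> 1" for y by (simp_all add: \<sigma>_def smooth_step_bounds)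
    have \<eta>b: "0 \<le> \<eta> y" "\<eta> y \<le> \<rho> y" for y
      unfolding \<eta>_def using \<sigma>b[of y] \<rho>_pos[of y] mult_right_mono[of "\<sigma> y" 1 "\<rho> y"] by simp_all
    have d\<eta>b: "\<bar>deriv \<eta> y\<bar> \<le> 2 * \<bar>M\<bar> * \<rho> y + \<gamma> * \<rho> y" for y
    proof -
      have "\<bar>deriv smooth_step (2 * y + (-1)) * 2 * \<rho> y\<bar> \<le> 2 * \<bar>M\<bar> * \<rho> y"
        using M[of "2 * y + (-1)"] \<rho>_pos[of y] by (simp add: abs_mult mult_right_mono)
      moreover have "\<bar>\<rho>' y * \<sigma> y\<bar> \<le> \<gamma> * \<rho> y"
        using \<rho>'[of y] \<sigma>b[of y] mult_left_le[of "\<sigma> y" "\<rho>' y"] by (simp add: abs_mult)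
      ultimately show ?thesis unfolding d\<eta> by linarith
    qed
    show ?thesis
    proof (intro exI conjI allI impI)
      show "smooth \<eta>" by (rule s\<eta>)
      show "\<bar>\<eta> y\<bar> \<le> inverse \<epsilon>" for y using \<eta>b[of y] \<rho>_le[of y] by simp
      show "\<bar>deriv \<eta> y\<bar> \<le> 2 * \<bar>M\<bar> * inverse \<epsilon> + \<gamma> * inverse \<epsilon>" for y
        using \<gamma> by (intro order_trans[OF d\<eta>b] add_mono mult_left_mono \<rho>_le) auto
      show "\<eta> 0 = 0" by (simp add: \<eta>_def \<sigma>_def smooth_step_eq_0)
      show "0 \<le> \<eta> y" for y by (rule \<eta>b)
      show "\<bar>deriv \<eta> y\<bar> \<le> \<gamma> * \<eta> y" if "y > 1" for y
      proof -
        have 1: "\<sigma> y = 1" using that by (simp add: \<sigma>_def smooth_step_eq_1)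
        have 2: "deriv smooth_step (2 * y + (-1)) = 0" using that by (intro smooth_step_deriv_eq_0) auto
        show ?thesis unfolding d\<eta> \<eta>_def 1 2 using \<rho>'[of y] by simp
      qed
      show "2 * \<bar>\<eta> y * deriv \<eta> y\<bar> \<le> D" if "y \<le> 1" for y
      proof -
        have "exp (- \<gamma>) \<le> exp ((- \<gamma>) * y)" using that \<gamma> by simp
        then have "exp (- \<gamma>) \<le> \<epsilon> + exp ((- \<gamma>) * y)" using \<epsilon> by linarith
        then have "\<rho> y \<le> inverse (exp (- \<gamma>))" unfolding \<rho>_def by (intro le_imp_inverse_le) auto
        then have r: "\<rho> y \<le> exp \<gamma>" by (simp add: exp_minus)
        have "\<bar>\<eta> y\<bar> * \<bar>deriv \<eta> y\<bar> \<le> exp \<gamma> * (2 * \<bar>M\<bar> * exp \<gamma> + \<gamma> * exp \<gamma>)"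
          using \<eta>b[of y] r \<gamma>
          by (intro mult_mono order_trans[OF d\<eta>b] add_mono mult_left_mono) auto
        then show ?thesis unfolding D_def abs_mult by simp
      qed
      show "exp (\<gamma> * Y) / 2 \<le> \<eta> y" if "y > Y" for y
      proof -
        have 1: "\<sigma> y = 1" using that Y by (simp add: \<sigma>_def smooth_step_eq_1)
        have "exp ((- \<gamma>) * y) \<le> \<epsilon>" using that \<gamma> by (simp add: \<epsilon>_def)
        then have "\<epsilon> + exp ((- \<gamma>) * y) \<le> 2 * \<epsilon>" by simp
        then have "inverse (2 * \<epsilon>) \<le> \<rho> y" unfolding \<rho>_def using den[of y] by (intro le_imp_inverse_le)
        then show ?thesis unfolding \<eta>_def 1 by (simp add: \<epsilon>_def exp_minus field_simps)
      qed
    qed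
  qed
  moreover have "0 \<le> D" using \<gamma> by (simp add: D_def)
  ultimately show ?thesis by blast
qed

text \<open>Since \<open>4 \<gamma>\<^sup>2 = lam 0\<close>, the spectral gap absorbs the commutator term above height \<open>1\<close>.\<close>

lemma harmonic_decay:
  "\<exists>C2>0. \<forall>W u Y. has_trace \<alpha> \<Omega> W u \<longrightarrow>
    (\<forall>v. has_trace \<alpha> \<Omega> v (\<lambda>x. 0) \<longrightarrow> cf.form (jet cyl W) (jet cyl v) = 0) \<longrightarrow> 1 \<le> Y \<longrightarrow>
    (\<integral>z. indicator {Y<..} (snd z) * (norm (weak_grad cyl W z))\<^sup>2 \<partial>N) \<le>
      C2 * exp (- sqrt (lam 0) * Y) * cf.form (jet cyl W) (jet cyl W)"
proof -
  define \<gamma> where "\<gamma> = sqrt (lam 0) / 2"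
  have \<gamma>: "0 < \<gamma>" "4 * \<gamma>\<^sup>2 = lam 0" using sqrt_lam[of 0] by (auto simp: \<gamma>_def power_divide)
  obtain D where D0: "0 \<le> D" and D: "\<forall>Y\<ge>1. \<exists>\<eta> B B'. smooth \<eta> \<and> (\<forall>y. \<bar>\<eta> y\<bar> \<le> B) \<and> (\<forall>y. \<bar>deriv \<eta> y\<bar> \<le> B') \<and> \<eta> 0 = 0 \<and>
    (\<forall>y>1. \<bar>deriv \<eta> y\<bar> \<le> \<gamma> * \<eta> y \<and> 0 \<le> \<eta> y) \<and> (\<forall>y\<le>1. 2 * \<bar>\<eta> y * deriv \<eta> y\<bar> \<le> D) \<and>
    (\<forall>y>Y. exp (\<gamma> * Y) / 2 \<le> \<eta> y)"
    using agmon_weight[OF \<gamma>(1)] by blast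
  obtain a where a: "a > 0" "\<And>x u. x \<in> \<Omega> \<Longrightarrow> a * (norm u)\<^sup>2 \<le> (A x *v u) \<bullet> u"
    using A_elliptic by blast
  \<comment> \<open>The 4 and the exponential come from \<eta> \<ge> exp(\<gamma> Y)/2 above Y, 1/a
    + 1 from ellipticity, and 2 D (1/lam 0 + 1) from the energy of the region where the cut-off
    varies. The final 1 gives positivity.\<close>
  define C2 where "C2 = 4 * (1 / a + 1) * (2 * D * (1 / lam 0 + 1)) + 1"
  have C2: "0 < C2" using a(1) D0 lam_pos[of 0] by (auto simp: C2_def intro!: add_nonneg_pos mult_nonneg_nonneg add_nonneg_nonneg)
  have main: "(\<integral>z. indicator {Y<..} (snd z) * (norm (weak_grad cyl W z))\<^sup>2 \<partial>N) \<le>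
      C2 * exp (- sqrt (lam 0) * Y) * cf.form (jet cyl W) (jet cyl W)"
    if tr: "has_trace \<alpha> \<Omega> W u" and har: "\<forall>v. has_trace \<alpha> \<Omega> v (\<lambda>x. 0) \<longrightarrow> cf.form (jet cyl W) (jet cyl v) = 0"
      and Y: "1 \<le> Y" for W u Y
  proof -
    obtain \<eta> B B' where \<eta>: "smooth \<eta>" "\<forall>y. \<bar>\<eta> y\<bar> \<le> B" "\<forall>y. \<bar>deriv \<eta> y\<bar> \<le> B'" "\<eta> 0 = 0"
      "\<forall>y>1. \<bar>deriv \<eta> y\<bar> \<le> \<gamma> * \<eta> y \<and> 0 \<le> \<eta> y" "\<forall>y\<le>1. 2 * \<bar>\<eta> y * deriv \<eta> y\<bar> \<le> D"
      "\<forall>y>Y. exp (\<gamma> * Y) / 2 \<le> \<eta> y"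
      using D Y by blast
    note \<eta>m = smooth_borel_measurable[OF \<eta>(1)]
    obtain v where v: "has_trace \<alpha> \<Omega> v (\<lambda>x. 0)" and jv: "AE z in N. jet cyl v z = ((\<eta> (snd z))\<^sup>2 * W z,
      ((\<eta> (snd z))\<^sup>2 *\<^sub>R fst (weak_grad cyl W z),
        (\<eta> (snd z))\<^sup>2 * snd (weak_grad cyl W z) + 2 * \<eta> (snd z) * deriv \<eta> (snd z) * W z))"
      using cutoff_zero_trace[OF \<eta>(1) \<eta>(2)[rule_format] \<eta>(3)[rule_format] \<eta>(4) tr] by blast
    have H1: "W \<in> H1 N cyl"
      using tr unfolding has_trace_def HL_eq H1_closure_def by blast
    note WH = cylN.H1_jet[OF H1]
    define r where "r z = snd (weak_grad cyl W z)" for z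
    have rL: "r \<in> L2 N"
    proof (rule L2_bounded_mult[OF WH(3)])
      show "r \<in> borel_measurable N"
        unfolding r_def[abs_def]
        by (rule measurable_compose[OF L2D(1)[OF WH(3)] borel_measurable_continuous_onI[OF continuous_on_snd[OF continuous_on_id]]])
      show "AE z in N. norm (r z) \<le> 1 * norm (weak_grad cyl W z)"
      proof (rule AE_I2)
        fix z show "norm (r z) \<le> 1 * norm (weak_grad cyl W z)"
          using norm_snd_le[of "snd (weak_grad cyl W z)" "fst (weak_grad cyl W z)"] by (simp add: r_def)
      qed
    qed
    have mult: "(\<lambda>z. \<eta> (snd z) * r z) \<in> L2 N"
    proof (rule L2_bounded_mult[OF rL])
      show "(\<lambda>z. \<eta> (snd z) * r z) \<in> borel_measurable N"
        using measurable_snd_N[OF \<eta>m] L2D(1)[OF rL] by measurable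
      show "AE z in N. norm (\<eta> (snd z) * r z) \<le> B * norm (r z)"
        using \<eta>(2) by (intro AE_I2) (auto simp: abs_mult intro!: mult_right_mono)
    qed
    note gap = weighted_gap[OF \<eta>m \<eta>(2)[rule_format] tr]
    have one: "(\<lambda>y::real. 1::real) \<in> borel_measurable borel" by simp
    note gap1 = weighted_gap[OF one, of 1, OF _ tr]
    \<comment> \<open>\<open>f1\<close> and \<open>f2\<close> are the horizontal and vertical parts
      of the weighted energy, \<open>f3\<close> the weighted mass, and \<open>f4\<close> bounds the
      error of the cut-off. \<open>f0\<close> is the density of the form at W and \<eta>^2 W, whose
      integral is zero.\<close>
    define f1 where "f1 z = base_weighted \<eta> z (jet cyl W z) (jet cyl W z)" for z
    define f2 where "f2 z = (norm (\<eta> (snd z) * r z))\<^sup>2" for z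
    define f3 where "f3 z = (norm (\<eta> (snd z) * W z))\<^sup>2" for z
    define f4 where "f4 z = (norm (W z))\<^sup>2 + (norm (r z))\<^sup>2" for z
    define f0 where "f0 z = cyl_density z (jet cyl W z) (jet cyl v z)" for z
    have i1: "integrable N f1" unfolding f1_def[abs_def] by (rule gap(3))
    have i2: "integrable N f2" unfolding f2_def[abs_def] by (rule L2D(2)[OF mult])
    have i3: "integrable N f3" unfolding f3_def[abs_def] by (rule L2D(2)[OF gap(2)])
    have i4: "integrable N f4"
      unfolding f4_def[abs_def] by (intro Bochner_Integration.integrable_add L2D(2) WH rL)
    have i0: "integrable N f0" unfolding f0_def[abs_def] by (rule cf.integrable_form[OF WH(4) has_trace_L2(1)[OF v]])
    have f0_0: "integral\<^sup>L N f0 = 0"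
      using har v unfolding cf.form_def f0_def[abs_def] by blast
    \<comment> \<open>The commutator is 2 \<eta> \<eta>' W times the vertical derivative. Above
      height 1 Young's inequality with |\<eta>'| \<le> \<gamma> \<eta> yields half of
      \<open>f2\<close> and (2 \<gamma>)^2 / 2 = lam 0 / 2 times \<open>f3\<close>; below, D times
      \<open>f4\<close>.\<close>
    have pt: "AE z in N. f1 z + (1 / 2) * f2 z - (1 / 2 * lam 0) * f3 z - D * f4 z \<le> f0 z"
      using jv AE_cyl
    proof eventually_elim
      case (elim z)
      let ?e = "\<eta> (snd z)" and ?e' = "deriv \<eta> (snd z)" and ?w = "W z" and ?r = "r z"
      have f0: "f0 z = f1 z + f2 z + 2 * ?e * ?e' * ?w * ?r"
        unfolding f0_def f1_def f2_def elim(1)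
        by (simp add: cyl_density_def base_weighted_def jet_def diag_ext_def inner_prod_def r_def
            power2_eq_square algebra_simps)
      have sq: "2 * (\<bar>?w\<bar> * \<bar>?r\<bar>) \<le> ?w\<^sup>2 + ?r\<^sup>2"
        using sum_squares_bound[of "\<bar>?w\<bar>" "\<bar>?r\<bar>"] by simp
      have "- (2 * ?e * ?e' * ?w * ?r) \<le> (1 / 2) * f2 z + (1 / 2 * lam 0) * f3 z + D * f4 z"
      proof (cases "snd z > 1")
        case True
        then have e: "\<bar>?e'\<bar> \<le> \<gamma> * ?e" "0 \<le> ?e" using \<eta>(5) by auto
        have "- (2 * ?e * ?e' * ?w * ?r) \<le> \<bar>2 * ?e * ?e' * ?w * ?r\<bar>" by simp
        also have "\<dots> = (2 * ?e * \<bar>?w\<bar> * \<bar>?r\<bar>) * \<bar>?e'\<bar>" using e(2) by (simp add: abs_mult)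
        also have "\<dots> \<le> (2 * ?e * \<bar>?w\<bar> * \<bar>?r\<bar>) * (\<gamma> * ?e)" using e by (intro mult_left_mono) auto
        also have "\<dots> = 2 * (2 * \<gamma> * (?e * \<bar>?w\<bar>)) * (?e * \<bar>?r\<bar>) / 2" by simp
        also have "\<dots> \<le> ((2 * \<gamma> * (?e * \<bar>?w\<bar>))\<^sup>2 + (?e * \<bar>?r\<bar>)\<^sup>2) / 2"
          by (intro divide_right_mono sum_squares_bound) simp
        also have "\<dots> = (1 / 2) * f2 z + (1 / 2 * lam 0) * f3 z"
          by (simp add: f2_def f3_def power_mult_distrib \<gamma>(2)[symmetric])
        also have "\<dots> \<le> (1 / 2) * f2 z + (1 / 2 * lam 0) * f3 z + D * f4 z"
          using D0 by (simp add: f4_def)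
        finally show ?thesis .
      next
        case False
        then have e: "2 * \<bar>?e * ?e'\<bar> \<le> D" using \<eta>(6) by auto
        have "- (2 * ?e * ?e' * ?w * ?r) \<le> \<bar>2 * ?e * ?e' * ?w * ?r\<bar>" by simp
        also have "\<dots> = (2 * \<bar>?e * ?e'\<bar>) * (\<bar>?w\<bar> * \<bar>?r\<bar>)" by (simp add: abs_mult)
        also have "\<dots> \<le> D * (\<bar>?w\<bar> * \<bar>?r\<bar>)" using e by (intro mult_right_mono) auto
        also have "\<dots> \<le> D * f4 z"
        proof (rule mult_left_mono[OF _ D0])
          have "0 \<le> \<bar>?w\<bar> * \<bar>?r\<bar>" by simp
          with sq have "\<bar>?w\<bar> * \<bar>?r\<bar> \<le> ?w\<^sup>2 + ?r\<^sup>2" by linarith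
          then show "\<bar>?w\<bar> * \<bar>?r\<bar> \<le> f4 z" by (simp add: f4_def)
        qed
        also have "\<dots> \<le> (1 / 2) * f2 z + (1 / 2 * lam 0) * f3 z + D * f4 z"
          using lam_pos[of 0] by (simp add: f2_def f3_def)
        finally show ?thesis .
      qed
      then show ?case unfolding f0 by linarith
    qed
    have "(\<integral>z. f1 z + (1 / 2) * f2 z - (1 / 2 * lam 0) * f3 z - D * f4 z \<partial>N) \<le> (\<integral>z. f0 z \<partial>N)"
      using i0 i1 i2 i3 i4 pt by (intro integral_mono_AE) auto
    then have e1: "integral\<^sup>L N f1 + (1 / 2) * integral\<^sup>L N f2 - (1 / 2) * (lam 0 * integral\<^sup>L N f3) - D * integral\<^sup>L N f4 \<le> 0"
      using i1 i2 i3 i4 f0_0 by simp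
    have e2: "lam 0 * integral\<^sup>L N f3 \<le> integral\<^sup>L N f1"
      using gap(1) unfolding L2_norm_sq f1_def[abs_def] f3_def[abs_def] .
    \<comment> \<open>By the spectral gap half of lam 0 times the mass is at most half of
      \<open>f1\<close>. Half of the weighted energy thus survives the absorption.\<close>
    have e3: "integral\<^sup>L N f1 + integral\<^sup>L N f2 \<le> 2 * (D * integral\<^sup>L N f4)"
      using e1 e2 by linarith
    define X where "X = cf.form (jet cyl W) (jet cyl W)"
    \<comment> \<open>The same spectral gap, now with constant weight 1, controls the unweighted
      mass by the energy.\<close>
    have f4X: "integral\<^sup>L N f4 \<le> (1 / lam 0 + 1) * X"
    proof -
      let ?b = "\<lambda>z. base_weighted (\<lambda>y. 1) z (jet cyl W z) (jet cyl W z)"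
      have ib: "integrable N ?b" by (rule gap1(3)) simp
      have ir: "integrable N (\<lambda>z. (norm (r z))\<^sup>2)" and iw: "integrable N (\<lambda>z. (norm (W z))\<^sup>2)"
        by (intro L2D(2) rL WH)+
      have "cyl_density z (jet cyl W z) (jet cyl W z) = ?b z + (norm (r z))\<^sup>2" for z
        by (simp add: cyl_density_def base_weighted_def jet_def diag_ext_def inner_prod_def r_def power2_eq_square)
      then have X: "X = integral\<^sup>L N ?b + (\<integral>z. (norm (r z))\<^sup>2 \<partial>N)"
        unfolding X_def cf.form_def using ib ir by simp
      have g: "lam 0 * (\<integral>z. (norm (W z))\<^sup>2 \<partial>N) \<le> integral\<^sup>L N ?b"
        using gap1(1) by (simp add: L2_norm_sq)
      have w0: "0 \<le> (\<integral>z. (norm (W z))\<^sup>2 \<partial>N)" and r0: "0 \<le> (\<integral>z. (norm (r z))\<^sup>2 \<partial>N)" by simp_all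
      have "0 \<le> lam 0 * (\<integral>z. (norm (W z))\<^sup>2 \<partial>N)" using w0 lam_pos[of 0] by simp
      then have rX: "(\<integral>z. (norm (r z))\<^sup>2 \<partial>N) \<le> X" using X g by linarith
      have "lam 0 * (\<integral>z. (norm (W z))\<^sup>2 \<partial>N) \<le> X" using X g r0 by linarith
      then have wX: "(\<integral>z. (norm (W z))\<^sup>2 \<partial>N) \<le> 1 / lam 0 * X"
        using lam_pos[of 0] by (simp add: field_simps)
      have "integral\<^sup>L N f4 = (\<integral>z. (norm (W z))\<^sup>2 \<partial>N) + (\<integral>z. (norm (r z))\<^sup>2 \<partial>N)"
        unfolding f4_def[abs_def] using ir iw by simp
      with rX wX show ?thesis by (simp add: distrib_right)
    qed
    have X0: "0 \<le> X" unfolding X_def by (rule cf.form_nonneg)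
    have e2Y: "exp (- (2 * (\<gamma> * Y))) = exp (- sqrt (lam 0) * Y)" by (simp add: \<gamma>_def)
    have low: "AE z in N. indicator {Y<..} (snd z) * (norm (weak_grad cyl W z))\<^sup>2 \<le>
        (4 * (1 / a + 1) * exp (- (2 * (\<gamma> * Y)))) * (f1 z + f2 z)"
    proof -
      obtain B2 where "AE z in N. 0 \<le> c (fst z) \<and> c (fst z) \<le> B2" by (rule cyl_c_bounds)
      then show ?thesis
        using AE_cyl
      proof eventually_elim
        case (elim z)
        let ?g = "fst (weak_grad cyl W z)"
        have ag: "a * (norm ?g)\<^sup>2 \<le> (A (fst z) *v ?g) \<bullet> ?g" using a elim by blast
        have "0 \<le> c (fst z) * (W z * W z)" using elim by simp
        with ag have "a * (norm ?g)\<^sup>2 \<le> (A (fst z) *v ?g) \<bullet> ?g + c (fst z) * W z * W z"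
          unfolding mult.assoc by linarith
        then have f1: "(\<eta> (snd z))\<^sup>2 * (a * (norm ?g)\<^sup>2) \<le> f1 z"
          unfolding f1_def base_weighted_def jet_def fst_conv snd_conv by (intro mult_left_mono) auto
        have f2: "f2 z = (\<eta> (snd z))\<^sup>2 * (r z)\<^sup>2" by (simp add: f2_def power_mult_distrib)
        have f10: "0 \<le> f1 z" using order_trans[OF _ f1] a(1) by simp
        have f20: "0 \<le> f2 z" by (simp add: f2_def)
        have k0: "0 \<le> 4 * (1 / a + 1) * exp (- (2 * (\<gamma> * Y)))" using a(1) by simp
        show ?case
        proof (cases "Y < snd z")
          case False
          then show ?thesis using mult_nonneg_nonneg[OF k0 add_nonneg_nonneg[OF f10 f20]] by simp
        next
          case True
          have alg: "(4 * e * h) * (k * (x + y)) = (4 * k * e) * (h * x + h * y)" for e h k x y :: real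
            by (simp add: algebra_simps)
          have "exp (\<gamma> * Y) / 2 \<le> \<eta> (snd z)" using \<eta>(7) True by blast
          then have "(exp (\<gamma> * Y) / 2)\<^sup>2 \<le> (\<eta> (snd z))\<^sup>2" by (intro power_mono) auto
          then have "4 * exp (- (2 * (\<gamma> * Y))) * (exp (\<gamma> * Y) / 2)\<^sup>2 \<le> 4 * exp (- (2 * (\<gamma> * Y))) * (\<eta> (snd z))\<^sup>2"
            by (intro mult_left_mono) auto
          moreover have "4 * exp (- (2 * (\<gamma> * Y))) * (exp (\<gamma> * Y) / 2)\<^sup>2 = 1"
            by (simp add: power_divide exp_double[symmetric] exp_minus mult.commute)
          ultimately have one: "1 \<le> 4 * exp (- (2 * (\<gamma> * Y))) * (\<eta> (snd z))\<^sup>2" by simp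
          have "(norm (weak_grad cyl W z))\<^sup>2 = (norm ?g)\<^sup>2 + (r z)\<^sup>2"
            by (simp add: norm_prod_def r_def)
          also have "\<dots> \<le> (1 / a + 1) * (a * (norm ?g)\<^sup>2 + (r z)\<^sup>2)"
            using a(1) by (simp add: field_simps)
          also have "\<dots> = 1 * ((1 / a + 1) * (a * (norm ?g)\<^sup>2 + (r z)\<^sup>2))" by simp
          also have "\<dots> \<le> (4 * exp (- (2 * (\<gamma> * Y))) * (\<eta> (snd z))\<^sup>2) * ((1 / a + 1) * (a * (norm ?g)\<^sup>2 + (r z)\<^sup>2))"
            using a(1) by (intro mult_right_mono[OF one]) auto
          also have "\<dots> = (4 * (1 / a + 1) * exp (- (2 * (\<gamma> * Y)))) * ((\<eta> (snd z))\<^sup>2 * (a * (norm ?g)\<^sup>2) + (\<eta> (snd z))\<^sup>2 * (r z)\<^sup>2)"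
            by (rule alg)
          also have "\<dots> \<le> (4 * (1 / a + 1) * exp (- (2 * (\<gamma> * Y)))) * (f1 z + f2 z)"
            unfolding f2 by (intro mult_left_mono[OF _ k0] add_right_mono f1)
          finally show ?thesis using True by simp
        qed
      qed
    qed
    let ?k = "4 * (1 / a + 1) * exp (- (2 * (\<gamma> * Y)))"
    have k0: "0 \<le> ?k" using a(1) by simp
    have "(\<integral>z. indicator {Y<..} (snd z) * (norm (weak_grad cyl W z))\<^sup>2 \<partial>N) \<le> (\<integral>z. ?k * (f1 z + f2 z) \<partial>N)"
    proof (rule integral_mono_AE[OF _ _ low])
      show "integrable N (\<lambda>z. ?k * (f1 z + f2 z))" using i1 i2 by simp
      show "integrable N (\<lambda>z. indicator {Y<..} (snd z) * (norm (weak_grad cyl W z))\<^sup>2)"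
      proof (rule Bochner_Integration.integrable_bound[OF L2D(2)[OF WH(3)]])
        have "(indicator {Y<..} :: real \<Rightarrow> real) \<in> borel_measurable borel" by measurable
        from measurable_snd_N[OF this] L2D(1)[OF WH(3)]
        show "(\<lambda>z. indicator {Y<..} (snd z) * (norm (weak_grad cyl W z))\<^sup>2) \<in> borel_measurable N" by measurable
      qed (auto simp: indicator_def)
    qed
    also have "\<dots> = ?k * (integral\<^sup>L N f1 + integral\<^sup>L N f2)" using i1 i2 by simp
    also have "\<dots> \<le> ?k * (2 * (D * ((1 / lam 0 + 1) * X)))"
      using e3 mult_left_mono[OF f4X D0] by (intro mult_left_mono[OF _ k0]) linarith
    also have "\<dots> = (4 * (1 / a + 1) * (2 * D * (1 / lam 0 + 1))) * (exp (- (2 * (\<gamma> * Y))) * X)"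
      by (simp only: mult_ac)
    also have "\<dots> \<le> C2 * (exp (- (2 * (\<gamma> * Y))) * X)"
      using X0 by (intro mult_right_mono) (auto simp: C2_def)
    finally show ?thesis unfolding e2Y X_def by (simp only: mult.assoc)
  qed
  show ?thesis
    by (rule exI[of _ C2]) (use C2 main in blast)
qed

lemma L2_norm_truncated:
  assumes G: "G \<in> borel_measurable N" and Y: "0 \<le> Y"
  shows "(L2_norm (weighted \<alpha> (\<Omega> \<times> {Y<..})) G)\<^sup>2 = (\<integral>z. indicator {Y<..} (snd z) * (norm (G z))\<^sup>2 \<partial>N)"
proof -
  let ?E = "\<Omega> \<times> {Y<..}"
  have E: "?E \<in> sets lebesgue" using open_dom by (simp add: open_Times)
  have sub: "?E \<subseteq> cyl" using Y by (auto simp: cylinder_def)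
  have Gc: "G \<in> borel_measurable (lebesgue_on cyl)" using G by (simp add: cylN.measurable_M_iff)
  have Ge: "G \<in> borel_measurable (lebesgue_on ?E)"
    using measurable_restrict_mono[OF Gc sub] .
  have "(indicator {Y<..} :: real \<Rightarrow> real) \<in> borel_measurable borel" by measurable
  from measurable_snd_N[OF this] G
  have m: "(\<lambda>z. indicator {Y<..} (snd z) * (norm (G z))\<^sup>2) \<in> borel_measurable N" by measurable
  have w: "(\<lambda>z::(real^'n) \<times> real. snd z powr \<alpha>) \<in> borel_measurable (lebesgue_on ?E)"
  proof -
    have "(\<lambda>y::real. y powr \<alpha>) \<in> borel_measurable borel" by measurable
    from borel_measurable_snd_lborel[OF this]
    have "(\<lambda>z::(real^'n) \<times> real. snd z powr \<alpha>) \<in> borel_measurable lborel" by simp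
    then show ?thesis by (intro measurable_restrict_space1 measurable_completion)
  qed
  have "(L2_norm (weighted \<alpha> ?E) G)\<^sup>2 = (\<integral>z. snd z powr \<alpha> * (norm (G z))\<^sup>2 \<partial>lebesgue_on ?E)"
    unfolding L2_norm_sq weighted_def using Ge w by (subst integral_density) auto
  also have "\<dots> = (\<integral>z. indicator ?E z *\<^sub>R (snd z powr \<alpha> * (norm (G z))\<^sup>2) \<partial>lebesgue)"
    using E by (simp add: integral_restrict_space)
  also have "\<dots> = (\<integral>z. indicator cyl z *\<^sub>R (snd z powr \<alpha> * (indicator {Y<..} (snd z) * (norm (G z))\<^sup>2)) \<partial>lebesgue)"
    using Y by (intro Bochner_Integration.integral_cong) (auto simp: indicator_def mem_cyl)
  also have "\<dots> = (\<integral>z. indicator {Y<..} (snd z) * (norm (G z))\<^sup>2 \<partial>N)"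
    using cyl_sets by (simp add: cylN.integral_M[OF m] integral_restrict_space)
  finally show ?thesis .
qed

text \<open>Decay and energy bound are combined at almost every time and integrated over (0, T),
  which costs the factor T.\<close>

lemma solution_decay:
  assumes T: "0 < T"
  shows "\<exists>C>0. \<forall>f g h U Y.
     f \<in> Bochner_L2 T (L2 \<mu>) (L2_norm \<mu>) \<longrightarrow> g \<in> HHs \<longrightarrow> h \<in> L2 \<mu> \<longrightarrow>
     weak_solution \<Omega> A c lam \<phi> s T f g h U \<longrightarrow> Y \<ge> 1 \<longrightarrow>
     Bochner_L2_norm T (L2_norm (weighted \<alpha> (\<Omega> \<times> {Y<..}))) (\<lambda>t. weak_grad cyl (U t))
       \<le> C * exp (- sqrt (lam 0) * Y / 2) *
          (Bochner_L2_norm T (L2_norm \<mu>) f + nrm g + L2_norm \<mu> h)"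
proof -
  let ?L = "lebesgue_on {0<..<T}"
  obtain K where K: "K > 0" "\<forall>f g h U. f \<in> Bochner_L2 T (L2 \<mu>) (L2_norm \<mu>) \<longrightarrow> g \<in> HHs \<longrightarrow> h \<in> L2 \<mu> \<longrightarrow>
    weak_solution \<Omega> A c lam \<phi> s T f g h U \<longrightarrow>
    (AE t in ?L. (\<exists>u. has_trace \<alpha> \<Omega> (U t) u) \<and>
      (\<forall>v. has_trace \<alpha> \<Omega> v (\<lambda>x. 0) \<longrightarrow> cf.form (jet cyl (U t)) (jet cyl v) = 0) \<and>
      cf.form (jet cyl (U t)) (jet cyl (U t)) \<le>
        K * (Bochner_L2_norm T (L2_norm \<mu>) f + nrm g + L2_norm \<mu> h)\<^sup>2)"
    using solution_energy[OF T] by blast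
  obtain C2 where C2: "C2 > 0" "\<forall>W u Y. has_trace \<alpha> \<Omega> W u \<longrightarrow>
    (\<forall>v. has_trace \<alpha> \<Omega> v (\<lambda>x. 0) \<longrightarrow> cf.form (jet cyl W) (jet cyl v) = 0) \<longrightarrow> 1 \<le> Y \<longrightarrow>
    (\<integral>z. indicator {Y<..} (snd z) * (norm (weak_grad cyl W z))\<^sup>2 \<partial>N) \<le>
      C2 * exp (- sqrt (lam 0) * Y) * cf.form (jet cyl W) (jet cyl W)"
    using harmonic_decay by blast
  have "Bochner_L2_norm T (L2_norm (weighted \<alpha> (\<Omega> \<times> {Y<..}))) (\<lambda>t. weak_grad cyl (U t))
       \<le> sqrt (T * (C2 * K)) * exp (- sqrt (lam 0) * Y / 2) *
          (Bochner_L2_norm T (L2_norm \<mu>) f + nrm g + L2_norm \<mu> h)"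
    if f: "f \<in> Bochner_L2 T (L2 \<mu>) (L2_norm \<mu>)" and g: "g \<in> HHs" and h: "h \<in> L2 \<mu>"
      and sol: "weak_solution \<Omega> A c lam \<phi> s T f g h U" and Y: "1 \<le> Y" for f g h U Y
  proof -
    define \<Lambda> where "\<Lambda> = Bochner_L2_norm T (L2_norm \<mu>) f + nrm g + L2_norm \<mu> h"
    have \<Lambda>: "0 \<le> \<Lambda>"
      using nrm_nonneg[OF g] L2_norm_nonneg[of \<mu> h] by (simp add: \<Lambda>_def Bochner_L2_norm_def)
    \<comment> \<open>The estimate of the squared norm decays like exp(-sqrt(lam 0) Y); taking the
      root halves the rate.\<close>
    define e where "e = exp (- sqrt (lam 0) * Y / 2)"
    have e: "exp (- sqrt (lam 0) * Y) = e\<^sup>2"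
      by (simp add: e_def exp_double[symmetric])
    define X where "X t = (L2_norm (weighted \<alpha> (\<Omega> \<times> {Y<..})) (weak_grad cyl (U t)))\<^sup>2" for t
    define R where "R = C2 * K * (e * \<Lambda>)\<^sup>2"
    have XR: "AE t in ?L. X t \<le> R"
      using K(2)[rule_format, OF f g h sol]
    proof eventually_elim
      case (elim t)
      then obtain u where tr: "has_trace \<alpha> \<Omega> (U t) u" by blast
      have "U t \<in> H1 N cyl"
        using tr unfolding has_trace_def HL_eq H1_closure_def by blast
      then have m: "weak_grad cyl (U t) \<in> borel_measurable N"
        by (intro L2D(1) cylN.H1_jet(3))
      have "X t = (\<integral>z. indicator {Y<..} (snd z) * (norm (weak_grad cyl (U t) z))\<^sup>2 \<partial>N)"
        unfolding X_def by (rule L2_norm_truncated[OF m]) (use Y in simp)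
      also have "\<dots> \<le> C2 * exp (- sqrt (lam 0) * Y) * cf.form (jet cyl (U t)) (jet cyl (U t))"
        using C2(2) tr elim Y by blast
      also have "\<dots> \<le> C2 * exp (- sqrt (lam 0) * Y) * (K * \<Lambda>\<^sup>2)"
        using elim C2(1) unfolding \<Lambda>_def by (intro mult_left_mono) auto
      also have "\<dots> = R" unfolding e R_def by (simp only: power_mult_distrib mult_ac)
      finally show ?case .
    qed
    have R: "0 \<le> R" using C2(1) K(1) by (simp add: R_def)
    have "(\<integral>t. X t \<partial>?L) \<le> T * R"
    \<comment> \<open>A Bochner integral of a non-integrable function is 0 by default, so the bound
      on the integral holds in either case.\<close>
    proof (cases "integrable ?L X")
      case True
      have iR: "integrable ?L (\<lambda>t. R)"
        by (rule integrable_continuous_open_interval) simp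
      have "(\<integral>t. X t \<partial>?L) \<le> (\<integral>t. R \<partial>?L)"
        by (rule integral_mono_AE[OF True iR XR])
      also have "\<dots> = T * R"
        using T by (simp add: measure_restrict_space)
      finally show ?thesis .
    next
      case False
      then show ?thesis using T R by (simp add: not_integrable_integral_eq)
    qed
    then have "sqrt (\<integral>t. X t \<partial>?L) \<le> sqrt (T * R)" by simp
    also have "T * R = (T * (C2 * K)) * (e * \<Lambda>)\<^sup>2" by (simp add: R_def mult_ac)
    also have "sqrt \<dots> = sqrt (T * (C2 * K)) * (e * \<Lambda>)"
      using \<Lambda> by (simp add: real_sqrt_mult e_def)
    finally show ?thesis
      unfolding Bochner_L2_norm_def[of T "L2_norm (weighted \<alpha> (\<Omega> \<times> {Y<..}))"] X_def[symmetric] \<Lambda>_def[symmetric] e_def[symmetric]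
      by (simp only: mult.assoc)
  qed
  moreover have "0 < sqrt (T * (C2 * K))" using T C2(1) K(1) by simp
  ultimately show ?thesis by blast
qed

end

theorem proposition5p1:
  fixes \<Omega> :: "(real^'n) set"
    and A :: "real^'n \<Rightarrow> real^'n^'n" and c :: "real^'n \<Rightarrow> real"
    and lam :: "nat \<Rightarrow> real" and \<phi> :: "nat \<Rightarrow> real^'n \<Rightarrow> real"
    and s T :: real
  assumes "open \<Omega>" and "bounded \<Omega>" and "convex \<Omega>" and "\<Omega> \<noteq> {}" and "polytope (closure \<Omega>)"
    and "T > 0"
    and "admissible_coefficients \<Omega> A c"
    and "dirichlet_eigenpairs \<Omega> A c lam \<phi>"
    and "0 < s" and "s < 1"
  shows "\<exists>C>0. \<forall>f g h U Y.
     f \<in> Bochner_L2 T (L2 (lebesgue_on \<Omega>)) (L2_norm (lebesgue_on \<Omega>)) \<longrightarrow>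
     g \<in> HH \<Omega> lam \<phi> s \<longrightarrow>
     h \<in> L2 (lebesgue_on \<Omega>) \<longrightarrow>
     weak_solution \<Omega> A c lam \<phi> s T f g h U \<longrightarrow>
     Y \<ge> 1 \<longrightarrow>
     Bochner_L2_norm T (L2_norm (weighted (1 - 2 * s) (\<Omega> \<times> {Y<..})))
         (\<lambda>t. weak_grad (cylinder \<Omega>) (U t))
       \<le> C * exp (- sqrt (lam 0) * Y / 2) *
          (Bochner_L2_norm T (L2_norm (lebesgue_on \<Omega>)) f + HH_norm \<Omega> lam \<phi> s g
            + L2_norm (lebesgue_on \<Omega>) h)"
proof -
  interpret dirichlet_cylinder \<Omega> A c lam \<phi> s
    using assms by unfold_locales auto
  show ?thesis
    by (rule solution_decay[OF \<open>T > 0\<close>])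
qed

end
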